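(* Let $\mathfrak{p}\in\mathbb{R}/\pi\mathbb{Z}$. There exists a critical length $\ell_{\mathfrak{p}} > 0$ with the following properties. For $\ell>0$, let $U_{\mathfrak{p},\ell}\in X(\mathbb{R}\times\mathbb{T}_\ell)$ be a minimizer of $$\mathcal{I}_{\mathrm{2d}}(\mathfrak{p}) = \inf\{ E(\psi) : \psi \in X(\mathbb{R}\times\mathbb{T}_\ell),\ [P](\psi) = \mathfrak{p}\}.$$ (i) If $\ell\in(0,\ell_{\mathfrak{p}})$, then $U_{\mathfrak{p},\ell}$ is a planar dark soliton, up to a translation and a phase shift. (ii) If $\ell\in(\ell_{\mathfrak{p}},\infty)$, then $U_{\mathfrak{p},\ell}$ cannot depend only on the variable $x$, and therefore cannot be a planar dark soliton.
   Context: $\mathbb{T}_\ell = \mathbb{R}/\ell\mathbb{Z}$; $\langle z, w\rangle_{\mathbb{C}} = \mathrm{Re}(z\overline{w})$; functions are complex-valued; points of $\mathbb{R}\times\mathbb{T}_\ell$ are denoted $(x,y)$. Minimizers of $\mathcal{I}_{\mathrm{2d}}(\mathfrak{p})$ exist for every $\ell>0$ and every $\mathfrak{p}\in\mathbb{R}/\pi\mathbb{Z}$. Dark solitons: for $|c|<\sqrt2$, $\mathfrak{u}_c(x) = \sqrt{\frac{2-c^2}{2}}\tanh\Big(\frac{\sqrt{2-c^2}}{2}x\Big) + i\frac{c}{\sqrt2}$. The planar dark soliton is $\mathfrak{u}_c$ viewed as a function on $\mathbb{R}\times\mathbb{T}_\ell$ not depending on $y$. Energy: $e(\psi) = \frac12|\nabla\psi|^2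 + \frac14(1-|\psi|^2)^2$, and $E(\psi) = \frac1\ell\int_{\mathbb{R}}\int_{\mathbb{T}_\ell} e(\psi)$. Energy spaces: for $D = \mathbb{R}$ or $D = \mathbb{R}\times\mathbb{T}_\ell$, $X(D) = \{\psi \in H^1_{\mathrm{loc}}(D) : \nabla\psi\in L^2(D),\ 1-|\psi|^2\in L^2(D)\}$. Untwisted momentum: for $\psi\in X(\mathbb{R})$, $[P](\psi) = \frac12\lim_{R\to+\infty}\big(\int_{-R}^R\langle i\partial_x\psi,\psi\rangle_{\mathbb{C}} + \arg(\psi(R)) - \arg(\psi(-R))\big)$ modulo $\pi$, a well-defined element of $\mathbb{R}/\pi\mathbb{Z}$. For $\psi\in X(\mathbb{R}\times\mathbb{T}_\ell)$ write $\psi = \widehat\psi + w$ with $\widehat\psi(x) = \frac1\ell\int_{\mathbb{T}_\ell}\psi(x,y)\,dy$ (then $\widehat\psi\in X(\mathbb{R})$ and $w\in H^1(\mathbb{R}\times\mathbb{T}_\ell)$), and $[P](\psi) = [P](\widehat\psi) + \frac{1}{2\ell}\int_{\mathbb{R}}\int_{\mathbb{T}_\ell}\langle i\partial_x w, w\rangle_{\mathbb{C}}$ modulo $\pi$.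
   Formalization: The class 𝔭 = 0 in ℝ/πℤ is excluded: there the minimizers are exactly the constants of modulus one for every ℓ, which depend only on x and are not dark solitons with |c| < √2, so both (i) and (ii) fail. *)

theory Defs
  imports "HOL-Analysis.Analysis" "HOL-Library.Real_Mod"
begin

(* Elements of Sobolev and Lebesgue classes are Borel representatives, so identities between them
   are stated almost everywhere. A function on R x T_l is its lift to the plane, l-periodic in the
   second variable; integrals over R x T_l are taken over the fundamental domain R x [0, l). Weak
   differentiability is local, so it may be tested on the lift. *)

definition L2_on :: "'a::euclidean_space set \<Rightarrow> ('a \<Rightarrow> 'b::real_normed_vector) \<Rightarrow> bool" where
  "L2_on D f \<longleftrightarrow> f \<in> borel_measurable borel \<and> set_integrable lborel D (\<lambda>z. (norm (f z))\<^sup>2)"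

definition L2_loc :: "('a::euclidean_space \<Rightarrow> complex) \<Rightarrow> bool" where
  "L2_loc f \<longleftrightarrow> (\<forall>K. compact K \<longrightarrow> L2_on K f)"

definition locally_integrable :: "('a::euclidean_space \<Rightarrow> complex) \<Rightarrow> bool" where
  "locally_integrable f \<longleftrightarrow>
     f \<in> borel_measurable borel \<and> (\<forall>K. compact K \<longrightarrow> set_integrable lborel K f)"

(* Compactly supported C^1 functions with their Frechet derivative. Testing against these is
   equivalent, by mollification, to testing against smooth compactly supported functions. *)
definition test_function ::
    "('a::euclidean_space \<Rightarrow> real) \<Rightarrow> ('a \<Rightarrow> 'a \<Rightarrow>\<^sub>L real) \<Rightarrow> bool" where
  "test_function \<phi> D\<phi> \<longleftrightarrow>
     (\<forall>z. (\<phi> has_derivative blinfun_apply (D\<phi> z)) (at z)) \<and>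
     continuous_on UNIV D\<phi> \<and>
     (\<exists>K. compact K \<and> (\<forall>z. z \<notin> K \<longrightarrow> \<phi> z = 0))"

definition has_weak_partial ::
    "'a \<Rightarrow> ('a::euclidean_space \<Rightarrow> complex) \<Rightarrow> ('a \<Rightarrow> complex) \<Rightarrow> bool" where
  "has_weak_partial b f g \<longleftrightarrow>
     locally_integrable f \<and> locally_integrable g \<and>
     (\<forall>\<phi> D\<phi>. test_function \<phi> D\<phi> \<longrightarrow>
        (LINT z|lborel. blinfun_apply (D\<phi> z) b *\<^sub>R f z) = - (LINT z|lborel. \<phi> z *\<^sub>R g z))"

(* Determined up to null sets whenever a weak derivative exists. *)
definition weak_partial ::
    "'a \<Rightarrow> ('a::euclidean_space \<Rightarrow> complex) \<Rightarrow> 'a \<Rightarrow> complex" where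
  "weak_partial b f = (SOME g. has_weak_partial b f g)"

definition H1_loc :: "('a::euclidean_space \<Rightarrow> complex) \<Rightarrow> bool" where
  "H1_loc f \<longleftrightarrow> L2_loc f \<and> (\<forall>b\<in>Basis. \<exists>g. L2_loc g \<and> has_weak_partial b f g)"

(* The energy space, with the integrability conditions imposed on D: X(R) is energy_space UNIV. *)
definition energy_space :: "'a::euclidean_space set \<Rightarrow> ('a \<Rightarrow> complex) set" where
  "energy_space D =
     {\<psi>. H1_loc \<psi> \<and> (\<forall>b\<in>Basis. L2_on D (weak_partial b \<psi>)) \<and> L2_on D (\<lambda>z. 1 - (cmod (\<psi> z))\<^sup>2)}"

definition strip :: "real \<Rightarrow> (real \<times> real) set" where
  "strip l = UNIV \<times> {0..<l}"

definition energy_space_2d :: "real \<Rightarrow> (real \<times> real \<Rightarrow> complex) set" where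
  "energy_space_2d l =
     {\<psi> \<in> energy_space (strip l). \<forall>x y. \<psi> (x, y + l) = \<psi> (x, y)}"

definition energy_density :: "('a::euclidean_space \<Rightarrow> complex) \<Rightarrow> 'a \<Rightarrow> real" where
  "energy_density \<psi> z =
     1/2 * (\<Sum>b\<in>Basis. (cmod (weak_partial b \<psi> z))\<^sup>2) + 1/4 * (1 - (cmod (\<psi> z))\<^sup>2)\<^sup>2"

definition energy :: "real \<Rightarrow> (real \<times> real \<Rightarrow> complex) \<Rightarrow> real" where
  "energy l \<psi> = 1/l * (LINT z:strip l|lborel. energy_density \<psi> z)"

(* R/\<pi>Z as a set of cosets *)
definition R_mod_pi :: "real set set" where
  "R_mod_pi = UNIV // {(s, t). [s = t] (rmod pi)}"

(* The inner product on type complex is Re (z * cnj w). *)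
definition momentum_upto :: "(real \<Rightarrow> complex) \<Rightarrow> real \<Rightarrow> real" where
  "momentum_upto v R =
     1/2 * ((LINT x:{-R..R}|lborel. (\<i> * weak_partial 1 v x) \<bullet> v x) + Arg (v R) - Arg (v (- R)))"

(* The untwisted momentum, as a coset of \<pi>Z. The values v R and v (- R) are those of the continuous
   representative of \<psi>. Convergence in R/\<pi>Z is convergence of a suitable lift \<theta> to R; the choice
   of the branch of the argument only changes momentum_upto by multiples of \<pi>. *)
definition momentum_1d :: "(real \<Rightarrow> complex) \<Rightarrow> real set" where
  "momentum_1d \<psi> =
     {p. \<exists>v \<theta>. continuous_on UNIV v \<and> (AE x in lborel. v x = \<psi> x) \<and>
               (\<forall>R. [\<theta> R = momentum_upto v R] (rmod pi)) \<and> (\<theta> \<longlongrightarrow> p) at_top}"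

definition y_mean :: "real \<Rightarrow> (real \<times> real \<Rightarrow> complex) \<Rightarrow> real \<Rightarrow> complex" where
  "y_mean l \<psi> x = (LINT y:{0..<l}|lborel. \<psi> (x, y)) / of_real l"

definition momentum_2d :: "real \<Rightarrow> (real \<times> real \<Rightarrow> complex) \<Rightarrow> real set" where
  "momentum_2d l \<psi> =
     (let w = (\<lambda>(x, y). \<psi> (x, y) - y_mean l \<psi> x)
      in (\<lambda>p. p + 1 / (2 * l) * (LINT z:strip l|lborel. (\<i> * weak_partial (1, 0) w z) \<bullet> w z))
           ` momentum_1d (y_mean l \<psi>))"

definition min_energy_2d :: "real \<Rightarrow> real set \<Rightarrow> real" where
  "min_energy_2d l \<pp> = Inf {energy l \<psi> |\<psi>. \<psi> \<in> energy_space_2d l \<and> momentum_2d l \<psi> = \<pp>}"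

definition is_minimizer_2d :: "real \<Rightarrow> real set \<Rightarrow> (real \<times> real \<Rightarrow> complex) \<Rightarrow> bool" where
  "is_minimizer_2d l \<pp> U \<longleftrightarrow>
     U \<in> energy_space_2d l \<and> momentum_2d l U = \<pp> \<and> energy l U = min_energy_2d l \<pp>"

definition dark_soliton :: "real \<Rightarrow> real \<Rightarrow> complex" where
  "dark_soliton c x =
     of_real (sqrt ((2 - c\<^sup>2) / 2) * tanh (sqrt (2 - c\<^sup>2) / 2 * x)) + \<i> * of_real (c / sqrt 2)"

definition planar_dark_soliton_upto_symmetry :: "(real \<times> real \<Rightarrow> complex) \<Rightarrow> bool" where
  "planar_dark_soliton_upto_symmetry U \<longleftrightarrow>
     (\<exists>c a \<alpha>. \<bar>c\<bar> < sqrt 2 \<and> (AE (x, y) in lborel. U (x, y) = cis \<alpha> * dark_soliton c (x - a)))"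

definition depends_only_on_x :: "(real \<times> real \<Rightarrow> complex) \<Rightarrow> bool" where
  "depends_only_on_x U \<longleftrightarrow> (\<exists>v. AE (x, y) in lborel. U (x, y) = v x)"

end

(* Restricting U to the lines y = const turns E(U) into the mean over y of one-dimensional energies plus
   the mean of |d_y U|^2 / 2. On the line, the minimal energy as a function of the momentum is attained
   on the dark solitons (a calibration argument), so the energy of a slice is bounded below by a parabola
   touching this curve at the prescribed momentum. The momenta of the slices average to that momentum,
   so the linear term disappears, and their fluctuation is at most of the order of
   |d_x U|^2 |d_y U|^2; for small l the term in d_y U absorbs it, and the soliton is optimal.

   If the soliton is optimal for the length l', stretching y shows that for every l < l' a minimizer
   satisfies d_y U = 0, hence is a minimizing profile on the line: it solves the travelling wave equation,
   whose two first integrals vanish for finite energy, which leaves only rotated and translated solitons.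

   For large l the soliton is beaten by a perturbation proportional to cos (2 pi y / l) in a direction in
   which the second variation (with the momentum as Lagrange constraint) is negative. The critical length
   is the supremum of the lengths for which the soliton is optimal. *)
theory Submission
  imports Defs
begin

text \<open>As a function of its momentum the soliton energy is concave: its slope
  \<open>- sqrt 2 * sin \<omega>\<close> decreases along the branch. Jensen's inequality for the
  slices thus points the wrong way, and letting the momentum vary with y lowers the mean of the
  one-dimensional energies. This is why a parabola replaces the tangent line, why a short period
  protects the soliton and why a long one destroys it. The loss is at most
  \<open>K * l * Dx * Dy\<close>, where \<open>Dx\<close> and \<open>Dy\<close> are the squared
  norms of the two partial derivatives. Below the soliton energy \<open>I\<close> one has
  \<open>Dx\<close> \<le> \<open>2 * l * I\<close>, so for small \<open>l\<close> the loss is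
  covered by \<open>Dy / 2\<close>.

  The parabola also frees the one-dimensional problem from its constraint: its slope is the Lagrange
  multiplier, so variations may change the momentum.

  Momentum exists only modulo pi, so identities are stated for \<open>cis (2 * p)\<close>, where
  both this ambiguity and the branch of the argument disappear. The class of 0 is the end of the
  branch, where the soliton degenerates to a constant; the theorem concerns all other
  classes.\<close>

section \<open>Absolutely continuous curves\<close>

text \<open>Local absolute continuity in integral form, with \<open>g\<close> fixed up to null sets.
  In this form the calculus below never differentiates almost everywhere.\<close>

definition has_ac_derivative :: "(real \<Rightarrow> 'b::euclidean_space) \<Rightarrow> (real \<Rightarrow> 'b) \<Rightarrow> bool" where
  "has_ac_derivative v g \<longleftrightarrow> g \<in> borel_measurable borel \<and> (\<forall>a b. set_integrable lborel {a..b} g) \<and>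
     (\<forall>a b. a \<le> b \<longrightarrow> v b - v a = (LINT x:{a..b}|lborel. g x))"

lemma ac_measurable: "has_ac_derivative v g \<Longrightarrow> g \<in> borel_measurable borel"
  and ac_integrable: "has_ac_derivative v g \<Longrightarrow> set_integrable lborel {a..b} g"
  and ac_diff: "has_ac_derivative v g \<Longrightarrow> a \<le> b \<Longrightarrow> v b - v a = (LINT x:{a..b}|lborel. g x)"
  by (auto simp: has_ac_derivative_def)

lemma set_integral_Icc_combine:
  fixes g :: "real \<Rightarrow> 'b::euclidean_space"
  assumes "set_integrable lborel {a..c} g" "a \<le> b" "b \<le> c"
  shows "(LINT x:{a..c}|lborel. g x) = (LINT x:{a..b}|lborel. g x) + (LINT x:{b..c}|lborel. g x)"
proof -
  have "set_integrable lborel {a..b} g" "set_integrable lborel {b..c} g"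
    using assms by (auto intro: set_integrable_subset)
  moreover have "g integrable_on {a..c}"
    using assms(1) set_borel_integral_eq_integral(1) by blast
  ultimately show ?thesis
    using assms Henstock_Kurzweil_Integration.integral_combine[of a b c g]
    by (simp add: set_borel_integral_eq_integral(2))
qed

lemma ac_continuous_on:
  assumes "has_ac_derivative v g"
  shows "continuous_on S v"
proof -
  have "isCont v x" for x
  proof -
    have int: "g integrable_on {x-1..x+1}"
      using ac_integrable[OF assms] set_borel_integral_eq_integral(1) by blast
    have "continuous_on {x-1..x+1} (\<lambda>y. v (x-1) + integral {x-1..y} g)"
      by (intro continuous_intros indefinite_integral_continuous_1 int)
    moreover have "v (x-1) + integral {x-1..y} g = v y" if "y \<in> {x-1..x+1}" for y
      using ac_diff[OF assms, of "x-1" y] that set_borel_integral_eq_integral(2)[OF ac_integrable[OF assms], of "x-1" y]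
      by (simp add: algebra_simps)
    ultimately have "continuous_on {x-1..x+1} v"
      by (metis (no_types, lifting) continuous_on_cong)
    then have "continuous_on {x-1<..<x+1} v"
      by (rule continuous_on_subset) auto
    then show ?thesis
      by (simp add: continuous_on_eq_continuous_at)
  qed
  then show ?thesis by (simp add: continuous_at_imp_continuous_on)
qed

lemma ac_measurable_self: "has_ac_derivative v g \<Longrightarrow> v \<in> borel_measurable borel"
  using ac_continuous_on[of v g UNIV] borel_measurable_continuous_onI by blast

lemma ac_cong_AE:
  assumes "has_ac_derivative v g" "AE x in lborel. g x = h x" "h \<in> borel_measurable borel"
  shows "has_ac_derivative v h"
proof -
  have "set_integrable lborel {a..b} h" for a b
    using ac_integrable[OF assms(1)] ac_measurable[OF assms(1)] assms(2,3)
    by (subst set_integrable_cong_AE[where g=g]) auto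
  moreover have "(LINT x:{a..b}|lborel. h x) = (LINT x:{a..b}|lborel. g x)" for a b
    using ac_measurable[OF assms(1)] assms(2,3)
    by (intro set_lebesgue_integral_cong_AE) auto
  ultimately show ?thesis using assms unfolding has_ac_derivative_def by auto
qed

lemma ac_C1:
  assumes "\<And>x. (f has_vector_derivative f' x) (at x)" "continuous_on UNIV f'"
  shows "has_ac_derivative f f'"
  unfolding has_ac_derivative_def
proof (intro conjI allI impI)
  show "f' \<in> borel_measurable borel" using assms(2) by (rule borel_measurable_continuous_onI)
  show int: "set_integrable lborel {a..b} f'" for a b
    by (rule borel_integrable_compact[unfolded set_integrable_def[symmetric]] | 
        simp add: set_integrable_def borel_integrable_compact continuous_on_subset[OF assms(2)])+
  show "f b - f a = (LINT x:{a..b}|lborel. f' x)" if "a \<le> b" for a b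
    using fundamental_theorem_of_calculus[OF that, of f f'] assms(1)
    by (simp add: set_borel_integral_eq_integral(2)[OF int] has_vector_derivative_at_within integral_unique)
qed

text \<open>A substitute for "derivative zero almost everywhere implies constant". Adding the bounds
  over a fine equipartition gives \<open>norm (F b - F a)\<close> \<le>
  \<open>\<epsilon> * (K b - K a)\<close> for every \<epsilon>. In the applications \<open>K\<close>
  is the primitive of the norm of a derivative.\<close>

lemma constant_if_small_increments:
  fixes F :: "real \<Rightarrow> 'b::real_normed_vector" and K :: "real \<Rightarrow> real"
  assumes "a \<le> b"
    and "\<And>\<epsilon>. \<epsilon> > 0 \<Longrightarrow> \<exists>\<delta>>0. \<forall>x y. a \<le> x \<and> x \<le> y \<and> y \<le> b \<and> y - x < \<delta> \<longrightarrow> norm (F y - F x) \<le> \<epsilon> * (K y - K x)"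
  shows "F b = F a"
proof -
  have bound: "norm (F b - F a) \<le> \<epsilon> * (K b - K a)" if e: "\<epsilon> > 0" for \<epsilon>
  proof -
    obtain \<delta> where \<delta>: "\<delta> > 0" "\<And>x y. a \<le> x \<Longrightarrow> x \<le> y \<Longrightarrow> y \<le> b \<Longrightarrow> y - x < \<delta> \<Longrightarrow> norm (F y - F x) \<le> \<epsilon> * (K y - K x)"
      using assms(2)[OF e] by blast
    obtain N :: nat where N: "(b - a) / \<delta> < real N" using reals_Archimedean2 by blast
    have N0: "0 < real N" using N \<delta>(1) assms(1) by (smt (verit) divide_nonneg_pos)
    define h where "h = (b - a) / real N"
    have h: "0 \<le> h" "h < \<delta>" "real N * h = b - a"
      using N N0 \<delta>(1) assms(1) by (auto simp: h_def field_simps)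
    have "i \<le> N \<Longrightarrow> norm (F (a + real i * h) - F a) \<le> \<epsilon> * (K (a + real i * h) - K a)" for i
    proof (induction i)
      case (Suc i)
      have le: "real (Suc i) * h \<le> real N * h" using Suc.prems h by (intro mult_right_mono) auto
      have "norm (F (a + real (Suc i) * h) - F (a + real i * h)) \<le> \<epsilon> * (K (a + real (Suc i) * h) - K (a + real i * h))"
        by (rule \<delta>(2)) (use h le in \<open>auto simp: algebra_simps\<close>)
      moreover have "norm (F (a + real (Suc i) * h) - F a) \<le> norm (F (a + real (Suc i) * h) - F (a + real i * h)) + norm (F (a + real i * h) - F a)"
        by (metis add.commute diff_add_cancel add_diff_eq norm_triangle_ineq)
      ultimately show ?case using Suc by (simp add: algebra_simps)
    qed simp
    from this[of N] show ?thesis using h(3) by simp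
  qed
  show ?thesis
  proof (rule ccontr)
    assume "F b \<noteq> F a"
    then have n: "norm (F b - F a) > 0" by simp
    define D where "D = \<bar>K b - K a\<bar> + 1"
    have D: "D > 0" "K b - K a \<le> D" by (auto simp: D_def)
    have "norm (F b - F a) \<le> norm (F b - F a) / (2 * D) * (K b - K a)"
      using bound[of "norm (F b - F a) / (2 * D)"] n D by simp
    also have "\<dots> \<le> norm (F b - F a) / (2 * D) * D" using n D by (intro mult_left_mono) auto
    also have "\<dots> < norm (F b - F a)" using n D by simp
    finally show False by simp
  qed
qed

lemma borel_measurable_bilinear:
  fixes prod :: "'a::euclidean_space \<Rightarrow> 'b::euclidean_space \<Rightarrow> 'c::euclidean_space"
  assumes "bounded_bilinear prod" "p \<in> borel_measurable M" "q \<in> borel_measurable M"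
  shows "(\<lambda>x. prod (p x) (q x)) \<in> borel_measurable M"
proof -
  have "continuous_on UNIV (\<lambda>z. prod (fst z) (snd z))"
    by (rule bounded_bilinear.continuous_on[OF assms(1) continuous_on_fst[OF continuous_on_id] continuous_on_snd[OF continuous_on_id]])
  from borel_measurable_continuous_Pair[OF assms(2,3) this] show ?thesis by simp
qed

lemma set_integrable_continuous_bilinear:
  fixes prod :: "'a::euclidean_space \<Rightarrow> 'b::euclidean_space \<Rightarrow> 'c::euclidean_space" and a b :: real
  assumes "bounded_bilinear prod" "set_integrable lborel {a..b} g" "continuous_on UNIV w"
    and [measurable]: "g \<in> borel_measurable borel"
  shows "set_integrable lborel {a..b} (\<lambda>x. prod (g x) (w x))"
proof -
  interpret bounded_bilinear prod by fact
  obtain K where K: "K > 0" "\<And>x y. norm (prod x y) \<le> norm x * norm y * K" using pos_bounded by blast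
  have "compact (w ` {a..b})" by (intro compact_continuous_image continuous_on_subset[OF assms(3)] compact_Icc) auto
  then obtain B where B: "\<And>x. x \<in> {a..b} \<Longrightarrow> norm (w x) \<le> B"
    by (meson bounded_iff compact_imp_bounded imageI)
  have [measurable]: "w \<in> borel_measurable borel" using assms(3) by (rule borel_measurable_continuous_onI)
  have [measurable]: "(\<lambda>x. prod (g x) (w x)) \<in> borel_measurable borel"
    by (rule borel_measurable_bilinear[OF assms(1)]) measurable
  show ?thesis
  proof (rule set_integrable_bound[where f = "\<lambda>x. (B * K) *\<^sub>R g x"])
    show "set_integrable lborel {a..b} (\<lambda>x. (B * K) *\<^sub>R g x)" using assms(2) by simp
    show "set_borel_measurable lborel {a..b} (\<lambda>x. prod (g x) (w x))"
      unfolding set_borel_measurable_def by measurable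
    show "AE x in lborel. x \<in> {a..b} \<longrightarrow> norm (prod (g x) (w x)) \<le> norm ((B * K) *\<^sub>R g x)"
    proof (intro AE_I2 impI)
      fix x assume "x \<in> {a..b}"
      then have Bx: "norm (w x) \<le> B" by (rule B)
      then have "0 \<le> B" by (meson norm_ge_zero order_trans)
      have "norm (prod (g x) (w x)) \<le> norm (g x) * norm (w x) * K" by (rule K)
      also have "\<dots> \<le> norm (g x) * B * K" using Bx K(1) by (intro mult_right_mono mult_left_mono) auto
      finally show "norm (prod (g x) (w x)) \<le> norm ((B * K) *\<^sub>R g x)" using \<open>0 \<le> B\<close> K(1) by (simp add: ac_simps)
    qed
  qed
qed

lemma set_integral_bounded_linear:
  fixes g :: "real \<Rightarrow> 'b::euclidean_space"
  assumes "bounded_linear T" "set_integrable lborel S g"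
  shows "(LINT x:S|lborel. T (g x)) = T (LINT x:S|lborel. g x)" "set_integrable lborel S (\<lambda>x. T (g x))"
proof -
  interpret bounded_linear T by fact
  show "(LINT x:S|lborel. T (g x)) = T (LINT x:S|lborel. g x)"
    using integral_bounded_linear[OF assms(1) assms(2)[unfolded set_integrable_def]]
    by (simp add: set_lebesgue_integral_def scaleR)
  show "set_integrable lborel S (\<lambda>x. T (g x))"
    using integrable_bounded_linear[OF assms(1) assms(2)[unfolded set_integrable_def]]
    by (simp add: set_integrable_def scaleR)
qed

lemma set_integral_norm_le:
  fixes f :: "real \<Rightarrow> 'b::euclidean_space"
  assumes "set_integrable lborel S f" "set_integrable lborel S k" "\<And>x. x \<in> S \<Longrightarrow> norm (f x) \<le> k x"
  shows "norm (LINT x:S|lborel. f x) \<le> (LINT x:S|lborel. k x)"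
proof -
  have "norm (LINT x:S|lborel. f x) \<le> (LINT x:S|lborel. norm (f x))"
    using integral_norm_bound[of lborel "\<lambda>x. indicator S x *\<^sub>R f x"] by (simp add: set_lebesgue_integral_def)
  also have "\<dots> \<le> (LINT x:S|lborel. k x)"
    using assms by (intro set_integral_mono set_integrable_norm) auto
  finally show ?thesis .
qed

lemma ac_uniformly_continuous:
  assumes "has_ac_derivative v g" "\<epsilon> > 0"
  obtains \<delta> where "\<delta> > 0" "\<And>x y. x \<in> {a..b} \<Longrightarrow> y \<in> {a..b} \<Longrightarrow> \<bar>y - x\<bar> < \<delta> \<Longrightarrow> norm (v y - v x) \<le> \<epsilon>"
proof -
  have "uniformly_continuous_on {a..b} v"
    by (intro compact_uniformly_continuous ac_continuous_on[OF assms(1)]) auto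
  then show ?thesis using that assms(2) unfolding uniformly_continuous_on_def dist_norm
    by (metis less_imp_le real_norm_def)
qed

text \<open>Product rule. On a short interval, freezing \<open>w\<close> at the right end and
  \<open>v\<close> at the left end makes the increment of the product an exact integral. Uniform
  continuity of \<open>v\<close> and \<open>w\<close> bounds its distance from the integral of
  \<open>f\<close> by \<epsilon> times the integral of \<open>k\<close>.\<close>

lemma ac_bounded_bilinear:
  fixes prod :: "'a::euclidean_space \<Rightarrow> 'b::euclidean_space \<Rightarrow> 'c::euclidean_space"
  assumes bl: "bounded_bilinear prod" and v: "has_ac_derivative v g" and w: "has_ac_derivative w h"
  shows "has_ac_derivative (\<lambda>x. prod (v x) (w x)) (\<lambda>x. prod (v x) (h x) + prod (g x) (w x))"
proof -
  interpret bounded_bilinear prod by fact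
  obtain B where B: "B > 0" "\<And>x y. norm (prod x y) \<le> norm x * norm y * B" using pos_bounded by blast
  note [measurable] = ac_measurable[OF v] ac_measurable[OF w] ac_measurable_self[OF v] ac_measurable_self[OF w]
  have [measurable]: "(\<lambda>x. prod (v x) (h x)) \<in> borel_measurable borel"
    "(\<lambda>x. prod (g x) (w x)) \<in> borel_measurable borel" by (rule borel_measurable_bilinear[OF bl]; measurable)+
  have i1: "set_integrable lborel {a..b} (\<lambda>x. prod (g x) (w x))" for a b
    by (rule set_integrable_continuous_bilinear[OF bl ac_integrable[OF v] ac_continuous_on[OF w] ac_measurable[OF v]])
  have i2: "set_integrable lborel {a..b} (\<lambda>x. prod (v x) (h x))" for a b
    by (rule set_integrable_continuous_bilinear[OF bounded_bilinear.flip[OF bl] ac_integrable[OF w] ac_continuous_on[OF v] ac_measurable[OF w]])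
  define f where "f = (\<lambda>x. prod (v x) (h x) + prod (g x) (w x))"
  have i: "set_integrable lborel {a..b} f" for a b unfolding f_def using i1 i2 by auto
  define k where "k = (\<lambda>x. norm (g x) + norm (h x))"
  have ik: "set_integrable lborel {a..b} k" for a b
    unfolding k_def using ac_integrable[OF v] ac_integrable[OF w] by (auto intro!: set_integral_add set_integrable_norm)
  have main: "prod (v b) (w b) - prod (v a) (w a) = (LINT x:{a..b}|lborel. f x)" if ab: "a \<le> b" for a b
  proof -
    define F where "F = (\<lambda>x. prod (v x) (w x) - (LINT s:{a..x}|lborel. f s))"
    define K where "K = (\<lambda>x. LINT s:{a..x}|lborel. k s)"
    have "F b = F a"
    proof (rule constant_if_small_increments[OF ab, where K = K])
      fix \<epsilon> :: real assume "\<epsilon> > 0"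
      then have e: "\<epsilon> / B > 0" using B(1) by simp
      obtain d1 where d1: "d1 > 0" "\<And>x y. x \<in> {a..b} \<Longrightarrow> y \<in> {a..b} \<Longrightarrow> \<bar>y - x\<bar> < d1 \<Longrightarrow> norm (v y - v x) \<le> \<epsilon> / B"
        using ac_uniformly_continuous[OF v e] by metis
      obtain d2 where d2: "d2 > 0" "\<And>x y. x \<in> {a..b} \<Longrightarrow> y \<in> {a..b} \<Longrightarrow> \<bar>y - x\<bar> < d2 \<Longrightarrow> norm (w y - w x) \<le> \<epsilon> / B"
        using ac_uniformly_continuous[OF w e] by metis
      have "norm (F y - F x) \<le> \<epsilon> * (K y - K x)" if xy: "a \<le> x" "x \<le> y" "y \<le> b" "y - x < min d1 d2" for x y
      proof -
        have Fy: "F y - F x = prod (v y) (w y) - prod (v x) (w x) - (LINT s:{x..y}|lborel. f s)"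
          unfolding F_def using set_integral_Icc_combine[OF i, of a x y] xy by simp
        have Ky: "K y - K x = (LINT s:{x..y}|lborel. k s)"
          unfolding K_def using set_integral_Icc_combine[OF ik, of a x y] xy by simp
        have "prod (v y) (w y) - prod (v x) (w x) = prod (v y - v x) (w y) + prod (v x) (w y - w x)"
          by (simp add: diff_left diff_right)
        also have "prod (v y - v x) (w y) = (LINT s:{x..y}|lborel. prod (g s) (w y))"
          by (simp add: ac_diff[OF v xy(2)] set_integral_bounded_linear(1)[OF bounded_linear_left ac_integrable[OF v]])
        also have "prod (v x) (w y - w x) = (LINT s:{x..y}|lborel. prod (v x) (h s))"
          by (simp add: ac_diff[OF w xy(2)] set_integral_bounded_linear(1)[OF bounded_linear_right ac_integrable[OF w]])
        finally have eq: "F y - F x = (LINT s:{x..y}|lborel. (prod (g s) (w y) + prod (v x) (h s)) - f s)"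
          unfolding Fy
          using set_integral_bounded_linear(2)[OF bounded_linear_left ac_integrable[OF v]]
            set_integral_bounded_linear(2)[OF bounded_linear_right ac_integrable[OF w]] i
          by (subst set_integral_diff) (auto simp: set_integral_add)
        have "norm (F y - F x) \<le> (LINT s:{x..y}|lborel. \<epsilon> * k s)"
          unfolding eq
        proof (rule set_integral_norm_le)
          show "set_integrable lborel {x..y} (\<lambda>s. prod (g s) (w y) + prod (v x) (h s) - f s)"
            using set_integral_bounded_linear(2)[OF bounded_linear_left ac_integrable[OF v]]
              set_integral_bounded_linear(2)[OF bounded_linear_right ac_integrable[OF w]] i
            by (auto intro!: set_integral_diff set_integral_add)
          show "set_integrable lborel {x..y} (\<lambda>s. \<epsilon> * k s)" using ik by simp
          fix s assume s: "s \<in> {x..y}"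
          have "prod (g s) (w y) + prod (v x) (h s) - f s = prod (g s) (w y - w s) - prod (v s - v x) (h s)"
            by (simp add: f_def diff_left diff_right)
          also have "norm \<dots> \<le> norm (prod (g s) (w y - w s)) + norm (prod (v s - v x) (h s))"
            by (rule norm_triangle_ineq4)
          also have "norm (prod (g s) (w y - w s)) \<le> norm (g s) * (\<epsilon> / B) * B"
            using B d2(2)[of s y] s xy
            by (intro order_trans[OF B(2)] mult_right_mono mult_left_mono) auto
          also have "norm (prod (v s - v x) (h s)) \<le> (\<epsilon> / B) * norm (h s) * B"
            using B d1(2)[of x s] s xy
            by (intro order_trans[OF B(2)] mult_right_mono mult_left_mono) auto
          finally show "norm (prod (g s) (w y) + prod (v x) (h s) - f s) \<le> \<epsilon> * k s"
            using B(1) by (simp add: k_def algebra_simps)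
        qed
        then show ?thesis by (simp add: Ky)
      qed
      then show "\<exists>\<delta>>0. \<forall>x y. a \<le> x \<and> x \<le> y \<and> y \<le> b \<and> y - x < \<delta> \<longrightarrow> norm (F y - F x) \<le> \<epsilon> * (K y - K x)"
        using d1(1) d2(1) by (intro exI[of _ "min d1 d2"]) auto
    qed
    moreover have "(LINT s:{a..a}|lborel. f s) = 0"
      using set_integral_Icc_combine[OF i, of a a a] by simp
    ultimately show ?thesis by (simp add: F_def algebra_simps)
  qed
  show ?thesis unfolding has_ac_derivative_def
    using main i unfolding f_def by (auto intro!: borel_measurable_add)
qed

text \<open>Chain rule. On a short interval \<open>H\<close> is linearised at \<open>s x\<close>.
  The modulus of continuity of \<open>H'\<close> on the compact range of \<open>s\<close> controls
  both this linearisation and the freezing of \<open>H'\<close> under the integral; each costs half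
  of \<epsilon>. The open set \<open>U\<close> admits functions such as \<open>1 / sqrt\<close> that
  are smooth only on part of the line.\<close>

lemma ac_compose:
  fixes H :: "real \<Rightarrow> 'b::euclidean_space"
  assumes s: "has_ac_derivative s r" and U: "open U" "\<And>x. s x \<in> U"
    and H: "\<And>z. z \<in> U \<Longrightarrow> (H has_vector_derivative H' z) (at z)" and H': "continuous_on U H'"
  shows "has_ac_derivative (\<lambda>x. H (s x)) (\<lambda>x. r x *\<^sub>R H' (s x))"
proof -
  note [measurable] = ac_measurable[OF s] ac_measurable_self[OF s]
  have cs: "continuous_on UNIV (\<lambda>x. H' (s x))"
    by (intro continuous_on_compose2[OF H'] ac_continuous_on[OF s]) (use U in auto)
  then have [measurable]: "(\<lambda>x. H' (s x)) \<in> borel_measurable borel" by (rule borel_measurable_continuous_onI)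
  define f where "f = (\<lambda>x. r x *\<^sub>R H' (s x))"
  have i: "set_integrable lborel {a..b} f" for a b unfolding f_def
    by (rule set_integrable_continuous_bilinear[OF bounded_bilinear_scaleR ac_integrable[OF s] cs ac_measurable[OF s]])
  have ik: "set_integrable lborel {a..b} (\<lambda>x. \<bar>r x\<bar>)" for a b
    using ac_integrable[OF s] by (auto intro!: set_integrable_abs)
  have main: "H (s b) - H (s a) = (LINT x:{a..b}|lborel. f x)" if ab: "a \<le> b" for a b
  proof -
    define F where "F = (\<lambda>x. H (s x) - (LINT t:{a..x}|lborel. f t))"
    define K where "K = (\<lambda>x. LINT t:{a..x}|lborel. \<bar>r t\<bar>)"
    have "F b = F a"
    proof (rule constant_if_small_increments[OF ab, where K = K])
      fix \<epsilon> :: real assume e: "\<epsilon> > 0"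
      obtain c d where cd: "s ` {a..b} = {c..d}"
        using continuous_image_closed_interval[OF ab ac_continuous_on[OF s]] by blast
      have sub: "{c..d} \<subseteq> U" unfolding cd[symmetric] using U(2) by blast
      have "uniformly_continuous_on {c..d} H'"
        by (intro compact_uniformly_continuous continuous_on_subset[OF H' sub]) auto
      then obtain d0 where d0: "d0 > 0" "\<And>x y. x \<in> {c..d} \<Longrightarrow> y \<in> {c..d} \<Longrightarrow> \<bar>y - x\<bar> < d0 \<Longrightarrow> norm (H' y - H' x) \<le> \<epsilon> / 2"
        using e unfolding uniformly_continuous_on_def dist_norm
        by (metis half_gt_zero less_imp_le real_norm_def)
      have "d0 / 2 > 0" using d0 by simp
      then obtain d1 where d1: "d1 > 0" "\<And>x y. x \<in> {a..b} \<Longrightarrow> y \<in> {a..b} \<Longrightarrow> \<bar>y - x\<bar> < d1 \<Longrightarrow> norm (s y - s x) \<le> d0 / 2"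
        using ac_uniformly_continuous[OF s] by metis
      have "norm (F y - F x) \<le> \<epsilon> * (K y - K x)" if xy: "a \<le> x" "x \<le> y" "y \<le> b" "y - x < d1" for x y
      proof -
        have Fy: "F y - F x = H (s y) - H (s x) - (LINT s:{x..y}|lborel. f s)"
          unfolding F_def using set_integral_Icc_combine[OF i, of a x y] xy by simp
        have Ky: "K y - K x = (LINT t:{x..y}|lborel. \<bar>r t\<bar>)"
          unfolding K_def using set_integral_Icc_combine[OF ik, of a x y] xy by simp
        have mem: "s t \<in> {c..d}" if "t \<in> {x..y}" for t using that xy cd by auto
        have near: "\<bar>s t - s x\<bar> \<le> d0 / 2" if "t \<in> {x..y}" for t
          using d1(2)[of x t] that xy by auto
        have lin: "norm (H (s y) - H (s x) - (s y - s x) *\<^sub>R H' (s x)) \<le> \<bar>s y - s x\<bar> * (\<epsilon> / 2)"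
        proof -
          have "norm (H (s y) - H (s x) - (\<lambda>z. z *\<^sub>R H' (s x)) (s y - s x)) \<le> norm (s y - s x) * (\<epsilon> / 2)"
          proof (rule differentiable_bound_linearization[where S = "closed_segment (s x) (s y)" and f' = "\<lambda>z h. h *\<^sub>R H' z"])
            show "\<And>t. t \<in> {0..1} \<Longrightarrow> s x + t *\<^sub>R (s y - s x) \<in> closed_segment (s x) (s y)"
              by (auto simp: closed_segment_def algebra_simps intro!: exI)
            have seg: "closed_segment (s x) (s y) \<subseteq> {c..d}" using mem[of x] mem[of y] xy
              by (auto simp: closed_segment_eq_real_ivl split: if_splits)
            show "(H has_derivative (\<lambda>h. h *\<^sub>R H' z)) (at z within closed_segment (s x) (s y))"
              if "z \<in> closed_segment (s x) (s y)" for z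
              using H[of z] that seg sub unfolding has_vector_derivative_def
              by (blast intro: has_derivative_at_withinI)
            show "s x \<in> closed_segment (s x) (s y)" by simp
            show "onorm ((\<lambda>h. h *\<^sub>R H' z) - (\<lambda>h. h *\<^sub>R H' (s x))) \<le> \<epsilon> / 2" if z: "z \<in> closed_segment (s x) (s y)" for z
            proof (rule onorm_le)
              have "\<bar>z - s x\<bar> \<le> \<bar>s y - s x\<bar>"
                using z by (auto simp: closed_segment_eq_real_ivl split: if_splits)
              then have "norm (H' z - H' (s x)) \<le> \<epsilon> / 2"
                using d0(2)[of "s x" z] seg z near[of y] xy d0(1) mem[of x] by auto
              then show "norm (((\<lambda>h. h *\<^sub>R H' z) - (\<lambda>h. h *\<^sub>R H' (s x))) h) \<le> \<epsilon> / 2 * norm h" for h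
                using mult_left_mono[of "norm (H' z - H' (s x))" "\<epsilon> / 2" "\<bar>h\<bar>"] by (simp add: scaleR_diff_right[symmetric] ac_simps)
            qed
          qed
          then show ?thesis by simp
        qed
        have eq: "(LINT t:{x..y}|lborel. f t) - (s y - s x) *\<^sub>R H' (s x) = (LINT t:{x..y}|lborel. r t *\<^sub>R (H' (s t) - H' (s x)))"
          using i[of x y] set_integral_bounded_linear[OF bounded_linear_scaleR_left ac_integrable[OF s], of x y "H' (s x)"]
          by (subst ac_diff[OF s xy(2)]) (simp add: f_def scaleR_diff_right)
        have int2: "set_integrable lborel {x..y} (\<lambda>t. r t *\<^sub>R (H' (s t) - H' (s x)))"
          using i[of x y] set_integral_bounded_linear(2)[OF bounded_linear_scaleR_left ac_integrable[OF s], of x y "H' (s x)"]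
          by (simp add: f_def scaleR_diff_right)
        have b2: "norm (LINT t:{x..y}|lborel. r t *\<^sub>R (H' (s t) - H' (s x))) \<le> (LINT t:{x..y}|lborel. (\<epsilon> / 2) * \<bar>r t\<bar>)"
        proof (rule set_integral_norm_le[OF int2])
          show "set_integrable lborel {x..y} (\<lambda>t. (\<epsilon> / 2) * \<bar>r t\<bar>)" using ik by simp
          fix t assume t: "t \<in> {x..y}"
          have "norm (H' (s t) - H' (s x)) \<le> \<epsilon> / 2"
            using d0(2)[of "s x" "s t"] near[OF t] mem[OF t] mem[of x] xy d0(1) by auto
          then show "norm (r t *\<^sub>R (H' (s t) - H' (s x))) \<le> (\<epsilon> / 2) * \<bar>r t\<bar>"
            using mult_left_mono[of "norm (H' (s t) - H' (s x))" "\<epsilon> / 2" "\<bar>r t\<bar>"] by (simp add: ac_simps)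
        qed
        have b1: "\<bar>s y - s x\<bar> \<le> (LINT t:{x..y}|lborel. \<bar>r t\<bar>)"
          using set_integral_norm_le[OF ac_integrable[OF s] ik, of x y] ac_diff[OF s xy(2)] by simp
        have "norm (F y - F x) \<le> norm (H (s y) - H (s x) - (s y - s x) *\<^sub>R H' (s x)) + norm ((LINT t:{x..y}|lborel. f t) - (s y - s x) *\<^sub>R H' (s x))"
          unfolding Fy using norm_triangle_ineq4[of "H (s y) - H (s x) - (s y - s x) *\<^sub>R H' (s x)" "(LINT t:{x..y}|lborel. f t) - (s y - s x) *\<^sub>R H' (s x)"]
          by simp
        also have "\<dots> \<le> \<bar>s y - s x\<bar> * (\<epsilon> / 2) + (\<epsilon> / 2) * (LINT t:{x..y}|lborel. \<bar>r t\<bar>)"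
          using lin b2 unfolding eq by simp
        also have "\<dots> \<le> \<epsilon> * (K y - K x)" unfolding Ky using mult_left_mono[OF b1, of "\<epsilon>"] e by (simp add: field_simps)
        finally show ?thesis .
      qed
      then show "\<exists>\<delta>>0. \<forall>x y. a \<le> x \<and> x \<le> y \<and> y \<le> b \<and> y - x < \<delta> \<longrightarrow> norm (F y - F x) \<le> \<epsilon> * (K y - K x)"
        using d1(1) by (intro exI[of _ d1]) auto
    qed
    moreover have "(LINT s:{a..a}|lborel. f s) = 0"
      using set_integral_Icc_combine[OF i, of a a a] by simp
    ultimately show ?thesis by (simp add: F_def algebra_simps)
  qed
  show ?thesis unfolding has_ac_derivative_def
    using main i unfolding f_def by auto
qed

lemma set_integrable_if_integrable:
  fixes f :: "real \<Rightarrow> 'b::euclidean_space"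
  shows "integrable lborel f \<Longrightarrow> S \<in> sets borel \<Longrightarrow> set_integrable lborel S f"
  unfolding set_integrable_def by (intro integrable_mult_indicator) auto

lemma set_integrable_const_Icc: "set_integrable lborel {a..b::real} (\<lambda>_. c::'b::euclidean_space)"
  using borel_integrable_compact[of "{a..b}" "\<lambda>_. c"] by (simp add: set_integrable_def)

lemma ac_const: "has_ac_derivative (\<lambda>x. c) (\<lambda>x. 0)"
  by (rule ac_C1) (auto intro!: derivative_eq_intros)

lemma ac_add:
  assumes "has_ac_derivative v g" "has_ac_derivative w h"
  shows "has_ac_derivative (\<lambda>x. v x + w x) (\<lambda>x. g x + h x)"
  using assms unfolding has_ac_derivative_def by (auto simp: set_integral_add algebra_simps)

lemma ac_bounded_linear:
  assumes "bounded_linear T" "has_ac_derivative v g"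
  shows "has_ac_derivative (\<lambda>x. T (v x)) (\<lambda>x. T (g x))"
proof -
  interpret bounded_linear T by fact
  have "(\<lambda>x. T (g x)) \<in> borel_measurable borel"
    using borel_measurable_continuous_onI[OF linear_continuous_on[OF assms(1)]] ac_measurable[OF assms(2)]
    by (rule measurable_compose_rev)
  then show ?thesis
    using assms(2) unfolding has_ac_derivative_def
    by (auto simp: set_integral_bounded_linear[OF assms(1)] diff[symmetric])
qed

lemma ac_diff_fun:
  assumes "has_ac_derivative v g" "has_ac_derivative w h"
  shows "has_ac_derivative (\<lambda>x. v x - w x) (\<lambda>x. g x - h x)"
  using ac_add[OF assms(1) ac_bounded_linear[OF bounded_linear_minus[OF bounded_linear_ident] assms(2)]] by simp

lemma ac_primitive:
  fixes g :: "real \<Rightarrow> 'b::euclidean_space"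
  assumes "g \<in> borel_measurable borel" "\<And>a b. set_integrable lborel {a..b} g"
  obtains v where "has_ac_derivative v g" "v 0 = 0"
proof -
  define v where "v x = (if x \<ge> 0 then (LINT s:{0..x}|lborel. g s) else - (LINT s:{x..0}|lborel. g s))" for x
  have z: "(LINT s:{a}|lborel. g s) = 0" for a
    using set_integral_Icc_combine[OF assms(2), of a a a] by simp
  have "v b - v a = (LINT s:{a..b}|lborel. g s)" if "a \<le> b" for a b
    using set_integral_Icc_combine[OF assms(2), of 0 a b] set_integral_Icc_combine[OF assms(2), of a 0 b]
      set_integral_Icc_combine[OF assms(2), of a b 0] that
    by (auto simp: v_def algebra_simps)
  then have "has_ac_derivative v g" using assms by (auto simp: has_ac_derivative_def)
  moreover have "v 0 = 0" by (simp add: v_def z)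
  ultimately show ?thesis using that by blast
qed

lemma ac_zero_imp_const:
  assumes "has_ac_derivative v (\<lambda>x. 0)"
  shows "v x = v y"
  using ac_diff[OF assms, of x y] ac_diff[OF assms, of y x] by (cases "x \<le> y") auto

lemma ac_norm_square:
  assumes "has_ac_derivative v g"
  shows "has_ac_derivative (\<lambda>x. (norm (v x))\<^sup>2) (\<lambda>x. 2 * (g x \<bullet> v x))"
  using ac_bounded_bilinear[OF bounded_bilinear_inner assms assms]
  by (simp add: power2_norm_eq_inner inner_commute)

section \<open>Decay at infinity and curves of finite energy\<close>

lemma window_integral_tendsto_zero:
  fixes f :: "real \<Rightarrow> real"
  assumes "integrable lborel f"
  shows "((\<lambda>x. LINT s:{x..x+\<delta>}|lborel. f s) \<longlongrightarrow> 0) at_top"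
    and "((\<lambda>x. LINT s:{-x..-x+\<delta>}|lborel. f s) \<longlongrightarrow> 0) at_top"
proof -
  have [measurable]: "f \<in> borel_measurable borel" using borel_measurable_integrable[OF assms] by simp
  have "((\<lambda>x. LINT s|lborel. indicator {x..x+\<delta>} s *\<^sub>R f s) \<longlongrightarrow> (LINT s|(lborel::real measure). (0::real))) at_top"
  proof (rule integral_dominated_convergence_at_top[where s = "\<lambda>x s. indicator {x..x+\<delta>} s *\<^sub>R f s" and f = "\<lambda>_. 0" and w = "\<lambda>s. \<bar>f s\<bar>" and M = lborel])
    show "AE s in lborel. ((\<lambda>x. indicat_real {x..x + \<delta>} s *\<^sub>R f s) \<longlongrightarrow> 0) at_top"
    proof (rule AE_I2)
      show "((\<lambda>x. indicat_real {x..x + \<delta>} s *\<^sub>R f s) \<longlongrightarrow> 0) at_top" for s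
        by (intro tendsto_eventually eventually_at_top_linorderI[of "s + 1"]) auto
    qed
  qed (use assms in \<open>auto simp: indicator_def intro!: always_eventually\<close>)
  then show "((\<lambda>x. LINT s:{x..x+\<delta>}|lborel. f s) \<longlongrightarrow> 0) at_top"
    by (simp add: set_lebesgue_integral_def)
  have "((\<lambda>x. LINT s|lborel. indicator {-x..-x+\<delta>} s *\<^sub>R f s) \<longlongrightarrow> (LINT s|(lborel::real measure). (0::real))) at_top"
  proof (rule integral_dominated_convergence_at_top[where s = "\<lambda>x s. indicator {-x..-x+\<delta>} s *\<^sub>R f s" and f = "\<lambda>_. 0" and w = "\<lambda>s. \<bar>f s\<bar>" and M = lborel])
    show "AE s in lborel. ((\<lambda>x. indicat_real {-x..-x + \<delta>} s *\<^sub>R f s) \<longlongrightarrow> 0) at_top"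
    proof (rule AE_I2)
      show "((\<lambda>x. indicat_real {-x..-x + \<delta>} s *\<^sub>R f s) \<longlongrightarrow> 0) at_top" for s
        by (intro tendsto_eventually eventually_at_top_linorderI[of "\<delta> - s + 1"]) auto
    qed
  qed (use assms in \<open>auto simp: indicator_def intro!: always_eventually\<close>)
  then show "((\<lambda>x. LINT s:{-x..-x+\<delta>}|lborel. f s) \<longlongrightarrow> 0) at_top"
    by (simp add: set_lebesgue_integral_def)
qed

lemma set_integral_ge_const:
  fixes f :: "real \<Rightarrow> real"
  assumes "set_integrable lborel {x..x+\<delta>} f" "\<And>s. s \<in> {x..x+\<delta>} \<Longrightarrow> c \<le> f s" "0 \<le> \<delta>"
  shows "c * \<delta> \<le> (LINT s:{x..x+\<delta>}|lborel. f s)"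
proof -
  have "(LINT s:{x..x+\<delta>}|lborel. c) \<le> (LINT s:{x..x+\<delta>}|lborel. f s)"
    using assms by (intro set_integral_mono) (auto simp: set_integrable_def)
  moreover have "(LINT s:{x..x+\<delta>}|lborel. c) = c * \<delta>"
    using assms(3) by (simp add: set_lebesgue_integral_def)
  ultimately show ?thesis by simp
qed

text \<open>An integrable function may keep returning to large values, but its integrals over moving
  windows tend to zero. Adding the reflected function makes both ends small at the same
  radii.\<close>

lemma integrable_sequence_to_zero:
  fixes f :: "real \<Rightarrow> real"
  assumes f: "integrable lborel f" "\<And>x. 0 \<le> f x"
  obtains R :: "nat \<Rightarrow> real" where "filterlim R at_top sequentially"
    "(\<lambda>n. f (R n)) \<longlonglongrightarrow> 0" "(\<lambda>n. f (- R n)) \<longlonglongrightarrow> 0"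
proof -
  define k where "k = (\<lambda>x. f x + f (- x))"
  have k: "integrable lborel k"
    unfolding k_def using f(1) lborel_integrable_real_affine[OF f(1), of "-1" 0] by simp
  have "\<exists>R. R > real n \<and> k R < 1 / (real n + 1)" for n
  proof (rule ccontr)
    assume "\<not> ?thesis"
    then have ge: "\<And>R. R > real n \<Longrightarrow> 1 / (real n + 1) \<le> k R" by (meson not_le)
    have "eventually (\<lambda>x. (LINT s:{x..x+1}|lborel. k s) < 1 / (real n + 1)) at_top"
      using order_tendstoD(2)[OF window_integral_tendsto_zero(1)[OF k, of 1], of "1 / (real n + 1)"] by simp
    then obtain x where x: "x > real n" "(LINT s:{x..x+1}|lborel. k s) < 1 / (real n + 1)"
      using eventually_happens'[OF trivial_limit_at_top_linorder eventually_conj[OF eventually_gt_at_top[of "real n"]]] by blast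
    have "1 / (real n + 1) * 1 \<le> (LINT s:{x..x+1}|lborel. k s)"
      by (rule set_integral_ge_const) (use x ge in \<open>auto intro!: set_integrable_if_integrable k\<close>)
    then show False using x(2) by simp
  qed
  then obtain R where R: "\<And>n. R n > real n" "\<And>n. k (R n) < 1 / (real n + 1)" by metis
  have lim: "(\<lambda>n. 1 / (real n + 1)) \<longlonglongrightarrow> 0"
    using LIMSEQ_inverse_real_of_nat by (simp add: inverse_eq_divide add.commute)
  have "filterlim R at_top sequentially"
    by (rule filterlim_at_top_mono[OF filterlim_real_sequentially]) (use R(1) in \<open>auto intro!: always_eventually less_imp_le\<close>)
  moreover have "f (R n) \<le> 1 / (real n + 1)" "f (- R n) \<le> 1 / (real n + 1)" for n
    using R(2)[of n] f(2)[of "R n"] f(2)[of "- R n"] by (auto simp: k_def)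
  then have "(\<lambda>n. f (R n)) \<longlonglongrightarrow> 0" "(\<lambda>n. f (- R n)) \<longlonglongrightarrow> 0"
    by (auto intro!: tendsto_sandwich[OF _ _ tendsto_const lim] simp: f(2))
  ultimately show ?thesis using that by blast
qed

definition finite_energy_1d :: "(real \<Rightarrow> complex) \<Rightarrow> (real \<Rightarrow> complex) \<Rightarrow> bool" where
  "finite_energy_1d v g \<longleftrightarrow> has_ac_derivative v g \<and> integrable lborel (\<lambda>x. (cmod (g x))\<^sup>2) \<and>
     integrable lborel (\<lambda>x. (1 - (cmod (v x))\<^sup>2)\<^sup>2)"

definition energy_1d :: "(real \<Rightarrow> complex) \<Rightarrow> (real \<Rightarrow> complex) \<Rightarrow> real" where
  "energy_1d v g = (LINT x|lborel. 1/2 * (cmod (g x))\<^sup>2 + 1/4 * (1 - (cmod (v x))\<^sup>2)\<^sup>2)"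

text \<open>Weighted Young inequality: \<open>norm (g s)\<close> is at most
  \<open>l / 2 + (norm (g s))\<^sup>2 / (2 * l)\<close>, where \<open>l\<close> is a weight. It is
  chosen so large that the second part contributes at most half of \<epsilon>; a step of length
  \<open>\<epsilon> / l\<close> handles the first. The modulus of continuity holds on the whole
  line.\<close>

lemma ac_uniformly_continuous_L2:
  assumes "has_ac_derivative v g" "integrable lborel (\<lambda>x. (norm (g x))\<^sup>2)" "\<epsilon> > 0"
  obtains \<delta> where "\<delta> > 0" "\<And>x y. x \<le> y \<Longrightarrow> y \<le> x + \<delta> \<Longrightarrow> norm (v y - v x) \<le> \<epsilon>"
proof -
  define G where "G = (LINT x|lborel. (norm (g x))\<^sup>2)"
  have G: "G \<ge> 0" by (simp add: G_def)
  define l where "l = G / \<epsilon> + 1"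
  have l: "l > 0" "G / (2 * l) \<le> \<epsilon> / 2"
    using G assms(3) by (auto simp: l_def add_nonneg_pos field_simps)
  have "norm (v y - v x) \<le> \<epsilon>" if xy: "x \<le> y" "y \<le> x + \<epsilon> / l" for x y
  proof -
    have i: "set_integrable lborel {x..y} (\<lambda>s. (norm (g s))\<^sup>2)"
      unfolding set_integrable_def using assms(2) by (intro integrable_mult_indicator) auto
    have "norm (v y - v x) \<le> (LINT s:{x..y}|lborel. l / 2 + (norm (g s))\<^sup>2 * (1 / (2 * l)))"
      unfolding ac_diff[OF assms(1) xy(1)]
    proof (rule set_integral_norm_le[OF ac_integrable[OF assms(1)]])
      show "set_integrable lborel {x..y} (\<lambda>s. l / 2 + (norm (g s))\<^sup>2 * (1 / (2 * l)))"
        using i by (intro set_integral_add(1) set_integrable_mult_left set_integrable_const_Icc) auto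
      fix s
      have "0 \<le> (l - norm (g s))\<^sup>2" by simp
      then show "norm (g s) \<le> l / 2 + (norm (g s))\<^sup>2 * (1 / (2 * l))"
        using l by (simp add: field_simps power2_eq_square)
    qed
    also have "\<dots> = (LINT s:{x..y}|lborel. l / 2) + (LINT s:{x..y}|lborel. (norm (g s))\<^sup>2) * (1 / (2 * l))"
      using i by (subst set_integral_add) (auto intro!: set_integrable_const_Icc)
    also have "(LINT s:{x..y}|lborel. l / 2) \<le> \<epsilon> / 2"
      using xy l by (simp add: set_lebesgue_integral_def field_simps)
    also have "(LINT s:{x..y}|lborel. (norm (g s))\<^sup>2) \<le> G"
      unfolding G_def set_lebesgue_integral_def using assms(2)
      by (intro integral_mono integrable_mult_indicator) (auto simp: indicator_def)
    finally have "norm (v y - v x) \<le> \<epsilon> / 2 + G * (1 / (2 * l))" using l by (simp add: divide_right_mono)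
    also have "\<dots> \<le> \<epsilon>" using l(2) by simp
    finally show ?thesis .
  qed
  then show ?thesis using that[of "\<epsilon> / l"] l assms(3) by simp
qed

text \<open>If the modulus is \<epsilon> away from 1 at some point, uniform continuity keeps it
  \<epsilon>/2 away on a window of fixed length. That window costs a fixed amount of potential
  energy, which is impossible far out.\<close>

lemma finite_energy_modulus_limit:
  assumes "finite_energy_1d v g"
  shows "((\<lambda>x. cmod (v x)) \<longlongrightarrow> 1) at_top" "((\<lambda>x. cmod (v (- x))) \<longlongrightarrow> 1) at_top"
proof -
  note fe = assms[unfolded finite_energy_1d_def]
  define f where "f = (\<lambda>x. (1 - (cmod (v x))\<^sup>2)\<^sup>2)"
  have f: "integrable lborel f" using fe by (simp add: f_def)
  have fi: "set_integrable lborel {a..b} f" for a b :: real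
    unfolding set_integrable_def using f by (intro integrable_mult_indicator) auto
  have key: "\<exists>\<eta>>0. \<exists>\<delta>. \<forall>x. \<epsilon> \<le> \<bar>cmod (v x) - 1\<bar> \<longrightarrow> \<eta> \<le> (LINT s:{x..x+\<delta>}|lborel. f s)" if e: "\<epsilon> > 0" for \<epsilon>
  proof -
    obtain \<delta> where d: "\<delta> > 0" "\<And>x y. x \<le> y \<Longrightarrow> y \<le> x + \<delta> \<Longrightarrow> norm (v y - v x) \<le> \<epsilon> / 2"
      using ac_uniformly_continuous_L2[of v g "\<epsilon>/2"] fe e by auto
    have "(\<epsilon>/2)\<^sup>2 * \<delta> \<le> (LINT s:{x..x+\<delta>}|lborel. f s)" if x: "\<epsilon> \<le> \<bar>cmod (v x) - 1\<bar>" for x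
    proof (rule set_integral_ge_const[OF fi])
      fix s assume s: "s \<in> {x..x+\<delta>}"
      have "\<bar>cmod (v s) - cmod (v x)\<bar> \<le> \<epsilon> / 2"
        using d(2)[of x s] s norm_triangle_ineq3[of "v s" "v x"] by auto
      then have "\<epsilon> / 2 \<le> \<bar>1 - cmod (v s)\<bar>" using x by linarith
      also have "\<dots> \<le> \<bar>1 - cmod (v s)\<bar> * (1 + cmod (v s))" by (simp add: mult_le_cancel_left1)
      also have "\<dots> = \<bar>1 - (cmod (v s))\<^sup>2\<bar>"
      proof -
        have "1 - (cmod (v s))\<^sup>2 = (1 - cmod (v s)) * (1 + cmod (v s))" by (simp add: power2_eq_square algebra_simps)
        then show ?thesis by (simp add: abs_mult)
      qed
      finally show "(\<epsilon>/2)\<^sup>2 \<le> f s" unfolding f_def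
        using e by (metis abs_le_square_iff abs_of_pos half_gt_zero power2_abs)
    qed (use d in auto)
    moreover have "(\<epsilon>/2)\<^sup>2 * \<delta> > 0" using e d by simp
    ultimately show ?thesis by blast
  qed
  show "((\<lambda>x. cmod (v x)) \<longlongrightarrow> 1) at_top"
  proof (rule tendstoI)
    fix \<epsilon> :: real assume "\<epsilon> > 0"
    from key[OF this] obtain \<eta> \<delta> where k: "\<eta> > 0" "\<And>x. \<epsilon> \<le> \<bar>cmod (v x) - 1\<bar> \<Longrightarrow> \<eta> \<le> (LINT s:{x..x+\<delta>}|lborel. f s)" by blast
    show "eventually (\<lambda>x. dist (cmod (v x)) 1 < \<epsilon>) at_top"
      using order_tendstoD(2)[OF window_integral_tendsto_zero(1)[OF f] k(1), of \<delta>]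
      proof eventually_elim
        case (elim x)
        then show ?case using k(2)[of x] by (cases "\<epsilon> \<le> \<bar>cmod (v x) - 1\<bar>") (auto simp: dist_real_def)
      qed
  qed
  show "((\<lambda>x. cmod (v (- x))) \<longlongrightarrow> 1) at_top"
  proof (rule tendstoI)
    fix \<epsilon> :: real assume "\<epsilon> > 0"
    from key[OF this] obtain \<eta> \<delta> where k: "\<eta> > 0" "\<And>x. \<epsilon> \<le> \<bar>cmod (v x) - 1\<bar> \<Longrightarrow> \<eta> \<le> (LINT s:{x..x+\<delta>}|lborel. f s)" by blast
    show "eventually (\<lambda>x. dist (cmod (v (- x))) 1 < \<epsilon>) at_top"
      using order_tendstoD(2)[OF window_integral_tendsto_zero(2)[OF f] k(1), of \<delta>]
      proof eventually_elim
        case (elim x)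
        then show ?case using k(2)[of "-x"] by (cases "\<epsilon> \<le> \<bar>cmod (v (-x)) - 1\<bar>") (auto simp: dist_real_def)
      qed
  qed
qed

section \<open>The soliton branch on the line\<close>

text \<open>The parameter is the angle with speed \<open>c = sqrt 2 * sin \<omega>\<close>, so the
  soliton joins \<open>- cos \<omega> + \<i> * sin \<omega>\<close> to
  \<open>cos \<omega> + \<i> * sin \<omega>\<close>. The integral contributes
  \<open>sin (2 * \<omega>) / 2\<close> and the phase jump \<open>\<omega> - pi / 2\<close>; adding
  pi brings the branch into the interval from 0 to pi.\<close>

definition soliton_momentum :: "real \<Rightarrow> real" where
  "soliton_momentum \<omega> = pi / 2 + \<omega> + sin (2 * \<omega>) / 2"

definition soliton_energy :: "real \<Rightarrow> real" where
  "soliton_energy \<omega> = 2 * sqrt 2 / 3 * cos \<omega> ^ 3"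

lemma abs_sin_diff_le: "\<bar>sin a - sin b\<bar> \<le> \<bar>a - b :: real\<bar>"
proof -
  have "\<bar>sin a - sin b\<bar> = 2 * \<bar>sin ((a - b) / 2)\<bar> * \<bar>cos ((a + b) / 2)\<bar>"
    by (simp add: sin_diff_sin abs_mult)
  also have "\<dots> \<le> 2 * \<bar>(a - b) / 2\<bar> * 1"
    by (intro mult_mono abs_sin_x_le_abs_x) auto
  finally show ?thesis by simp
qed

text \<open>The expression \<open>x - sin x * cos x\<close> is the area of the segment that a chord
  of half-angle \<open>x\<close> cuts off the unit disc. The soliton runs along the chord with
  \<open>x = pi / 2 - \<bar>\<omega>\<bar>\<close>.\<close>

lemma sector_momentum_mono:
  "a \<le> b \<Longrightarrow> a - sin a * cos a \<le> b - sin b * cos (b::real)"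
  using abs_sin_diff_le[of "2 * b" "2 * a"] by (simp add: sin_double)

text \<open>Up to the factor \<open>sqrt 2\<close> in the energy, \<open>(x - sin x * cos x, 2 / 3 * sin x ^ 3)\<close> with \<open>x = \<pi> / 2 - |\<omega>|\<close> is the
  momentum-energy curve of the solitons, and \<open>cos x\<close> is its slope.\<close>
lemma soliton_energy_tangent:
  assumes f: "0 \<le> f" "f \<le> pi / 2" and F: "0 \<le> F" "F \<le> pi / 2" and q: "F - sin F * cos F \<le> q"
  shows "2 / 3 * sin F ^ 3 \<le> sin f - sin f ^ 3 / 3 - f * cos f + cos f * q"
proof -
  define D where "D x = sin x - sin x ^ 3 / 3 - x * cos x + cos x * (F - sin F * cos F)" for x
  define D' where "D' x = sin x * ((x - sin x * cos x) - (F - sin F * cos F))" for x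
  have der: "(D has_real_derivative D' x) (at x)" for x
    unfolding D_def D'_def
    by (auto intro!: derivative_eq_intros simp: power2_eq_square algebra_simps)
  have "D F \<le> D f"
  proof (cases "F \<le> f")
    case True
    show ?thesis
    proof (rule DERIV_nonneg_imp_nondecreasing[OF True])
      fix x assume "F \<le> x" "x \<le> f"
      then show "\<exists>y. (D has_real_derivative y) (at x) \<and> 0 \<le> y"
        using der[of x] sector_momentum_mono[of F x] f F
        by (intro exI[of _ "D' x"]) (auto simp: D'_def intro!: mult_nonneg_nonneg sin_ge_zero)
    qed
  next
    case False
    show ?thesis
    proof (rule DERIV_nonpos_imp_nonincreasing[of f F])
      fix x assume "f \<le> x" "x \<le> F"
      then show "\<exists>y. (D has_real_derivative y) (at x) \<and> y \<le> 0"
        using der[of x] sector_momentum_mono[of x F] f F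
        by (intro exI[of _ "D' x"]) (auto simp: D'_def intro!: mult_nonneg_nonpos sin_ge_zero)
    qed (use False in simp)
  qed
  moreover have "D F = sin F * (1 - (cos F)\<^sup>2) - sin F ^ 3 / 3"
    by (simp add: D_def power2_eq_square algebra_simps)
  then have "D F = sin F * (sin F)\<^sup>2 - sin F ^ 3 / 3" by (simp only: sin_squared_eq)
  then have "D F = 2 / 3 * sin F ^ 3"
    by (simp add: power2_eq_square power3_eq_cube)
  moreover have "D f \<le> sin f - sin f ^ 3 / 3 - f * cos f + cos f * q"
    unfolding D_def using q cos_ge_zero[of f] f by (intro add_mono mult_left_mono) auto
  ultimately show ?thesis by linarith
qed

section \<open>Calibrations and the sharp energy bound on the line\<close>

text \<open>At a point of squared modulus \<open>r\<close>, the unit vector along a line at distance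
  \<open>m\<close> from the origin has radial component \<open>sqrt (r - m\<^sup>2) / sqrt r\<close>
  and angular component \<open>m / sqrt r\<close>. The radial part, weighted by \<open>1 - r\<close>
  and expressed as a derivative in \<open>r\<close>, is this slope; the angular part is charged to
  the momentum. The truncations make the slope continuous everywhere and zero for \<open>r\<close>
  \<le> \<open>m\<^sup>2\<close> and for \<open>r\<close> \<ge> 1.\<close>

definition calibration_slope :: "real \<Rightarrow> real \<Rightarrow> real" where
  "calibration_slope m r = max 0 (1 - r) * sqrt (max 0 (r - m\<^sup>2)) / (2 * max (m\<^sup>2) r)"

lemma calibration_exists:
  assumes m: "0 < m"
  obtains H where "\<And>s. (H has_vector_derivative calibration_slope m s) (at s)"
    "H 0 = H (m\<^sup>2)" "m \<le> 1 \<Longrightarrow> H 1 - H (m\<^sup>2) = sqrt (1 - m\<^sup>2) - sqrt (1 - m\<^sup>2) ^ 3 / 3 - m * arctan (sqrt (1 - m\<^sup>2) / m)"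
proof -
  have m2: "m\<^sup>2 > 0" using m by simp
  have c: "continuous_on UNIV (calibration_slope m)"
    unfolding calibration_slope_def using m2 by (intro continuous_intros) (auto simp: max_def not_le)
  have "\<exists>H. \<forall>x::real. (-\<infinity>::ereal) < ereal x \<longrightarrow> ereal x < \<infinity> \<longrightarrow> (H has_vector_derivative calibration_slope m x) (at x)"
    by (rule einterval_antiderivative) (use c in \<open>auto simp: continuous_on_eq_continuous_at\<close>)
  then obtain H where H: "\<And>s. (H has_vector_derivative calibration_slope m s) (at s)" by auto
  then have Hr: "\<And>s. (H has_real_derivative calibration_slope m s) (at s)"
    by (simp add: has_real_derivative_iff_has_vector_derivative)
  have Hc: "continuous_on S H" for S
    by (meson Hr DERIV_isCont continuous_at_imp_continuous_on)
  have "H (m\<^sup>2) = H 0"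
  proof (rule DERIV_isconst_end[OF m2 Hc])
    fix x assume "0 < x" "x < m\<^sup>2"
    then show "DERIV H x :> 0" using Hr[of x] by (simp add: calibration_slope_def max_def)
  qed
  moreover have "H 1 - H (m\<^sup>2) = sqrt (1 - m\<^sup>2) - sqrt (1 - m\<^sup>2) ^ 3 / 3 - m * arctan (sqrt (1 - m\<^sup>2) / m)" if "m \<le> 1"
  proof (cases "m = 1")
    case False
    then have m1: "m\<^sup>2 < 1" using that m by (simp add: power_less_one_iff)
    \<comment> \<open>Substituting \<open>t = sqrt (s - m\<^sup>2)\<close> turns the integrand into
      \<open>1 - m\<^sup>2 / (t\<^sup>2 + m\<^sup>2) - t\<^sup>2\<close>, which explains the three
      terms.\<close>
    define K where "K s = sqrt (s - m\<^sup>2) - sqrt (s - m\<^sup>2) ^ 3 / 3 - m * arctan (sqrt (s - m\<^sup>2) / m)" for s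
    have "H 1 - K 1 = H (m\<^sup>2) - K (m\<^sup>2)"
    proof (rule DERIV_isconst_end[OF m1, of "\<lambda>s. H s - K s"])
      show "continuous_on {m\<^sup>2..1} (\<lambda>s. H s - K s)"
        unfolding K_def using m by (intro continuous_intros Hc) auto
      fix x assume x: "m\<^sup>2 < x" "x < 1"
      define t where "t = sqrt (x - m\<^sup>2)"
      have t: "t > 0" "t\<^sup>2 = x - m\<^sup>2" using x by (auto simp: t_def)
      have x0: "x > 0" using x m2 by linarith
      have eq: "1 + (t / m)\<^sup>2 = x / m\<^sup>2" using m t(2) by (simp add: field_simps)
      have "(K has_real_derivative (inverse t / 2 - (3 * t\<^sup>2 * (inverse t / 2)) / 3 - m * (inverse (1 + (t / m)\<^sup>2) * (inverse t / 2 / m)))) (at x)"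
        unfolding K_def t_def
        by (rule derivative_eq_intros refl | use x m in simp)+
      moreover have "inverse t / 2 - (3 * t\<^sup>2 * (inverse t / 2)) / 3 - m * (inverse (1 + (t / m)\<^sup>2) * (inverse t / 2 / m)) = calibration_slope m x"
      proof -
        have "inverse t / 2 - (3 * t\<^sup>2 * (inverse t / 2)) / 3 - m * (inverse (1 + (t / m)\<^sup>2) * (inverse t / 2 / m)) = (x - m\<^sup>2 - t\<^sup>2 * x) / (2 * t * x)"
          unfolding eq using m t(1) x0 by (simp add: field_simps)
        also have "x - m\<^sup>2 - t\<^sup>2 * x = t * t * (1 - x)" using t(2) by (simp add: algebra_simps power2_eq_square)
        also have "\<dots> / (2 * t * x) = calibration_slope m x"
          using x t x0 by (simp add: calibration_slope_def t_def[symmetric] max_def field_simps)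
        finally show ?thesis .
      qed
      ultimately have "(K has_real_derivative calibration_slope m x) (at x)" by (simp only:)
      then show "((\<lambda>s. H s - K s) has_real_derivative 0) (at x)"
        using DERIV_diff[OF Hr[of x], of K "calibration_slope m x"] by simp
    qed
    then show ?thesis by (simp add: K_def)
  qed simp
  ultimately show ?thesis using that H by metis
qed

lemma momentum_parallelogram:
  "(g \<bullet> v)\<^sup>2 + (g \<bullet> (\<i> * v))\<^sup>2 = (cmod g)\<^sup>2 * (cmod v)\<^sup>2"
  unfolding cmod_power2 by (simp add: inner_complex_def power2_eq_square algebra_simps)

text \<open>The square that is discarded vanishes when
  \<open>sqrt 2 * x = \<bar>1 - r\<bar>\<close>, the equipartition of energy that holds along
  solitons; this is why the final bound is sharp.\<close>

lemma young_energy: "\<bar>1 - r\<bar> * x \<le> sqrt 2 * (1/2 * x\<^sup>2 + 1/4 * (1 - r)\<^sup>2)"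
proof -
  have [simp]: "sqrt 2 * (sqrt 2 * y) = 2 * y" for y by (simp flip: mult.assoc)
  have "0 \<le> (sqrt 2 * x - \<bar>1 - r\<bar>)\<^sup>2" by simp
  also have "\<dots> = 2 * sqrt 2 * (sqrt 2 * (1/2 * x\<^sup>2 + 1/4 * (1 - r)\<^sup>2) - \<bar>1 - r\<bar> * x)"
    by (simp add: power2_diff power_mult_distrib algebra_simps)
  finally show ?thesis by (simp add: zero_le_mult_iff)
qed

text \<open>Cauchy-Schwarz in the orthogonal frame \<open>v\<close>, \<open>\<i> * v\<close> against
  the vector with entries \<open>t\<close> and \<open>m\<close>, whose squared length is
  \<open>r\<close>, followed by Young. The sign \<sigma> serves the two sides of the point of
  minimal modulus, the sign \<tau> the two senses of rotation.\<close>

lemma calibration_pointwise: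
  fixes g v :: complex
  assumes m: "0 < m" "m \<le> cmod v" and s: "\<sigma> \<in> {-1, 1}" "\<tau> \<in> {-1, 1}"
  defines "r \<equiv> (cmod v)\<^sup>2"
  shows "\<sigma> * (2 * (g \<bullet> v) * calibration_slope m r) + \<tau> * m * ((1 - r) * (g \<bullet> (\<i> * v)) / r)
    \<le> sqrt 2 * (1/2 * (cmod g)\<^sup>2 + 1/4 * (1 - r)\<^sup>2)"
proof -
  define t where "t = sqrt (r - m\<^sup>2)"
  have r: "m\<^sup>2 \<le> r" "0 < r" using m by (auto simp: r_def power_mono)
  have t: "t \<ge> 0" "t\<^sup>2 + m\<^sup>2 = r" using r by (auto simp: t_def)
  define a b where "a = \<bar>g \<bullet> v\<bar>" and "b = \<bar>g \<bullet> (\<i> * v)\<bar>"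
  have ab: "a\<^sup>2 + b\<^sup>2 = (cmod g)\<^sup>2 * r" unfolding a_def b_def r_def by (simp add: momentum_parallelogram)
  have "(t * a + m * b)\<^sup>2 \<le> (t\<^sup>2 + m\<^sup>2) * (a\<^sup>2 + b\<^sup>2)"
  proof -
    have "0 \<le> (t * b - m * a)\<^sup>2" by simp
    then show ?thesis by (simp add: power2_eq_square algebra_simps)
  qed
  also have "\<dots> = (cmod g * r)\<^sup>2" unfolding ab t(2) by (simp add: power2_eq_square)
  finally have cs: "t * a + m * b \<le> cmod g * r"
    using r by (auto intro: power2_le_imp_le)
  have slope: "calibration_slope m r = max 0 (1 - r) * t / (2 * r)"
    using r by (simp add: calibration_slope_def t_def max_def)
  have "\<sigma> * (2 * (g \<bullet> v) * calibration_slope m r) \<le> \<bar>1 - r\<bar> * (t * a) / r"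
  proof -
    have "\<sigma> * (2 * (g \<bullet> v) * calibration_slope m r) \<le> \<bar>\<sigma> * (2 * (g \<bullet> v) * calibration_slope m r)\<bar>" by simp
    also have "\<dots> = a * max 0 (1 - r) * t / r"
      unfolding slope using s r t by (auto simp: abs_mult a_def)
    also have "\<dots> \<le> a * \<bar>1 - r\<bar> * t / r"
      using r t by (intro divide_right_mono mult_right_mono mult_left_mono) (auto simp: a_def)
    finally show ?thesis by (simp add: ac_simps)
  qed
  moreover have "\<tau> * m * ((1 - r) * (g \<bullet> (\<i> * v)) / r) \<le> \<bar>1 - r\<bar> * (m * b) / r"
  proof -
    have "\<tau> * m * ((1 - r) * (g \<bullet> (\<i> * v)) / r) \<le> \<bar>\<tau> * m * ((1 - r) * (g \<bullet> (\<i> * v)) / r)\<bar>" by (rule abs_ge_self)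
    also have "\<dots> = \<bar>1 - r\<bar> * (m * b) / r" using s r m by (auto simp: abs_mult b_def)
    finally show ?thesis .
  qed
  ultimately have "\<sigma> * (2 * (g \<bullet> v) * calibration_slope m r) + \<tau> * m * ((1 - r) * (g \<bullet> (\<i> * v)) / r)
    \<le> \<bar>1 - r\<bar> * (t * a) / r + \<bar>1 - r\<bar> * (m * b) / r" by linarith
  also have "\<dots> = \<bar>1 - r\<bar> * (t * a + m * b) / r" by (simp add: add_divide_distrib distrib_left)
  also have "\<dots> \<le> \<bar>1 - r\<bar> * (cmod g * r) / r"
    using cs r by (intro divide_right_mono mult_left_mono) auto
  also have "\<dots> = \<bar>1 - r\<bar> * cmod g" using r by simp
  also have "\<dots> \<le> sqrt 2 * (1/2 * (cmod g)\<^sup>2 + 1/4 * (1 - r)\<^sup>2)" by (rule young_energy)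
  finally show ?thesis .
qed

text \<open>Adding the bounds for both values of \<tau> cancels the angular term; where the modulus
  is below \<open>m\<close> the slope is zero.\<close>

lemma calibration_pointwise_radial:
  fixes g v :: complex
  assumes m: "0 < m" and s: "\<sigma> \<in> {-1, 1}"
  defines "r \<equiv> (cmod v)\<^sup>2"
  shows "\<sigma> * (2 * (g \<bullet> v) * calibration_slope m r) \<le> sqrt 2 * (1/2 * (cmod g)\<^sup>2 + 1/4 * (1 - r)\<^sup>2)"
proof (cases "m \<le> cmod v")
  case True
  show ?thesis
    using calibration_pointwise[OF m True s, of 1 g] calibration_pointwise[OF m True s, of "-1" g]
    unfolding r_def by auto
next
  case False
  then have "r \<le> m\<^sup>2" by (auto simp: r_def power_mono)
  then have "calibration_slope m r = 0" by (simp add: calibration_slope_def max_def)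
  then show ?thesis by simp
qed

lemma energy_density_1d_integrable:
  assumes "finite_energy_1d v g"
  shows "integrable lborel (\<lambda>x. 1/2 * (cmod (g x))\<^sup>2 + 1/4 * (1 - (cmod (v x))\<^sup>2)\<^sup>2)"
  using assms unfolding finite_energy_1d_def
  by (auto intro!: Bochner_Integration.integrable_add)

lemma increment_le_energy:
  assumes fe: "finite_energy_1d v g" and F: "has_ac_derivative F f" and ab: "a \<le> b"
    and le: "\<And>x. f x \<le> sqrt 2 * (1/2 * (cmod (g x))\<^sup>2 + 1/4 * (1 - (cmod (v x))\<^sup>2)\<^sup>2)"
  shows "F b - F a \<le> sqrt 2 * (LINT x:{a..b}|lborel. 1/2 * (cmod (g x))\<^sup>2 + 1/4 * (1 - (cmod (v x))\<^sup>2)\<^sup>2)"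
proof -
  have i: "set_integrable lborel {a..b} (\<lambda>x. 1/2 * (cmod (g x))\<^sup>2 + 1/4 * (1 - (cmod (v x))\<^sup>2)\<^sup>2)"
    by (rule set_integrable_if_integrable[OF energy_density_1d_integrable[OF fe]]) simp
  have "F b - F a \<le> (LINT x:{a..b}|lborel. sqrt 2 * (1/2 * (cmod (g x))\<^sup>2 + 1/4 * (1 - (cmod (v x))\<^sup>2)\<^sup>2))"
    unfolding ac_diff[OF F ab]
    by (intro set_integral_mono ac_integrable[OF F] set_integrable_mult_right impI i le)
  then show ?thesis by (simp only: set_integral_mult_right)
qed

lemma two_sided_increments_le_energy:
  assumes fe: "finite_energy_1d v g" and F: "has_ac_derivative F f" and G: "has_ac_derivative G k"
    and leF: "\<And>x. f x \<le> sqrt 2 * (1/2 * (cmod (g x))\<^sup>2 + 1/4 * (1 - (cmod (v x))\<^sup>2)\<^sup>2)"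
    and leG: "\<And>x. k x \<le> sqrt 2 * (1/2 * (cmod (g x))\<^sup>2 + 1/4 * (1 - (cmod (v x))\<^sup>2)\<^sup>2)"
    and ab: "a \<le> x0" "x0 \<le> b"
  shows "(F x0 - F a) + (G b - G x0) \<le> sqrt 2 * energy_1d v g"
proof -
  define e where "e x = 1/2 * (cmod (g x))\<^sup>2 + 1/4 * (1 - (cmod (v x))\<^sup>2)\<^sup>2" for x
  have e: "integrable lborel e" unfolding e_def by (rule energy_density_1d_integrable[OF fe])
  have "(LINT x:{a..x0}|lborel. e x) + (LINT x:{x0..b}|lborel. e x) = (LINT x:{a..b}|lborel. e x)"
    using ab by (intro set_integral_Icc_combine[symmetric] set_integrable_if_integrable e) auto
  also have "\<dots> \<le> energy_1d v g"
    unfolding energy_1d_def e_def[symmetric] set_lebesgue_integral_def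
    by (intro integral_mono integrable_mult_indicator e) (auto simp: indicator_def e_def)
  finally have "sqrt 2 * ((LINT x:{a..x0}|lborel. e x) + (LINT x:{x0..b}|lborel. e x)) \<le> sqrt 2 * energy_1d v g" by simp
  then show ?thesis
    using increment_le_energy[OF fe F ab(1) leF] increment_le_energy[OF fe G ab(2) leG]
    unfolding e_def by (simp add: algebra_simps)
qed

text \<open>Each of the two ways between infinity and the zero costs at least
  \<open>H 1 - H (m\<^sup>2)\<close>. Nothing is charged below modulus \<open>m\<close>, so the
  angle, undefined at the zero, never enters. Letting \<open>m\<close> tend to 0 leaves the energy
  of the black soliton.\<close>

lemma energy_vanishing_lower_bound:
  assumes fe: "finite_energy_1d v g" and x0: "v x0 = 0"
  shows "2 * sqrt 2 / 3 \<le> energy_1d v g"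
proof -
  have ac: "has_ac_derivative v g" using fe by (simp add: finite_energy_1d_def)
  have bound: "2 * (sqrt (1 - m\<^sup>2) - sqrt (1 - m\<^sup>2) ^ 3 / 3 - m * arctan (sqrt (1 - m\<^sup>2) / m)) \<le> sqrt 2 * energy_1d v g"
    if m: "0 < m" "m < 1" for m
  proof -
    obtain H where H: "\<And>s. (H has_vector_derivative calibration_slope m s) (at s)"
      "H 0 = H (m\<^sup>2)" "H 1 - H (m\<^sup>2) = sqrt (1 - m\<^sup>2) - sqrt (1 - m\<^sup>2) ^ 3 / 3 - m * arctan (sqrt (1 - m\<^sup>2) / m)"
      using calibration_exists[OF m(1)] m(2) by (metis less_imp_le)
    have c: "continuous_on UNIV (calibration_slope m)"
      unfolding calibration_slope_def using m by (intro continuous_intros) (auto simp: max_def not_le)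
    have HF: "has_ac_derivative (\<lambda>x. H ((cmod (v x))\<^sup>2)) (\<lambda>x. (2 * (g x \<bullet> v x)) *\<^sub>R calibration_slope m ((cmod (v x))\<^sup>2))"
      by (rule ac_compose[OF ac_norm_square[OF ac], of UNIV]) (use H(1) c in auto)
    have HG: "has_ac_derivative (\<lambda>x. - H ((cmod (v x))\<^sup>2)) (\<lambda>x. - ((2 * (g x \<bullet> v x)) *\<^sub>R calibration_slope m ((cmod (v x))\<^sup>2)))"
      by (rule ac_bounded_linear[OF bounded_linear_minus[OF bounded_linear_ident] HF])
    have le: "H ((cmod (v (-R)))\<^sup>2) + H ((cmod (v R))\<^sup>2) - 2 * H 0 \<le> sqrt 2 * energy_1d v g" if "R \<ge> \<bar>x0\<bar>" for R
    proof -
      have "(- H ((cmod (v x0))\<^sup>2) - - H ((cmod (v (-R)))\<^sup>2)) + (H ((cmod (v R))\<^sup>2) - H ((cmod (v x0))\<^sup>2)) \<le> sqrt 2 * energy_1d v g"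
        by (rule two_sided_increments_le_energy[OF fe HG HF])
          (use calibration_pointwise_radial[OF m(1), of 1] calibration_pointwise_radial[OF m(1), of "-1"] that in \<open>auto\<close>)
      then show ?thesis using x0 by simp
    qed
    have Hc: "isCont H s" for s using H(1) by (rule has_vector_derivative_continuous)
    have "((\<lambda>R. H ((cmod (v (-R)))\<^sup>2) + H ((cmod (v R))\<^sup>2) - 2 * H 0) \<longlongrightarrow> H (1\<^sup>2) + H (1\<^sup>2) - 2 * H 0) at_top"
      by (intro tendsto_intros isCont_tendsto_compose[OF Hc] finite_energy_modulus_limit[OF fe])
    then have "H (1\<^sup>2) + H (1\<^sup>2) - 2 * H 0 \<le> sqrt 2 * energy_1d v g"
      by (rule tendsto_upperbound) (use le in \<open>auto intro: eventually_at_top_linorderI\<close>)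
    then show ?thesis using H(2,3) by simp
  qed
  have "((\<lambda>m::real. 2 * (sqrt (1 - m\<^sup>2) - sqrt (1 - m\<^sup>2) ^ 3 / 3 - m * arctan (sqrt (1 - m\<^sup>2) / m))) \<longlongrightarrow>
      2 * (sqrt (1 - 0\<^sup>2) - sqrt (1 - 0\<^sup>2) ^ 3 / 3 - 0)) (at_right 0)"
  proof (intro tendsto_intros)
    show "((\<lambda>m::real. m * arctan (sqrt (1 - m\<^sup>2) / m)) \<longlongrightarrow> 0) (at_right 0)"
    proof (rule Lim_null_comparison[where g = "\<lambda>m. m * (pi / 2)"])
      show "\<forall>\<^sub>F m in at_right 0. norm (m * arctan (sqrt (1 - m\<^sup>2) / m)) \<le> m * (pi / 2)"
        using eventually_at_right_less[of "0::real"]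
      proof eventually_elim
        case (elim m)
        have "\<bar>arctan (sqrt (1 - m\<^sup>2) / m)\<bar> \<le> pi / 2"
          using arctan_lbound[of "sqrt (1 - m\<^sup>2) / m"] arctan_ubound[of "sqrt (1 - m\<^sup>2) / m"] by linarith
        then show ?case using elim by (simp add: abs_mult mult_left_mono)
      qed
    qed (auto intro!: tendsto_eq_intros)
  qed simp
  moreover have "\<forall>\<^sub>F m in at_right 0. 2 * (sqrt (1 - m\<^sup>2) - sqrt (1 - m\<^sup>2) ^ 3 / 3 - m * arctan (sqrt (1 - m\<^sup>2) / m)) \<le> sqrt 2 * energy_1d v g"
    using bound by (auto simp: eventually_at_right_field intro!: exI[of _ 1])
  ultimately have "2 * (sqrt (1 - 0\<^sup>2) - sqrt (1 - 0\<^sup>2) ^ 3 / 3 - 0) \<le> sqrt 2 * energy_1d v g"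
    by (rule tendsto_upperbound) simp
  then have "4 / 3 \<le> sqrt 2 * energy_1d v g" by simp
  then have "sqrt 2 * (4 / 3) \<le> sqrt 2 * (sqrt 2 * energy_1d v g)" by (intro mult_left_mono) auto
  also have "\<dots> = 2 * energy_1d v g" by (simp flip: mult.assoc)
  finally show ?thesis by linarith
qed

lemma tendsto_symmetric_set_integral:
  fixes f :: "real \<Rightarrow> 'b::euclidean_space"
  assumes "integrable lborel f"
  shows "((\<lambda>R. LINT x:{-R..R}|lborel. f x) \<longlongrightarrow> (LINT x|lborel. f x)) at_top"
proof -
  have [measurable]: "f \<in> borel_measurable borel" using borel_measurable_integrable[OF assms] by simp
  show ?thesis unfolding set_lebesgue_integral_def
  proof (rule integral_dominated_convergence_at_top[where w = "\<lambda>s. norm (f s)"])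
    show "AE s in lborel. ((\<lambda>x. indicat_real {-x..x} s *\<^sub>R f s) \<longlongrightarrow> f s) at_top"
    proof (rule AE_I2)
      show "((\<lambda>x. indicat_real {-x..x} s *\<^sub>R f s) \<longlongrightarrow> f s) at_top" for s
        by (intro tendsto_eventually eventually_at_top_linorderI[of "\<bar>s\<bar>"]) (auto simp: indicator_def)
    qed
  qed (use assms in \<open>auto simp: indicator_def intro!: always_eventually\<close>)
qed

lemma momentum_integrand_swap: "(\<i> * g) \<bullet> v = - (g \<bullet> (\<i> * v))"
  by (simp add: inner_complex_def)

lemma set_integrable_momentum_integrand:
  assumes "has_ac_derivative v g"
  shows "set_integrable lborel {a..b} (\<lambda>x. (\<i> * g x) \<bullet> v x)"
proof -
  have "continuous_on UNIV (\<lambda>x. \<i> * v x)" by (intro continuous_intros ac_continuous_on[OF assms])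
  from set_integrable_continuous_bilinear[OF bounded_bilinear_inner ac_integrable[OF assms] this ac_measurable[OF assms], of a b]
  show ?thesis unfolding momentum_integrand_swap by (simp add: set_integrable_def)
qed

lemma angle_integrand_bound:
  fixes g v :: complex
  assumes "0 < m" "m \<le> cmod v"
  shows "\<bar>(1 - (cmod v)\<^sup>2) * (g \<bullet> (\<i> * v)) / (cmod v)\<^sup>2\<bar> \<le> sqrt 2 / m * (1/2 * (cmod g)\<^sup>2 + 1/4 * (1 - (cmod v)\<^sup>2)\<^sup>2)"
proof -
  have v: "cmod v > 0" using assms by linarith
  have "\<bar>g \<bullet> (\<i> * v)\<bar> \<le> cmod g * cmod v"
    using Cauchy_Schwarz_ineq2[of g "\<i> * v"] by (simp add: norm_mult)
  then have "\<bar>(1 - (cmod v)\<^sup>2) * (g \<bullet> (\<i> * v)) / (cmod v)\<^sup>2\<bar> \<le> \<bar>1 - (cmod v)\<^sup>2\<bar> * (cmod g * cmod v) / (cmod v)\<^sup>2"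
    by (auto simp: abs_mult intro!: divide_right_mono mult_left_mono)
  also have "\<dots> = \<bar>1 - (cmod v)\<^sup>2\<bar> * cmod g / cmod v" using v by (simp add: power2_eq_square)
  also have "\<dots> \<le> \<bar>1 - (cmod v)\<^sup>2\<bar> * cmod g / m" using assms v by (intro divide_left_mono mult_pos_pos) auto
  also have "\<dots> \<le> (sqrt 2 * (1/2 * (cmod g)\<^sup>2 + 1/4 * (1 - (cmod v)\<^sup>2)\<^sup>2)) / m"
    using assms(1) by (intro divide_right_mono young_energy) auto
  finally show ?thesis by (simp add: field_simps)
qed

lemma angle_integrand_integrable:
  assumes fe: "finite_energy_1d v g" and m: "0 < m" "\<And>x. m \<le> cmod (v x)"
  defines "\<theta>' \<equiv> \<lambda>x. (1 - (cmod (v x))\<^sup>2) * (g x \<bullet> (\<i> * v x)) / (cmod (v x))\<^sup>2"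
  shows "integrable lborel \<theta>'" "\<exists>T. has_ac_derivative T \<theta>'"
proof -
  have ac: "has_ac_derivative v g" using fe by (simp add: finite_energy_1d_def)
  note [measurable] = ac_measurable[OF ac] ac_measurable_self[OF ac]
  have nz: "cmod (v x) > 0" for x using m by (smt (verit))
  have mth[measurable]: "\<theta>' \<in> borel_measurable borel" unfolding \<theta>'_def by measurable
  show int: "integrable lborel \<theta>'"
  proof (rule Bochner_Integration.integrable_bound[where f = "\<lambda>x. sqrt 2 / m * (1/2 * (cmod (g x))\<^sup>2 + 1/4 * (1 - (cmod (v x))\<^sup>2)\<^sup>2)"])
    show "integrable lborel (\<lambda>x. sqrt 2 / m * (1/2 * (cmod (g x))\<^sup>2 + 1/4 * (1 - (cmod (v x))\<^sup>2)\<^sup>2))"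
      by (rule integrable_mult_right) (rule energy_density_1d_integrable[OF fe])
    show "AE x in lborel. norm (\<theta>' x) \<le> norm (sqrt 2 / m * (1/2 * (cmod (g x))\<^sup>2 + 1/4 * (1 - (cmod (v x))\<^sup>2)\<^sup>2))"
      using angle_integrand_bound[OF m(1) m(2)] unfolding \<theta>'_def by (intro AE_I2) (smt (verit) real_norm_def)
  qed simp
  then show "\<exists>T. has_ac_derivative T \<theta>'"
    using ac_primitive[OF mth set_integrable_if_integrable[OF int]] by (metis borel_closed closed_real_atLeastAtMost)
qed

lemma inverse_sqrt_derivative:
  assumes "z > 0"
  shows "((\<lambda>s. 1 / sqrt s) has_real_derivative - 1 / (2 * z * sqrt z)) (at z)"
proof -
  have "((\<lambda>s. 1 / sqrt s) has_real_derivative - (inverse (sqrt z) / 2) / (sqrt z * sqrt z)) (at z)"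
    using assms by (auto intro!: derivative_eq_intros)
  then show ?thesis using assms by (simp add: field_simps)
qed

text \<open>Removing the accumulated phase \<open>\<integral>\<langle>\<i>v',v\<rangle>\<close> from \<open>v\<close> leaves a curve whose angular speed is
  \<open>(1 - |v|\<^sup>2)\<close> times that of \<open>v\<close>, hence integrable: its total angle is twice the momentum.\<close>
lemma momentum_as_total_angle:
  assumes fe: "finite_energy_1d v g" and m: "0 < m" "\<And>x. m \<le> cmod (v x)"
  defines "\<theta>' \<equiv> \<lambda>x. (1 - (cmod (v x))\<^sup>2) * (g x \<bullet> (\<i> * v x)) / (cmod (v x))\<^sup>2"
  assumes T: "has_ac_derivative T \<theta>'" and R: "R \<ge> 0"
  shows "cis (LINT x:{-R..R}|lborel. (\<i> * g x) \<bullet> v x) * v R * cnj (v (-R)) = of_real (cmod (v R) * cmod (v (-R))) * cis (T R - T (-R))"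
proof -
  have ac: "has_ac_derivative v g" using fe by (simp add: finite_energy_1d_def)
  note [measurable] = ac_measurable[OF ac] ac_measurable_self[OF ac]
  have nz: "cmod (v x) > 0" for x using m by (smt (verit))
  define j where "j = (\<lambda>x. (\<i> * g x) \<bullet> v x)"
  have "j \<in> borel_measurable borel" unfolding j_def by measurable
  then obtain W where W: "has_ac_derivative W j"
    using ac_primitive[of j] set_integrable_momentum_integrand[OF ac] unfolding j_def by metis
  have E: "has_ac_derivative (\<lambda>x. cis (W x - T x)) (\<lambda>x. (j x - \<theta>' x) *\<^sub>R (\<i> * cis (W x - T x)))"
  proof (rule ac_compose[where H = cis and H' = "\<lambda>a. \<i> * cis a", OF ac_diff_fun[OF W T], of UNIV])
    show "(cis has_vector_derivative \<i> * cis z) (at z)" for z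
      unfolding has_vector_derivative_def by (auto intro!: derivative_eq_intros)
    show "continuous_on UNIV (\<lambda>a. \<i> * cis a)" by (intro continuous_intros)
  qed auto
  have Q: "has_ac_derivative (\<lambda>x. complex_of_real (1 / sqrt ((cmod (v x))\<^sup>2)))
      (\<lambda>x. (2 * (g x \<bullet> v x)) *\<^sub>R complex_of_real (- 1 / (2 * (cmod (v x))\<^sup>2 * sqrt ((cmod (v x))\<^sup>2))))"
  proof (rule ac_compose[where H = "\<lambda>s. complex_of_real (1 / sqrt s)" and H' = "\<lambda>s. complex_of_real (- 1 / (2 * s * sqrt s))",
        OF ac_norm_square[OF ac], of "{0<..}"])
    show "((\<lambda>s. complex_of_real (1 / sqrt s)) has_vector_derivative complex_of_real (- 1 / (2 * z * sqrt z))) (at z)"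
      if "z \<in> {0<..}" for z
      using that by (intro has_vector_derivative_of_real inverse_sqrt_derivative) simp
    show "continuous_on {0<..} (\<lambda>s. complex_of_real (- 1 / (2 * s * sqrt s)))"
      by (intro continuous_intros) auto
  qed (use nz in auto)
  \<comment> \<open>The curve \<open>v / cmod v\<close>, turned back by its own angle:
    \<open>W - T\<close> has derivative minus the angular speed of \<open>v\<close>. Writing the
    modulus as the square root of its square keeps the chain rule applicable.\<close>
  define D where "D = (\<lambda>x. v x * (complex_of_real (1 / sqrt ((cmod (v x))\<^sup>2)) * cis (W x - T x)))"
  have "has_ac_derivative D (\<lambda>x. 0)"
  proof -
    have "v x * (complex_of_real (1 / sqrt ((cmod (v x))\<^sup>2)) * ((j x - \<theta>' x) *\<^sub>R (\<i> * cis (W x - T x))) +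
          ((2 * (g x \<bullet> v x)) *\<^sub>R complex_of_real (- 1 / (2 * (cmod (v x))\<^sup>2 * sqrt ((cmod (v x))\<^sup>2)))) * cis (W x - T x))
        + g x * (complex_of_real (1 / sqrt ((cmod (v x))\<^sup>2)) * cis (W x - T x)) = 0" for x
    proof -
      define b s where "b = g x \<bullet> (\<i> * v x)" and "s = (cmod (v x))\<^sup>2"
      have s: "s > 0" using nz[of x] by (simp add: s_def)
      have jt: "j x - \<theta>' x = - b / s"
        using s unfolding j_def \<theta>'_def momentum_integrand_swap b_def[symmetric] s_def[symmetric] by (simp add: field_simps)
      have "g x * cnj (v x) = of_real (g x \<bullet> v x) + \<i> * of_real b"
        by (simp add: complex_eq_iff inner_complex_def b_def)
      then have "g x * (cnj (v x) * v x) = v x * (of_real (g x \<bullet> v x) + \<i> * of_real b)" by (metis mult.assoc mult.commute)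
      moreover have "cnj (v x) * v x = of_real s"
        unfolding s_def cmod_power2 by (simp add: complex_eq_iff power2_eq_square)
      ultimately have "g x * of_real s = v x * (of_real (g x \<bullet> v x) + \<i> * of_real b)" by simp
      then have g: "g x = v x * (of_real (g x \<bullet> v x) + \<i> * of_real b) / of_real s" using s by (simp add: field_simps)
      define c where "c = g x \<bullet> v x"
      have g: "g x = v x * (of_real c + \<i> * of_real b) / of_real s" using g unfolding c_def .
      show ?thesis
        unfolding jt s_def[symmetric] c_def[symmetric] unfolding g scaleR_conv_of_real using s by (simp add: field_simps)
    qed
    then show ?thesis
      using ac_bounded_bilinear[OF bounded_bilinear_mult ac ac_bounded_bilinear[OF bounded_bilinear_mult Q E]]
      unfolding D_def by simp
  qed
  then have "D R = D (-R)" by (rule ac_zero_imp_const)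
  then have "v R * cis (W R - T R) * cmod (v (-R)) = v (-R) * cis (W (-R) - T (-R)) * cmod (v R)"
    using nz[of R] nz[of "-R"] by (simp add: D_def field_simps)
  then have "v R * cis (W R - T R) * cmod (v (-R)) * (cnj (v (-R)) * cis (T R - W (-R)))
     = v (-R) * cis (W (-R) - T (-R)) * cmod (v R) * (cnj (v (-R)) * cis (T R - W (-R)))" by simp
  then have "(v R * cnj (v (-R)) * (cis (W R - T R) * cis (T R - W (-R)))) * cmod (v (-R))
     = (v (-R) * cnj (v (-R))) * cmod (v R) * (cis (W (-R) - T (-R)) * cis (T R - W (-R)))" by (simp only: ac_simps)
  then have "(v R * cnj (v (-R)) * cis (W R - W (-R))) * cmod (v (-R))
     = (cmod (v R) * cmod (v (-R)) * cis (T R - T (-R))) * cmod (v (-R))"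
    by (simp add: cis_mult complex_norm_square[symmetric] power2_eq_square ac_simps)
  then have "v R * cnj (v (-R)) * cis (W R - W (-R)) = cmod (v R) * cmod (v (-R)) * cis (T R - T (-R))"
    using nz[of "-R"] by (simp only: mult_cancel_right) simp
  moreover have "(LINT x:{-R..R}|lborel. (\<i> * g x) \<bullet> v x) = W R - W (-R)"
    using ac_diff[OF W, of "-R" R] R unfolding j_def by simp
  ultimately show "cis (LINT x:{-R..R}|lborel. (\<i> * g x) \<bullet> v x) * v R * cnj (v (-R)) = of_real (cmod (v R) * cmod (v (-R))) * cis (T R - T (-R))"
    by (simp add: ac_simps)
qed

text \<open>The radial cost of going down to modulus \<open>m\<close> and up again is now
  accompanied by \<open>m\<close> times the total angle, taken with the favourable sign \<tau>. If
  \<open>m = 1\<close>, the slope is identically zero, so \<open>H\<close> is constant and any point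
  can serve as the turning point.\<close>

lemma energy_nonvanishing_lower_bound:
  assumes fe: "finite_energy_1d v g" and m: "0 < m" "m \<le> 1" "\<And>x. m \<le> cmod (v x)" and x0: "m = 1 \<or> (\<exists>x0. cmod (v x0) = m)"
  defines "\<theta>' \<equiv> \<lambda>x. (1 - (cmod (v x))\<^sup>2) * (g x \<bullet> (\<i> * v x)) / (cmod (v x))\<^sup>2"
  shows "2 * (sqrt (1 - m\<^sup>2) - sqrt (1 - m\<^sup>2) ^ 3 / 3 - m * arctan (sqrt (1 - m\<^sup>2) / m)) + m * \<bar>LINT x|lborel. \<theta>' x\<bar> \<le> sqrt 2 * energy_1d v g"
proof -
  have ac: "has_ac_derivative v g" using fe by (simp add: finite_energy_1d_def)
  obtain T where T: "has_ac_derivative T \<theta>'" using angle_integrand_integrable(2)[OF fe m(1,3)] unfolding \<theta>'_def by blast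
  obtain H where H: "\<And>s. (H has_vector_derivative calibration_slope m s) (at s)"
    "H 1 - H (m\<^sup>2) = sqrt (1 - m\<^sup>2) - sqrt (1 - m\<^sup>2) ^ 3 / 3 - m * arctan (sqrt (1 - m\<^sup>2) / m)"
    using calibration_exists[OF m(1)] m(2) by metis
  have c: "continuous_on UNIV (calibration_slope m)"
    unfolding calibration_slope_def using m(1) by (intro continuous_intros) (auto simp: max_def not_le)
  obtain x0 where x0: "H ((cmod (v x0))\<^sup>2) = H (m\<^sup>2)"
  proof (cases "m = 1")
    case True
    have "H ((cmod (v 0))\<^sup>2) = H (m\<^sup>2)"
    proof (rule DERIV_isconst_all[of H], rule allI)
      show "DERIV H x :> 0" for x
        using H(1)[of x] True unfolding has_real_derivative_iff_has_vector_derivative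
        by (simp add: calibration_slope_def max_def split: if_splits)
    qed
    then show ?thesis using that by blast
  qed (use x0 that in auto)
  have HF: "has_ac_derivative (\<lambda>x. H ((cmod (v x))\<^sup>2)) (\<lambda>x. (2 * (g x \<bullet> v x)) *\<^sub>R calibration_slope m ((cmod (v x))\<^sup>2))"
    by (rule ac_compose[OF ac_norm_square[OF ac], of UNIV]) (use H(1) c in auto)
  define \<tau> :: real where "\<tau> = (if (LINT x|lborel. \<theta>' x) \<ge> 0 then 1 else -1)"
  have tau: "\<tau> \<in> {-1, 1}" "\<tau> * (LINT x|lborel. \<theta>' x) = \<bar>LINT x|lborel. \<theta>' x\<bar>" by (auto simp: \<tau>_def)
  have F: "has_ac_derivative (\<lambda>x. \<sigma> * H ((cmod (v x))\<^sup>2) + \<tau> * m * T x)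
     (\<lambda>x. \<sigma> * ((2 * (g x \<bullet> v x)) *\<^sub>R calibration_slope m ((cmod (v x))\<^sup>2)) + \<tau> * m * \<theta>' x)" for \<sigma>
    by (intro ac_add ac_bounded_linear[OF bounded_linear_mult_right] HF T)
  have le: "H ((cmod (v (-R)))\<^sup>2) + H ((cmod (v R))\<^sup>2) - 2 * H (m\<^sup>2) + m * \<tau> * (LINT x:{-R..R}|lborel. \<theta>' x) \<le> sqrt 2 * energy_1d v g"
    if R: "R \<ge> \<bar>x0\<bar>" for R
  proof -
    have "((-1) * H ((cmod (v x0))\<^sup>2) + \<tau> * m * T x0 - ((-1) * H ((cmod (v (-R)))\<^sup>2) + \<tau> * m * T (-R)))
      + (1 * H ((cmod (v R))\<^sup>2) + \<tau> * m * T R - (1 * H ((cmod (v x0))\<^sup>2) + \<tau> * m * T x0)) \<le> sqrt 2 * energy_1d v g"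
      by (rule two_sided_increments_le_energy[OF fe F F])
        (use calibration_pointwise[OF m(1) m(3) _ tau(1), of 1] calibration_pointwise[OF m(1) m(3) _ tau(1), of "-1"] R in
          \<open>auto simp: \<theta>'_def\<close>)
    moreover have "T R - T (-R) = (LINT x:{-R..R}|lborel. \<theta>' x)" using ac_diff[OF T, of "-R" R] R by simp
    then have "\<tau> * m * T R - \<tau> * m * T (-R) = m * \<tau> * (LINT x:{-R..R}|lborel. \<theta>' x)"
      by (metis mult.commute right_diff_distrib)
    ultimately show ?thesis using x0 by simp
  qed
  have Hc: "isCont H s" for s using H(1) by (rule has_vector_derivative_continuous)
  have "((\<lambda>R. H ((cmod (v (-R)))\<^sup>2) + H ((cmod (v R))\<^sup>2) - 2 * H (m\<^sup>2) + m * \<tau> * (LINT x:{-R..R}|lborel. \<theta>' x))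
      \<longlongrightarrow> H (1\<^sup>2) + H (1\<^sup>2) - 2 * H (m\<^sup>2) + m * \<tau> * (LINT x|lborel. \<theta>' x)) at_top"
    unfolding \<theta>'_def
    by (intro tendsto_intros isCont_tendsto_compose[OF Hc] finite_energy_modulus_limit[OF fe] tendsto_symmetric_set_integral
        angle_integrand_integrable(1)[OF fe m(1,3)])
  then have "H (1\<^sup>2) + H (1\<^sup>2) - 2 * H (m\<^sup>2) + m * \<tau> * (LINT x|lborel. \<theta>' x) \<le> sqrt 2 * energy_1d v g"
    by (rule tendsto_upperbound) (use le in \<open>auto intro: eventually_at_top_linorderI\<close>)
  then show ?thesis using H(2) tau(2) by (simp add: mult.assoc)
qed

lemma cis_eq_imp_int_multiple:
  assumes "cis (2 * a) = cis (2 * b)"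
  obtains k :: int where "a = b + of_int k * pi"
proof -
  have "exp (\<i> * of_real (2 * a)) = exp (\<i> * of_real (2 * b))" using assms by (simp add: cis_conv_exp)
  then obtain n :: int where "\<i> * of_real (2 * a) = \<i> * of_real (2 * b) + of_real (of_int (2 * n) * pi) * \<i>"
    unfolding exp_eq by blast
  then have "Im (\<i> * of_real (2 * a)) = Im (\<i> * of_real (2 * b) + of_real (of_int (2 * n) * pi) * \<i>)" by (rule arg_cong)
  then have "a = b + of_int n * pi" by simp
  then show ?thesis using that by blast
qed

text \<open>The calibration bound depends on the unknown minimal modulus \<open>cos f\<close> and on
  a real lift \<open>q\<close> of the momentum; \<open>soliton_energy_tangent\<close> takes the
  worst case over \<open>f\<close>. Only the class of \<open>q\<close> modulo pi is prescribed, and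
  the least favourable lift is the one nearest to 0.\<close>

theorem energy_1d_lower_bound:
  assumes fe: "finite_energy_1d v g" and R: "filterlim R at_top sequentially"
    and lim: "(\<lambda>n. cis (LINT x:{-R n..R n}|lborel. (\<i> * g x) \<bullet> v x) * v (R n) * cnj (v (- R n))) \<longlonglongrightarrow> cis (2 * P)"
    and P: "cis (2 * P) = cis (2 * soliton_momentum \<omega>)" and \<omega>: "\<bar>\<omega>\<bar> \<le> pi / 2"
  shows "soliton_energy \<omega> \<le> energy_1d v g"
proof (cases "\<exists>x0. v x0 = 0")
  case True
  have "cos \<omega> ^ 3 \<le> 1 ^ 3" using \<omega> by (intro power_mono) (auto intro!: cos_ge_zero)
  then have "soliton_energy \<omega> \<le> 2 * sqrt 2 / 3" by (simp add: soliton_energy_def mult_left_le)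
  also have "\<dots> \<le> energy_1d v g" using energy_vanishing_lower_bound[OF fe] True by blast
  finally show ?thesis .
next
  case False
  have ac: "has_ac_derivative v g" using fe by (simp add: finite_energy_1d_def)
  \<comment> \<open>The minimal modulus, capped at 1. A value below 1 forces the minimum to be
    attained, because the modulus tends to 1 at both ends; it is positive because \<open>v\<close>
    has no zero.\<close>
  obtain m where m: "0 < m" "m \<le> 1" "\<And>x. m \<le> cmod (v x)" "m = 1 \<or> (\<exists>x0. cmod (v x0) = m)"
  proof (cases "\<forall>x. 1 \<le> cmod (v x)")
    case True
    then show ?thesis using that[of 1] by auto
  next
    case F: False
    then obtain x1 where x1: "cmod (v x1) < 1" by (meson not_le)
    obtain N1 where N1: "\<And>x. x \<ge> N1 \<Longrightarrow> cmod (v x1) < cmod (v x)"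
      using order_tendstoD(1)[OF finite_energy_modulus_limit(1)[OF fe] x1] by (auto simp: eventually_at_top_linorder)
    obtain N2 where N2: "\<And>x. x \<ge> N2 \<Longrightarrow> cmod (v x1) < cmod (v (-x))"
      using order_tendstoD(1)[OF finite_energy_modulus_limit(2)[OF fe] x1] by (auto simp: eventually_at_top_linorder)
    define N where "N = max \<bar>x1\<bar> (max N1 N2)"
    have "\<exists>x\<in>{-N..N}. \<forall>y\<in>{-N..N}. cmod (v x) \<le> cmod (v y)"
      by (rule continuous_attains_inf) (auto intro!: continuous_intros ac_continuous_on[OF ac] simp: N_def)
    then obtain x0 where x0: "\<And>y. y \<in> {-N..N} \<Longrightarrow> cmod (v x0) \<le> cmod (v y)" by blast
    have le1: "cmod (v x0) \<le> cmod (v x1)" by (rule x0) (auto simp: N_def)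
    have "cmod (v x0) \<le> cmod (v x)" for x
    proof -
      consider "x \<in> {-N..N}" | "x \<ge> N1" | "-x \<ge> N2" unfolding N_def by fastforce
      then show ?thesis
        using x0[of x] N1[of x] N2[of "-x"] le1 by cases auto
    qed
    then show ?thesis using that[of "cmod (v x0)"] False x1 le1 by auto
  qed
  define \<theta>' where "\<theta>' = (\<lambda>x. (1 - (cmod (v x))\<^sup>2) * (g x \<bullet> (\<i> * v x)) / (cmod (v x))\<^sup>2)"
  obtain T where T: "has_ac_derivative T \<theta>'" using angle_integrand_integrable(2)[OF fe m(1,3)] unfolding \<theta>'_def by blast
  have eq: "cis (LINT x:{-r..r}|lborel. (\<i> * g x) \<bullet> v x) * v r * cnj (v (-r))
      = of_real (cmod (v r) * cmod (v (-r))) * cis (LINT x:{-r..r}|lborel. \<theta>' x)" if "r \<ge> 0" for r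
    using momentum_as_total_angle[OF fe m(1,3) T[unfolded \<theta>'_def] that] ac_diff[OF T, of "-r" r] that by simp
  define q where "q = (LINT x|lborel. \<theta>' x) / 2"
  have "((\<lambda>r. of_real (cmod (v r) * cmod (v (-r))) * cis (LINT x:{-r..r}|lborel. \<theta>' x)) \<longlongrightarrow> of_real (1 * 1) * cis (2 * q)) at_top"
    unfolding q_def \<theta>'_def
    by (intro tendsto_intros finite_energy_modulus_limit[OF fe] tendsto_cis)
      (simp add: tendsto_symmetric_set_integral angle_integrand_integrable(1)[OF fe m(1,3)])
  then have "((\<lambda>r. cis (LINT x:{-r..r}|lborel. (\<i> * g x) \<bullet> v x) * v r * cnj (v (-r))) \<longlongrightarrow> cis (2 * q)) at_top"
    by (subst tendsto_cong[OF eventually_mono[OF eventually_ge_at_top[of 0]]]) (auto simp: eq)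
  then have "(\<lambda>n. cis (LINT x:{-R n..R n}|lborel. (\<i> * g x) \<bullet> v x) * v (R n) * cnj (v (- R n))) \<longlonglongrightarrow> cis (2 * q)"
    by (rule filterlim_compose[OF _ R])
  then have "cis (2 * q) = cis (2 * soliton_momentum \<omega>)" using LIMSEQ_unique[OF lim] P by simp
  then obtain k :: int where k: "q = soliton_momentum \<omega> + of_int k * pi" using cis_eq_imp_int_multiple by blast
  \<comment> \<open>\<open>F - sin F * cos F\<close> is the distance of
    \<open>soliton_momentum \<omega>\<close> from the integer multiples of pi, hence at most
    \<open>\<bar>q\<bar>\<close> whatever the integer \<open>k\<close> is.\<close>
  define F where "F = pi / 2 - \<bar>\<omega>\<bar>"
  have F: "0 \<le> F" "F \<le> pi / 2" using \<omega> by (auto simp: F_def)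
  have FF: "F - sin F * cos F = pi / 2 - \<bar>\<omega> + sin (2 * \<omega>) / 2\<bar>"
  proof -
    have "sin F * cos F = cos \<omega> * sin \<bar>\<omega>\<bar>" by (simp add: F_def cos_diff sin_diff)
    moreover have "\<bar>\<omega> + sin (2 * \<omega>) / 2\<bar> = \<bar>\<omega>\<bar> + cos \<omega> * sin \<bar>\<omega>\<bar>"
    proof (cases "\<omega> \<ge> 0")
      case True
      have "0 \<le> sin \<omega> * cos \<omega>" using True \<omega> by (intro mult_nonneg_nonneg sin_ge_zero cos_ge_zero) auto
      then show ?thesis using True by (simp add: sin_double)
    next
      case False
      have "0 \<le> sin (-\<omega>) * cos \<omega>" using False \<omega> by (intro mult_nonneg_nonneg sin_ge_zero cos_ge_zero) auto
      then show ?thesis using False by (simp add: sin_double)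
    qed
    ultimately show ?thesis by (simp add: F_def)
  qed
  have "F - sin F * cos F \<le> \<bar>q\<bar>"
  proof -
    have b: "\<bar>\<omega> + sin (2 * \<omega>) / 2\<bar> \<le> pi / 2"
      using FF sector_momentum_mono[OF F(1)] by simp
    consider "k = 0" | "k \<le> -1" | "k \<ge> 1" by linarith
    then show ?thesis
    proof cases
      case 1
      then show ?thesis unfolding FF k soliton_momentum_def by simp
    next
      case 2
      have "of_int k * pi \<le> (-1) * pi" using 2 by (intro mult_right_mono) auto
      then show ?thesis unfolding FF k soliton_momentum_def using b by linarith
    next
      case 3
      have "of_int k * pi \<ge> 1 * pi" using 3 by (intro mult_right_mono) auto
      then show ?thesis unfolding FF k soliton_momentum_def using b by linarith
    qed
  qed
  define f where "f = arccos m"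
  have f: "0 \<le> f" "f \<le> pi / 2" "cos f = m" "sqrt (1 - m\<^sup>2) = sin f"
    using m(1,2) arccos_le_pi2[of m] by (auto simp: f_def arccos_lbound sin_arccos)
  have "f < pi / 2" using f m(1) by (metis cos_pi_half less_eq_real_def less_irrefl)
  then have at: "arctan (sqrt (1 - m\<^sup>2) / m) = f"
    using f arctan_tan[of f] by (simp add: tan_def)
  have "2 * (2 / 3 * sin F ^ 3) \<le> 2 * (sin f - sin f ^ 3 / 3 - f * cos f + cos f * \<bar>q\<bar>)"
    using soliton_energy_tangent[OF f(1,2) F \<open>F - sin F * cos F \<le> \<bar>q\<bar>\<close>] by simp
  also have "\<dots> \<le> sqrt 2 * energy_1d v g"
    using energy_nonvanishing_lower_bound[OF fe m, folded \<theta>'_def, unfolded f(4) at[unfolded f(4)]] unfolding f(3) q_def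
    by (simp add: algebra_simps abs_mult)
  finally have "4 / 3 * sin F ^ 3 \<le> sqrt 2 * energy_1d v g" by simp
  then have "sqrt 2 * (4 / 3 * sin F ^ 3) \<le> sqrt 2 * (sqrt 2 * energy_1d v g)" by (intro mult_left_mono) auto
  also have "\<dots> = 2 * energy_1d v g" by (simp flip: mult.assoc)
  finally have "2 * sqrt 2 / 3 * sin F ^ 3 \<le> energy_1d v g" by linarith
  moreover have "sin F = cos \<omega>" by (simp add: F_def sin_diff)
  ultimately show ?thesis by (simp add: soliton_energy_def)
qed

section \<open>The momentum-energy curve and a parabola below it\<close>

text \<open>The difference equals \<open>(b - a) + sin (b - a) * cos (a + b)\<close>. The bound on
  \<open>a + b\<close> keeps the cosine above \<open>- \<bar>sin \<omega>\<bar>\<close>, away from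
  -1. So momentum separates points from \<omega> linearly, although its derivative
  \<open>2 * (cos x)\<^sup>2\<close> vanishes at the ends of the branch.\<close>

lemma soliton_momentum_diff:
  assumes "a \<le> b" "\<bar>a + b\<bar> \<le> \<bar>\<omega>\<bar> + pi / 2" "\<bar>\<omega>\<bar> \<le> pi / 2" "b - a \<le> pi"
  shows "(1 - \<bar>sin \<omega>\<bar>) * (b - a) \<le> soliton_momentum b - soliton_momentum a"
proof -
  have "(2 * b - 2 * a) / 2 = b - a" "(2 * b + 2 * a) / 2 = a + b" by simp_all
  then have "sin (2 * b) - sin (2 * a) = 2 * sin (b - a) * cos (a + b)"
    using sin_diff_sin[of "2 * b" "2 * a"] by (simp only:)
  then have "soliton_momentum b - soliton_momentum a = (b - a) + sin (b - a) * cos (a + b)"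
    by (simp add: soliton_momentum_def)
  moreover have "cos (\<bar>\<omega>\<bar> + pi / 2) \<le> cos \<bar>a + b\<bar>"
    using assms by (intro cos_monotone_0_pi_le) auto
  then have "- sin \<bar>\<omega>\<bar> \<le> cos (a + b)" by (simp add: cos_add)
  moreover have "0 \<le> sin \<bar>\<omega>\<bar>" by (rule sin_ge_zero) (use assms(3) pi_ge_zero in linarith)+
  then have "sin \<bar>\<omega>\<bar> = \<bar>sin \<omega>\<bar>" by (cases "\<omega> \<ge> 0") auto
  ultimately have c: "- \<bar>sin \<omega>\<bar> \<le> cos (a + b)" and e: "soliton_momentum b - soliton_momentum a = (b - a) + sin (b - a) * cos (a + b)" by auto
  have s: "0 \<le> sin (b - a)" "sin (b - a) \<le> b - a" using assms by (auto intro!: sin_ge_zero sin_x_le_x)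
  have "- (\<bar>sin \<omega>\<bar> * (b - a)) \<le> - (\<bar>sin \<omega>\<bar> * sin (b - a))"
    using s by (intro le_imp_neg_le mult_left_mono) auto
  also have "\<dots> = sin (b - a) * (- \<bar>sin \<omega>\<bar>)" by simp
  also have "\<dots> \<le> sin (b - a) * cos (a + b)" using s c by (intro mult_left_mono) auto
  finally show ?thesis unfolding e by (simp add: algebra_simps)
qed

lemma soliton_momentum_derivative:
  "(soliton_momentum has_real_derivative 2 * (cos x)\<^sup>2) (at x)"
proof -
  have "((\<lambda>\<omega>. pi / 2 + \<omega> + sin (2 * \<omega>) / 2) has_real_derivative 1 + cos (2 * x)) (at x)"
    by (auto intro!: derivative_eq_intros)
  then show ?thesis by (simp add: cos_double_cos soliton_momentum_def[abs_def])
qed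

lemma soliton_energy_derivative:
  "(soliton_energy has_real_derivative - (2 * sqrt 2 * (cos x)\<^sup>2 * sin x)) (at x)"
  unfolding soliton_energy_def[abs_def]
  by (auto intro!: derivative_eq_intros)

lemma soliton_momentum_ends: "soliton_momentum (- (pi/2)) = 0" "soliton_momentum (pi/2) = pi"
  by (simp_all add: soliton_momentum_def)

lemma abs_sin_less_one: "\<bar>\<omega>\<bar> < pi / 2 \<Longrightarrow> \<bar>sin \<omega>\<bar> < 1"
proof -
  assume "\<bar>\<omega>\<bar> < pi / 2"
  then have "cos \<omega> > 0" by (intro cos_gt_zero_pi) auto
  then have "(sin \<omega>)\<^sup>2 < 1" by (simp add: sin_squared_eq)
  then show ?thesis by (simp add: abs_square_less_1)
qed

lemma soliton_momentum_bounds: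
  assumes "\<bar>\<omega>\<bar> < pi / 2"
  shows "0 < soliton_momentum \<omega>" "soliton_momentum \<omega> < pi"
proof -
  have k: "1 - \<bar>sin \<omega>\<bar> > 0" using abs_sin_less_one[OF assms] by simp
  have "0 < (1 - \<bar>sin \<omega>\<bar>) * (\<omega> - (- (pi/2)))" using k assms by (intro mult_pos_pos) auto
  also have "\<dots> \<le> soliton_momentum \<omega> - soliton_momentum (- (pi/2))"
    using assms by (intro soliton_momentum_diff) auto
  finally show "0 < soliton_momentum \<omega>" by (simp add: soliton_momentum_ends)
  have "0 < (1 - \<bar>sin \<omega>\<bar>) * (pi/2 - \<omega>)" using k assms by (intro mult_pos_pos) auto
  also have "\<dots> \<le> soliton_momentum (pi/2) - soliton_momentum \<omega>"
    using assms by (intro soliton_momentum_diff) auto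
  finally show "soliton_momentum \<omega> < pi" by (simp add: soliton_momentum_ends)
qed

lemma soliton_momentum_surj:
  assumes "0 \<le> P" "P \<le> pi"
  obtains \<omega> where "\<bar>\<omega>\<bar> \<le> pi / 2" "soliton_momentum \<omega> = P"
proof -
  have "\<exists>x\<ge>-(pi/2). x \<le> pi/2 \<and> soliton_momentum x = P"
    by (rule IVT') (use assms in \<open>auto simp: soliton_momentum_ends soliton_momentum_def[abs_def] intro!: continuous_intros\<close>)
  then show ?thesis using that by (metis abs_le_iff minus_le_iff)
qed

text \<open>Energy plus \<open>sqrt 2 * sin \<omega>\<close> times momentum is stationary at
  \<omega>. Adding or subtracting \<open>sqrt 2 * D\<close> times the momentum makes it monotone
  between the two parameters, since there sines differ by at most \<open>D\<close>. Finally
  \<open>D\<close> is at most the momentum difference divided by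
  \<open>1 - \<bar>sin \<omega>\<bar>\<close>.\<close>

lemma soliton_energy_expansion:
  assumes \<omega>: "\<bar>\<omega>\<bar> < pi / 2" and \<omega>': "\<bar>\<omega>'\<bar> \<le> pi / 2"
  shows "soliton_energy \<omega> - sqrt 2 * sin \<omega> * (soliton_momentum \<omega>' - soliton_momentum \<omega>)
       - sqrt 2 / (1 - \<bar>sin \<omega>\<bar>) * (soliton_momentum \<omega>' - soliton_momentum \<omega>)\<^sup>2 \<le> soliton_energy \<omega>'"
proof -
  define k where "k = 1 - \<bar>sin \<omega>\<bar>"
  have k: "k > 0" using abs_sin_less_one[OF \<omega>] by (simp add: k_def)
  define D where "D = \<bar>\<omega>' - \<omega>\<bar>"
  define p where "p = soliton_momentum \<omega>' - soliton_momentum \<omega>"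
  define M where "M \<sigma> x = soliton_energy x + sqrt 2 * sin \<omega> * soliton_momentum x + \<sigma> * sqrt 2 * D * soliton_momentum x" for \<sigma> x
  have M: "(M \<sigma> has_real_derivative 2 * sqrt 2 * (cos x)\<^sup>2 * (sin \<omega> - sin x + \<sigma> * D)) (at x)" for \<sigma> x
    unfolding M_def
    by (auto intro!: derivative_eq_intros soliton_energy_derivative soliton_momentum_derivative simp: algebra_simps)
  have ends: "\<bar>\<omega> + \<omega>'\<bar> \<le> \<bar>\<omega>\<bar> + pi / 2" "\<bar>\<omega>' - \<omega>\<bar> \<le> pi" "\<bar>\<omega>\<bar> \<le> pi / 2" using \<omega> \<omega>' by linarith+
  have p: "k * D \<le> \<bar>p\<bar>"
  proof (cases "\<omega> \<le> \<omega>'")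
    case True
    then show ?thesis
      using soliton_momentum_diff[of \<omega> \<omega>' \<omega>] ends by (simp add: D_def p_def k_def)
  next
    case False
    then show ?thesis
      using soliton_momentum_diff[of \<omega>' \<omega> \<omega>] ends by (simp add: D_def p_def k_def add.commute)
  qed
  have "- (sqrt 2 * D * \<bar>p\<bar>) \<le> soliton_energy \<omega>' - soliton_energy \<omega> + sqrt 2 * sin \<omega> * p"
  proof (cases "\<omega> \<le> \<omega>'")
    case True
    have "M 1 \<omega> \<le> M 1 \<omega>'"
    proof (rule DERIV_nonneg_imp_nondecreasing[OF True])
      fix x assume "\<omega> \<le> x" "x \<le> \<omega>'"
      then have "0 \<le> sin \<omega> - sin x + 1 * D" using abs_sin_diff_le[of \<omega> x] by (simp add: D_def)
      then show "\<exists>y. (M 1 has_real_derivative y) (at x) \<and> 0 \<le> y"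
        using M[of 1 x] by (intro exI[of _ "2 * sqrt 2 * (cos x)\<^sup>2 * (sin \<omega> - sin x + 1 * D)"]) auto
    qed
    moreover have "0 \<le> p" using p k True soliton_momentum_diff[of \<omega> \<omega>' \<omega>] ends
      by (smt (verit) D_def k_def mult_nonneg_nonneg p_def)
    ultimately show ?thesis by (simp add: M_def p_def algebra_simps)
  next
    case False
    have "M (-1) \<omega>' \<ge> M (-1) \<omega>"
    proof (rule DERIV_nonpos_imp_nonincreasing[of \<omega>' \<omega> "M (-1)"])
      show "\<omega>' \<le> \<omega>" using False by simp
      fix x assume "\<omega>' \<le> x" "x \<le> \<omega>"
      then have "sin \<omega> - sin x + (-1) * D \<le> 0" using abs_sin_diff_le[of \<omega> x] by (simp add: D_def)
      then show "\<exists>y. (M (-1) has_real_derivative y) (at x) \<and> y \<le> 0"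
        using M[of "-1" x]
        by (intro exI[of _ "2 * sqrt 2 * (cos x)\<^sup>2 * (sin \<omega> - sin x + (-1) * D)"]) (auto intro!: mult_nonneg_nonpos)
    qed
    moreover have "p \<le> 0" using p k False soliton_momentum_diff[of \<omega>' \<omega> \<omega>] ends
      by (smt (verit) D_def k_def mult_nonneg_nonneg p_def)
    ultimately show ?thesis by (simp add: M_def p_def algebra_simps)
  qed
  moreover have "sqrt 2 * D * \<bar>p\<bar> \<le> sqrt 2 / k * p\<^sup>2"
  proof -
    have "D \<le> \<bar>p\<bar> / k" using p k by (simp add: field_simps)
    then have "D * \<bar>p\<bar> \<le> \<bar>p\<bar> / k * \<bar>p\<bar>" by (intro mult_right_mono) auto
    then have "sqrt 2 * (D * \<bar>p\<bar>) \<le> sqrt 2 * (\<bar>p\<bar> / k * \<bar>p\<bar>)" by (intro mult_left_mono) auto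
    then show ?thesis by (simp add: power2_eq_square mult.assoc)
  qed
  ultimately show ?thesis unfolding p_def[symmetric] k_def[symmetric] by linarith
qed

lemma reduce_mod_pi:
  obtains P' where "0 \<le> P'" "P' \<le> pi" "cis (2 * P) = cis (2 * P')"
proof -
  define P' where "P' = P - of_int \<lfloor>P / pi\<rfloor> * pi"
  have "0 \<le> P'" "P' \<le> pi"
    using floor_divide_lower[of pi P] floor_divide_upper[of pi P] by (simp_all add: P'_def algebra_simps)
  moreover have "cis (2 * P') = cis (2 * P) * cis (- (2 * pi * of_int \<lfloor>P / pi\<rfloor>))"
    by (simp add: P'_def cis_mult algebra_simps)
  then have "cis (2 * P) = cis (2 * P')" using cis_multiple_2pi[of "- of_int \<lfloor>P / pi\<rfloor>"] by simp
  ultimately show ?thesis using that by blast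
qed

text \<open>A lift of the momentum may be any real number, so the parabola has to stay below the
  pi-periodic extension of the curve. Between 0 and pi the local expansion suffices; outside, the
  parabola is pushed below 0, while energies are nonnegative.\<close>

lemma soliton_energy_support:
  assumes \<omega>: "\<bar>\<omega>\<bar> < pi / 2"
  obtains K where "0 \<le> K" "\<And>P. \<exists>\<omega>'. \<bar>\<omega>'\<bar> \<le> pi / 2 \<and> cis (2 * P) = cis (2 * soliton_momentum \<omega>') \<and>
     soliton_energy \<omega> - sqrt 2 * sin \<omega> * (P - soliton_momentum \<omega>) - K * (P - soliton_momentum \<omega>)\<^sup>2 \<le> soliton_energy \<omega>'"
proof -
  define p where "p = soliton_momentum \<omega>"
  define d where "d = min p (pi - p)"
  have d: "d > 0" using soliton_momentum_bounds[OF \<omega>] by (simp add: d_def p_def)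
  define k where "k = sqrt 2 / (1 - \<bar>sin \<omega>\<bar>)"
  have k: "k > 0" using abs_sin_less_one[OF \<omega>] by (simp add: k_def)
  define I where "I = soliton_energy \<omega>"
  have en: "0 \<le> soliton_energy x" if "\<bar>x\<bar> \<le> pi / 2" for x
    using that cos_ge_zero[of x] by (simp add: soliton_energy_def)
  have I: "I \<ge> 0" unfolding I_def using \<omega> by (intro en) auto
  \<comment> \<open>The first summand serves the expansion. The other two make
    \<open>K * x\<^sup>2\<close> exceed \<open>I\<close> and \<open>sqrt 2 * x\<close> as soon as
    \<open>x\<close> \<ge> \<open>d\<close>, and every \<open>P\<close> outside the basic interval
    is at least \<open>d\<close> away from \<open>p\<close>.\<close>
  define K where "K = k + I / d\<^sup>2 + sqrt 2 / d"
  have "\<exists>\<omega>'. \<bar>\<omega>'\<bar> \<le> pi / 2 \<and> cis (2 * P) = cis (2 * soliton_momentum \<omega>') \<and> I - sqrt 2 * sin \<omega> * (P - p) - K * (P - p)\<^sup>2 \<le> soliton_energy \<omega>'" for P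
  proof (cases "0 \<le> P \<and> P \<le> pi")
    case True
    then obtain \<omega>' where w: "\<bar>\<omega>'\<bar> \<le> pi / 2" "soliton_momentum \<omega>' = P" using soliton_momentum_surj by metis
    have "k * (P - p)\<^sup>2 \<le> K * (P - p)\<^sup>2" unfolding K_def using I d by (intro mult_right_mono) auto
    moreover have "I - sqrt 2 * sin \<omega> * (P - p) - k * (P - p)\<^sup>2 \<le> soliton_energy \<omega>'"
      using soliton_energy_expansion[OF \<omega> w(1)] unfolding I_def p_def w(2) k_def by simp
    ultimately show ?thesis using w by (intro exI[of _ \<omega>']) auto
  next
    case False
    obtain P' where P': "0 \<le> P'" "P' \<le> pi" "cis (2 * P) = cis (2 * P')" by (rule reduce_mod_pi)
    obtain \<omega>' where w: "\<bar>\<omega>'\<bar> \<le> pi / 2" "soliton_momentum \<omega>' = P'" using soliton_momentum_surj P' by metis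
    define x where "x = \<bar>P - p\<bar>"
    have x: "x \<ge> d" using False soliton_momentum_bounds[OF \<omega>] by (auto simp: x_def d_def p_def)
    have x0: "x > 0" using x d by simp
    have "I \<le> I / d\<^sup>2 * x\<^sup>2"
    proof -
      have "d\<^sup>2 \<le> x\<^sup>2" using x d by (intro power_mono) auto
      then have "I / d\<^sup>2 * d\<^sup>2 \<le> I / d\<^sup>2 * x\<^sup>2" using I by (intro mult_left_mono) auto
      then show ?thesis using d by simp
    qed
    moreover have "sqrt 2 * x \<le> sqrt 2 / d * x\<^sup>2"
    proof -
      have "sqrt 2 / d * (d * x) \<le> sqrt 2 / d * (x * x)" using x d x0 by (intro mult_left_mono mult_right_mono) auto
      then show ?thesis using d by (simp add: power2_eq_square)
    qed
    moreover have "- (sqrt 2 * sin \<omega> * (P - p)) \<le> sqrt 2 * x"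
    proof -
      have "\<bar>sqrt 2 * sin \<omega> * (P - p)\<bar> \<le> sqrt 2 * 1 * x"
        unfolding abs_mult x_def by (intro mult_mono) auto
      then show ?thesis by simp
    qed
    moreover have "K * (P - p)\<^sup>2 = k * x\<^sup>2 + I / d\<^sup>2 * x\<^sup>2 + sqrt 2 / d * x\<^sup>2" "0 \<le> k * x\<^sup>2"
      using k by (auto simp: K_def x_def algebra_simps)
    ultimately have "I - sqrt 2 * sin \<omega> * (P - p) - K * (P - p)\<^sup>2 \<le> 0" by linarith
    then show ?thesis using w P' en[OF w(1)] by (intro exI[of _ \<omega>']) auto
  qed
  moreover have "0 \<le> K" using k I d by (simp add: K_def)
  ultimately show ?thesis using that unfolding I_def p_def by blast
qed

text \<open>Twice the momentum, read on the unit circle: the product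
  \<open>v (R n) * cnj (v (- R n))\<close> carries the phase jump, so no argument is chosen. Radii
  along one sequence are used because a slice of a strip function approaches the mean profile only
  in that sense.\<close>

definition momentum_limit_1d :: "(real \<Rightarrow> complex) \<Rightarrow> (real \<Rightarrow> complex) \<Rightarrow> real \<Rightarrow> bool" where
  "momentum_limit_1d v g P \<longleftrightarrow> (\<exists>R. filterlim R at_top sequentially \<and>
     (\<lambda>n. cis (LINT x:{-R n..R n}|lborel. (\<i> * g x) \<bullet> v x) * v (R n) * cnj (v (- R n))) \<longlonglongrightarrow> cis (2 * P))"

corollary energy_1d_support:
  assumes \<omega>: "\<bar>\<omega>\<bar> < pi / 2"
  obtains K where "0 \<le> K" "\<And>v g P. finite_energy_1d v g \<Longrightarrow> momentum_limit_1d v g P \<Longrightarrow>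
     soliton_energy \<omega> - sqrt 2 * sin \<omega> * (P - soliton_momentum \<omega>) - K * (P - soliton_momentum \<omega>)\<^sup>2 \<le> energy_1d v g"
proof -
  obtain K where K: "0 \<le> K" "\<And>P. \<exists>\<omega>'. \<bar>\<omega>'\<bar> \<le> pi / 2 \<and> cis (2 * P) = cis (2 * soliton_momentum \<omega>') \<and>
     soliton_energy \<omega> - sqrt 2 * sin \<omega> * (P - soliton_momentum \<omega>) - K * (P - soliton_momentum \<omega>)\<^sup>2 \<le> soliton_energy \<omega>'"
    using soliton_energy_support[OF \<omega>] by blast
  show ?thesis
  proof (rule that[OF K(1)])
    fix v g P assume fe: "finite_energy_1d v g" and P: "momentum_limit_1d v g P"
    then obtain R where R: "filterlim R at_top sequentially"
     "(\<lambda>n. cis (LINT x:{-R n..R n}|lborel. (\<i> * g x) \<bullet> v x) * v (R n) * cnj (v (- R n))) \<longlonglongrightarrow> cis (2 * P)"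
      unfolding momentum_limit_1d_def by blast
    from K(2)[of P] obtain \<omega>' where w: "\<bar>\<omega>'\<bar> \<le> pi / 2" "cis (2 * P) = cis (2 * soliton_momentum \<omega>')"
     "soliton_energy \<omega> - sqrt 2 * sin \<omega> * (P - soliton_momentum \<omega>) - K * (P - soliton_momentum \<omega>)\<^sup>2 \<le> soliton_energy \<omega>'" by blast
    show "soliton_energy \<omega> - sqrt 2 * sin \<omega> * (P - soliton_momentum \<omega>) - K * (P - soliton_momentum \<omega>)\<^sup>2 \<le> energy_1d v g"
      using energy_1d_lower_bound[OF fe R w(2,1)] w(3) by linarith
  qed
qed

section \<open>Weak derivatives in the plane\<close>

lemma borel_measurable_fst_borel[measurable]: "fst \<in> borel_measurable (borel :: ('a::second_countable_topology \<times> 'b::second_countable_topology) measure)"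
  and borel_measurable_snd_borel[measurable]: "snd \<in> borel_measurable (borel :: ('a::second_countable_topology \<times> 'b::second_countable_topology) measure)"
  by (intro borel_measurable_continuous_onI continuous_intros)+

lemma plane_integrable_iff:
  fixes f :: "real \<times> real \<Rightarrow> 'b::euclidean_space"
  shows "integrable (lborel \<Otimes>\<^sub>M lborel) (case_prod (\<lambda>x y. f (x, y))) \<longleftrightarrow> integrable lborel f"
  by (simp add: lborel_prod)

lemma
  fixes f :: "real \<times> real \<Rightarrow> 'b::euclidean_space"
  assumes f: "integrable lborel f"
  shows plane_AE_integrable_x: "AE y in lborel. integrable lborel (\<lambda>x. f (x, y))"
    and plane_integrable_x: "integrable lborel (\<lambda>y. LINT x|lborel. f (x, y))"
    and plane_integral_x: "(LINT y|lborel. LINT x|lborel. f (x, y)) = (LINT z|lborel. f z)"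
    and plane_AE_integrable_y: "AE x in lborel. integrable lborel (\<lambda>y. f (x, y))"
    and plane_integrable_y: "integrable lborel (\<lambda>x. LINT y|lborel. f (x, y))"
    and plane_integral_y: "(LINT x|lborel. LINT y|lborel. f (x, y)) = (LINT z|lborel. f z)"
  using lborel_pair.AE_integrable_snd[OF f[folded plane_integrable_iff]] lborel_pair.integrable_snd[OF f[folded plane_integrable_iff]]
    lborel_pair.integral_snd[OF f[folded plane_integrable_iff]] lborel_pair.AE_integrable_fst[OF f[folded plane_integrable_iff]]
    lborel_pair.integrable_fst[OF f[folded plane_integrable_iff]] lborel_pair.integral_fst[OF f[folded plane_integrable_iff]]
  by (simp_all add: lborel_prod)

lemma plane_swap: "distr lborel borel prod.swap = (lborel :: (real \<times> real) measure)"
proof -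
  have "(lborel :: (real \<times> real) measure) = distr (lborel \<Otimes>\<^sub>M lborel) (lborel \<Otimes>\<^sub>M lborel) (\<lambda>(x, y). (y, x))"
    using lborel_pair.distr_pair_swap by (simp add: lborel_prod)
  then have "(lborel :: (real \<times> real) measure) = distr lborel lborel prod.swap"
    by (simp add: lborel_prod prod.swap_def[abs_def] case_prod_unfold)
  also have "\<dots> = distr lborel borel prod.swap" by (rule distr_cong) auto
  finally show ?thesis by simp
qed

lemma plane_AE_y: "(AE z in lborel. Q z) \<Longrightarrow> AE x in lborel. AE y in lborel. Q (x :: real, y :: real)"
  unfolding lborel_prod[symmetric] by (rule lborel_pair.AE_pair)

lemma borel_measurable_swap[measurable]: "prod.swap \<in> measurable borel (borel :: (real \<times> real) measure)"
  by (intro borel_measurable_continuous_onI continuous_on_swap)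

lemma plane_AE_swap: 
  assumes "AE z in lborel. Q z"
  shows "AE z in lborel. Q (prod.swap z :: real \<times> real)"
proof -
  have "AE z in distr lborel borel prod.swap. Q z" unfolding plane_swap by (rule assms)
  then show ?thesis by (rule AE_distrD[rotated]) simp
qed

lemma plane_AE_x:
  assumes "AE z in lborel. Q z"
  shows "AE y in lborel. AE x in lborel. Q (x :: real, y :: real)"
  using plane_AE_y[OF plane_AE_swap[OF assms]] by simp

lemma integrable_tensor:
  fixes b :: "real \<Rightarrow> 'b::euclidean_space"
  assumes "integrable lborel a" "integrable lborel b"
  shows "integrable lborel (\<lambda>z::real \<times> real. a (fst z) *\<^sub>R b (snd z))"
proof -
  have [measurable]: "a \<in> borel_measurable borel" "b \<in> borel_measurable borel"
    using assms borel_measurable_integrable by fastforce+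
  have "integrable (lborel \<Otimes>\<^sub>M lborel) (\<lambda>z::real \<times> real. a (fst z) *\<^sub>R b (snd z))"
  proof (rule lborel_pair.Fubini_integrable)
    have "(\<lambda>x. LINT y|lborel. norm (a (fst (x, y)) *\<^sub>R b (snd (x, y)))) = (\<lambda>x. \<bar>a x\<bar> * (LINT y|lborel. norm (b y)))"
      by simp
    then show "integrable lborel (\<lambda>x. LINT y|lborel. norm (a (fst (x, y)) *\<^sub>R b (snd (x, y))))"
      using assms by simp
  qed (use assms in auto)
  then show ?thesis by (simp add: lborel_prod)
qed

section \<open>Test functions of one variable\<close>

definition C1_compact :: "(real \<Rightarrow> real) \<Rightarrow> (real \<Rightarrow> real) \<Rightarrow> bool" where
  "C1_compact a a' \<longleftrightarrow> (\<forall>x. (a has_real_derivative a' x) (at x)) \<and> continuous_on UNIV a' \<and> (\<exists>N. \<forall>x. N < \<bar>x\<bar> \<longrightarrow> a x = 0)"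

lemma C1_compact_continuous: "C1_compact a a' \<Longrightarrow> continuous_on S a" "C1_compact a a' \<Longrightarrow> continuous_on S a'"
  unfolding C1_compact_def
  by (meson DERIV_isCont continuous_at_imp_continuous_on, meson continuous_on_subset subset_UNIV)

lemma C1_compact_support:
  assumes "C1_compact a a'"
  obtains N where "N > 0" "\<And>x. N < \<bar>x\<bar> \<Longrightarrow> a x = 0" "\<And>x. N < \<bar>x\<bar> \<Longrightarrow> a' x = 0"
proof -
  obtain N where N: "\<And>x. N < \<bar>x\<bar> \<Longrightarrow> a x = 0" and d: "\<And>x. (a has_real_derivative a' x) (at x)"
    using assms unfolding C1_compact_def by blast
  have "a' x = 0" if x: "N < \<bar>x\<bar>" for x
  proof -
    have "open {x. N < \<bar>x\<bar>}" by (intro open_Collect_less continuous_intros)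
    then have "eventually (\<lambda>y. a y = 0) (nhds x)"
      using x N by (auto simp: eventually_nhds)
    then have "(a has_real_derivative a' x) (at x) \<longleftrightarrow> ((\<lambda>_. 0) has_real_derivative a' x) (at x)"
      by (intro DERIV_cong_ev) auto
    then show ?thesis using d[of x] DERIV_unique DERIV_const by blast
  qed
  then show ?thesis using that[of "max N 1"] N by auto
qed

lemma continuous_compact_support_integrable:
  fixes f :: "real \<Rightarrow> 'b::euclidean_space"
  assumes "continuous_on UNIV f" "\<And>x. N < \<bar>x\<bar> \<Longrightarrow> f x = 0"
  shows "integrable lborel f"
proof -
  have "integrable lborel (\<lambda>x. indicator {-N..N} x *\<^sub>R f x)"
    by (rule borel_integrable_compact) (auto intro: continuous_on_subset[OF assms(1)])
  moreover have "(\<lambda>x. indicator {-N..N} x *\<^sub>R f x) = f"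
    using assms(2) by (auto simp: indicator_def fun_eq_iff)
  ultimately show ?thesis by simp
qed

lemma C1_compact_integrable:
  assumes "C1_compact a a'"
  shows "integrable lborel a" "integrable lborel a'"
  using C1_compact_support[OF assms] C1_compact_continuous[OF assms] continuous_compact_support_integrable by metis+

lemma C1_compact_measurable:
  assumes "C1_compact a a'"
  shows "a \<in> borel_measurable borel" "a' \<in> borel_measurable borel"
  using C1_compact_continuous[OF assms] borel_measurable_continuous_onI by blast+

lemma continuous_compact_support_bounded:
  fixes f :: "real \<Rightarrow> real"
  assumes "continuous_on UNIV f" "\<And>x. N < \<bar>x\<bar> \<Longrightarrow> f x = 0"
  obtains C where "C \<ge> 0" "\<And>x. \<bar>f x\<bar> \<le> C"
proof -
  have "compact (f ` {-N..N})" by (intro compact_continuous_image continuous_on_subset[OF assms(1)]) auto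
  then obtain B where B: "\<And>x. x \<in> {-N..N} \<Longrightarrow> \<bar>f x\<bar> \<le> B"
    by (metis bounded_iff compact_imp_bounded imageI real_norm_def)
  have "\<bar>f x\<bar> \<le> max B 0" for x
    using B[of x] assms(2)[of x] by (cases "x \<in> {-N..N}") auto
  then show ?thesis using that[of "max B 0"] by simp
qed

text \<open>\<open>Q\<close> is half the square of the positive part. Obtaining it as an
  antiderivative of \<open>max 0\<close> spares a case distinction at the origin.\<close>

lemma C1_ramp_exists:
  obtains Q h :: "real \<Rightarrow> real" where "\<And>t. (Q has_real_derivative h t) (at t)" "continuous_on UNIV h"
    "\<And>t. t \<le> 0 \<Longrightarrow> Q t = 0" "\<And>t. t > 0 \<Longrightarrow> Q t > 0"
proof -
  have "\<exists>H. \<forall>x::real. (-\<infinity>::ereal) < ereal x \<longrightarrow> ereal x < \<infinity> \<longrightarrow> (H has_vector_derivative max 0 x) (at x)"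
    by (rule einterval_antiderivative) (auto intro!: continuous_intros)
  then obtain H where H: "\<And>x. (H has_real_derivative max 0 x) (at x)"
    by (auto simp: has_real_derivative_iff_has_vector_derivative)
  have Hc: "continuous_on S H" for S by (meson H DERIV_isCont continuous_at_imp_continuous_on)
  define Q where "Q t = H t - H 0" for t
  have Q: "(Q has_real_derivative max 0 t) (at t)" for t
    unfolding Q_def using H[of t] by (auto intro!: derivative_eq_intros)
  have "Q t = 0" if "t \<le> 0" for t
  proof (cases "t = 0")
    case False
    then have t: "t < 0" using that by simp
    have "H 0 = H t" by (rule DERIV_isconst_end[OF t Hc]) (use H in \<open>metis less_imp_le max_absorb1\<close>)
    then show ?thesis by (simp add: Q_def)
  qed (simp add: Q_def)
  moreover have "Q t > 0" if t: "t > 0" for t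
  proof -
    obtain z where "0 < z" "z < t" "Q t - Q 0 = (t - 0) * max 0 z"
      using MVT2[of 0 t Q "\<lambda>t. max 0 t"] Q t by blast
    then show ?thesis using t by (simp add: Q_def)
  qed
  moreover have "continuous_on UNIV (\<lambda>t::real. max 0 t)" by (intro continuous_intros)
  ultimately show ?thesis using that[of Q "\<lambda>t. max 0 t"] Q by blast
qed

lemma C1_bump_sequence:
  fixes c d :: real
  obtains b b' :: "nat \<Rightarrow> real \<Rightarrow> real" where "\<And>n. C1_compact (b n) (b' n)" "\<And>n x. 0 \<le> b n x" "\<And>n x. b n x \<le> 1"
    "\<And>n x. x \<notin> {c..d} \<Longrightarrow> b n x = 0" "\<And>x. (\<lambda>n. b n x) \<longlonglongrightarrow> indicator {c<..<d} x"
proof -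
  obtain Q h where Q: "\<And>t. (Q has_real_derivative h t) (at t)" "continuous_on UNIV h"
    "\<And>t. t \<le> 0 \<Longrightarrow> Q t = 0" "\<And>t. t > 0 \<Longrightarrow> Q t > 0" using C1_ramp_exists by blast
  have Qc: "continuous_on S Q" for S by (meson Q(1) DERIV_isCont continuous_at_imp_continuous_on)
  have Q0: "Q t \<ge> 0" for t using Q(3)[of t] Q(4)[of t] by (cases "t \<le> 0") auto
  define \<beta> where "\<beta> x = Q (x - c) * Q (d - x)" for x
  define \<beta>' where "\<beta>' x = h (x - c) * Q (d - x) - Q (x - c) * h (d - x)" for x
  have \<beta>: "(\<beta> has_real_derivative \<beta>' x) (at x)" for x
  proof -
    have 1: "((\<lambda>x. Q (x - c)) has_real_derivative h (x - c)) (at x)"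
      using DERIV_chain2[OF Q(1), of "\<lambda>x. x - c" 1 x UNIV] by (simp add: DERIV_diff[OF DERIV_ident DERIV_const, simplified])
    have 2: "((\<lambda>x. Q (d - x)) has_real_derivative h (d - x) * (-1)) (at x)"
      by (rule DERIV_chain2[OF Q(1)]) (auto intro!: derivative_eq_intros)
    show ?thesis unfolding \<beta>_def[abs_def] \<beta>'_def using DERIV_mult[OF 1 2] by (simp add: algebra_simps)
  qed
  have \<beta>0: "\<beta> x \<ge> 0" for x by (simp add: \<beta>_def Q0)
  have \<beta>z: "\<beta> x = 0" if "x \<notin> {c<..<d}" for x using that Q(3) by (auto simp: \<beta>_def not_less)
  have \<beta>p: "\<beta> x > 0" if "x \<in> {c<..<d}" for x using that Q(4) by (auto simp: \<beta>_def)
  have \<beta>'c: "continuous_on UNIV \<beta>'" unfolding \<beta>'_def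
    by (intro continuous_intros continuous_on_compose2[OF Qc] continuous_on_compose2[OF Q(2)]) auto
  have \<beta>c: "continuous_on UNIV \<beta>" by (meson \<beta> DERIV_isCont continuous_at_imp_continuous_on)
  \<comment> \<open>The map from \<open>s\<close> to \<open>n * s / (1 + n * s)\<close> saturates at
    1 for \<open>s > 0\<close> and fixes 0, so these functions remain continuously differentiable
    and tend to the indicator of the open interval.\<close>
  define b where "b n x = real n * \<beta> x / (1 + real n * \<beta> x)" for n x
  define b' where "b' n x = real n * \<beta>' x / (1 + real n * \<beta> x)\<^sup>2" for n x
  have den: "1 + real n * \<beta> x > 0" for n x using \<beta>0[of x] by (simp add: add_pos_nonneg)
  have bz: "b n x = 0" if "x \<notin> {c<..<d}" for n x using \<beta>z[OF that] by (simp add: b_def)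
  have "C1_compact (b n) (b' n)" for n
    unfolding C1_compact_def
  proof (intro conjI allI)
    fix x
    have n0: "1 + real n * \<beta> x \<noteq> 0" using den[of n x] by simp
    have "(b n has_real_derivative ((real n * \<beta>' x) * (1 + real n * \<beta> x) - (real n * \<beta> x) * (real n * \<beta>' x)) / ((1 + real n * \<beta> x) * (1 + real n * \<beta> x))) (at x)"
      unfolding b_def[abs_def] using n0 by (auto intro!: derivative_eq_intros \<beta>)
    then show "(b n has_real_derivative b' n x) (at x)"
      by (rule DERIV_cong) (simp add: b'_def power2_eq_square algebra_simps)
    show "continuous_on UNIV (b' n)" unfolding b'_def
      using den by (intro continuous_intros \<beta>c \<beta>'c) (metis less_irrefl power_not_zero)
    show "\<exists>N. \<forall>x. N < \<bar>x\<bar> \<longrightarrow> b n x = 0"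
      by (rule exI[of _ "max \<bar>c\<bar> \<bar>d\<bar>"]) (auto intro!: bz)
  qed
  moreover have "0 \<le> b n x" "b n x \<le> 1" for n x using den[of n x] \<beta>0[of x] by (auto simp: b_def)
  moreover have "b n x = 0" if "x \<notin> {c..d}" for n x using that by (intro bz) auto
  moreover have "(\<lambda>n. b n x) \<longlonglongrightarrow> indicator {c<..<d} x" for x
  proof (cases "x \<in> {c<..<d}")
    case True
    have p: "\<beta> x > 0" by (rule \<beta>p[OF True])
    have "filterlim (\<lambda>n. 1 + real n * \<beta> x) at_top sequentially"
      by (rule filterlim_tendsto_add_at_top[OF tendsto_const filterlim_at_top_mult_tendsto_pos[OF tendsto_const p filterlim_real_sequentially]])
    then have "(\<lambda>n. inverse (1 + real n * \<beta> x)) \<longlonglongrightarrow> 0" by (rule tendsto_inverse_0_at_top)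
    then have "(\<lambda>n. 1 - inverse (1 + real n * \<beta> x)) \<longlonglongrightarrow> 1 - 0" by (intro tendsto_intros)
    moreover have "1 - inverse (1 + real n * \<beta> x) = b n x" for n
      using den[of n x] by (simp add: b_def field_simps)
    ultimately show ?thesis using True by simp
  qed (simp add: bz)
  ultimately show ?thesis using that by blast
qed

lemma integrable_cutoff:
  fixes f :: "'a::euclidean_space \<Rightarrow> complex"
  assumes f: "locally_integrable f" and m: "\<phi> \<in> borel_measurable borel" and C: "\<And>z. \<bar>\<phi> z\<bar> \<le> C"
    and K: "compact K" "\<And>z. z \<notin> K \<Longrightarrow> \<phi> z = 0"
  shows "integrable lborel (\<lambda>z. \<phi> z *\<^sub>R f z)"
proof -
  have [measurable]: "f \<in> borel_measurable borel" using f by (simp add: locally_integrable_def)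
  note m[measurable]
  have "C \<ge> 0" using C abs_ge_zero order_trans by blast
  have "integrable lborel (\<lambda>z. C *\<^sub>R (indicator K z *\<^sub>R f z))"
    using f K(1) unfolding locally_integrable_def set_integrable_def by (intro integrable_scaleR_right) auto
  then show ?thesis
  proof (rule Bochner_Integration.integrable_bound)
    show "AE z in lborel. norm (\<phi> z *\<^sub>R f z) \<le> norm (C *\<^sub>R indicat_real K z *\<^sub>R f z)"
      using C K(2) \<open>C \<ge> 0\<close> by (intro AE_I2) (auto simp: indicator_def intro!: mult_right_mono)
  qed simp
qed

lemma tensor_cutoff:
  assumes a: "continuous_on UNIV a" "\<And>x. N < \<bar>x\<bar> \<Longrightarrow> a x = 0" and b: "continuous_on UNIV b" "\<And>x. M < \<bar>x\<bar> \<Longrightarrow> b x = 0"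
    and f: "locally_integrable (f :: real \<times> real \<Rightarrow> complex)"
  shows "integrable lborel (\<lambda>z. (a (fst z) * b (snd z)) *\<^sub>R f z)"
proof -
  obtain C where C: "C \<ge> 0" "\<And>x. \<bar>a x\<bar> \<le> C" using continuous_compact_support_bounded[OF a] by blast
  obtain D where D: "D \<ge> 0" "\<And>x. \<bar>b x\<bar> \<le> D" using continuous_compact_support_bounded[OF b] by blast
  show ?thesis
  proof (rule integrable_cutoff[OF f, where C = "C * D" and K = "{-N..N} \<times> {-M..M}"])
    have [measurable]: "a \<in> borel_measurable borel" "b \<in> borel_measurable borel"
      using a b by (auto intro: borel_measurable_continuous_onI)
    show "(\<lambda>z. a (fst z) * b (snd z)) \<in> borel_measurable borel" by measurable
    show "\<bar>a (fst z) * b (snd z)\<bar> \<le> C * D" for z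
      unfolding abs_mult using C D by (intro mult_mono) auto
    show "a (fst z) * b (snd z) = 0" if "z \<notin> {-N..N} \<times> {-M..M}" for z
      using that a(2)[of "fst z"] b(2)[of "snd z"] by (cases z) (force simp: not_le)
  qed (auto intro: compact_Times)
qed

section \<open>Uniqueness through tensor-product tests\<close>

text \<open>Open boxes form an intersection-stable generator of the Borel sets, so vanishing
  integrals spread by the Dynkin argument. The total integral is a separate hypothesis because
  complements are taken in the whole plane.\<close>

lemma zero_if_box_integrals_zero:
  fixes F :: "real \<times> real \<Rightarrow> complex"
  assumes F: "integrable lborel F" and box: "\<And>a b. (LINT z:box a b|lborel. F z) = 0" and tot: "(LINT z|lborel. F z) = 0"
  shows "AE z in lborel. F z = 0"
proof (rule sigma_finite_measure.density_zero[OF sigma_finite_lborel F])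
  fix A :: "(real \<times> real) set" assume A: "A \<in> sets lborel"
  have "Int_stable (range (\<lambda>(a, b). box a b :: (real \<times> real) set))"
    by (auto simp: Int_stable_def box_Int_box)
  moreover have "range (\<lambda>(a, b). box a b :: (real \<times> real) set) \<subseteq> Pow UNIV" by auto
  moreover have "A \<in> sigma_sets UNIV (range (\<lambda>(a, b). box a b))"
    using A unfolding sets_lborel borel_eq_box by simp
  ultimately show "(LINT z:A|lborel. F z) = 0"
  proof (induction rule: sigma_sets_induct_disjoint)
    case (basic A)
    then show ?case using box by auto
  next
    case empty
    show ?case by (simp add: set_lebesgue_integral_def)
  next
    case (compl A)
    then have Ab: "A \<in> sets borel" by (simp add: borel_eq_box)
    have "(LINT z:UNIV - A|lborel. F z) = (LINT z|lborel. F z - indicator A z *\<^sub>R F z)"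
      unfolding set_lebesgue_integral_def by (intro Bochner_Integration.integral_cong) (auto simp: indicator_def)
    also have "\<dots> = (LINT z|lborel. F z) - (LINT z:A|lborel. F z)"
      unfolding set_lebesgue_integral_def using Ab F by (intro Bochner_Integration.integral_diff integrable_mult_indicator) auto
    finally show ?case using compl tot by simp
  next
    case (union A)
    then have m: "A i \<in> sets lborel" for i by (auto simp: borel_eq_box)
    have "(LINT z:(\<Union>i. A i)|lborel. F z) = (\<Sum>i. (LINT z:A i|lborel. F z))"
    proof (rule lebesgue_integral_countable_add[OF m])
      show "i \<noteq> j \<Longrightarrow> A i \<inter> A j = {}" for i j using union(1) by (auto simp: disjoint_family_on_def)
      show "set_integrable lborel (\<Union>i. A i) F"
        unfolding set_integrable_def using m F by (intro integrable_mult_indicator) auto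
    qed
    then show ?case using union by simp
  qed
qed

text \<open>Products of bump functions converge, dominated on a compact box, to the indicator of an
  open box. Cutting \<open>f\<close> off to the growing boxes \<open>B N\<close> turns local
  integrability into the integrability that the box argument requires.\<close>

lemma zero_if_tensor_tests_vanish:
  fixes f :: "real \<times> real \<Rightarrow> complex"
  assumes f: "locally_integrable f"
    and test: "\<And>a a' b b'. C1_compact a a' \<Longrightarrow> C1_compact b b' \<Longrightarrow> (LINT z|lborel. (a (fst z) * b (snd z)) *\<^sub>R f z) = 0"
  shows "AE z in lborel. f z = 0"
proof -
  have [measurable]: "f \<in> borel_measurable borel" using f by (simp add: locally_integrable_def)
  have box0: "(LINT z:box p q|lborel. f z) = 0" for p q :: "real \<times> real"
  proof -
    obtain a a' where a: "\<And>n. C1_compact (a n) (a' n)" "\<And>n x. 0 \<le> a n x" "\<And>n x. a n x \<le> 1"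
      "\<And>n x. x \<notin> {fst p..fst q} \<Longrightarrow> a n x = 0" "\<And>x. (\<lambda>n. a n x) \<longlonglongrightarrow> indicator {fst p<..<fst q} x"
      using C1_bump_sequence[of "fst p" "fst q"] by metis
    obtain b b' where b: "\<And>n. C1_compact (b n) (b' n)" "\<And>n x. 0 \<le> b n x" "\<And>n x. b n x \<le> 1"
      "\<And>n x. x \<notin> {snd p..snd q} \<Longrightarrow> b n x = 0" "\<And>x. (\<lambda>n. b n x) \<longlonglongrightarrow> indicator {snd p<..<snd q} x"
      using C1_bump_sequence[of "snd p" "snd q"] by metis
    note [measurable] = C1_compact_measurable[OF a(1)] C1_compact_measurable[OF b(1)]
    define K where "K = {fst p..fst q} \<times> {snd p..snd q}"
    have K: "compact K" unfolding K_def by (intro compact_Times) auto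
    have "(\<lambda>n. LINT z|lborel. (a n (fst z) * b n (snd z)) *\<^sub>R f z) \<longlonglongrightarrow> (LINT z|lborel. indicator (box p q) z *\<^sub>R f z)"
    proof (rule integral_dominated_convergence[where w = "\<lambda>z. norm (indicator K z *\<^sub>R f z)"])
      show "integrable lborel (\<lambda>z. norm (indicator K z *\<^sub>R f z))"
        using f K unfolding locally_integrable_def set_integrable_def by (intro integrable_norm) auto
      show "AE z in lborel. (\<lambda>n. (a n (fst z) * b n (snd z)) *\<^sub>R f z) \<longlonglongrightarrow> indicator (box p q) z *\<^sub>R f z"
      proof (rule AE_I2)
        fix z :: "real \<times> real"
        have "(\<lambda>n. (a n (fst z) * b n (snd z)) *\<^sub>R f z) \<longlonglongrightarrow> (indicator {fst p<..<fst q} (fst z) * indicator {snd p<..<snd q} (snd z)) *\<^sub>R f z"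
          by (intro tendsto_intros a(5) b(5))
        moreover have "(indicator {fst p<..<fst q} (fst z) * indicator {snd p<..<snd q} (snd z) :: real) = indicator (box p q) z"
          by (cases p, cases q, cases z) (auto simp: indicator_def box_prod)
        ultimately show "(\<lambda>n. (a n (fst z) * b n (snd z)) *\<^sub>R f z) \<longlonglongrightarrow> indicator (box p q) z *\<^sub>R f z" by simp
      qed
      show "AE z in lborel. norm ((a n (fst z) * b n (snd z)) *\<^sub>R f z) \<le> norm (indicator K z *\<^sub>R f z)" for n
      proof (rule AE_I2)
        fix z :: "real \<times> real"
        have le: "\<bar>a n (fst z) * b n (snd z)\<bar> \<le> 1 * 1"
          unfolding abs_mult using a(2,3) b(2,3) by (intro mult_mono) (auto simp: abs_le_iff intro: order_trans[of _ 0])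
        have "\<bar>a n (fst z) * b n (snd z)\<bar> \<le> indicator K z"
          using le a(4)[of "fst z" n] b(4)[of "snd z" n] by (cases z) (auto simp: K_def indicator_def)
        then show "norm ((a n (fst z) * b n (snd z)) *\<^sub>R f z) \<le> norm (indicator K z *\<^sub>R f z)"
          by (auto simp: intro!: mult_right_mono)
      qed
    qed simp_all
    moreover have "(LINT z|lborel. (a n (fst z) * b n (snd z)) *\<^sub>R f z) = 0" for n by (rule test[OF a(1) b(1)])
    ultimately show ?thesis unfolding set_lebesgue_integral_def by (simp add: LIMSEQ_const_iff)
  qed
  define B where "B N = box (- real N, - real N) (real N, real N)" for N :: nat
  have "AE z in lborel. indicator (B N) z *\<^sub>R f z = 0" for N
  proof (rule zero_if_box_integrals_zero)
    have "B N \<subseteq> cbox (- real N, - real N) (real N, real N)" unfolding B_def by (rule box_subset_cbox)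
    moreover have "set_integrable lborel (cbox (- real N, - real N) (real N, real N)) f"
      using f compact_cbox unfolding locally_integrable_def by blast
    ultimately show "integrable lborel (\<lambda>z. indicator (B N) z *\<^sub>R f z)"
      using set_integrable_subset[of lborel _ f "B N"] unfolding set_integrable_def B_def by auto
    show "(LINT z|lborel. indicator (B N) z *\<^sub>R f z) = 0"
      using box0[of "(- real N, - real N)" "(real N, real N)"] by (simp add: set_lebesgue_integral_def B_def)
    show "(LINT z:box a b|lborel. indicator (B N) z *\<^sub>R f z) = 0" for a b
    proof -
      obtain c d where cd: "box a b \<inter> B N = box c d" unfolding B_def box_Int_box by blast
      have "(LINT z:box a b|lborel. indicator (B N) z *\<^sub>R f z) = (LINT z:box c d|lborel. f z)"
        unfolding set_lebesgue_integral_def cd[symmetric] by (simp add: indicator_inter_arith mult.assoc)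
      then show ?thesis by (simp add: box0)
    qed
  qed
  then have "AE z in lborel. \<forall>N. indicator (B N) z *\<^sub>R f z = 0" by (intro AE_all_countable[THEN iffD2] allI)
  then show ?thesis
  proof eventually_elim
    case (elim z)
    obtain N where "\<bar>fst z\<bar> + \<bar>snd z\<bar> < real N" using reals_Archimedean2 by blast
    then have "z \<in> B N" by (cases z) (auto simp: B_def box_prod)
    then show ?case using elim[rule_format, of N] by simp
  qed
qed

section \<open>Weak derivatives and absolute continuity on lines\<close>

lemma C1_compact_ac: "C1_compact a a' \<Longrightarrow> has_ac_derivative a a'"
  unfolding C1_compact_def by (intro ac_C1) (auto simp: has_real_derivative_iff_has_vector_derivative)

lemma integration_by_parts_C1_compact:
  fixes v g :: "real \<Rightarrow> complex"
  assumes a: "C1_compact a a'" and v: "has_ac_derivative v g"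
  shows "integrable lborel (\<lambda>x. a' x *\<^sub>R v x)" "integrable lborel (\<lambda>x. a x *\<^sub>R g x)"
    "(LINT x|lborel. a' x *\<^sub>R v x) = - (LINT x|lborel. a x *\<^sub>R g x)"
proof -
  obtain N where N: "N > 0" "\<And>x. N < \<bar>x\<bar> \<Longrightarrow> a x = 0" "\<And>x. N < \<bar>x\<bar> \<Longrightarrow> a' x = 0" using C1_compact_support[OF a] by blast
  have P: "has_ac_derivative (\<lambda>x. a x *\<^sub>R v x) (\<lambda>x. a x *\<^sub>R g x + a' x *\<^sub>R v x)"
    by (rule ac_bounded_bilinear[OF bounded_bilinear_scaleR C1_compact_ac[OF a] v])
  have i1: "integrable lborel (\<lambda>x. a' x *\<^sub>R v x)"
    by (rule continuous_compact_support_integrable[where N = N])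
      (use N in \<open>auto intro!: continuous_intros C1_compact_continuous[OF a] ac_continuous_on[OF v]\<close>)
  have e: "(\<lambda>x. indicator {-N-1..N+1} x *\<^sub>R (a x *\<^sub>R g x)) = (\<lambda>x. a x *\<^sub>R g x)"
  proof (rule ext)
    show "indicator {-N-1..N+1} x *\<^sub>R (a x *\<^sub>R g x) = a x *\<^sub>R g x" for x
      using N(2)[of x] by (cases "N < \<bar>x\<bar>") (auto simp: indicator_def)
  qed
  have "set_integrable lborel {-N-1..N+1} (\<lambda>x. a x *\<^sub>R g x)"
    using set_integrable_continuous_bilinear[OF bounded_bilinear.flip[OF bounded_bilinear_scaleR] ac_integrable[OF v] C1_compact_continuous(1)[OF a] ac_measurable[OF v]]
    by blast
  then have i2: "integrable lborel (\<lambda>x. a x *\<^sub>R g x)" unfolding set_integrable_def e .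
  have "0 = (LINT x:{-N-1..N+1}|lborel. a x *\<^sub>R g x + a' x *\<^sub>R v x)"
    using ac_diff[OF P, of "-N-1" "N+1"] N by simp
  also have "\<dots> = (LINT x|lborel. a x *\<^sub>R g x + a' x *\<^sub>R v x)"
    unfolding set_lebesgue_integral_def
  proof (rule Bochner_Integration.integral_cong)
    show "indicator {-N-1..N+1} x *\<^sub>R (a x *\<^sub>R g x + a' x *\<^sub>R v x) = a x *\<^sub>R g x + a' x *\<^sub>R v x" for x
      using N(2,3)[of x] by (cases "N < \<bar>x\<bar>") (auto simp: indicator_def)
  qed simp
  also have "\<dots> = (LINT x|lborel. a x *\<^sub>R g x) + (LINT x|lborel. a' x *\<^sub>R v x)"
    by (rule Bochner_Integration.integral_add[OF i2 i1])
  finally show "(LINT x|lborel. a' x *\<^sub>R v x) = - (LINT x|lborel. a x *\<^sub>R g x)"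
    by (simp add: eq_neg_iff_add_eq_0 add.commute)
  show "integrable lborel (\<lambda>x. a' x *\<^sub>R v x)" "integrable lborel (\<lambda>x. a x *\<^sub>R g x)" by fact+
qed

lemma test_function_continuous: "test_function \<phi> D \<Longrightarrow> continuous_on UNIV \<phi>" "test_function \<phi> D \<Longrightarrow> continuous_on UNIV (\<lambda>z. blinfun_apply (D z) b)"
proof -
  assume t: "test_function \<phi> D"
  show "continuous_on UNIV \<phi>"
    using t unfolding test_function_def by (meson has_derivative_continuous continuous_at_imp_continuous_on)
  show "continuous_on UNIV (\<lambda>z. blinfun_apply (D z) b)"
    using t unfolding test_function_def by (intro continuous_intros) auto
qed

lemma test_function_support:
  assumes "test_function \<phi> D"
  obtains K where "compact K" "\<And>z. z \<notin> K \<Longrightarrow> \<phi> z = 0" "\<And>z b. z \<notin> K \<Longrightarrow> blinfun_apply (D z) b = 0"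
proof -
  obtain K where K: "compact K" "\<And>z. z \<notin> K \<Longrightarrow> \<phi> z = 0" and d: "\<And>z. (\<phi> has_derivative blinfun_apply (D z)) (at z)"
    using assms unfolding test_function_def by blast
  have "blinfun_apply (D z) b = 0" if z: "z \<notin> K" for z b
  proof -
    have "open (- K)" using K(1) by (simp add: compact_imp_closed open_Compl)
    then have "(\<phi> has_derivative (\<lambda>_. 0)) (at z)"
      by (rule has_derivative_transform_within_open[OF has_derivative_const[of 0]]) (use z K(2) in auto)
    then have "blinfun_apply (D z) = (\<lambda>_. 0)" using d has_derivative_unique by blast
    then show ?thesis by simp
  qed
  then show ?thesis using that K by blast
qed

lemma continuous_compact_support_bounded':
  fixes f :: "'a::euclidean_space \<Rightarrow> real"
  assumes "continuous_on UNIV f" "compact K" "\<And>z. z \<notin> K \<Longrightarrow> f z = 0"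
  obtains C where "\<And>z. \<bar>f z\<bar> \<le> C"
proof -
  have "compact (f ` K)" by (intro compact_continuous_image continuous_on_subset[OF assms(1)] assms(2)) auto
  then obtain B where B: "\<And>x. x \<in> K \<Longrightarrow> \<bar>f x\<bar> \<le> B"
    by (metis bounded_iff compact_imp_bounded imageI real_norm_def)
  have "\<bar>f x\<bar> \<le> max B 0" for x
    using B[of x] assms(3)[of x] by (cases "x \<in> K") auto
  then show ?thesis using that by blast
qed

lemma test_function_integrable:
  assumes t: "test_function \<phi> D" and f: "locally_integrable f"
  shows "integrable lborel (\<lambda>z. \<phi> z *\<^sub>R f z)" "integrable lborel (\<lambda>z. blinfun_apply (D z) b *\<^sub>R f z)"
proof -
  obtain K where K: "compact K" "\<And>z. z \<notin> K \<Longrightarrow> \<phi> z = 0" "\<And>z b. z \<notin> K \<Longrightarrow> blinfun_apply (D z) b = 0"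
    using test_function_support[OF t] by metis
  obtain C where C: "\<And>z. \<bar>\<phi> z\<bar> \<le> C" using continuous_compact_support_bounded'[OF test_function_continuous(1)[OF t] K(1,2)] by blast
  obtain C' where C': "\<And>z. \<bar>blinfun_apply (D z) b\<bar> \<le> C'" using continuous_compact_support_bounded'[OF test_function_continuous(2)[OF t] K(1,3)] by blast
  show "integrable lborel (\<lambda>z. \<phi> z *\<^sub>R f z)"
    using integrable_cutoff[OF f borel_measurable_continuous_onI[OF test_function_continuous(1)[OF t]] C K(1,2)] .
  show "integrable lborel (\<lambda>z. blinfun_apply (D z) b *\<^sub>R f z)"
    using integrable_cutoff[OF f borel_measurable_continuous_onI[OF test_function_continuous(2)[OF t]] C' K(1,3)] .
qed

lemma test_function_slice:
  assumes "test_function \<phi> D"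
  shows "C1_compact (\<lambda>x::real. \<phi> (x, y::real)) (\<lambda>x. blinfun_apply (D (x, y)) (1, 0))"
  unfolding C1_compact_def
proof (intro conjI allI)
  have d: "\<And>z. (\<phi> has_derivative blinfun_apply (D z)) (at z)" using assms unfolding test_function_def by blast
  fix x :: real
  have "((\<lambda>x. (x, y)) has_derivative (\<lambda>h. (h, 0))) (at x)"
    by (intro has_derivative_Pair has_derivative_ident has_derivative_const)
  then have "((\<lambda>x. \<phi> (x, y)) has_derivative (\<lambda>h. blinfun_apply (D (x, y)) (h, 0))) (at x)"
    using has_derivative_compose[of "\<lambda>x. (x, y)" "\<lambda>h. (h, 0)" x UNIV \<phi> "blinfun_apply (D (x, y))"] d by simp
  moreover have "(\<lambda>h. blinfun_apply (D (x, y)) (h, 0)) = (*) (blinfun_apply (D (x, y)) (1, 0))"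
  proof (rule ext)
    show "blinfun_apply (D (x, y)) (h, 0) = blinfun_apply (D (x, y)) (1, 0) * h" for h
      using blinfun.scaleR_right[of "D (x, y)" h "(1, 0)"] by simp
  qed
  ultimately show "((\<lambda>x. \<phi> (x, y)) has_real_derivative blinfun_apply (D (x, y)) (1, 0)) (at x)"
    by (simp only: has_field_derivative_def)
  show "continuous_on UNIV (\<lambda>x. blinfun_apply (D (x, y)) (1, 0))"
    by (rule continuous_on_compose2[OF test_function_continuous(2)[OF assms]]) (auto intro!: continuous_intros)
  obtain K where K: "compact K" "\<And>z. z \<notin> K \<Longrightarrow> \<phi> z = 0" using test_function_support[OF assms] by metis
  obtain N where "\<And>z. z \<in> K \<Longrightarrow> norm z \<le> N" using K(1) compact_imp_bounded bounded_iff by metis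
  then have "\<phi> (x, y) = 0" if "N < \<bar>x\<bar>" for x
    using K(2)[of "(x, y)"] that norm_fst_le[of x y] by force
  then show "\<exists>N. \<forall>x. N < \<bar>x\<bar> \<longrightarrow> \<phi> (x, y) = 0" by blast
qed

lemma test_function_real:
  assumes "test_function \<phi> D"
  shows "C1_compact \<phi> (\<lambda>x::real. blinfun_apply (D x) 1)"
  unfolding C1_compact_def
proof (intro conjI allI)
  fix x
  have "(\<phi> has_derivative blinfun_apply (D x)) (at x)" using assms unfolding test_function_def by blast
  moreover have "blinfun_apply (D x) = (*) (blinfun_apply (D x) 1)"
  proof (rule ext)
    show "blinfun_apply (D x) h = blinfun_apply (D x) 1 * h" for h
      using blinfun.scaleR_right[of "D x" h 1] by simp
  qed
  ultimately show "(\<phi> has_real_derivative blinfun_apply (D x) 1) (at x)"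
    by (simp only: has_field_derivative_def)
  show "continuous_on UNIV (\<lambda>x. blinfun_apply (D x) 1)" by (rule test_function_continuous(2)[OF assms])
  obtain K where K: "compact K" "\<And>z. z \<notin> K \<Longrightarrow> \<phi> z = 0" using test_function_support[OF assms] by metis
  obtain N where "\<And>z. z \<in> K \<Longrightarrow> norm z \<le> N" using K(1) compact_imp_bounded bounded_iff by metis
  then have "\<phi> x = 0" if "N < \<bar>x\<bar>" for x using K(2)[of x] that by force
  then show "\<exists>N. \<forall>x. N < \<bar>x\<bar> \<longrightarrow> \<phi> x = 0" by blast
qed

lemma test_function_tensor:
  assumes a: "C1_compact a a'" and b: "C1_compact b b'"
  obtains D where "test_function (\<lambda>z::real \<times> real. a (fst z) * b (snd z)) D"
    "\<And>z. blinfun_apply (D z) (1, 0) = a' (fst z) * b (snd z)"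
proof -
  define D :: "real \<times> real \<Rightarrow> (real \<times> real) \<Rightarrow>\<^sub>L real"
    where "D z = (a' (fst z) * b (snd z)) *\<^sub>R fst_blinfun + (a (fst z) * b' (snd z)) *\<^sub>R snd_blinfun" for z
  have D: "blinfun_apply (D z) h = (a' (fst z) * b (snd z)) * fst h + (a (fst z) * b' (snd z)) * snd h" for z h
    by (simp add: D_def blinfun.bilinear_simps)
  obtain N where N: "\<And>x. N < \<bar>x\<bar> \<Longrightarrow> a x = 0" using C1_compact_support[OF a] by metis
  obtain M where M: "\<And>x. M < \<bar>x\<bar> \<Longrightarrow> b x = 0" using C1_compact_support[OF b] by metis
  have "test_function (\<lambda>z. a (fst z) * b (snd z)) D"
    unfolding test_function_def
  proof (intro conjI allI)
    fix z :: "real \<times> real"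
    have "((\<lambda>z. a (fst z)) has_derivative (\<lambda>h. a' (fst z) * fst h)) (at z)"
      using has_derivative_compose[OF bounded_linear_imp_has_derivative[OF bounded_linear_fst], of a "(*) (a' (fst z))" z] a
      unfolding C1_compact_def has_field_derivative_def by simp
    moreover have "((\<lambda>z. b (snd z)) has_derivative (\<lambda>h. b' (snd z) * snd h)) (at z)"
      using has_derivative_compose[OF bounded_linear_imp_has_derivative[OF bounded_linear_snd], of b "(*) (b' (snd z))" z] b
      unfolding C1_compact_def has_field_derivative_def by simp
    ultimately show "((\<lambda>z. a (fst z) * b (snd z)) has_derivative blinfun_apply (D z)) (at z)"
      unfolding D[abs_def] by (auto intro!: derivative_eq_intros)
    have "continuous_on UNIV (\<lambda>z::real\<times>real. a (fst z))" "continuous_on UNIV (\<lambda>z::real\<times>real. a' (fst z))"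
      "continuous_on UNIV (\<lambda>z::real\<times>real. b (snd z))" "continuous_on UNIV (\<lambda>z::real\<times>real. b' (snd z))"
      by (rule continuous_on_compose2[OF C1_compact_continuous(1)[OF a] continuous_on_fst[OF continuous_on_id] subset_UNIV]
          continuous_on_compose2[OF C1_compact_continuous(2)[OF a] continuous_on_fst[OF continuous_on_id] subset_UNIV]
          continuous_on_compose2[OF C1_compact_continuous(1)[OF b] continuous_on_snd[OF continuous_on_id] subset_UNIV]
          continuous_on_compose2[OF C1_compact_continuous(2)[OF b] continuous_on_snd[OF continuous_on_id] subset_UNIV])+
    then show "continuous_on UNIV D" unfolding D_def[abs_def] by (intro continuous_intros)
    show "\<exists>K. compact K \<and> (\<forall>z. z \<notin> K \<longrightarrow> a (fst z) * b (snd z) = 0)"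
    proof (intro exI conjI allI impI)
      show "compact ({-N..N} \<times> {-M..M})" by (intro compact_Times) auto
      fix z :: "real \<times> real" assume "z \<notin> {-N..N} \<times> {-M..M}"
      then show "a (fst z) * b (snd z) = 0" using N[of "fst z"] M[of "snd z"] by (cases z) (force simp: not_le)
    qed
  qed
  then show ?thesis using that[of D] D by simp
qed

lemma has_weak_partial_locally_integrable:
  "has_weak_partial b f g \<Longrightarrow> locally_integrable f" "has_weak_partial b f g \<Longrightarrow> locally_integrable g"
  by (auto simp: has_weak_partial_def)

lemma locally_integrable_measurable: "locally_integrable f \<Longrightarrow> f \<in> borel_measurable borel"
  by (simp add: locally_integrable_def)

lemma locally_integrable_diff:
  assumes "locally_integrable f" "locally_integrable g"
  shows "locally_integrable (\<lambda>z. f z - g z)"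
  using assms unfolding locally_integrable_def by (auto intro!: set_integral_diff)

lemma has_weak_partial_unique:
  fixes f g g' :: "real \<times> real \<Rightarrow> complex"
  assumes g: "has_weak_partial b f g" and g': "has_weak_partial b f g'"
  shows "AE z in lborel. g z = g' z"
proof -
  have "AE z in lborel. g z - g' z = 0"
  proof (rule zero_if_tensor_tests_vanish)
    note li = has_weak_partial_locally_integrable(2)[OF g] has_weak_partial_locally_integrable(2)[OF g']
    show "locally_integrable (\<lambda>z. g z - g' z)" by (intro locally_integrable_diff li)
    fix a a' c c' assume a: "C1_compact a a'" and c: "C1_compact c c'"
    obtain D where D: "test_function (\<lambda>z::real \<times> real. a (fst z) * c (snd z)) D" using test_function_tensor[OF a c] by metis
    have "(LINT z|lborel. (a (fst z) * c (snd z)) *\<^sub>R (g z - g' z)) = (LINT z|lborel. (a (fst z) * c (snd z)) *\<^sub>R g z) - (LINT z|lborel. (a (fst z) * c (snd z)) *\<^sub>R g' z)"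
      unfolding scaleR_diff_right by (intro Bochner_Integration.integral_diff test_function_integrable(1)[OF D] li)
    also have "\<dots> = 0"
    proof -
      have "(LINT z|lborel. blinfun_apply (D z) b *\<^sub>R f z) = - (LINT z|lborel. (a (fst z) * c (snd z)) *\<^sub>R g z)"
        using g D unfolding has_weak_partial_def by blast
      moreover have "(LINT z|lborel. blinfun_apply (D z) b *\<^sub>R f z) = - (LINT z|lborel. (a (fst z) * c (snd z)) *\<^sub>R g' z)"
        using g' D unfolding has_weak_partial_def by blast
      ultimately show ?thesis by simp
    qed
    finally show "(LINT z|lborel. (a (fst z) * c (snd z)) *\<^sub>R (g z - g' z)) = 0" .
  qed
  then show ?thesis by eventually_elim simp
qed

lemma weak_partial_eq:
  fixes f g :: "real \<times> real \<Rightarrow> complex"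
  assumes "has_weak_partial b f g"
  shows "has_weak_partial b f (weak_partial b f)" "AE z in lborel. weak_partial b f z = g z"
proof -
  show 1: "has_weak_partial b f (weak_partial b f)" unfolding weak_partial_def by (rule someI[where P = "has_weak_partial b f", OF assms])
  show "AE z in lborel. weak_partial b f z = g z" by (rule has_weak_partial_unique[OF 1 assms])
qed

lemma locally_integrable_slice:
  fixes g :: "real \<times> real \<Rightarrow> complex"
  assumes g: "locally_integrable g"
  shows "AE y in lborel. \<forall>a b. set_integrable lborel {a..b} (\<lambda>x. g (x, y))"
proof -
  have "AE y in lborel. y \<in> {- real n..real n} \<longrightarrow> set_integrable lborel {- real n..real n} (\<lambda>x. g (x, y))" for n :: nat
  proof -
    have "integrable lborel (\<lambda>z. indicator ({- real n..real n} \<times> {- real n..real n}) z *\<^sub>R g z)"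
      using g unfolding locally_integrable_def set_integrable_def by (auto intro: compact_Times)
    from plane_AE_integrable_x[OF this] show ?thesis
    proof eventually_elim
      case (elim y)
      then show ?case by (auto simp: set_integrable_def indicator_times)
    qed
  qed
  then have "AE y in lborel. \<forall>n::nat. y \<in> {- real n..real n} \<longrightarrow> set_integrable lborel {- real n..real n} (\<lambda>x. g (x, y))"
    by (intro AE_all_countable[THEN iffD2] allI)
  then show ?thesis
  proof eventually_elim
    case (elim y)
    show ?case
    proof (intro allI)
      fix a b :: real
      obtain n :: nat where n: "\<bar>y\<bar> + \<bar>a\<bar> + \<bar>b\<bar> < real n" using reals_Archimedean2 by blast
      have "y \<in> {- real n..real n}" using n by (simp add: abs_if split: if_splits)
      then have "set_integrable lborel {- real n..real n} (\<lambda>x. g (x, y))" using elim by blast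
      then show "set_integrable lborel {a..b} (\<lambda>x. g (x, y))"
        by (rule set_integrable_subset) (use n in auto)
    qed
  qed
qed

lemma borel_measurable_slice:
  assumes [measurable]: "g \<in> borel_measurable (borel :: (real \<times> real) measure)"
  shows "(\<lambda>x. g (x, y)) \<in> borel_measurable borel" "(\<lambda>x. g (y, x)) \<in> borel_measurable borel"
  by measurable

text \<open>Fubini reduces the identity to integration by parts on almost every horizontal line,
  where a test function restricts to a one-dimensional test function.\<close>

theorem weak_partial_x_if_ac:
  fixes f g :: "real \<times> real \<Rightarrow> complex"
  assumes f: "locally_integrable f" and g: "locally_integrable g"
    and ac: "AE y in lborel. \<exists>v. has_ac_derivative v (\<lambda>x. g (x, y)) \<and> (AE x in lborel. f (x, y) = v x)"
  shows "has_weak_partial (1, 0) f g"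
  unfolding has_weak_partial_def
proof (intro conjI allI impI f g)
  note [measurable] = locally_integrable_measurable[OF f] locally_integrable_measurable[OF g]
  fix \<phi> :: "real \<times> real \<Rightarrow> real" and D assume t: "test_function \<phi> D"
  note i = test_function_integrable[OF t]
  have "(LINT z|lborel. blinfun_apply (D z) (1, 0) *\<^sub>R f z) = (LINT y|lborel. LINT x|lborel. blinfun_apply (D (x, y)) (1, 0) *\<^sub>R f (x, y))"
    by (rule plane_integral_x[OF i(2)[OF f], symmetric])
  also have "\<dots> = (LINT y|lborel. - (LINT x|lborel. \<phi> (x, y) *\<^sub>R g (x, y)))"
  proof (rule integral_cong_AE)
    show "(\<lambda>y. LINT x|lborel. blinfun_apply (D (x, y)) (1, 0) *\<^sub>R f (x, y)) \<in> borel_measurable lborel"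
      by (rule borel_measurable_integrable[OF plane_integrable_x[OF i(2)[OF f]]])
    show "(\<lambda>y. - (LINT x|lborel. \<phi> (x, y) *\<^sub>R g (x, y))) \<in> borel_measurable lborel"
      by (intro borel_measurable_uminus borel_measurable_integrable[OF plane_integrable_x[OF i(1)[OF g]]])
    from ac show "AE y in lborel. (LINT x|lborel. blinfun_apply (D (x, y)) (1, 0) *\<^sub>R f (x, y)) = - (LINT x|lborel. \<phi> (x, y) *\<^sub>R g (x, y))"
    proof eventually_elim
      case (elim y)
      then obtain v where v: "has_ac_derivative v (\<lambda>x. g (x, y))" "AE x in lborel. f (x, y) = v x" by blast
      note s = test_function_slice[OF t, of y]
      note [measurable] = C1_compact_measurable[OF s] ac_measurable_self[OF v(1)]
      have "(LINT x|lborel. blinfun_apply (D (x, y)) (1, 0) *\<^sub>R f (x, y)) = (LINT x|lborel. blinfun_apply (D (x, y)) (1, 0) *\<^sub>R v x)"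
        by (rule integral_cong_AE) (use v(2) in \<open>auto\<close>)
      then show ?case using integration_by_parts_C1_compact(3)[OF s v(1)] by simp
    qed
  qed
  also have "\<dots> = - (LINT z|lborel. \<phi> z *\<^sub>R g z)" using plane_integral_x[OF i(1)[OF g]] by simp
  finally show "(LINT z|lborel. blinfun_apply (D z) (1, 0) *\<^sub>R f z) = - (LINT z|lborel. \<phi> z *\<^sub>R g z)" .
qed

text \<open>Signed kernel of the primitive that starts at 0. It writes the primitive as an integral
  over a fixed space, so that its joint measurability in both variables is automatic.\<close>

definition primitive_kernel :: "real \<Rightarrow> real \<Rightarrow> real" where
  "primitive_kernel x s = (if 0 \<le> s \<and> s \<le> x then 1 else if x \<le> s \<and> s \<le> 0 then -1 else 0)"

lemma primitive_kernel_ac: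
  fixes g :: "real \<Rightarrow> complex"
  assumes [measurable]: "g \<in> borel_measurable borel" and i: "\<And>a b. set_integrable lborel {a..b} g"
  shows "has_ac_derivative (\<lambda>x. LINT s|lborel. primitive_kernel x s *\<^sub>R g s) g"
proof -
  obtain v where v: "has_ac_derivative v g" "v 0 = 0" using ac_primitive[OF assms] by blast
  have "(LINT s|lborel. primitive_kernel x s *\<^sub>R g s) = v x" for x
  proof (cases "x \<ge> 0")
    case True
    have "(LINT s|lborel. primitive_kernel x s *\<^sub>R g s) = (LINT s:{0..x}|lborel. g s)"
      unfolding set_lebesgue_integral_def using True
      by (intro Bochner_Integration.integral_cong) (auto simp: primitive_kernel_def)
    then show ?thesis using ac_diff[OF v(1) True] v(2) by simp
  next
    case False
    have "(LINT s|lborel. primitive_kernel x s *\<^sub>R g s) = (LINT s|lborel. - (indicator {x..0} s *\<^sub>R g s))"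
      using False by (intro Bochner_Integration.integral_cong) (auto simp: primitive_kernel_def)
    also have "\<dots> = - (LINT s:{x..0}|lborel. g s)" unfolding set_lebesgue_integral_def by simp
    finally have "(LINT s|lborel. primitive_kernel x s *\<^sub>R g s) = - (v 0 - v x)" using ac_diff[OF v(1), of x 0] False by simp
    then show ?thesis by (simp add: v(2))
  qed
  then show ?thesis using v(1) by simp
qed

lemma locally_integrable_if_cutoffs:
  fixes h :: "real \<times> real \<Rightarrow> complex"
  assumes [measurable]: "h \<in> borel_measurable borel"
    and i: "\<And>n::nat. integrable lborel (\<lambda>z. indicator ({- real n..real n} \<times> {- real n..real n}) z *\<^sub>R h z)"
  shows "locally_integrable h"
  unfolding locally_integrable_def
proof (intro conjI allI impI)
  fix K :: "(real \<times> real) set" assume K: "compact K"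
  obtain N where N: "\<And>z. z \<in> K \<Longrightarrow> norm z \<le> N" using K compact_imp_bounded bounded_iff by metis
  obtain n :: nat where n: "N < real n" using reals_Archimedean2 by blast
  have "K \<subseteq> {- real n..real n} \<times> {- real n..real n}"
  proof
    fix z assume "z \<in> K"
    then have "norm z \<le> N" by (rule N)
    moreover have "\<bar>fst z\<bar> \<le> norm z" "\<bar>snd z\<bar> \<le> norm z"
      using norm_fst_le[of "fst z" "snd z"] norm_snd_le[of "snd z" "fst z"] by auto
    ultimately show "z \<in> {- real n..real n} \<times> {- real n..real n}" using n by (cases z) auto
  qed
  moreover have "set_integrable lborel ({- real n..real n} \<times> {- real n..real n}) h"
    using i[of n] by (simp add: set_integrable_def)
  ultimately show "set_integrable lborel K h"
    using borel_compact[OF K] by (intro set_integrable_subset[of lborel "{- real n..real n} \<times> {- real n..real n}" h K]) auto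
qed simp

lemma AE_snd:
  assumes "AE y in lborel. Q y"
  shows "AE z in lborel. Q (snd (z :: real \<times> real))"
proof -
  obtain N where N: "{y. \<not> Q y} \<subseteq> N" "N \<in> sets lborel" "emeasure lborel N = 0"
    using assms by (auto elim!: AE_E)
  have "emeasure (lborel \<Otimes>\<^sub>M lborel) ((UNIV :: real set) \<times> N) = 0"
    using N by (subst lborel.emeasure_pair_measure_Times) auto
  then have "(UNIV :: real set) \<times> N \<in> null_sets lborel" using N
    by (intro null_setsI) (auto simp: lborel_prod borel_Times)
  then show ?thesis by (rule AE_I') (use N(1) in \<open>auto\<close>)
qed

lemma AE_fst:
  assumes "AE x in lborel. Q x"
  shows "AE z in lborel. Q (fst (z :: real \<times> real))"
  using plane_AE_swap[OF AE_snd[OF assms]] by simp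

lemma zero_mean_antiderivative:
  assumes c: "continuous_on UNIV \<alpha>" and N: "\<And>x. N < \<bar>x\<bar> \<Longrightarrow> \<alpha> x = 0" and z: "(LINT x|lborel. \<alpha> x) = (0::real)"
  obtains a where "C1_compact a \<alpha>"
proof -
  have "\<exists>H. \<forall>x::real. (-\<infinity>::ereal) < ereal x \<longrightarrow> ereal x < \<infinity> \<longrightarrow> (H has_vector_derivative \<alpha> x) (at x)"
    by (rule einterval_antiderivative) (use c in \<open>auto simp: continuous_on_eq_continuous_at\<close>)
  then obtain A where A: "\<And>x. (A has_vector_derivative \<alpha> x) (at x)" by auto
  have ac: "has_ac_derivative A \<alpha>" by (rule ac_C1[OF A c])
  define M where "M = max N 0 + 1"
  define a where "a x = A x - A (- M)" for x
  have "a x = 0" if x: "M < \<bar>x\<bar>" for x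
  proof (cases "x > 0")
    case True
    have "a x = (LINT s:{-M..x}|lborel. \<alpha> s)" unfolding a_def using ac_diff[OF ac, of "-M" x] x True by (simp add: M_def)
    also have "\<dots> = (LINT s|lborel. \<alpha> s)" unfolding set_lebesgue_integral_def
    proof (rule Bochner_Integration.integral_cong)
      show "indicator {-M..x} s *\<^sub>R \<alpha> s = \<alpha> s" for s using N[of s] x True by (cases "N < \<bar>s\<bar>") (auto simp: indicator_def M_def)
    qed simp
    finally show ?thesis using z by simp
  next
    case False
    have "- a x = (LINT s:{x..-M}|lborel. \<alpha> s)" unfolding a_def using ac_diff[OF ac, of x "-M"] x False by simp
    also have "\<dots> = (LINT s:{x..-M}|lborel. 0)"
    proof (rule set_lebesgue_integral_cong)
      show "\<forall>s. s \<in> {x..- M} \<longrightarrow> \<alpha> s = 0" using N by (auto simp: M_def)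
    qed simp
    finally show ?thesis by simp
  qed
  then have "C1_compact a \<alpha>" unfolding C1_compact_def a_def[abs_def] using A c
    by (auto simp: has_real_derivative_iff_has_vector_derivative intro!: derivative_eq_intros exI[of _ M])
  then show ?thesis using that by blast
qed

lemma unit_bump_exists:
  obtains a a' where "C1_compact a a'" "(LINT x|lborel. a x) = 1"
proof -
  obtain b b' where b: "\<And>n. C1_compact (b n) (b' n)" "\<And>n x. 0 \<le> b n x" "\<And>n x. b n x \<le> 1"
    "\<And>n x. x \<notin> {0..1} \<Longrightarrow> b n x = 0" "\<And>x. (\<lambda>n. b n x) \<longlonglongrightarrow> indicator {0<..<1::real} x"
    using C1_bump_sequence[of 0 1] by metis
  note [measurable] = C1_compact_measurable[OF b(1)]
  have "(\<lambda>n. LINT x|lborel. b n x) \<longlonglongrightarrow> (LINT x|lborel. indicator {0<..<1::real} x)"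
  proof (rule integral_dominated_convergence[where w = "indicator {0..1}"])
    show "AE x in lborel. norm (b n x) \<le> indicator {0..1} x" for n
      using b(2,3,4) by (intro AE_I2) (auto simp: indicator_def)
  qed (use b(5) in auto)
  then have "(\<lambda>n. LINT x|lborel. b n x) \<longlonglongrightarrow> 1" by simp
  then have "eventually (\<lambda>n. (LINT x|lborel. b n x) > 0) sequentially" by (rule order_tendstoD) simp
  then obtain n where n: "(LINT x|lborel. b n x) > 0" using eventually_happens by force
  define I where "I = (LINT x|lborel. b n x)"
  have "C1_compact (\<lambda>x. b n x / I) (\<lambda>x. b' n x / I)"
    using b(1)[of n] n unfolding C1_compact_def I_def by (auto intro!: derivative_eq_intros continuous_intros)
  moreover have "(LINT x|lborel. b n x / I) = 1" using n by (simp add: I_def)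
  ultimately show ?thesis using that by blast
qed

text \<open>The argument of du Bois-Reymond with a parameter. The primitive \<open>G\<close> of
  \<open>g\<close> along lines has the same weak derivative as \<open>f\<close>, so
  \<open>f - G\<close> has weak derivative 0 and must be a function \<open>F\<close> of the second
  variable alone. On almost every line \<open>F y + G\<close> is then the required
  representative.\<close>

theorem weak_partial_x_imp_ac:
  fixes f g :: "real \<times> real \<Rightarrow> complex"
  assumes w: "has_weak_partial (1, 0) f g"
  shows "AE y in lborel. \<exists>v. has_ac_derivative v (\<lambda>x. g (x, y)) \<and> (AE x in lborel. f (x, y) = v x)"
proof -
  note fli = has_weak_partial_locally_integrable(1)[OF w] and gli = has_weak_partial_locally_integrable(2)[OF w]
  note [measurable] = locally_integrable_measurable[OF fli] locally_integrable_measurable[OF gli]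
  define G where "G z = (LINT s|lborel. primitive_kernel (fst z) s *\<^sub>R g (s, snd z))" for z :: "real \<times> real"
  have Gm[measurable]: "G \<in> borel_measurable borel"
  proof -
    have "(\<lambda>z. LINT s|lborel. primitive_kernel (fst z) s *\<^sub>R g (s, snd z)) \<in> borel_measurable (borel :: (real \<times> real) measure)"
      unfolding primitive_kernel_def by measurable
    then show ?thesis unfolding G_def[abs_def] .
  qed
  have slice: "AE y in lborel. \<forall>a b. set_integrable lborel {a..b} (\<lambda>x. g (x, y))" by (rule locally_integrable_slice[OF gli])
  have Gac: "AE y in lborel. has_ac_derivative (\<lambda>x. G (x, y)) (\<lambda>x. g (x, y))"
    using slice
  proof eventually_elim
    case (elim y)
    show ?case unfolding G_def fst_conv snd_conv
      by (rule primitive_kernel_ac) (use elim borel_measurable_slice[OF locally_integrable_measurable[OF gli]] in auto)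
  qed
  \<comment> \<open>On a square the primitive is bounded by the integral of the norm of
    \<open>g\<close> along the whole side, a function of the second variable that is integrable by
    Fubini.\<close>
  have Gli: "locally_integrable G"
  proof (rule locally_integrable_if_cutoffs[OF Gm])
    fix n :: nat
    define Qn where "Qn = {- real n..real n} \<times> {- real n..real n}"
    have [measurable]: "{- real n..real n} \<times> {- real n..real n} \<in> sets borel"
      by (intro borel_closed closed_Times closed_real_atLeastAtMost)
    have gQ: "integrable lborel (\<lambda>z. norm (indicator Qn z *\<^sub>R g z))"
      using gli unfolding locally_integrable_def set_integrable_def Qn_def by (intro integrable_norm) (auto intro: compact_Times)
    define B where "B y = (LINT x|lborel. norm (indicator Qn (x, y) *\<^sub>R g (x, y)))" for y
    have B: "integrable lborel B" unfolding B_def[abs_def] by (rule plane_integrable_x[OF gQ])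
    have "integrable lborel (\<lambda>z::real \<times> real. indicator {- real n..real n} (fst z) *\<^sub>R B (snd z))"
      by (rule integrable_tensor[OF _ B]) auto
    then show "integrable lborel (\<lambda>z. indicator ({- real n..real n} \<times> {- real n..real n}) z *\<^sub>R G z)"
    proof (rule Bochner_Integration.integrable_bound)
      have B0: "B y \<ge> 0" for y unfolding B_def by (intro Bochner_Integration.integral_nonneg) simp
      from AE_snd[OF plane_AE_integrable_x[OF gQ]]
      show "AE z in lborel. norm (indicator ({- real n..real n} \<times> {- real n..real n}) z *\<^sub>R G z) \<le> norm (indicator {- real n..real n} (fst z) *\<^sub>R B (snd z))"
      proof eventually_elim
        case (elim z)
        show ?case
        proof (cases "z \<in> Qn")
          case True
          have "norm (G z) \<le> (LINT s|lborel. norm (primitive_kernel (fst z) s *\<^sub>R g (s, snd z)))"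
            unfolding G_def by (rule integral_norm_bound)
          also have "\<dots> \<le> B (snd z)" unfolding B_def
            using True by (intro integral_mono'[OF elim]) (auto simp: Qn_def primitive_kernel_def indicator_def)
          finally show ?thesis using True B0[of "snd z"] by (auto simp: Qn_def indicator_def)
        qed (simp add: Qn_def)
      qed
    qed simp
  qed
  have "has_weak_partial (1, 0) G g"
    by (rule weak_partial_x_if_ac[OF Gli gli]) (use Gac in \<open>eventually_elim, auto\<close>)
  then have kz: "(LINT z|lborel. (a' (fst z) * b (snd z)) *\<^sub>R (f z - G z)) = 0" if a: "C1_compact a a'" and b: "C1_compact b b'" for a a' b b'
  proof -
    obtain D where D: "test_function (\<lambda>z::real \<times> real. a (fst z) * b (snd z)) D" "\<And>z. blinfun_apply (D z) (1, 0) = a' (fst z) * b (snd z)"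
      using test_function_tensor[OF a b] by metis
    have "(LINT z|lborel. (a' (fst z) * b (snd z)) *\<^sub>R (f z - G z)) = (LINT z|lborel. blinfun_apply (D z) (1, 0) *\<^sub>R f z) - (LINT z|lborel. blinfun_apply (D z) (1, 0) *\<^sub>R G z)"
      unfolding scaleR_diff_right D(2)[symmetric] by (intro Bochner_Integration.integral_diff test_function_integrable(2)[OF D(1)] fli Gli)
    moreover have "(LINT z|lborel. blinfun_apply (D z) (1, 0) *\<^sub>R f z) = - (LINT z|lborel. (a (fst z) * b (snd z)) *\<^sub>R g z)"
      using w D(1) unfolding has_weak_partial_def by blast
    moreover have "(LINT z|lborel. blinfun_apply (D z) (1, 0) *\<^sub>R G z) = - (LINT z|lborel. (a (fst z) * b (snd z)) *\<^sub>R g z)"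
      using \<open>has_weak_partial (1, 0) G g\<close> D(1) unfolding has_weak_partial_def by blast
    ultimately show ?thesis by simp
  qed
  define k where "k z = f z - G z" for z
  have kli: "locally_integrable k" unfolding k_def[abs_def] by (rule locally_integrable_diff[OF fli Gli])
  note [measurable] = locally_integrable_measurable[OF kli]
  obtain \<alpha> \<alpha>' where al: "C1_compact \<alpha> \<alpha>'" "(LINT x|lborel. \<alpha> x) = 1" by (rule unit_bump_exists)
  note [measurable] = C1_compact_measurable[OF al(1)]
  \<comment> \<open>If \<open>k\<close> is constant along the line at height \<open>y\<close>,
    averaging against a bump of integral 1 returns that constant.\<close>
  define F where "F y = (LINT x|lborel. \<alpha> x *\<^sub>R k (x, y))" for y
  have Fm[measurable]: "F \<in> borel_measurable borel" unfolding F_def[abs_def] by measurable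
  have tens: "integrable lborel (\<lambda>z. (a (fst z) * b (snd z)) *\<^sub>R k z)" if a: "C1_compact a a'" and b: "C1_compact b b'" for a a' b b'
  proof -
    obtain N where N: "\<And>x. N < \<bar>x\<bar> \<Longrightarrow> a x = 0" using C1_compact_support[OF a] by metis
    obtain M where M: "\<And>x. M < \<bar>x\<bar> \<Longrightarrow> b x = 0" using C1_compact_support[OF b] by metis
    show ?thesis by (rule tensor_cutoff[OF C1_compact_continuous(1)[OF a] N C1_compact_continuous(1)[OF b] M kli])
  qed
  have Fli: "locally_integrable (\<lambda>z::real \<times> real. F (snd z))"
  proof (rule locally_integrable_if_cutoffs)
    fix n :: nat
    obtain N where N: "\<And>x. N < \<bar>x\<bar> \<Longrightarrow> \<alpha> x = 0" using C1_compact_support[OF al(1)] by metis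
    obtain C where C: "C \<ge> 0" "\<And>x. \<bar>\<alpha> x\<bar> \<le> C"
      using continuous_compact_support_bounded[OF C1_compact_continuous(1)[OF al(1)] N] by metis
    have "integrable lborel (\<lambda>z. (\<alpha> (fst z) * indicator {- real n..real n} (snd z)) *\<^sub>R k z)"
    proof (rule integrable_cutoff[OF kli, where C = C and K = "{-N..N} \<times> {- real n..real n}"])
      show "\<bar>\<alpha> (fst z) * indicator {- real n..real n} (snd z)\<bar> \<le> C" for z
        using C by (auto simp: indicator_def)
      show "\<alpha> (fst z) * indicator {- real n..real n} (snd z) = 0" if "z \<notin> {-N..N} \<times> {- real n..real n}" for z
        using that N[of "fst z"] by (cases z) (force simp: not_le indicator_def)
    qed (auto intro: compact_Times)
    from plane_integrable_x[OF this]
    have "integrable lborel (\<lambda>y. LINT x|lborel. indicator {- real n..real n} y *\<^sub>R (\<alpha> x *\<^sub>R k (x, y)))"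
      by (simp add: mult.commute)
    then have "integrable lborel (\<lambda>y. indicator {- real n..real n} y *\<^sub>R F y)"
      unfolding F_def integral_scaleR_right .
    then have "integrable lborel (\<lambda>z::real \<times> real. indicator {- real n..real n} (fst z) *\<^sub>R (indicator {- real n..real n} (snd z) *\<^sub>R F (snd z)))"
      by (intro integrable_tensor) auto
    then show "integrable lborel (\<lambda>z. indicator ({- real n..real n} \<times> {- real n..real n}) z *\<^sub>R F (snd z))"
      by (simp add: indicator_times case_prod_unfold)
  qed simp
  have "AE z in lborel. k z - F (snd z) = 0"
  proof (rule zero_if_tensor_tests_vanish)
    show "locally_integrable (\<lambda>z. k z - F (snd z))" by (rule locally_integrable_diff[OF kli Fli])
    fix a a' b b' assume a: "C1_compact a a'" and b: "C1_compact b b'"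
    define c where "c = (LINT x|lborel. a x)"
    have "continuous_on UNIV (\<lambda>x. a x - c * \<alpha> x)" by (intro continuous_intros C1_compact_continuous[OF a] C1_compact_continuous[OF al(1)])
    moreover obtain N where N: "\<And>x. N < \<bar>x\<bar> \<Longrightarrow> a x = 0" using C1_compact_support[OF a] by metis
    moreover obtain N' where N': "\<And>x. N' < \<bar>x\<bar> \<Longrightarrow> \<alpha> x = 0" using C1_compact_support[OF al(1)] by metis
    moreover have "(LINT x|lborel. a x - c * \<alpha> x) = 0"
      using C1_compact_integrable[OF a] C1_compact_integrable[OF al(1)] al(2) by (simp add: c_def)
    \<comment> \<open>Subtracting the right multiple of the bump leaves mean zero, so the difference
      is the derivative of a compactly supported function and pairs to zero with
      \<open>k\<close>.\<close>
    ultimately obtain A where A: "C1_compact A (\<lambda>x. a x - c * \<alpha> x)"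
      using zero_mean_antiderivative[of "\<lambda>x. a x - c * \<alpha> x" "max N N'"] by auto
    have "(LINT z|lborel. ((a (fst z) - c * \<alpha> (fst z)) * b (snd z)) *\<^sub>R k z) = 0" unfolding k_def by (rule kz[OF A b])
    moreover have "(LINT z|lborel. ((a (fst z) - c * \<alpha> (fst z)) * b (snd z)) *\<^sub>R k z) =
        (LINT z|lborel. (a (fst z) * b (snd z)) *\<^sub>R k z - c *\<^sub>R ((\<alpha> (fst z) * b (snd z)) *\<^sub>R k z))"
      by (intro Bochner_Integration.integral_cong) (simp_all add: algebra_simps)
    moreover have "\<dots> = (LINT z|lborel. (a (fst z) * b (snd z)) *\<^sub>R k z) - c *\<^sub>R (LINT z|lborel. (\<alpha> (fst z) * b (snd z)) *\<^sub>R k z)"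
      using Bochner_Integration.integral_diff[OF tens[OF a b] integrable_scaleR_right[OF tens[OF al(1) b], of c]]
      by (simp only: integral_scaleR_right)
    ultimately have 1: "(LINT z|lborel. (a (fst z) * b (snd z)) *\<^sub>R k z) = c *\<^sub>R (LINT z|lborel. (\<alpha> (fst z) * b (snd z)) *\<^sub>R k z)" by simp
    have "(LINT z|lborel. (\<alpha> (fst z) * b (snd z)) *\<^sub>R k z) = (LINT y|lborel. LINT x|lborel. b y *\<^sub>R (\<alpha> x *\<^sub>R k (x, y)))"
      using plane_integral_x[OF tens[OF al(1) b]] by (simp add: mult.commute)
    also have "\<dots> = (LINT y|lborel. b y *\<^sub>R F y)" unfolding integral_scaleR_right F_def ..
    finally have 2: "(LINT z|lborel. (\<alpha> (fst z) * b (snd z)) *\<^sub>R k z) = (LINT y|lborel. b y *\<^sub>R F y)" .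
    have bF: "integrable lborel (\<lambda>y. b y *\<^sub>R F y)"
    proof -
      have "integrable lborel (\<lambda>y. LINT x|lborel. b y *\<^sub>R (\<alpha> x *\<^sub>R k (x, y)))"
        using plane_integrable_x[OF tens[OF al(1) b]] by (simp add: mult.commute)
      then show ?thesis unfolding integral_scaleR_right F_def .
    qed
    have iT: "integrable lborel (\<lambda>z. a (fst z) *\<^sub>R (b (snd z) *\<^sub>R F (snd z)))"
      by (rule integrable_tensor[OF C1_compact_integrable(1)[OF a] bF])
    have "(LINT z|lborel. a (fst z) *\<^sub>R (b (snd z) *\<^sub>R F (snd z))) = (LINT y|lborel. LINT x|lborel. a x *\<^sub>R (b y *\<^sub>R F y))"
      using plane_integral_x[OF iT] by simp
    also have "\<dots> = (LINT y|lborel. c *\<^sub>R (b y *\<^sub>R F y))"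
      unfolding c_def using C1_compact_integrable(1)[OF a] by (subst integral_scaleR_left) auto
    also have "\<dots> = c *\<^sub>R (LINT y|lborel. b y *\<^sub>R F y)" by (simp only: integral_scaleR_right)
    finally have 3: "(LINT z|lborel. (a (fst z) * b (snd z)) *\<^sub>R F (snd z)) = c *\<^sub>R (LINT y|lborel. b y *\<^sub>R F y)" by simp
    have "(LINT z|lborel. (a (fst z) * b (snd z)) *\<^sub>R (k z - F (snd z))) = (LINT z|lborel. (a (fst z) * b (snd z)) *\<^sub>R k z) - (LINT z|lborel. (a (fst z) * b (snd z)) *\<^sub>R F (snd z))"
      unfolding scaleR_diff_right using tens[OF a b] iT by (intro Bochner_Integration.integral_diff) auto
    then show "(LINT z|lborel. (a (fst z) * b (snd z)) *\<^sub>R (k z - F (snd z))) = 0" using 1 2 3 by simp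
  qed
  then have "AE y in lborel. AE x in lborel. k (x, y) - F (snd (x, y)) = 0" by (rule plane_AE_x)
  with Gac show ?thesis
  proof eventually_elim
    case (elim y)
    have "has_ac_derivative (\<lambda>x. F y + G (x, y)) (\<lambda>x. 0 + g (x, y))" by (intro ac_add ac_const elim(1))
    moreover have "AE x in lborel. f (x, y) = F y + G (x, y)"
      using elim(2) by eventually_elim (simp add: k_def algebra_simps)
    ultimately show ?case by (intro exI[of _ "\<lambda>x. F y + G (x, y)"]) simp
  qed
qed

section \<open>Linear changes of variables\<close>

text \<open>Here \<open>c\<close> is the absolute determinant of \<open>L\<close>, encoded by the
  change-of-variables formula, and \<open>M\<close> is the inverse of \<open>L\<close>. Test
  functions are transported by \<open>M\<close>, and \<open>c\<close> cancels. The instances are the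
  exchange of coordinates and the stretching of y.\<close>

lemma has_weak_partial_compose_linear:
  fixes L M :: "'a::euclidean_space \<Rightarrow> 'a" and f g :: "'a \<Rightarrow> complex"
  assumes L: "bounded_linear L" and M: "bounded_linear M" and LM: "\<And>z. L (M z) = z" "\<And>z. M (L z) = z"
    and c: "c > 0" and lb: "lborel = density (distr lborel borel L) (\<lambda>_. ennreal c)"
    and w: "has_weak_partial (L b) f g"
  shows "has_weak_partial b (\<lambda>z. f (L z)) (\<lambda>z. g (L z))"
proof -
  have [measurable]: "L \<in> borel_measurable borel"
    by (intro borel_measurable_continuous_onI linear_continuous_on L)
  have int: "integrable lborel h \<longleftrightarrow> integrable lborel (\<lambda>z. h (L z))" "(LINT z|lborel. h z) = c *\<^sub>R (LINT z|lborel. h (L z))"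
    if [measurable]: "h \<in> borel_measurable borel" for h :: "'a \<Rightarrow> complex"
  proof -
    have "integrable lborel h \<longleftrightarrow> integrable (density (distr lborel borel L) (\<lambda>_. ennreal c)) h" using lb by simp
    also have "\<dots> \<longleftrightarrow> integrable lborel (\<lambda>z. c *\<^sub>R h (L z))"
      using c by (subst integrable_density) (auto simp: integrable_distr_eq)
    also have "\<dots> \<longleftrightarrow> integrable lborel (\<lambda>z. h (L z))"
      using c integrable_scaleR_right[of "1 / c" lborel "\<lambda>z. c *\<^sub>R h (L z)"] integrable_scaleR_right[of c lborel "\<lambda>z. h (L z)"]
      by auto
    finally show "integrable lborel h \<longleftrightarrow> integrable lborel (\<lambda>z. h (L z))" .
    have "(LINT z|lborel. h z) = (LINT z|density (distr lborel borel L) (\<lambda>_. ennreal c). h z)" using lb by simp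
    also have "\<dots> = c *\<^sub>R (LINT z|lborel. h (L z))"
      using c by (subst integral_density) (auto simp: integral_distr)
    finally show "(LINT z|lborel. h z) = c *\<^sub>R (LINT z|lborel. h (L z))" .
  qed
  have li: "locally_integrable (\<lambda>z. h (L z))" if h: "locally_integrable h" for h :: "'a \<Rightarrow> complex"
    unfolding locally_integrable_def
  proof (intro conjI allI impI)
    note [measurable] = locally_integrable_measurable[OF h]
    show "(\<lambda>z. h (L z)) \<in> borel_measurable borel" by measurable
    fix K :: "'a set" assume K: "compact K"
    have LK: "compact (L ` K)" by (intro compact_continuous_image linear_continuous_on L K)
    note [measurable] = borel_compact[OF LK]
    have "integrable lborel (\<lambda>z. indicator (L ` K) z *\<^sub>R h z)"
      using h LK unfolding locally_integrable_def set_integrable_def by blast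
    then have "integrable lborel (\<lambda>z. indicator (L ` K) (L z) *\<^sub>R h (L z))" by (subst (asm) int(1)) simp_all
    moreover have "indicator (L ` K) (L z) = (indicator K z :: real)" for z
      using LM(2) by (metis image_iff indicator_simps)
    ultimately show "set_integrable lborel K (\<lambda>z. h (L z))" unfolding set_integrable_def by simp
  qed
  show ?thesis
    unfolding has_weak_partial_def
  proof (intro conjI allI impI li has_weak_partial_locally_integrable[OF w])
    fix \<phi> :: "'a \<Rightarrow> real" and D assume t: "test_function \<phi> D"
    define D' where "D' z = D (M z) o\<^sub>L Blinfun M" for z
    have D': "blinfun_apply (D' z) h = blinfun_apply (D (M z)) (M h)" for z h
      by (simp add: D'_def bounded_linear_Blinfun_apply[OF M])
    have Mc: "continuous_on UNIV M" by (rule linear_continuous_on[OF M])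
    have t': "test_function (\<lambda>z. \<phi> (M z)) D'"
      unfolding test_function_def
    proof (intro conjI allI)
      fix z
      show "((\<lambda>z. \<phi> (M z)) has_derivative blinfun_apply (D' z)) (at z)"
        using has_derivative_compose[OF bounded_linear_imp_has_derivative[OF M], of \<phi> "blinfun_apply (D (M z))" z] t
        unfolding test_function_def D'[abs_def] by simp
      have "continuous_on UNIV (\<lambda>z. D (M z))"
        by (rule continuous_on_compose2[OF _ Mc subset_UNIV]) (use t in \<open>simp add: test_function_def\<close>)
      then show "continuous_on UNIV D'" unfolding D'_def[abs_def]
        by (intro bounded_bilinear.continuous_on[OF bounded_bilinear_blinfun_compose] continuous_on_const)
      obtain K where K: "compact K" "\<And>z. z \<notin> K \<Longrightarrow> \<phi> z = 0" using test_function_support[OF t] by metis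
      show "\<exists>K. compact K \<and> (\<forall>z. z \<notin> K \<longrightarrow> \<phi> (M z) = 0)"
      proof (intro exI conjI allI impI)
        show "compact (L ` K)" by (intro compact_continuous_image linear_continuous_on L K)
        show "\<phi> (M z) = 0" if "z \<notin> L ` K" for z using that K(2)[of "M z"] LM(1)[of z] by (metis imageI)
      qed
    qed
    have "(LINT z|lborel. blinfun_apply (D' z) (L b) *\<^sub>R f z) = - (LINT z|lborel. \<phi> (M z) *\<^sub>R g z)"
      using w t' unfolding has_weak_partial_def by blast
    moreover have "(LINT z|lborel. blinfun_apply (D' z) (L b) *\<^sub>R f z) = c *\<^sub>R (LINT z|lborel. blinfun_apply (D z) b *\<^sub>R f (L z))"
      using int(2)[OF borel_measurable_integrable[OF test_function_integrable(2)[OF t' has_weak_partial_locally_integrable(1)[OF w], of "L b"], simplified]]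
      by (simp add: D' LM)
    moreover have "(LINT z|lborel. \<phi> (M z) *\<^sub>R g z) = c *\<^sub>R (LINT z|lborel. \<phi> z *\<^sub>R g (L z))"
      using int(2)[OF borel_measurable_integrable[OF test_function_integrable(1)[OF t' has_weak_partial_locally_integrable(2)[OF w]], simplified]]
      by (simp add: LM)
    ultimately have "c *\<^sub>R (LINT z|lborel. blinfun_apply (D z) b *\<^sub>R f (L z)) = c *\<^sub>R (- (LINT z|lborel. \<phi> z *\<^sub>R g (L z)))" by simp
    then show "(LINT z|lborel. blinfun_apply (D z) b *\<^sub>R f (L z)) = - (LINT z|lborel. \<phi> z *\<^sub>R g (L z))"
      using c by (simp only: scaleR_cancel_left) simp
  qed
qed

lemma bounded_linear_swap: "bounded_linear (prod.swap :: 'a::real_normed_vector \<times> 'b::real_normed_vector \<Rightarrow> 'b \<times> 'a)"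
  unfolding prod.swap_def[abs_def]
  by (intro bounded_linear_Pair bounded_linear_fst bounded_linear_snd)

lemma lborel_swap_density: "(lborel :: (real \<times> real) measure) = density (distr lborel borel prod.swap) (\<lambda>_. ennreal 1)"
  unfolding plane_swap by (simp add: density_1)

lemma has_weak_partial_swap:
  fixes f g :: "real \<times> real \<Rightarrow> complex"
  assumes "has_weak_partial (prod.swap b) f g"
  shows "has_weak_partial b (\<lambda>z. f (prod.swap z)) (\<lambda>z. g (prod.swap z))"
  by (rule has_weak_partial_compose_linear[where M = prod.swap, OF bounded_linear_swap bounded_linear_swap _ _ zero_less_one lborel_swap_density])
    (use assms in simp_all)

lemma weak_partial_y_imp_ac:
  fixes f g :: "real \<times> real \<Rightarrow> complex"
  assumes w: "has_weak_partial (0, 1) f g"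
  shows "AE x in lborel. \<exists>v. has_ac_derivative v (\<lambda>y. g (x, y)) \<and> (AE y in lborel. f (x, y) = v y)"
  using weak_partial_x_imp_ac[OF has_weak_partial_swap[of "(1, 0)" f g]] w by simp

lemma locally_integrable_swap:
  fixes f :: "real \<times> real \<Rightarrow> complex"
  assumes "locally_integrable f"
  shows "locally_integrable (\<lambda>z. f (prod.swap z))"
proof -
  have "has_weak_partial (prod.swap 0) f (\<lambda>_. 0)"
    unfolding has_weak_partial_def using assms by (auto simp: locally_integrable_def set_integrable_def blinfun.zero_right zero_prod_def[symmetric] prod.swap_def)
  from has_weak_partial_locally_integrable(1)[OF has_weak_partial_swap[OF this]] show ?thesis .
qed

lemma weak_partial_y_if_ac:
  fixes f g :: "real \<times> real \<Rightarrow> complex"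
  assumes f: "locally_integrable f" and g: "locally_integrable g"
    and ac: "AE x in lborel. \<exists>v. has_ac_derivative v (\<lambda>y. g (x, y)) \<and> (AE y in lborel. f (x, y) = v y)"
  shows "has_weak_partial (0, 1) f g"
proof -
  have "has_weak_partial (1, 0) (\<lambda>z. f (prod.swap z)) (\<lambda>z. g (prod.swap z))"
    by (rule weak_partial_x_if_ac[OF locally_integrable_swap[OF f] locally_integrable_swap[OF g]]) (use ac in simp)
  from has_weak_partial_swap[of "(0, 1)", simplified, OF this] show ?thesis by simp
qed

lemma has_weak_partial_scale_y:
  fixes f g :: "real \<times> real \<Rightarrow> complex"
  assumes l: "l > 0" and w: "has_weak_partial (fst b, l * snd b) f g"
  shows "has_weak_partial b (\<lambda>(x, y). f (x, l * y)) (\<lambda>(x, y). g (x, l * y))"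
proof -
  define L where "L z = (fst z, l * snd z)" for z :: "real \<times> real"
  define M where "M z = (fst z, snd z / l)" for z :: "real \<times> real"
  have lin: "bounded_linear L" "bounded_linear M" unfolding L_def[abs_def] M_def[abs_def]
    by (intro bounded_linear_Pair bounded_linear_fst bounded_linear_compose[OF bounded_linear_mult_right bounded_linear_snd]
        bounded_linear_compose[OF bounded_linear_divide bounded_linear_snd])+
  define c :: "real \<times> real \<Rightarrow> real" where "c j = (if j = (1, 0) then 1 else l)" for j
  have "(lborel :: (real \<times> real) measure) = density (distr lborel borel (\<lambda>x. 0 + (\<Sum>j\<in>Basis. (c j * (x \<bullet> j)) *\<^sub>R j))) (\<lambda>_. (\<Prod>j\<in>Basis. \<bar>c j\<bar>))"
    by (rule lborel_affine_euclidean) (use l in \<open>auto simp: c_def\<close>)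
  moreover have B: "(Basis :: (real \<times> real) set) = {(1, 0), (0, 1)}" by (auto simp: Basis_prod_def)
  have "(\<lambda>x::real \<times> real. 0 + (\<Sum>j\<in>Basis. (c j * (x \<bullet> j)) *\<^sub>R j)) = L"
    by (auto simp: B c_def L_def fun_eq_iff)
  moreover have "(\<Prod>j\<in>(Basis :: (real \<times> real) set). \<bar>c j\<bar>) = l" using l by (simp add: B c_def)
  ultimately have lb: "(lborel :: (real \<times> real) measure) = density (distr lborel borel L) (\<lambda>_. ennreal l)" by simp
  have "has_weak_partial b (\<lambda>z. f (L z)) (\<lambda>z. g (L z))"
    by (rule has_weak_partial_compose_linear[OF lin _ _ l lb]) (use l w in \<open>auto simp: L_def M_def\<close>)
  then show ?thesis by (simp add: L_def case_prod_unfold)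
qed

lemma has_weak_partial_scaleR:
  fixes f g :: "'a::euclidean_space \<Rightarrow> complex"
  assumes "has_weak_partial b f g"
  shows "has_weak_partial (c *\<^sub>R b) f (\<lambda>z. c *\<^sub>R g z)"
  unfolding has_weak_partial_def
proof (intro conjI allI impI)
  show "locally_integrable f" by (rule has_weak_partial_locally_integrable[OF assms])
  show "locally_integrable (\<lambda>z. c *\<^sub>R g z)"
    using has_weak_partial_locally_integrable(2)[OF assms] unfolding locally_integrable_def by auto
  fix \<phi> :: "'a \<Rightarrow> real" and D assume "test_function \<phi> D"
  then have "(LINT z|lborel. blinfun_apply (D z) b *\<^sub>R f z) = - (LINT z|lborel. \<phi> z *\<^sub>R g z)"
    using assms unfolding has_weak_partial_def by blast
  then have "c *\<^sub>R (LINT z|lborel. blinfun_apply (D z) b *\<^sub>R f z) = - (c *\<^sub>R (LINT z|lborel. \<phi> z *\<^sub>R g z))" by simp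
  then show "(LINT z|lborel. blinfun_apply (D z) (c *\<^sub>R b) *\<^sub>R f z) = - (LINT z|lborel. \<phi> z *\<^sub>R (c *\<^sub>R g z))"
    unfolding integral_scaleR_right[symmetric] by (simp only: blinfun.scaleR_right scaleR_scaleR real_scaleR_def mult.commute)
qed

lemma has_weak_partial_diff:
  fixes f g :: "real \<times> real \<Rightarrow> complex"
  assumes fg: "has_weak_partial b f g" and fg': "has_weak_partial b f' g'"
  shows "has_weak_partial b (\<lambda>z. f z - f' z) (\<lambda>z. g z - g' z)"
  unfolding has_weak_partial_def
proof (intro conjI allI impI locally_integrable_diff)
  note li = has_weak_partial_locally_integrable[OF fg] has_weak_partial_locally_integrable[OF fg']
  show "locally_integrable f" "locally_integrable f'" "locally_integrable g" "locally_integrable g'" by (rule li)+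
  fix \<phi> :: "real \<times> real \<Rightarrow> real" and D assume t: "test_function \<phi> D"
  have 1: "(LINT z|lborel. blinfun_apply (D z) b *\<^sub>R f z) = - (LINT z|lborel. \<phi> z *\<^sub>R g z)"
    using fg t unfolding has_weak_partial_def by blast
  have 2: "(LINT z|lborel. blinfun_apply (D z) b *\<^sub>R f' z) = - (LINT z|lborel. \<phi> z *\<^sub>R g' z)"
    using fg' t unfolding has_weak_partial_def by blast
  have "(LINT z|lborel. blinfun_apply (D z) b *\<^sub>R (f z - f' z)) = (LINT z|lborel. blinfun_apply (D z) b *\<^sub>R f z) - (LINT z|lborel. blinfun_apply (D z) b *\<^sub>R f' z)"
    unfolding scaleR_diff_right by (intro Bochner_Integration.integral_diff test_function_integrable[OF t] li)
  moreover have "(LINT z|lborel. \<phi> z *\<^sub>R (g z - g' z)) = (LINT z|lborel. \<phi> z *\<^sub>R g z) - (LINT z|lborel. \<phi> z *\<^sub>R g' z)"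
    unfolding scaleR_diff_right by (intro Bochner_Integration.integral_diff test_function_integrable[OF t] li)
  ultimately show "(LINT z|lborel. blinfun_apply (D z) b *\<^sub>R (f z - f' z)) = - (LINT z|lborel. \<phi> z *\<^sub>R (g z - g' z))"
    using 1 2 by simp
qed

section \<open>The one-dimensional case\<close>

lemma locally_integrable_1d:
  fixes g :: "real \<Rightarrow> complex"
  assumes "g \<in> borel_measurable borel" "\<And>a b. set_integrable lborel {a..b} g"
  shows "locally_integrable g"
  unfolding locally_integrable_def
proof (intro conjI allI impI assms)
  fix K :: "real set" assume K: "compact K"
  obtain N where "\<And>z. z \<in> K \<Longrightarrow> norm z \<le> N" using K compact_imp_bounded bounded_iff by metis
  then have "K \<subseteq> {-N..N}" by (auto simp: abs_le_iff minus_le_iff)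
  then show "set_integrable lborel K g"
    using set_integrable_subset[OF assms(2)] borel_compact[OF K] by auto
qed

lemma locally_integrable_1dD: "locally_integrable g \<Longrightarrow> set_integrable lborel {a..b::real} g"
  by (simp add: locally_integrable_def)

lemma locally_integrable_continuous:
  assumes "continuous_on UNIV (f :: 'a::euclidean_space \<Rightarrow> complex)"
  shows "locally_integrable f"
  unfolding locally_integrable_def set_integrable_def
  by (intro conjI allI impI borel_measurable_continuous_onI assms borel_integrable_compact continuous_on_subset[OF assms subset_UNIV])

lemma weak_partial_if_ac_1d:
  assumes ac: "has_ac_derivative v g" and f: "f \<in> borel_measurable borel" "AE x in lborel. f x = v x"
  shows "has_weak_partial (1::real) f g"
  unfolding has_weak_partial_def
proof (intro conjI allI impI)
  note [measurable] = f(1) ac_measurable_self[OF ac] ac_measurable[OF ac]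
  show "locally_integrable g" by (rule locally_integrable_1d[OF ac_measurable[OF ac] ac_integrable[OF ac]])
  show "locally_integrable f"
  proof (rule locally_integrable_1d[OF f(1)])
    show "set_integrable lborel {a..b} f" for a b
      using locally_integrable_1dD[OF locally_integrable_continuous[OF ac_continuous_on[OF ac]], of a b] f(2)
      by (subst set_integrable_cong_AE[where g = v]) auto
  qed
  fix \<phi> :: "real \<Rightarrow> real" and D assume t: "test_function \<phi> D"
  note s = test_function_real[OF t]
  note [measurable] = C1_compact_measurable[OF s]
  have "(LINT x|lborel. blinfun_apply (D x) 1 *\<^sub>R f x) = (LINT x|lborel. blinfun_apply (D x) 1 *\<^sub>R v x)"
    by (rule integral_cong_AE) (use f(2) in auto)
  then show "(LINT x|lborel. blinfun_apply (D x) 1 *\<^sub>R f x) = - (LINT x|lborel. \<phi> x *\<^sub>R g x)"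
    using integration_by_parts_C1_compact(3)[OF s ac] by simp
qed

lemma locally_integrable_fst:
  fixes g :: "real \<Rightarrow> complex"
  assumes g: "locally_integrable g"
  shows "locally_integrable (\<lambda>z::real \<times> real. g (fst z))"
proof -
  note [measurable] = locally_integrable_measurable[OF g]
  have "locally_integrable (\<lambda>z::real \<times> real. g (snd z))"
  proof (rule locally_integrable_if_cutoffs)
    fix n :: nat
    have "integrable lborel (\<lambda>z::real \<times> real. indicator {- real n..real n} (fst z) *\<^sub>R (indicator {- real n..real n} (snd z) *\<^sub>R g (snd z)))"
      using locally_integrable_1dD[OF g] by (intro integrable_tensor) (auto simp: set_integrable_def)
    then show "integrable lborel (\<lambda>z. indicator ({- real n..real n} \<times> {- real n..real n}) z *\<^sub>R g (snd z))"
      by (simp add: indicator_times case_prod_unfold)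
  qed simp
  from locally_integrable_swap[OF this] show ?thesis by simp
qed

text \<open>Extending a function of x constantly in y lets the one-dimensional theory be read off
  from the planar one: uniqueness and absolutely continuous representatives need no second
  proof.\<close>

lemma has_weak_partial_fst:
  assumes "has_weak_partial (1::real) v g"
  shows "has_weak_partial (1, 0) (\<lambda>z::real \<times> real. v (fst z)) (\<lambda>z. g (fst z))"
  unfolding has_weak_partial_def
proof (intro conjI allI impI)
  note li = locally_integrable_fst[OF has_weak_partial_locally_integrable(1)[OF assms]] locally_integrable_fst[OF has_weak_partial_locally_integrable(2)[OF assms]]
  show "locally_integrable (\<lambda>z::real \<times> real. v (fst z))" "locally_integrable (\<lambda>z::real \<times> real. g (fst z))" by (rule li)+
  fix \<phi> :: "real \<times> real \<Rightarrow> real" and D assume t: "test_function \<phi> D"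
  have slice: "(LINT x|lborel. blinfun_apply (D (x, y)) (1, 0) *\<^sub>R v x) = - (LINT x|lborel. \<phi> (x, y) *\<^sub>R g x)" for y
  proof -
    define a a' where "a x = \<phi> (x, y)" and "a' x = blinfun_apply (D (x, y)) (1, 0)" for x
    have a: "C1_compact a a'" unfolding a_def[abs_def] a'_def[abs_def] by (rule test_function_slice[OF t])
    obtain N where N: "\<And>x. N < \<bar>x\<bar> \<Longrightarrow> a x = 0" using C1_compact_support[OF a] by metis
    have "test_function a (\<lambda>x. a' x *\<^sub>R id_blinfun)"
      unfolding test_function_def
    proof (intro conjI allI)
      show "(a has_derivative blinfun_apply (a' x *\<^sub>R id_blinfun)) (at x)" for x
        using a unfolding C1_compact_def has_field_derivative_def
        by (simp add: blinfun.bilinear_simps[abs_def])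
      show "continuous_on UNIV (\<lambda>x. a' x *\<^sub>R id_blinfun)" by (intro continuous_intros C1_compact_continuous(2)[OF a])
      show "\<exists>K. compact K \<and> (\<forall>z. z \<notin> K \<longrightarrow> a z = 0)"
      proof (intro exI conjI allI impI)
        show "compact {-N..N}" by simp
        show "a z = 0" if "z \<notin> {-N..N}" for z using that N[of z] by (auto simp: not_le)
      qed
    qed
    then have "(LINT x|lborel. blinfun_apply (a' x *\<^sub>R id_blinfun) 1 *\<^sub>R v x) = - (LINT x|lborel. a x *\<^sub>R g x)"
      using assms unfolding has_weak_partial_def by blast
    then show ?thesis by (simp add: a_def a'_def blinfun.bilinear_simps)
  qed
  show "(LINT z|lborel. blinfun_apply (D z) (1, 0) *\<^sub>R v (fst z)) = - (LINT z|lborel. \<phi> z *\<^sub>R g (fst z))"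
    using plane_integral_x[OF test_function_integrable(2)[OF t li(1)], of "(1, 0)"] plane_integral_x[OF test_function_integrable(1)[OF t li(2)]]
    by (simp add: slice)
qed

lemma AE_real_const: "(AE x in (lborel :: real measure). P) \<Longrightarrow> P"
  using AE_iff_measurable[of UNIV "lborel :: real measure" "\<lambda>_. P"] by (cases P) auto

lemma weak_partial_imp_ac_1d:
  assumes "has_weak_partial (1::real) f g"
  obtains v where "has_ac_derivative v g" "AE x in lborel. f x = v x"
proof -
  have "AE y in (lborel :: real measure). \<exists>v. has_ac_derivative v g \<and> (AE x in lborel. f x = v x)"
    using weak_partial_x_imp_ac[OF has_weak_partial_fst[OF assms]] by simp
  from AE_real_const[OF this] show ?thesis using that by blast
qed

lemma weak_partial_eq_1d:
  assumes w: "has_weak_partial (1::real) f g"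
  shows "has_weak_partial 1 f (weak_partial 1 f)" "AE x in lborel. weak_partial 1 f x = g x"
proof -
  show 1: "has_weak_partial 1 f (weak_partial 1 f)" unfolding weak_partial_def by (rule someI[where P = "has_weak_partial 1 f", OF w])
  have "AE z in (lborel :: (real \<times> real) measure). weak_partial 1 f (fst z) = g (fst z)"
    by (rule has_weak_partial_unique[OF has_weak_partial_fst[OF 1] has_weak_partial_fst[OF w]])
  from plane_AE_x[OF this] have "AE y in (lborel :: real measure). AE x in lborel. weak_partial 1 f x = g x" by simp
  then show "AE x in lborel. weak_partial 1 f x = g x" by (rule AE_real_const)
qed

lemma continuous_AE_eq:
  fixes f g :: "real \<Rightarrow> complex"
  assumes "continuous_on UNIV f" "continuous_on UNIV g" "AE x in lborel. f x = g x"
  shows "f = g"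
proof (rule ccontr)
  assume "f \<noteq> g"
  then obtain x where x: "f x \<noteq> g x" by auto
  have o: "open {x. f x \<noteq> g x}" using assms(1,2) by (rule open_Collect_neq)
  have "emeasure lborel {x. f x \<noteq> g x} = 0"
    using assms(3) o by (subst (asm) AE_iff_measurable[OF _ refl]) auto
  moreover obtain e where e: "e > 0" "ball x e \<subseteq> {x. f x \<noteq> g x}" using x o open_contains_ball by blast
  have "{x..x + e/2} \<subseteq> {x. f x \<noteq> g x}" using e by (intro order_trans[OF _ e(2)]) (auto simp: dist_real_def)
  then have "emeasure lborel {x..x + e/2} \<le> emeasure lborel {x. f x \<noteq> g x}" using o by (intro emeasure_mono) auto
  ultimately show False using e(1) by simp
qed

section \<open>Momentum of profiles on the line\<close>

lemma rcong_pi_cis: "[a = b] (rmod pi) \<Longrightarrow> cis (2 * a) = cis (2 * b)"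
proof -
  assume "[a = b] (rmod pi)"
  then obtain n :: int where "b = a + of_int n * pi" by (auto simp: rcong_altdef)
  then have "2 * b = 2 * a + 2 * pi * of_int n" by simp
  then have "cis (2 * b) = cis (2 * a) * cis (2 * pi * of_int n)" by (simp only: cis_mult)
  then show ?thesis by (simp add: cis_multiple_2pi)
qed

lemma cis_rcong_pi: "cis (2 * a) = cis (2 * b) \<Longrightarrow> [a = b] (rmod pi)"
proof -
  assume "cis (2 * a) = cis (2 * b)"
  then obtain k :: int where "b = a + of_int k * pi" by (metis cis_eq_imp_int_multiple)
  then show ?thesis unfolding rcong_altdef by blast
qed

text \<open>Doubling and passing to the unit circle turns the two arguments into
  \<open>sgn (v R)\<close> and a conjugate, which do not depend on the branch.\<close>

lemma momentum_upto_cis: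
  assumes ac: "has_ac_derivative v g" and nz: "v R \<noteq> 0" "v (- R) \<noteq> 0"
  shows "cis (2 * momentum_upto v R) = cis (LINT x:{-R..R}|lborel. (\<i> * g x) \<bullet> v x) * sgn (v R) * cnj (sgn (v (- R)))"
proof -
  note w = weak_partial_eq_1d[OF weak_partial_if_ac_1d[OF ac ac_measurable_self[OF ac]], simplified]
  note [measurable] = ac_measurable[OF ac] ac_measurable_self[OF ac] locally_integrable_measurable[OF has_weak_partial_locally_integrable(2)[OF w(1)]]
  have "(LINT x:{-R..R}|lborel. (\<i> * weak_partial 1 v x) \<bullet> v x) = (LINT x:{-R..R}|lborel. (\<i> * g x) \<bullet> v x)"
    by (rule set_lebesgue_integral_cong_AE) (use w(2) in auto)
  then have "2 * momentum_upto v R = (LINT x:{-R..R}|lborel. (\<i> * g x) \<bullet> v x) + Arg (v R) + (- Arg (v (- R)))"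
    by (simp add: momentum_upto_def field_simps)
  then have "cis (2 * momentum_upto v R) = cis (LINT x:{-R..R}|lborel. (\<i> * g x) \<bullet> v x) * cis (Arg (v R)) * cis (- Arg (v (- R)))"
    by (simp only: cis_mult)
  also have "cis (- Arg (v (- R))) = cnj (cis (Arg (v (- R))))" by (simp add: cis_cnj)
  finally show ?thesis using nz by (simp add: cis_Arg)
qed

lemma momentum_1dD:
  assumes "p \<in> momentum_1d \<psi>"
  obtains v where "continuous_on UNIV v" "AE x in lborel. v x = \<psi> x"
    "((\<lambda>R. cis (2 * momentum_upto v R)) \<longlongrightarrow> cis (2 * p)) at_top"
proof -
  obtain v \<theta> where v: "continuous_on UNIV v" "AE x in lborel. v x = \<psi> x" and
    th: "\<And>R. [\<theta> R = momentum_upto v R] (rmod pi)" "(\<theta> \<longlongrightarrow> p) at_top"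
    using assms unfolding momentum_1d_def by blast
  have "((\<lambda>R. cis (2 * \<theta> R)) \<longlongrightarrow> cis (2 * p)) at_top" by (intro tendsto_intros th)
  then have "((\<lambda>R. cis (2 * momentum_upto v R)) \<longlongrightarrow> cis (2 * p)) at_top" by (simp only: rcong_pi_cis[OF th(1)])
  then show ?thesis using that v by blast
qed

lemma momentum_1dI:
  assumes v: "continuous_on UNIV v" "AE x in lborel. v x = \<psi> x"
    and lim: "((\<lambda>R. cis (2 * momentum_upto v R)) \<longlongrightarrow> cis (2 * p)) at_top"
  shows "p \<in> momentum_1d \<psi>"
proof -
  \<comment> \<open>The lift that stays nearest to \<open>p\<close>. It converges because
    \<open>Arg\<close> is continuous at 1.\<close>
  define \<theta> where "\<theta> R = p + Arg (cis (2 * momentum_upto v R - 2 * p)) / 2" for R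
  have "[\<theta> R = momentum_upto v R] (rmod pi)" for R
  proof (rule cis_rcong_pi)
    have "cis (2 * \<theta> R) = cis (2 * p) * cis (Arg (cis (2 * momentum_upto v R - 2 * p)))" by (simp add: \<theta>_def cis_mult algebra_simps)
    also have "\<dots> = cis (2 * momentum_upto v R)" by (simp add: cis_Arg sgn_eq cis_mult)
    finally show "cis (2 * \<theta> R) = cis (2 * momentum_upto v R)" .
  qed
  moreover have "(\<theta> \<longlongrightarrow> p) at_top"
  proof -
    have "((\<lambda>R. cis (2 * momentum_upto v R) * cis (- (2 * p))) \<longlongrightarrow> cis (2 * p) * cis (- (2 * p))) at_top" by (intro tendsto_intros lim)
    then have "((\<lambda>R. cis (2 * momentum_upto v R - 2 * p)) \<longlongrightarrow> 1) at_top" by (simp add: cis_mult)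
    then have A: "((\<lambda>R. Arg (cis (2 * momentum_upto v R - 2 * p))) \<longlongrightarrow> Arg 1) at_top"
      by (intro isCont_tendsto_compose[OF continuous_at_Arg]) auto
    then have "(\<theta> \<longlongrightarrow> p + Arg 1 / 2) at_top" unfolding \<theta>_def[abs_def]
      by (intro tendsto_add tendsto_const tendsto_divide A) simp
    then show ?thesis by simp
  qed
  ultimately show ?thesis unfolding momentum_1d_def using v by blast
qed

text \<open>Two curves whose difference is square integrable have momenta differing by an absolutely
  convergent integral. What remains is a boundary term; it dies along radii where the difference
  tends to zero at both ends, and along these radii the phases of the two curves agree as
  well.\<close>

theorem momentum_limit_perturb:
  assumes fe: "finite_energy_1d v g" and ac': "has_ac_derivative v' g'"
    and lim: "((\<lambda>R. cis (2 * momentum_upto v' R)) \<longlongrightarrow> cis (2 * p)) at_top"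
    and u: "integrable lborel (\<lambda>x. (cmod (v x - v' x))\<^sup>2)"
    and j: "integrable lborel (\<lambda>x. (\<i> * (g' x + g x)) \<bullet> (v x - v' x))"
  shows "momentum_limit_1d v g (p + 1/2 * (LINT x|lborel. (\<i> * (g' x + g x)) \<bullet> (v x - v' x)))"
proof -
  have ac: "has_ac_derivative v g" using fe by (simp add: finite_energy_1d_def)
  obtain R where R: "filterlim R at_top sequentially" "(\<lambda>n. (cmod (v (R n) - v' (R n)))\<^sup>2) \<longlonglongrightarrow> 0"
      "(\<lambda>n. (cmod (v (- R n) - v' (- R n)))\<^sup>2) \<longlonglongrightarrow> 0"
    using integrable_sequence_to_zero[OF u] by auto
  have un: "(\<lambda>n. v (R n) - v' (R n)) \<longlonglongrightarrow> 0" "(\<lambda>n. v (- R n) - v' (- R n)) \<longlonglongrightarrow> 0"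
    using tendsto_real_sqrt[OF R(2)] tendsto_real_sqrt[OF R(3)] by (simp_all add: tendsto_norm_zero_iff)
  have vn: "(\<lambda>n. cmod (v (R n))) \<longlonglongrightarrow> 1" "(\<lambda>n. cmod (v (- R n))) \<longlonglongrightarrow> 1"
    using filterlim_compose[OF finite_energy_modulus_limit(1)[OF fe] R(1)] filterlim_compose[OF finite_energy_modulus_limit(2)[OF fe] R(1)] by simp_all
  \<comment> \<open>Finite energy is assumed for \<open>v\<close> alone; along the chosen radii
    \<open>v'\<close> inherits the limiting modulus 1, and its direction may replace
    \<open>v\<close> itself.\<close>
  have lemma_sgn: "(\<lambda>n. a n - sgn (b n)) \<longlonglongrightarrow> 0" "eventually (\<lambda>n. b n \<noteq> 0) sequentially" "(\<lambda>n. cmod (b n)) \<longlonglongrightarrow> 1"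
    if ab: "(\<lambda>n. a n - b n) \<longlonglongrightarrow> 0" and a: "(\<lambda>n. cmod (a n)) \<longlonglongrightarrow> 1" for a b :: "nat \<Rightarrow> complex"
  proof -
    have "(\<lambda>n. cmod (a n) - cmod (b n)) \<longlonglongrightarrow> 0"
      by (rule Lim_null_comparison[OF always_eventually tendsto_norm_zero[OF ab]]) (simp add: norm_triangle_ineq3)
    then have "(\<lambda>n. cmod (a n) - (cmod (a n) - cmod (b n))) \<longlonglongrightarrow> 1 - 0" by (intro tendsto_intros a)
    then show b: "(\<lambda>n. cmod (b n)) \<longlonglongrightarrow> 1" by simp
    have "eventually (\<lambda>n. cmod (b n) > 0) sequentially" by (rule order_tendstoD(1)[OF b]) simp
    then show ev: "eventually (\<lambda>n. b n \<noteq> 0) sequentially" by eventually_elim auto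
    have "(\<lambda>n. b n - sgn (b n)) \<longlonglongrightarrow> 0"
    proof (rule Lim_null_comparison)
      show "eventually (\<lambda>n. norm (b n - sgn (b n)) \<le> \<bar>cmod (b n) - 1\<bar>) sequentially"
        using ev
      proof eventually_elim
        case (elim n)
        have eq: "b n - sgn (b n) = of_real (cmod (b n) - 1) * sgn (b n)"
          using elim by (simp add: sgn_eq field_simps)
        show ?case unfolding eq norm_mult norm_of_real using elim by (simp add: norm_sgn)
      qed
      have "(\<lambda>n. \<bar>cmod (b n) - 1\<bar>) \<longlonglongrightarrow> \<bar>1 - 1\<bar>" by (intro tendsto_intros b)
      then show "(\<lambda>n. \<bar>cmod (b n) - 1\<bar>) \<longlonglongrightarrow> 0" by simp
    qed
    then show "(\<lambda>n. a n - sgn (b n)) \<longlonglongrightarrow> 0" using tendsto_add[OF ab] by fastforce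
  qed
  note plus = lemma_sgn[OF un(1) vn(1)] and minus = lemma_sgn[OF un(2) vn(2)]
  define J where "J = (LINT x|lborel. (\<i> * (g' x + g x)) \<bullet> (v x - v' x))"
  \<comment> \<open>Since \<open>(\<i> * a) \<bullet> b\<close> is antisymmetric in \<open>a\<close>
    and \<open>b\<close>, the two momentum integrands differ by
    \<open>(\<i> * (g' x + g x)) \<bullet> (v x - v' x)\<close> plus the derivative of
    \<open>B\<close>.\<close>
  define B where "B x = (\<i> * (v x - v' x)) \<bullet> v' x" for x
  have acB: "has_ac_derivative B (\<lambda>x. (\<i> * (v x - v' x)) \<bullet> g' x + (\<i> * (g x - g' x)) \<bullet> v' x)"
    unfolding B_def
    by (rule ac_bounded_bilinear[OF bounded_bilinear_inner ac_bounded_linear[OF bounded_linear_mult_right ac_diff_fun[OF ac ac']] ac'])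
  have split: "(LINT x:{-r..r}|lborel. (\<i> * g x) \<bullet> v x) = (LINT x:{-r..r}|lborel. (\<i> * g' x) \<bullet> v' x)
      + (LINT x:{-r..r}|lborel. (\<i> * (g' x + g x)) \<bullet> (v x - v' x)) + (B r - B (-r))" if "r \<ge> 0" for r
  proof -
    have "(LINT x:{-r..r}|lborel. (\<i> * g x) \<bullet> v x) = (LINT x:{-r..r}|lborel. ((\<i> * g' x) \<bullet> v' x + (\<i> * (g' x + g x)) \<bullet> (v x - v' x)) + ((\<i> * (v x - v' x)) \<bullet> g' x + (\<i> * (g x - g' x)) \<bullet> v' x))"
      by (intro set_lebesgue_integral_cong) (auto simp: inner_complex_def algebra_simps)
    also have "\<dots> = (LINT x:{-r..r}|lborel. (\<i> * g' x) \<bullet> v' x + (\<i> * (g' x + g x)) \<bullet> (v x - v' x)) + (LINT x:{-r..r}|lborel. (\<i> * (v x - v' x)) \<bullet> g' x + (\<i> * (g x - g' x)) \<bullet> v' x)"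
      by (intro set_integral_add(2) set_integral_add(1) set_integrable_momentum_integrand[OF ac'] set_integrable_if_integrable[OF j] ac_integrable[OF acB]) simp
    also have "(LINT x:{-r..r}|lborel. (\<i> * g' x) \<bullet> v' x + (\<i> * (g' x + g x)) \<bullet> (v x - v' x)) = (LINT x:{-r..r}|lborel. (\<i> * g' x) \<bullet> v' x) + (LINT x:{-r..r}|lborel. (\<i> * (g' x + g x)) \<bullet> (v x - v' x))"
      by (intro set_integral_add(2) set_integrable_momentum_integrand[OF ac'] set_integrable_if_integrable[OF j]) simp
    also have "(LINT x:{-r..r}|lborel. (\<i> * (v x - v' x)) \<bullet> g' x + (\<i> * (g x - g' x)) \<bullet> v' x) = B r - B (-r)"
      using ac_diff[OF acB, of "-r" r] that by simp
    finally show ?thesis .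
  qed
  have B0: "(\<lambda>n. B (R n)) \<longlonglongrightarrow> 0" "(\<lambda>n. B (- R n)) \<longlonglongrightarrow> 0"
  proof -
    have Bb: "norm (B x) \<le> cmod (v x - v' x) * cmod (v' x)" for x
      using Cauchy_Schwarz_ineq2[of "\<i> * (v x - v' x)" "v' x"] by (simp add: B_def norm_mult)
    have "(\<lambda>n. cmod (v (R n) - v' (R n)) * cmod (v' (R n))) \<longlonglongrightarrow> 0 * 1" by (intro tendsto_mult tendsto_norm_zero un plus)
    then have z: "(\<lambda>n. cmod (v (R n) - v' (R n)) * cmod (v' (R n))) \<longlonglongrightarrow> 0" by simp
    show "(\<lambda>n. B (R n)) \<longlonglongrightarrow> 0" by (rule Lim_null_comparison[OF always_eventually z]) (use Bb in auto)
    have "(\<lambda>n. cmod (v (- R n) - v' (- R n)) * cmod (v' (- R n))) \<longlonglongrightarrow> 0 * 1" by (intro tendsto_mult tendsto_norm_zero un minus)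
    then have z: "(\<lambda>n. cmod (v (- R n) - v' (- R n)) * cmod (v' (- R n))) \<longlonglongrightarrow> 0" by simp
    show "(\<lambda>n. B (- R n)) \<longlonglongrightarrow> 0" by (rule Lim_null_comparison[OF always_eventually z]) (use Bb in auto)
  qed
  define a where "a n = (LINT x:{-R n..R n}|lborel. (\<i> * g' x) \<bullet> v' x)" for n
  define b where "b n = (LINT x:{-R n..R n}|lborel. (\<i> * (g' x + g x)) \<bullet> (v x - v' x)) + (B (R n) - B (- R n))" for n
  have bl: "b \<longlonglongrightarrow> J"
  proof -
    have "(\<lambda>n. LINT x:{-R n..R n}|lborel. (\<i> * (g' x + g x)) \<bullet> (v x - v' x)) \<longlonglongrightarrow> J"
      unfolding J_def by (rule filterlim_compose[OF tendsto_symmetric_set_integral[OF j] R(1)])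
    then have "b \<longlonglongrightarrow> J + (0 - 0)" unfolding b_def[abs_def] by (intro tendsto_intros B0)
    then show ?thesis by simp
  qed
  have al: "(\<lambda>n. cis (a n) * sgn (v' (R n)) * cnj (sgn (v' (- R n)))) \<longlonglongrightarrow> cis (2 * p)"
  proof (rule Lim_transform_eventually[OF filterlim_compose[OF lim R(1)]])
    show "eventually (\<lambda>n. cis (2 * momentum_upto v' (R n)) = cis (a n) * sgn (v' (R n)) * cnj (sgn (v' (- R n)))) sequentially"
      using plus(2) minus(2) by eventually_elim (simp add: momentum_upto_cis[OF ac'] a_def)
  qed
  have dl: "(\<lambda>n. v (R n) * cnj (v (- R n)) - sgn (v' (R n)) * cnj (sgn (v' (- R n)))) \<longlonglongrightarrow> 0"
  proof -
    have "(\<lambda>n. cmod (v (R n) - sgn (v' (R n))) * cmod (v (- R n)) + 1 * cmod (v (- R n) - sgn (v' (- R n)))) \<longlonglongrightarrow> 0 * 1 + 1 * 0"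
      by (intro tendsto_intros tendsto_norm_zero plus(1) minus(1) vn)
    then have z: "(\<lambda>n. cmod (v (R n) - sgn (v' (R n))) * cmod (v (- R n)) + 1 * cmod (v (- R n) - sgn (v' (- R n)))) \<longlonglongrightarrow> 0" by simp
    show ?thesis
    proof (rule Lim_null_comparison[OF always_eventually z], rule allI)
      fix n
      have "v (R n) * cnj (v (- R n)) - sgn (v' (R n)) * cnj (sgn (v' (- R n)))
          = (v (R n) - sgn (v' (R n))) * cnj (v (- R n)) + sgn (v' (R n)) * cnj (v (- R n) - sgn (v' (- R n)))"
        by (simp add: algebra_simps)
      also have "norm \<dots> \<le> cmod (v (R n) - sgn (v' (R n))) * cmod (v (- R n)) + 1 * cmod (v (- R n) - sgn (v' (- R n)))"
        by (rule norm_triangle_le) (auto simp: norm_mult norm_sgn simp flip: complex_cnj_diff intro!: add_mono mult_right_mono)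
      finally show "norm (v (R n) * cnj (v (- R n)) - sgn (v' (R n)) * cnj (sgn (v' (- R n)))) \<le> cmod (v (R n) - sgn (v' (R n))) * cmod (v (- R n)) + 1 * cmod (v (- R n) - sgn (v' (- R n)))" .
    qed
  qed
  have "(\<lambda>n. cis (a n + b n) * (v (R n) * cnj (v (- R n)) - sgn (v' (R n)) * cnj (sgn (v' (- R n))))) \<longlonglongrightarrow> 0"
    by (rule Lim_null_comparison[OF always_eventually tendsto_norm_zero[OF dl]]) (simp add: norm_mult)
  moreover have "(\<lambda>n. cis (b n) * (cis (a n) * sgn (v' (R n)) * cnj (sgn (v' (- R n))))) \<longlonglongrightarrow> cis J * cis (2 * p)"
    by (intro tendsto_intros bl al)
  ultimately have "(\<lambda>n. cis (a n + b n) * (v (R n) * cnj (v (- R n)) - sgn (v' (R n)) * cnj (sgn (v' (- R n))))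
      + cis (b n) * (cis (a n) * sgn (v' (R n)) * cnj (sgn (v' (- R n))))) \<longlonglongrightarrow> 0 + cis J * cis (2 * p)" by (rule tendsto_add)
  moreover have "cis (a n + b n) * (v (R n) * cnj (v (- R n)) - sgn (v' (R n)) * cnj (sgn (v' (- R n))))
      + cis (b n) * (cis (a n) * sgn (v' (R n)) * cnj (sgn (v' (- R n)))) = cis (a n + b n) * v (R n) * cnj (v (- R n))" for n
    by (simp add: cis_mult[symmetric] algebra_simps)
  ultimately have "(\<lambda>n. cis (a n + b n) * v (R n) * cnj (v (- R n))) \<longlonglongrightarrow> 0 + cis J * cis (2 * p)"
    by (simp only:)
  then have "(\<lambda>n. cis (a n + b n) * v (R n) * cnj (v (- R n))) \<longlonglongrightarrow> cis (2 * (p + 1/2 * J))"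
    by (simp add: cis_mult algebra_simps)
  moreover have "eventually (\<lambda>n. cis (a n + b n) * v (R n) * cnj (v (- R n)) = cis (LINT x:{-R n..R n}|lborel. (\<i> * g x) \<bullet> v x) * v (R n) * cnj (v (- R n))) sequentially"
    using filterlim_at_top[THEN iffD1, OF R(1), rule_format, of 0]
    by eventually_elim (simp add: split a_def b_def algebra_simps)
  ultimately have "(\<lambda>n. cis (LINT x:{-R n..R n}|lborel. (\<i> * g x) \<bullet> v x) * v (R n) * cnj (v (- R n))) \<longlonglongrightarrow> cis (2 * (p + 1/2 * J))"
    by (rule Lim_transform_eventually)
  then show ?thesis unfolding momentum_limit_1d_def J_def using R(1) by blast
qed

section \<open>Slicing a function on the strip\<close>

lemma integral_Cauchy_Schwarz:
  fixes f g :: "'a \<Rightarrow> real"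
  assumes f: "integrable M (\<lambda>x. (f x)\<^sup>2)" and g: "integrable M (\<lambda>x. (g x)\<^sup>2)" and fg: "integrable M (\<lambda>x. f x * g x)"
  shows "(LINT x|M. f x * g x)\<^sup>2 \<le> (LINT x|M. (f x)\<^sup>2) * (LINT x|M. (g x)\<^sup>2)"
proof -
  define F G H where "F = (LINT x|M. (f x)\<^sup>2)" and "G = (LINT x|M. (g x)\<^sup>2)" and "H = (LINT x|M. f x * g x)"
  have q: "0 \<le> s\<^sup>2 * F + 2 * s * t * H + t\<^sup>2 * G" for s t
  proof -
    have "0 \<le> (LINT x|M. (s * f x + t * g x)\<^sup>2)" by (intro Bochner_Integration.integral_nonneg) simp
    also have "\<dots> = (LINT x|M. (s\<^sup>2 * (f x)\<^sup>2 + (2 * s * t) * (f x * g x)) + t\<^sup>2 * (g x)\<^sup>2)"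
      by (intro Bochner_Integration.integral_cong refl) (simp add: power2_eq_square algebra_simps)
    also have "\<dots> = s\<^sup>2 * F + 2 * s * t * H + t\<^sup>2 * G"
      using f g fg by (simp add: F_def G_def H_def)
    finally show ?thesis .
  qed
  have FG: "F \<ge> 0" "G \<ge> 0" by (simp_all add: F_def G_def)
  show ?thesis unfolding F_def[symmetric] G_def[symmetric] H_def[symmetric]
  proof (cases "G > 0")
    case True
    have "0 \<le> G\<^sup>2 * F + 2 * G * (- H) * H + (- H)\<^sup>2 * G" using q[of G "-H"] by simp
    also have "\<dots> = G * (F * G - H\<^sup>2)" by (simp add: power2_eq_square algebra_simps)
    finally show "H\<^sup>2 \<le> F * G" using True by (simp add: zero_le_mult_iff)
  next
    case False
    then have G0: "G = 0" using FG by simp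
    have "H = 0"
    proof (rule ccontr)
      assume "H \<noteq> 0"
      have "0 \<le> H\<^sup>2 * F + 2 * H * (- (F + 1)) * H" using q[of H "- (F + 1)"] G0 by simp
      also have "\<dots> = - (H\<^sup>2 * (F + 2))" by (simp add: power2_eq_square algebra_simps)
      finally show False using \<open>H \<noteq> 0\<close> FG by (simp add: mult_le_0_iff)
    qed
    then show "H\<^sup>2 \<le> F * G" using G0 by simp
  qed
qed

lemma integrable_real_product:
  fixes f g :: "'a \<Rightarrow> real"
  assumes "integrable M (\<lambda>x. (f x)\<^sup>2)" "integrable M (\<lambda>x. (g x)\<^sup>2)" "f \<in> borel_measurable M" "g \<in> borel_measurable M"
  shows "integrable M (\<lambda>x. f x * g x)"
proof (rule Bochner_Integration.integrable_bound[OF Bochner_Integration.integrable_add[OF assms(1,2)]])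
  show "AE x in M. norm (f x * g x) \<le> norm ((f x)\<^sup>2 + (g x)\<^sup>2)"
  proof (rule AE_I2)
    fix x
    have "0 \<le> (\<bar>f x\<bar> - \<bar>g x\<bar>)\<^sup>2" by simp
    then have "2 * (\<bar>f x\<bar> * \<bar>g x\<bar>) \<le> (f x)\<^sup>2 + (g x)\<^sup>2" by (simp add: power2_diff)
    moreover have "0 \<le> \<bar>f x\<bar> * \<bar>g x\<bar>" by simp
    ultimately have "\<bar>f x\<bar> * \<bar>g x\<bar> \<le> (f x)\<^sup>2 + (g x)\<^sup>2" by linarith
    then show "norm (f x * g x) \<le> norm ((f x)\<^sup>2 + (g x)\<^sup>2)" by (simp add: abs_mult)
  qed
qed (use assms in measurable)

lemma Basis_plane: "(Basis :: (real \<times> real) set) = {(1, 0), (0, 1)}"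
  by (auto simp: Basis_prod_def)

lemma AE_plane_from_x:
  assumes "{z :: real \<times> real. Q z} \<in> sets borel" "AE x in lborel. AE y in lborel. Q (x, y)"
  shows "AE z in lborel. Q z"
proof -
  have "{z \<in> space (lborel \<Otimes>\<^sub>M lborel). Q z} \<in> sets (lborel \<Otimes>\<^sub>M lborel)"
    unfolding lborel_prod using assms(1) by simp
  from lborel_pair.AE_pair_measure[OF this assms(2)] show ?thesis by (simp only: lborel_prod)
qed

lemma scaleR_divide_complex: "r *\<^sub>R (z / w) = (r *\<^sub>R z) / (w :: complex)"
  by (simp add: scaleR_conv_of_real)

locale strip_function =
  fixes l :: real and \<psi> :: "real \<times> real \<Rightarrow> complex"
  assumes l: "0 < l" and psi: "\<psi> \<in> energy_space_2d l"
begin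

definition chi :: "real \<Rightarrow> real" where "chi y = indicator {0..<l} y"
definition gx :: "real \<times> real \<Rightarrow> complex" where "gx = weak_partial (1, 0) \<psi>"
definition gy :: "real \<times> real \<Rightarrow> complex" where "gy = weak_partial (0, 1) \<psi>"

lemma chi_props: "0 \<le> chi y" "chi y \<le> 1" "chi y * chi y = chi y" "(chi y)\<^sup>2 = chi y" "y \<in> {0..<l} \<Longrightarrow> chi y = 1" "y \<notin> {0..<l} \<Longrightarrow> chi y = 0"
  by (auto simp: chi_def indicator_def)

lemma chi_measurable[measurable]: "chi \<in> borel_measurable borel"
  unfolding chi_def[abs_def] by measurable

lemma indicator_strip: "indicator (strip l) z = chi (snd z)"
  by (cases z) (auto simp: strip_def chi_def indicator_def)

lemma chi_integrable: "integrable lborel chi" "(LINT y|lborel. chi y) = l"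
  unfolding chi_def[abs_def] using l by auto

lemma weak: "has_weak_partial (1, 0) \<psi> gx" "has_weak_partial (0, 1) \<psi> gy"
proof -
  have "\<exists>g. has_weak_partial b \<psi> g" if "b \<in> Basis" for b
    using psi that unfolding energy_space_2d_def energy_space_def H1_loc_def by blast
  then show "has_weak_partial (1, 0) \<psi> gx" "has_weak_partial (0, 1) \<psi> gy"
    unfolding gx_def gy_def using weak_partial_eq(1) by (metis Basis_plane insertCI)+
qed

lemmas li = has_weak_partial_locally_integrable[OF weak(1)] has_weak_partial_locally_integrable(2)[OF weak(2)]

lemma meas[measurable]: "\<psi> \<in> borel_measurable borel" "gx \<in> borel_measurable borel" "gy \<in> borel_measurable borel"
  using li locally_integrable_measurable by blast+

lemma integrable_L2:
  "integrable lborel (\<lambda>z. chi (snd z) * (cmod (gx z))\<^sup>2)" "integrable lborel (\<lambda>z. chi (snd z) * (cmod (gy z))\<^sup>2)"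
  "integrable lborel (\<lambda>z. chi (snd z) * (1 - (cmod (\<psi> z))\<^sup>2)\<^sup>2)"
  using psi unfolding energy_space_2d_def energy_space_def L2_on_def set_integrable_def gx_def gy_def
  by (auto simp: Basis_plane indicator_strip)

definition Dx :: real where "Dx = (LINT z|lborel. chi (snd z) * (cmod (gx z))\<^sup>2)"
definition Dy :: real where "Dy = (LINT z|lborel. chi (snd z) * (cmod (gy z))\<^sup>2)"
definition V :: real where "V = (LINT z|lborel. chi (snd z) * (1 - (cmod (\<psi> z))\<^sup>2)\<^sup>2)"

lemma D_nonneg: "0 \<le> Dx" "0 \<le> Dy" "0 \<le> V"
  unfolding Dx_def Dy_def V_def by (auto intro!: Bochner_Integration.integral_nonneg simp: chi_props)

lemma energy_eq: "l * energy l \<psi> = 1/2 * Dx + 1/2 * Dy + 1/4 * V"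
proof -
  have "l * energy l \<psi> = (LINT z|lborel. (1/2 * (chi (snd z) * (cmod (gx z))\<^sup>2) + 1/2 * (chi (snd z) * (cmod (gy z))\<^sup>2)) + 1/4 * (chi (snd z) * (1 - (cmod (\<psi> z))\<^sup>2)\<^sup>2))"
    unfolding energy_def set_lebesgue_integral_def indicator_strip energy_density_def gx_def gy_def
    using l by (simp add: Basis_plane algebra_simps)
  also have "\<dots> = 1/2 * Dx + 1/2 * Dy + 1/4 * V"
    unfolding Dx_def Dy_def V_def using integrable_L2 by simp
  finally show ?thesis .
qed

definition aF :: "real \<Rightarrow> real" where "aF x = (LINT y|lborel. chi y * (cmod (gy (x, y)))\<^sup>2)"

lemma aF_integrable: "integrable lborel aF" "(LINT x|lborel. aF x) = Dy"
  unfolding aF_def[abs_def] Dy_def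
  using plane_integrable_y[OF integrable_L2(2)] plane_integral_y[OF integrable_L2(2)] by simp_all

lemma aF_measurable[measurable]: "aF \<in> borel_measurable borel"
  using borel_measurable_integrable[OF aF_integrable(1)] by simp

lemma aF_nonneg: "0 \<le> aF x"
  unfolding aF_def by (intro Bochner_Integration.integral_nonneg) (simp add: chi_props)

lemma integrable_chi_scaleR:
  fixes f :: "real \<Rightarrow> 'b::euclidean_space"
  assumes "\<And>a b. set_integrable lborel {a..b} f"
  shows "integrable lborel (\<lambda>y. chi y *\<^sub>R f y)"
proof -
  have "{0..<l} \<subseteq> {0..l}" by auto
  then show ?thesis
    using set_integrable_subset[OF assms[of 0 l], of "{0..<l}"] unfolding set_integrable_def chi_def by simp
qed

lemma y_mean_eq: "y_mean l \<psi> x = (LINT y|lborel. chi y *\<^sub>R \<psi> (x, y)) / of_real l"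
  unfolding y_mean_def set_lebesgue_integral_def chi_def ..

text \<open>A one-dimensional Poincare inequality in supremum form: two values on a slice differ by
  at most the integral \<open>A\<close> of the derivative, hence so do a value and the mean.
  Cauchy-Schwarz on a period of length \<open>l\<close> bounds the square of \<open>A\<close>. The
  bound does not depend on \<open>y\<close>.\<close>

lemma mean_oscillation_slice:
  assumes v: "has_ac_derivative v (\<lambda>y. gy (x, y))" "AE y in lborel. \<psi> (x, y) = v y"
    and i: "integrable lborel (\<lambda>y. chi y * (cmod (gy (x, y)))\<^sup>2)" and y: "y \<in> {0..<l}"
  shows "(cmod (v y - y_mean l \<psi> x))\<^sup>2 \<le> l * aF x"
proof -
  note [measurable] = ac_measurable[OF v(1)] ac_measurable_self[OF v(1)] borel_measurable_slice[OF meas(1)]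
  define A where "A = (LINT s|lborel. chi s * cmod (gy (x, s)))"
  have iA: "integrable lborel (\<lambda>s. chi s * cmod (gy (x, s)))"
    using integrable_chi_scaleR[OF set_integrable_norm[OF ac_integrable[OF v(1)]]] by simp
  have osc: "cmod (v b - v a) \<le> A" if "a \<in> {0..<l}" "b \<in> {0..<l}" "a \<le> b" for a b
  proof -
    have "cmod (v b - v a) \<le> (LINT s:{a..b}|lborel. cmod (gy (x, s)))"
      unfolding ac_diff[OF v(1) that(3)]
      by (intro set_integral_norm_le ac_integrable[OF v(1)] set_integrable_norm) simp
    also have "\<dots> \<le> A" unfolding set_lebesgue_integral_def A_def
      using that by (intro integral_mono'[OF iA]) (auto simp: indicator_def chi_def)
    finally show ?thesis .
  qed
  have osc': "cmod (v a - v b) \<le> A" if "a \<in> {0..<l}" "b \<in> {0..<l}" for a b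
    using osc[of a b] osc[of b a] that by (cases "a \<le> b") (auto simp: norm_minus_commute)
  have iv: "integrable lborel (\<lambda>s. chi s *\<^sub>R v s)"
    by (rule integrable_chi_scaleR) (rule locally_integrable_1dD[OF locally_integrable_continuous[OF ac_continuous_on[OF v(1)]]])
  have "y_mean l \<psi> x = (LINT s|lborel. chi s *\<^sub>R v s) / of_real l"
    unfolding y_mean_eq
    by (intro arg_cong[where f = "\<lambda>t. t / of_real l"] integral_cong_AE) (use v(2) in \<open>auto\<close>)
  then have "of_real l * (v y - y_mean l \<psi> x) = of_real l * v y - (LINT s|lborel. chi s *\<^sub>R v s)"
    using l by (simp add: field_simps)
  also have "of_real l * v y = (LINT s|lborel. chi s *\<^sub>R v y)"
    using chi_integrable by (simp add: scaleR_conv_of_real)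
  also have "\<dots> - (LINT s|lborel. chi s *\<^sub>R v s) = (LINT s|lborel. chi s *\<^sub>R (v y - v s))"
    unfolding scaleR_diff_right using iv chi_integrable by (subst Bochner_Integration.integral_diff) auto
  finally have "l * cmod (v y - y_mean l \<psi> x) = cmod (LINT s|lborel. chi s *\<^sub>R (v y - v s))"
    using l by (metis abs_of_pos norm_mult norm_of_real)
  also have "\<dots> \<le> (LINT s|lborel. cmod (chi s *\<^sub>R (v y - v s)))" by (rule integral_norm_bound)
  also have "\<dots> \<le> (LINT s|lborel. chi s * A)"
  proof (rule integral_mono')
    show "integrable lborel (\<lambda>s. chi s * A)" using chi_integrable by simp
    show "cmod (chi s *\<^sub>R (v y - v s)) \<le> chi s * A" for s
      using osc'[of y s] y by (cases "s \<in> {0..<l}") (auto simp: chi_props)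
    show "0 \<le> chi s * A" for s
      unfolding A_def by (intro mult_nonneg_nonneg Bochner_Integration.integral_nonneg) (auto simp: chi_props)
  qed
  also have "\<dots> = l * A" using chi_integrable by simp
  finally have "cmod (v y - y_mean l \<psi> x) \<le> A" using l by simp
  then have "(cmod (v y - y_mean l \<psi> x))\<^sup>2 \<le> A\<^sup>2" by (intro power_mono) auto
  also have "A\<^sup>2 \<le> (LINT s|lborel. (chi s)\<^sup>2) * (LINT s|lborel. (chi s * cmod (gy (x, s)))\<^sup>2)"
  proof -
    have e: "chi s * cmod (gy (x, s)) = chi s * (chi s * cmod (gy (x, s)))" for s by (simp add: mult.assoc[symmetric] chi_props)
    have "(LINT s|lborel. chi s * (chi s * cmod (gy (x, s))))\<^sup>2 \<le> (LINT s|lborel. (chi s)\<^sup>2) * (LINT s|lborel. (chi s * cmod (gy (x, s)))\<^sup>2)"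
    proof (rule integral_Cauchy_Schwarz)
      show "integrable lborel (\<lambda>s. (chi s)\<^sup>2)" by (simp add: chi_props chi_integrable)
      show "integrable lborel (\<lambda>s. (chi s * cmod (gy (x, s)))\<^sup>2)" using i by (simp add: power_mult_distrib chi_props)
      show "integrable lborel (\<lambda>s. chi s * (chi s * cmod (gy (x, s))))" using iA by (simp only: e[symmetric])
    qed
    then show ?thesis unfolding A_def by (simp only: e[symmetric])
  qed
  also have "\<dots> = l * aF x" by (simp add: power_mult_distrib chi_props chi_integrable aF_def)
  finally show ?thesis .
qed

lemma locally_integrable_y_mean:
  fixes f :: "real \<times> real \<Rightarrow> complex"
  assumes f: "locally_integrable f"
  shows "integrable lborel (\<lambda>z. (indicator {a..b} (fst z) * chi (snd z)) *\<^sub>R f z)"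
    and "locally_integrable (\<lambda>x. (LINT y|lborel. chi y *\<^sub>R f (x, y)) / of_real l)"
proof -
  note [measurable] = locally_integrable_measurable[OF f]
  show i: "integrable lborel (\<lambda>z. (indicator {a..b} (fst z) * chi (snd z)) *\<^sub>R f z)" for a b
  proof (rule integrable_cutoff[OF f, where C = 1 and K = "{a..b} \<times> {0..l}"])
    show "\<bar>indicator {a..b} (fst z) * chi (snd z)\<bar> \<le> 1" for z by (simp add: chi_def indicator_def)
    show "indicator {a..b} (fst z) * chi (snd z) = 0" if "z \<notin> {a..b} \<times> {0..l}" for z
      using that by (cases z) (auto simp: chi_def indicator_def)
  qed (auto intro: compact_Times)
  show "locally_integrable (\<lambda>x. (LINT y|lborel. chi y *\<^sub>R f (x, y)) / of_real l)"
  proof (rule locally_integrable_1d)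
    fix a b :: real
    have "integrable lborel (\<lambda>x. LINT y|lborel. indicator {a..b} x *\<^sub>R (chi y *\<^sub>R f (x, y)))"
      using plane_integrable_y[OF i[of a b]] by simp
    then have "integrable lborel (\<lambda>x. indicator {a..b} x *\<^sub>R (LINT y|lborel. chi y *\<^sub>R f (x, y)))"
      unfolding integral_scaleR_right .
    then show "set_integrable lborel {a..b} (\<lambda>x. (LINT y|lborel. chi y *\<^sub>R f (x, y)) / of_real l)"
      unfolding set_integrable_def scaleR_divide_complex by (rule integrable_divide_zero)
  qed measurable
qed

definition gm :: "real \<Rightarrow> complex" where "gm x = (LINT y|lborel. chi y *\<^sub>R gx (x, y)) / of_real l"

lemma y_mean_fun: "y_mean l \<psi> = (\<lambda>x. (LINT y|lborel. chi y *\<^sub>R \<psi> (x, y)) / of_real l)"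
  using y_mean_eq by blast

lemma gm_li: "locally_integrable gm" "locally_integrable (y_mean l \<psi>)"
  unfolding gm_def[abs_def] y_mean_fun by (intro locally_integrable_y_mean(2) li)+

lemma gm_measurable[measurable]: "gm \<in> borel_measurable borel" "y_mean l \<psi> \<in> borel_measurable borel"
  using gm_li locally_integrable_measurable by blast+

lemma ac_slices: "AE y in lborel. \<exists>v. has_ac_derivative v (\<lambda>x. gx (x, y)) \<and> (AE x in lborel. \<psi> (x, y) = v x)"
  by (rule weak_partial_x_imp_ac[OF weak(1)])

text \<open>Averaging in y commutes with the weak x-derivative: Fubini brings the x-integral inside,
  integration by parts applies on almost every slice, and Fubini brings it out again.\<close>

lemma y_mean_weak: "has_weak_partial 1 (y_mean l \<psi>) gm"
  unfolding has_weak_partial_def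
proof (intro conjI allI impI gm_li)
  fix \<phi> :: "real \<Rightarrow> real" and D assume t: "test_function \<phi> D"
  define a' where "a' x = blinfun_apply (D x) 1" for x
  have a: "C1_compact \<phi> a'" unfolding a'_def[abs_def] by (rule test_function_real[OF t])
  note [measurable] = C1_compact_measurable[OF a]
  obtain N where N: "\<And>x. N < \<bar>x\<bar> \<Longrightarrow> \<phi> x = 0" "\<And>x. N < \<bar>x\<bar> \<Longrightarrow> a' x = 0" using C1_compact_support[OF a] by metis
  have cut: "integrable lborel (\<lambda>z. (c (fst z) * chi (snd z)) *\<^sub>R f z)"
    if c: "continuous_on UNIV c" "\<And>x. N < \<bar>x\<bar> \<Longrightarrow> c x = 0" and f: "locally_integrable f" for c and f :: "real \<times> real \<Rightarrow> complex"
  proof -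
    obtain C where C: "C \<ge> 0" "\<And>x. \<bar>c x\<bar> \<le> C" using continuous_compact_support_bounded[OF c] by metis
    have [measurable]: "c \<in> borel_measurable borel" using c(1) by (rule borel_measurable_continuous_onI)
    show ?thesis
    proof (rule integrable_cutoff[OF f, where C = C and K = "{-N..N} \<times> {0..l}"])
      show "\<bar>c (fst z) * chi (snd z)\<bar> \<le> C" for z using C by (auto simp: chi_def indicator_def)
      show "c (fst z) * chi (snd z) = 0" if "z \<notin> {-N..N} \<times> {0..l}" for z
        using that c(2)[of "fst z"] by (cases z) (force simp: chi_def indicator_def not_le)
    qed (auto intro: compact_Times)
  qed
  note i1 = cut[OF C1_compact_continuous(2)[OF a] N(2) li(1)] and i2 = cut[OF C1_compact_continuous(1)[OF a] N(1) li(2)]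
  have "(LINT x|lborel. a' x *\<^sub>R y_mean l \<psi> x) = (LINT x|lborel. (LINT y|lborel. (a' x * chi y) *\<^sub>R \<psi> (x, y)) / of_real l)"
    unfolding y_mean_eq scaleR_divide_complex scaleR_scaleR[symmetric] integral_scaleR_right ..
  also have "\<dots> = (LINT z|lborel. (a' (fst z) * chi (snd z)) *\<^sub>R \<psi> z) / of_real l"
    using plane_integral_y[OF i1] by simp
  also have "(LINT z|lborel. (a' (fst z) * chi (snd z)) *\<^sub>R \<psi> z) = (LINT y|lborel. LINT x|lborel. (a' x * chi y) *\<^sub>R \<psi> (x, y))"
    using plane_integral_x[OF i1] by simp
  also have "\<dots> = (LINT y|lborel. - (LINT x|lborel. (\<phi> x * chi y) *\<^sub>R gx (x, y)))"
  proof (rule integral_cong_AE)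
    show "(\<lambda>y. LINT x|lborel. (a' x * chi y) *\<^sub>R \<psi> (x, y)) \<in> borel_measurable lborel"
      using borel_measurable_integrable[OF plane_integrable_x[OF i1]] by simp
    show "(\<lambda>y. - (LINT x|lborel. (\<phi> x * chi y) *\<^sub>R gx (x, y))) \<in> borel_measurable lborel"
      using borel_measurable_integrable[OF plane_integrable_x[OF i2]] by simp
    from ac_slices show "AE y in lborel. (LINT x|lborel. (a' x * chi y) *\<^sub>R \<psi> (x, y)) = - (LINT x|lborel. (\<phi> x * chi y) *\<^sub>R gx (x, y))"
    proof eventually_elim
      case (elim y)
      then obtain v where v: "has_ac_derivative v (\<lambda>x. gx (x, y))" "AE x in lborel. \<psi> (x, y) = v x" by blast
      note [measurable] = ac_measurable_self[OF v(1)]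
      have "(LINT x|lborel. (a' x * chi y) *\<^sub>R \<psi> (x, y)) = (LINT x|lborel. chi y *\<^sub>R (a' x *\<^sub>R v x))"
        by (rule integral_cong_AE) (use v(2) in \<open>auto simp: mult.commute\<close>)
      also have "\<dots> = chi y *\<^sub>R (- (LINT x|lborel. \<phi> x *\<^sub>R gx (x, y)))"
        by (simp only: integral_scaleR_right integration_by_parts_C1_compact(3)[OF a v(1)])
      also have "\<dots> = - (LINT x|lborel. chi y *\<^sub>R (\<phi> x *\<^sub>R gx (x, y)))" by (simp only: integral_scaleR_right scaleR_minus_right)
      finally show ?case by (simp add: mult.commute)
    qed
  qed
  also have "\<dots> = - (LINT z|lborel. (\<phi> (fst z) * chi (snd z)) *\<^sub>R gx z)"
    using plane_integral_x[OF i2] by simp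
  also have "(LINT z|lborel. (\<phi> (fst z) * chi (snd z)) *\<^sub>R gx z) = (LINT x|lborel. LINT y|lborel. (\<phi> x * chi y) *\<^sub>R gx (x, y))"
    using plane_integral_y[OF i2] by simp
  also have "- \<dots> / of_real l = - (LINT x|lborel. (LINT y|lborel. (\<phi> x * chi y) *\<^sub>R gx (x, y)) / of_real l)" by simp
  also have "(LINT x|lborel. (LINT y|lborel. (\<phi> x * chi y) *\<^sub>R gx (x, y)) / of_real l) = (LINT x|lborel. \<phi> x *\<^sub>R gm x)"
    unfolding gm_def scaleR_divide_complex scaleR_scaleR[symmetric] integral_scaleR_right ..
  finally show "(LINT x|lborel. blinfun_apply (D x) 1 *\<^sub>R y_mean l \<psi> x) = - (LINT x|lborel. \<phi> x *\<^sub>R gm x)" unfolding a'_def .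
qed

end

lemma cmod_inner_bound: "\<bar>(\<i> * a) \<bullet> b\<bar> \<le> cmod a * cmod b"
  using Cauchy_Schwarz_ineq2[of "\<i> * a" b] by (simp add: norm_mult)

lemma young_product: "\<bar>a * b\<bar> \<le> (a\<^sup>2 + b\<^sup>2 :: real)"
proof -
  have "0 \<le> (\<bar>a\<bar> - \<bar>b\<bar>)\<^sup>2" by simp
  then have "2 * (\<bar>a\<bar> * \<bar>b\<bar>) \<le> a\<^sup>2 + b\<^sup>2" by (simp add: power2_diff)
  moreover have "0 \<le> \<bar>a\<bar> * \<bar>b\<bar>" by simp
  ultimately have "\<bar>a\<bar> * \<bar>b\<bar> \<le> a\<^sup>2 + b\<^sup>2" by linarith
  then show ?thesis by (simp add: abs_mult)
qed

lemma cmod_add_square: "(cmod (a + b))\<^sup>2 \<le> 2 * (cmod a)\<^sup>2 + 2 * (cmod b)\<^sup>2"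
proof -
  have "(cmod (a + b))\<^sup>2 \<le> (cmod a + cmod b)\<^sup>2" by (intro power_mono norm_triangle_ineq) auto
  also have "\<dots> \<le> 2 * (cmod a)\<^sup>2 + 2 * (cmod b)\<^sup>2"
    using sum_squares_bound[of "cmod a" "cmod b"] by (simp add: power2_sum)
  finally show ?thesis .
qed

context strip_function
begin

definition w :: "real \<times> real \<Rightarrow> complex" where "w z = \<psi> z - y_mean l \<psi> (fst z)"

lemma w_measurable[measurable]: "w \<in> borel_measurable borel"
  unfolding w_def[abs_def] by measurable

lemma AE_w_bound: "AE z in lborel. snd z \<in> {0..<l} \<longrightarrow> (cmod (w z))\<^sup>2 \<le> l * aF (fst z)"
proof (rule AE_plane_from_x)
  have "{z \<in> space borel. snd z \<in> {0..<l} \<longrightarrow> (cmod (w z))\<^sup>2 \<le> l * aF (fst z)} \<in> sets borel" by measurable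
  then show "{z. snd z \<in> {0..<l} \<longrightarrow> (cmod (w z))\<^sup>2 \<le> l * aF (fst z)} \<in> sets borel" by simp
  from weak_partial_y_imp_ac[OF weak(2)] plane_AE_integrable_y[OF integrable_L2(2)]
  show "AE x in lborel. AE y in lborel. snd (x, y) \<in> {0..<l} \<longrightarrow> (cmod (w (x, y)))\<^sup>2 \<le> l * aF (fst (x, y))"
  proof eventually_elim
    case (elim x)
    then obtain v where v: "has_ac_derivative v (\<lambda>y. gy (x, y))" "AE y in lborel. \<psi> (x, y) = v y" by blast
    from v(2) show ?case
    proof eventually_elim
      case (elim y)
      have i: "integrable lborel (\<lambda>y. chi y * (cmod (gy (x, y)))\<^sup>2)" using \<open>integrable lborel (\<lambda>y. chi (snd (x, y)) * (cmod (gy (x, y)))\<^sup>2)\<close> by simp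
      show ?case using mean_oscillation_slice[OF v i, of y] elim by (simp add: w_def)
    qed
  qed
qed

lemma AE_slice_w_bound: "AE y in lborel. AE x in lborel. y \<in> {0..<l} \<longrightarrow> (cmod (w (x, y)))\<^sup>2 \<le> l * aF x"
  using plane_AE_x[OF AE_w_bound] by simp

lemma gm_bound: "AE x in lborel. l * (cmod (gm x))\<^sup>2 \<le> (LINT y|lborel. chi y * (cmod (gx (x, y)))\<^sup>2)"
  using plane_AE_integrable_y[OF integrable_L2(1)]
proof eventually_elim
  case (elim x)
  note [measurable] = borel_measurable_slice[OF meas(2)]
  have i: "integrable lborel (\<lambda>y. (chi y * cmod (gx (x, y)))\<^sup>2)" using elim by (simp add: power_mult_distrib chi_props)
  have i2: "integrable lborel (\<lambda>y. (chi y)\<^sup>2)" by (simp add: chi_props chi_integrable)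
  have i3: "integrable lborel (\<lambda>y. chi y * (chi y * cmod (gx (x, y))))"
    by (rule integrable_real_product[OF i2 i]) measurable
  have "l * cmod (gm x) = cmod (LINT y|lborel. chi y *\<^sub>R gx (x, y))"
    using l by (simp add: gm_def norm_divide)
  also have "\<dots> \<le> (LINT y|lborel. cmod (chi y *\<^sub>R gx (x, y)))" by (rule integral_norm_bound)
  also have "\<dots> = (LINT y|lborel. chi y * (chi y * cmod (gx (x, y))))"
    by (intro Bochner_Integration.integral_cong refl) (simp add: mult.assoc[symmetric] chi_props)
  finally have "(l * cmod (gm x))\<^sup>2 \<le> (LINT y|lborel. chi y * (chi y * cmod (gx (x, y))))\<^sup>2"
    using l by (intro power_mono) auto
  also have "\<dots> \<le> (LINT y|lborel. (chi y)\<^sup>2) * (LINT y|lborel. (chi y * cmod (gx (x, y)))\<^sup>2)"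
    by (rule integral_Cauchy_Schwarz[OF i2 i i3])
  also have "\<dots> = l * (LINT y|lborel. chi y * (cmod (gx (x, y)))\<^sup>2)" by (simp add: power_mult_distrib chi_props chi_integrable)
  finally have "l * (l * (cmod (gm x))\<^sup>2) \<le> l * (LINT y|lborel. chi y * (cmod (gx (x, y)))\<^sup>2)"
    by (simp add: power_mult_distrib power2_eq_square ac_simps)
  then show ?case using l by simp
qed

lemma gm_L2: "integrable lborel (\<lambda>x. (cmod (gm x))\<^sup>2)" "l * (LINT x|lborel. (cmod (gm x))\<^sup>2) \<le> Dx"
proof -
  have i: "integrable lborel (\<lambda>x. LINT y|lborel. chi y * (cmod (gx (x, y)))\<^sup>2)"
    using plane_integrable_y[OF integrable_L2(1)] by simp
  have il: "integrable lborel (\<lambda>x. l * (cmod (gm x))\<^sup>2)"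
  proof (rule Bochner_Integration.integrable_bound[OF i])
    show "AE x in lborel. norm (l * (cmod (gm x))\<^sup>2) \<le> norm (LINT y|lborel. chi y * (cmod (gx (x, y)))\<^sup>2)"
      using gm_bound by eventually_elim (use l in auto)
  qed measurable
  then show "integrable lborel (\<lambda>x. (cmod (gm x))\<^sup>2)" using l by simp
  have "(LINT x|lborel. l * (cmod (gm x))\<^sup>2) \<le> (LINT x|lborel. LINT y|lborel. chi y * (cmod (gx (x, y)))\<^sup>2)"
    by (rule integral_mono_AE[OF il i gm_bound])
  then show "l * (LINT x|lborel. (cmod (gm x))\<^sup>2) \<le> Dx"
    using plane_integral_y[OF integrable_L2(1)] by (simp add: Dx_def)
qed

lemma integrable_chi_gm: "integrable lborel (\<lambda>z::real \<times> real. chi (snd z) * (cmod (gm (fst z)))\<^sup>2)"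
  using integrable_tensor[OF gm_L2(1) chi_integrable(1)] by (simp add: mult.commute)

lemma integral_chi_gm: "(LINT z|lborel. chi (snd (z::real \<times> real)) * (cmod (gm (fst z)))\<^sup>2) \<le> Dx"
proof -
  have "(LINT z|lborel. chi (snd (z::real \<times> real)) * (cmod (gm (fst z)))\<^sup>2) = (LINT y|lborel. LINT x|lborel. chi y * (cmod (gm x))\<^sup>2)"
    using plane_integral_x[OF integrable_chi_gm] by simp
  also have "\<dots> = l * (LINT x|lborel. (cmod (gm x))\<^sup>2)" by (simp add: chi_integrable)
  finally show ?thesis using gm_L2(2) by simp
qed

lemma integrable_chi_w: "integrable lborel (\<lambda>z. chi (snd z) * (cmod (w z))\<^sup>2)"
proof (rule Bochner_Integration.integrable_bound)
  show "integrable lborel (\<lambda>z::real \<times> real. (l * aF (fst z)) *\<^sub>R chi (snd z))"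
    using aF_integrable(1) by (intro integrable_tensor integrable_mult_right chi_integrable)
  show "AE z in lborel. norm (chi (snd z) * (cmod (w z))\<^sup>2) \<le> norm ((l * aF (fst z)) *\<^sub>R chi (snd z))"
    using AE_w_bound
  proof eventually_elim
    case (elim z)
    show ?case
    proof (cases "snd z \<in> {0..<l}")
      case True
      then show ?thesis using elim aF_nonneg[of "fst z"] l by (simp add: chi_props)
    qed (simp add: chi_props)
  qed
qed measurable

definition jw :: "(real \<times> real \<Rightarrow> complex) \<Rightarrow> real \<times> real \<Rightarrow> real" where
  "jw h z = chi (snd z) * ((\<i> * h z) \<bullet> w z)"

lemma integrable_jw:
  assumes [measurable]: "h \<in> borel_measurable borel" and h: "integrable lborel (\<lambda>z. chi (snd z) * (cmod (h z))\<^sup>2)"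
  shows "integrable lborel (jw h)"
proof (rule Bochner_Integration.integrable_bound[OF Bochner_Integration.integrable_add[OF h integrable_chi_w]])
  show "jw h \<in> borel_measurable lborel" unfolding jw_def[abs_def] by measurable
  show "AE z in lborel. norm (jw h z) \<le> norm (chi (snd z) * (cmod (h z))\<^sup>2 + chi (snd z) * (cmod (w z))\<^sup>2)"
  proof (rule AE_I2)
    fix z
    have "\<bar>(\<i> * h z) \<bullet> w z\<bar> \<le> (cmod (h z))\<^sup>2 + (cmod (w z))\<^sup>2"
      using order_trans[OF cmod_inner_bound, of "h z" "w z"] young_product[of "cmod (h z)" "cmod (w z)"] by simp
    then have "chi (snd z) * \<bar>(\<i> * h z) \<bullet> w z\<bar> \<le> chi (snd z) * ((cmod (h z))\<^sup>2 + (cmod (w z))\<^sup>2)"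
      by (intro mult_left_mono) (auto simp: chi_props)
    then show "norm (jw h z) \<le> norm (chi (snd z) * (cmod (h z))\<^sup>2 + chi (snd z) * (cmod (w z))\<^sup>2)"
      by (simp add: jw_def abs_mult chi_props distrib_left)
  qed
qed

lemma integrable_chi_gx_plus: "integrable lborel (\<lambda>z. chi (snd z) * (cmod (gm (fst z) + gx z))\<^sup>2)"
  "(LINT z|lborel. chi (snd z) * (cmod (gm (fst z) + gx z))\<^sup>2) \<le> 4 * Dx"
proof -
  have b: "integrable lborel (\<lambda>z. 2 * (chi (snd z) * (cmod (gm (fst z)))\<^sup>2) + 2 * (chi (snd z) * (cmod (gx z))\<^sup>2))"
    using integrable_chi_gm integrable_L2(1) by (intro Bochner_Integration.integrable_add integrable_mult_right)
  have le: "chi (snd z) * (cmod (gm (fst z) + gx z))\<^sup>2 \<le> 2 * (chi (snd z) * (cmod (gm (fst z)))\<^sup>2) + 2 * (chi (snd z) * (cmod (gx z))\<^sup>2)" for z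
    using mult_left_mono[OF cmod_add_square[of "gm (fst z)" "gx z"] chi_props(1)[of "snd z"]] by (simp add: algebra_simps)
  show i: "integrable lborel (\<lambda>z. chi (snd z) * (cmod (gm (fst z) + gx z))\<^sup>2)"
  proof (rule Bochner_Integration.integrable_bound[OF b])
    show "AE z in lborel. norm (chi (snd z) * (cmod (gm (fst z) + gx z))\<^sup>2) \<le> norm (2 * (chi (snd z) * (cmod (gm (fst z)))\<^sup>2) + 2 * (chi (snd z) * (cmod (gx z))\<^sup>2))"
      using le by (intro AE_I2) (simp add: chi_props abs_of_nonneg)
  qed measurable
  have "(LINT z|lborel. chi (snd z) * (cmod (gm (fst z) + gx z))\<^sup>2) \<le> (LINT z|lborel. 2 * (chi (snd z) * (cmod (gm (fst z)))\<^sup>2) + 2 * (chi (snd z) * (cmod (gx z))\<^sup>2))"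
    by (rule integral_mono[OF i b le])
  also have "\<dots> = 2 * (LINT z|lborel. chi (snd (z::real \<times> real)) * (cmod (gm (fst z)))\<^sup>2) + 2 * Dx"
    using integrable_chi_gm integrable_L2(1) by (simp add: Dx_def)
  finally show "(LINT z|lborel. chi (snd z) * (cmod (gm (fst z) + gx z))\<^sup>2) \<le> 4 * Dx" using integral_chi_gm by linarith
qed

lemma w_mean_zero: "AE x in lborel. integrable lborel (\<lambda>y. chi y *\<^sub>R w (x, y)) \<and> (LINT y|lborel. chi y *\<^sub>R w (x, y)) = 0"
proof -
  have "AE x in lborel. \<forall>n::nat. integrable lborel (\<lambda>y. (indicator {- real n..real n} x * chi y) *\<^sub>R \<psi> (x, y))"
    using plane_AE_integrable_y[OF locally_integrable_y_mean(1)[OF li(1)]] by (intro AE_all_countable[THEN iffD2] allI) simp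
  then show ?thesis
  proof eventually_elim
    case (elim x)
    obtain n :: nat where n: "\<bar>x\<bar> < real n" using reals_Archimedean2 by blast
    then have "x \<in> {- real n..real n}" by auto
    then have i: "integrable lborel (\<lambda>y. chi y *\<^sub>R \<psi> (x, y))" using elim[rule_format, of n] by simp
    have i2: "integrable lborel (\<lambda>y. chi y *\<^sub>R y_mean l \<psi> x)" using chi_integrable by simp
    have e: "(\<lambda>y. chi y *\<^sub>R w (x, y)) = (\<lambda>y. chi y *\<^sub>R \<psi> (x, y) - chi y *\<^sub>R y_mean l \<psi> x)"
      by (simp add: w_def scaleR_diff_right)
    have "(LINT y|lborel. chi y *\<^sub>R w (x, y)) = (LINT y|lborel. chi y *\<^sub>R \<psi> (x, y)) - (LINT y|lborel. chi y *\<^sub>R y_mean l \<psi> x)"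
      unfolding e by (rule Bochner_Integration.integral_diff[OF i i2])
    also have "(LINT y|lborel. chi y *\<^sub>R y_mean l \<psi> x) = l *\<^sub>R y_mean l \<psi> x" using chi_integrable by simp
    also have "\<dots> = (LINT y|lborel. chi y *\<^sub>R \<psi> (x, y))" using l by (simp add: y_mean_eq scaleR_conv_of_real)
    finally show ?case unfolding e using Bochner_Integration.integrable_diff[OF i i2] by simp
  qed
qed

text \<open>The fluctuation \<open>w\<close> has mean zero on almost every vertical slice, so
  anything that depends on x alone pairs to zero with it.\<close>

lemma integral_jw_gm: "(LINT z|lborel. jw (\<lambda>z. gm (fst z)) z) = 0"
proof -
  have i: "integrable lborel (jw (\<lambda>z. gm (fst z)))" by (rule integrable_jw[OF _ integrable_chi_gm]) measurable
  have "(LINT z|lborel. jw (\<lambda>z. gm (fst z)) z) = (LINT x|lborel. LINT y|lborel. jw (\<lambda>z. gm (fst z)) (x, y))"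
    using plane_integral_y[OF i] by simp
  also have "\<dots> = (LINT x|(lborel :: real measure). (0::real))"
  proof (rule integral_cong_AE)
    show "(\<lambda>x. LINT y|lborel. jw (\<lambda>z. gm (fst z)) (x, y)) \<in> borel_measurable lborel"
      by (rule borel_measurable_integrable[OF plane_integrable_y[OF i]])
    show "AE x in lborel. (LINT y|lborel. jw (\<lambda>z. gm (fst z)) (x, y)) = 0"
      using w_mean_zero
    proof eventually_elim
      case (elim x)
      have "(LINT y|lborel. jw (\<lambda>z. gm (fst z)) (x, y)) = (LINT y|lborel. (\<i> * gm x) \<bullet> (chi y *\<^sub>R w (x, y)))"
        by (simp add: jw_def)
      also have "\<dots> = (\<i> * gm x) \<bullet> (LINT y|lborel. chi y *\<^sub>R w (x, y))"
        using elim by (intro integral_inner_right) auto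
      finally show ?case using elim by simp
    qed
  qed simp
  finally show ?thesis by simp
qed

text \<open>The definition contains the derivative \<open>gx - gm\<close> of the fluctuation. Adding
  twice \<open>gm\<close> changes nothing, since it pairs to zero with \<open>w\<close>, and yields
  the expression \<open>gm + gx\<close> that \<open>momentum_limit_perturb\<close> produces when a
  slice is compared with the mean profile.\<close>

lemma momentum_2d_eq:
  "momentum_2d l \<psi> = (\<lambda>p. p + 1 / (2 * l) * (LINT z|lborel. jw (\<lambda>z. gm (fst z) + gx z) z)) ` momentum_1d (y_mean l \<psi>)"
proof -
  have "has_weak_partial (1, 0) (\<lambda>z. \<psi> z - y_mean l \<psi> (fst z)) (\<lambda>z. gx z - gm (fst z))"
    by (rule has_weak_partial_diff[OF weak(1) has_weak_partial_fst[OF y_mean_weak]])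
  then have "has_weak_partial (1, 0) w (\<lambda>z. gx z - gm (fst z))" unfolding w_def[abs_def] .
  note wp = weak_partial_eq[OF this]
  note [measurable] = locally_integrable_measurable[OF has_weak_partial_locally_integrable(2)[OF wp(1)]]
  have w': "(\<lambda>(x, y). \<psi> (x, y) - y_mean l \<psi> x) = w" by (auto simp: w_def)
  have i1: "integrable lborel (jw (\<lambda>z. gm (fst z) + gx z))" by (rule integrable_jw[OF _ integrable_chi_gx_plus(1)]) measurable
  have i2: "integrable lborel (jw (\<lambda>z. gm (fst z)))" by (rule integrable_jw[OF _ integrable_chi_gm]) measurable
  have "(LINT z:strip l|lborel. (\<i> * weak_partial (1, 0) w z) \<bullet> w z) = (LINT z|lborel. jw (\<lambda>z. gm (fst z) + gx z) z - 2 * jw (\<lambda>z. gm (fst z)) z)"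
    unfolding set_lebesgue_integral_def indicator_strip
  proof (rule integral_cong_AE)
    show "AE z in lborel. chi (snd z) *\<^sub>R ((\<i> * weak_partial (1, 0) w z) \<bullet> w z) = jw (\<lambda>z. gm (fst z) + gx z) z - 2 * jw (\<lambda>z. gm (fst z)) z"
      using wp(2)
    proof eventually_elim
      case (elim z)
      show ?case unfolding elim by (simp add: jw_def inner_complex_def algebra_simps)
    qed
  qed (unfold jw_def, measurable)
  also have "\<dots> = (LINT z|lborel. jw (\<lambda>z. gm (fst z) + gx z) z)"
    using i1 i2 integral_jw_gm by simp
  finally show ?thesis unfolding momentum_2d_def w' Let_def by simp
qed

text \<open>Twice the amount by which the momentum of the slice at height \<open>y\<close> exceeds
  the momentum of the mean profile.\<close>

definition q :: "real \<Rightarrow> real" where "q y = (LINT x|lborel. jw (\<lambda>z. gm (fst z) + gx z) (x, y))"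
definition e :: "real \<Rightarrow> real" where
  "e y = (LINT x|lborel. 1/2 * (chi y * (cmod (gx (x, y)))\<^sup>2) + 1/4 * (chi y * (1 - (cmod (\<psi> (x, y)))\<^sup>2)\<^sup>2))"

lemma integrable_jw_plus: "integrable lborel (jw (\<lambda>z. gm (fst z) + gx z))"
  by (rule integrable_jw[OF _ integrable_chi_gx_plus(1)]) measurable

lemma q_integrable: "integrable lborel q" "(LINT y|lborel. q y) = (LINT z|lborel. jw (\<lambda>z. gm (fst z) + gx z) z)"
  unfolding q_def[abs_def] using plane_integrable_x[OF integrable_jw_plus] plane_integral_x[OF integrable_jw_plus] by auto

lemma e_integrable: "integrable lborel e" "(LINT y|lborel. e y) = 1/2 * Dx + 1/4 * V"
proof -
  have i: "integrable lborel (\<lambda>z. 1/2 * (chi (snd z) * (cmod (gx z))\<^sup>2) + 1/4 * (chi (snd z) * (1 - (cmod (\<psi> z))\<^sup>2)\<^sup>2))"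
    using integrable_L2 by (intro Bochner_Integration.integrable_add integrable_mult_right)
  show "integrable lborel e" unfolding e_def[abs_def] using plane_integrable_x[OF i] by simp
  have "(LINT y|lborel. e y) = (LINT z|lborel. 1/2 * (chi (snd z) * (cmod (gx z))\<^sup>2) + 1/4 * (chi (snd z) * (1 - (cmod (\<psi> z))\<^sup>2)\<^sup>2))"
    unfolding e_def using plane_integral_x[OF i] by simp
  then show "(LINT y|lborel. e y) = 1/2 * Dx + 1/4 * V" using integrable_L2 by (simp add: Dx_def V_def)
qed

text \<open>Cauchy-Schwarz in x. The factor containing \<open>w\<close> is bounded by
  \<open>l * aF x\<close>, uniformly in the height, and \<open>aF\<close> integrates to
  \<open>Dy\<close>. The smallness of the fluctuation thus comes entirely from the transverse
  derivative.\<close>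

lemma q_square_bound: "AE y in lborel. (q y)\<^sup>2 \<le> (l * Dy) * (LINT x|lborel. chi y * (cmod (gm x + gx (x, y)))\<^sup>2)"
  using AE_slice_w_bound plane_AE_integrable_x[OF integrable_chi_gx_plus(1)] plane_AE_integrable_x[OF integrable_chi_w]
proof eventually_elim
  case (elim y)
  note [measurable] = borel_measurable_slice[OF meas(2)] borel_measurable_slice[OF w_measurable]
  define f g where "f x = chi y * cmod (gm x + gx (x, y))" and "g x = chi y * cmod (w (x, y))" for x
  have f2: "integrable lborel (\<lambda>x. (f x)\<^sup>2)" using elim(2) by (simp add: f_def power_mult_distrib chi_props)
  have g2: "integrable lborel (\<lambda>x. (g x)\<^sup>2)" using elim(3) by (simp add: g_def power_mult_distrib chi_props)
  have fg: "integrable lborel (\<lambda>x. f x * g x)"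
    by (rule integrable_real_product[OF f2 g2]) (unfold f_def g_def, measurable)
  have "\<bar>q y\<bar> \<le> (LINT x|lborel. \<bar>jw (\<lambda>z. gm (fst z) + gx z) (x, y)\<bar>)"
    unfolding q_def by (rule integral_abs_bound)
  also have "\<dots> \<le> (LINT x|lborel. f x * g x)"
  proof (rule integral_mono'[OF fg])
    show "\<bar>jw (\<lambda>z. gm (fst z) + gx z) (x, y)\<bar> \<le> f x * g x" for x
      using mult_left_mono[OF cmod_inner_bound[of "gm x + gx (x, y)" "w (x, y)"] chi_props(1)[of y]]
      by (cases "y \<in> {0..<l}") (simp_all add: jw_def f_def g_def abs_mult chi_props)
    show "0 \<le> f x * g x" for x by (simp add: f_def g_def chi_props)
  qed
  finally have "\<bar>q y\<bar> \<le> (LINT x|lborel. f x * g x)" .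
  then have "(q y)\<^sup>2 \<le> (LINT x|lborel. f x * g x)\<^sup>2" by (metis abs_ge_zero power2_abs power_mono)
  also have "\<dots> \<le> (LINT x|lborel. (f x)\<^sup>2) * (LINT x|lborel. (g x)\<^sup>2)" by (rule integral_Cauchy_Schwarz[OF f2 g2 fg])
  also have "\<dots> \<le> (LINT x|lborel. (f x)\<^sup>2) * (LINT x|lborel. l * aF x)"
  proof (rule mult_left_mono)
    show "(LINT x|lborel. (g x)\<^sup>2) \<le> (LINT x|lborel. l * aF x)"
    proof (rule integral_mono_AE[OF g2])
      show "AE x in lborel. (g x)\<^sup>2 \<le> l * aF x"
        using elim(1)
      proof eventually_elim
        case (elim x)
        then show ?case using l aF_nonneg[of x] by (cases "y \<in> {0..<l}") (auto simp: g_def chi_props)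
      qed
    qed (use aF_integrable in simp)
  qed simp
  also have "\<dots> = (l * Dy) * (LINT x|lborel. chi y * (cmod (gm x + gx (x, y)))\<^sup>2)"
    using aF_integrable by (simp add: f_def power_mult_distrib chi_props)
  finally show ?case .
qed

lemma q_square: "integrable lborel (\<lambda>y. (q y)\<^sup>2)" "(LINT y|lborel. (q y)\<^sup>2) \<le> 4 * l * Dx * Dy"
proof -
  have [measurable]: "q \<in> borel_measurable borel" using borel_measurable_integrable[OF q_integrable(1)] by simp
  have i: "integrable lborel (\<lambda>y. (l * Dy) * (LINT x|lborel. chi y * (cmod (gm x + gx (x, y)))\<^sup>2))"
    using plane_integrable_x[OF integrable_chi_gx_plus(1)] by simp
  show qi: "integrable lborel (\<lambda>y. (q y)\<^sup>2)"
  proof (rule Bochner_Integration.integrable_bound[OF i])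
    show "AE y in lborel. norm ((q y)\<^sup>2) \<le> norm ((l * Dy) * (LINT x|lborel. chi y * (cmod (gm x + gx (x, y)))\<^sup>2))"
      using q_square_bound by eventually_elim auto
  qed measurable
  have "(LINT y|lborel. (q y)\<^sup>2) \<le> (LINT y|lborel. (l * Dy) * (LINT x|lborel. chi y * (cmod (gm x + gx (x, y)))\<^sup>2))"
    by (rule integral_mono_AE[OF qi i q_square_bound])
  also have "\<dots> = (l * Dy) * (LINT z|lborel. chi (snd z) * (cmod (gm (fst z) + gx z))\<^sup>2)"
    using plane_integral_x[OF integrable_chi_gx_plus(1)] by simp
  also have "\<dots> \<le> (l * Dy) * (4 * Dx)"
    using l D_nonneg integrable_chi_gx_plus(2) by (intro mult_left_mono) auto
  finally show "(LINT y|lborel. (q y)\<^sup>2) \<le> 4 * l * Dx * Dy" by (simp add: ac_simps)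
qed

lemma y_mean_ac:
  assumes v: "continuous_on UNIV v" "AE x in lborel. v x = y_mean l \<psi> x"
  shows "has_ac_derivative v gm"
proof -
  obtain v' where v': "has_ac_derivative v' gm" "AE x in lborel. y_mean l \<psi> x = v' x"
    using weak_partial_imp_ac_1d[OF y_mean_weak] by blast
  have "v = v'" by (rule continuous_AE_eq[OF v(1) ac_continuous_on[OF v'(1)]]) (use v(2) v'(2) in \<open>eventually_elim, simp\<close>)
  then show ?thesis using v' by simp
qed

text \<open>For almost every height, slice minus mean profile is the slice of \<open>w\<close>,
  which is square integrable, so the perturbation theorem for momenta applies. The slice has to be
  replaced by its continuous representative \<open>u\<close>.\<close>

lemma slice_momentum:
  assumes v: "has_ac_derivative v gm" "AE x in lborel. v x = y_mean l \<psi> x"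
    and lim: "((\<lambda>R. cis (2 * momentum_upto v R)) \<longlongrightarrow> cis (2 * p)) at_top"
  shows "AE y in lborel. y \<in> {0..<l} \<longrightarrow> (\<exists>u. (AE x in lborel. \<psi> (x, y) = u x) \<and> finite_energy_1d u (\<lambda>x. gx (x, y)) \<and>
     energy_1d u (\<lambda>x. gx (x, y)) = e y \<and> momentum_limit_1d u (\<lambda>x. gx (x, y)) (p + 1/2 * q y))"
  using ac_slices AE_slice_w_bound plane_AE_integrable_x[OF integrable_L2(1)] plane_AE_integrable_x[OF integrable_L2(3)]
    plane_AE_integrable_x[OF integrable_chi_w] plane_AE_integrable_x[OF integrable_jw_plus]
proof eventually_elim
  case (elim y)
  show ?case
  proof (rule impI)
    assume y: "y \<in> {0..<l}"
    then have chi1: "chi y = 1" by (rule chi_props)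
    obtain u where u: "has_ac_derivative u (\<lambda>x. gx (x, y))" "AE x in lborel. \<psi> (x, y) = u x" using elim(1) by blast
    note [measurable] = ac_measurable_self[OF u(1)] ac_measurable[OF u(1)] borel_measurable_slice[OF meas(1)] borel_measurable_slice[OF w_measurable]
      ac_measurable_self[OF v(1)]
    have uv: "AE x in lborel. u x - v x = w (x, y)" using u(2) v(2) by eventually_elim (simp add: w_def)
    have pot: "integrable lborel (\<lambda>x. (1 - (cmod (u x))\<^sup>2)\<^sup>2)"
    proof (rule integrable_cong_AE_imp)
      show "integrable lborel (\<lambda>x. (1 - (cmod (\<psi> (x, y)))\<^sup>2)\<^sup>2)" using elim(4) by (simp add: chi1)
      show "AE x in lborel. (1 - (cmod (\<psi> (x, y)))\<^sup>2)\<^sup>2 = (1 - (cmod (u x))\<^sup>2)\<^sup>2" using u(2) by eventually_elim simp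
    qed measurable
    have fe: "finite_energy_1d u (\<lambda>x. gx (x, y))"
      unfolding finite_energy_1d_def using u(1) pot elim(3) by (simp add: chi1)
    moreover have "energy_1d u (\<lambda>x. gx (x, y)) = e y"
      unfolding energy_1d_def e_def
    proof (rule integral_cong_AE)
      show "AE x in lborel. 1/2 * (cmod (gx (x, y)))\<^sup>2 + 1/4 * (1 - (cmod (u x))\<^sup>2)\<^sup>2 = 1/2 * (chi y * (cmod (gx (x, y)))\<^sup>2) + 1/4 * (chi y * (1 - (cmod (\<psi> (x, y)))\<^sup>2)\<^sup>2)"
        using u(2) by eventually_elim (simp add: chi1)
    qed measurable
    moreover have "momentum_limit_1d u (\<lambda>x. gx (x, y)) (p + 1/2 * (LINT x|lborel. (\<i> * (gm x + gx (x, y))) \<bullet> (u x - v x)))"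
    proof (rule momentum_limit_perturb[OF fe v(1) lim])
      show "integrable lborel (\<lambda>x. (cmod (u x - v x))\<^sup>2)"
      proof (rule integrable_cong_AE_imp)
        show "integrable lborel (\<lambda>x. (cmod (w (x, y)))\<^sup>2)" using elim(5) by (simp add: chi1)
        show "AE x in lborel. (cmod (w (x, y)))\<^sup>2 = (cmod (u x - v x))\<^sup>2" using uv by eventually_elim simp
      qed measurable
      show "integrable lborel (\<lambda>x. (\<i> * (gm x + gx (x, y))) \<bullet> (u x - v x))"
      proof (rule integrable_cong_AE_imp)
        show "integrable lborel (\<lambda>x. jw (\<lambda>z. gm (fst z) + gx z) (x, y))" by (rule elim(6))
        show "AE x in lborel. jw (\<lambda>z. gm (fst z) + gx z) (x, y) = (\<i> * (gm x + gx (x, y))) \<bullet> (u x - v x)"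
          using uv by eventually_elim (simp add: jw_def chi1)
      qed measurable
    qed
    moreover have "(LINT x|lborel. (\<i> * (gm x + gx (x, y))) \<bullet> (u x - v x)) = q y"
      unfolding q_def
    proof (rule integral_cong_AE)
      show "AE x in lborel. (\<i> * (gm x + gx (x, y))) \<bullet> (u x - v x) = jw (\<lambda>z. gm (fst z) + gx z) (x, y)"
        using uv by eventually_elim (simp add: jw_def chi1)
    qed (unfold jw_def, measurable)
    ultimately show "\<exists>u. (AE x in lborel. \<psi> (x, y) = u x) \<and> finite_energy_1d u (\<lambda>x. gx (x, y)) \<and>
       energy_1d u (\<lambda>x. gx (x, y)) = e y \<and> momentum_limit_1d u (\<lambda>x. gx (x, y)) (p + 1/2 * q y)"
      using u(2) by auto
  qed
qed

end

lemma ac_derivative_unique: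
  fixes v :: "real \<Rightarrow> complex"
  assumes "has_ac_derivative v g" "has_ac_derivative v h"
  shows "AE x in lborel. g x = h x"
proof -
  have "has_weak_partial 1 v g" "has_weak_partial 1 v h"
    by (auto intro!: weak_partial_if_ac_1d assms ac_measurable_self[OF assms(1)])
  from weak_partial_eq_1d(2)[OF this(1)] weak_partial_eq_1d(2)[OF this(2)] show ?thesis
    by eventually_elim simp
qed

context strip_function
begin

text \<open>The parabola is integrated over the heights. A slice deviates from the prescribed
  momentum by \<open>1/2 * q y - m\<close>, which has mean zero; the linear term drops out, and the
  quadratic one is at most \<open>K * l * Dx * Dy\<close>. In between, a nonnegative term
  \<open>K * m\<^sup>2 * l\<close> is given away.\<close>

lemma energy_lower_bound:
  assumes K: "0 \<le> K" "\<And>v g P. finite_energy_1d v g \<Longrightarrow> momentum_limit_1d v g P \<Longrightarrow>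
     soliton_energy \<omega> - sqrt 2 * sin \<omega> * (P - soliton_momentum \<omega>) - K * (P - soliton_momentum \<omega>)\<^sup>2 \<le> energy_1d v g"
    and mom: "soliton_momentum \<omega> \<in> momentum_2d l \<psi>"
  shows "l * soliton_energy \<omega> + 1/2 * Dy - K * l * Dx * Dy \<le> l * energy l \<psi>"
proof -
  define m where "m = 1 / (2 * l) * (LINT y|lborel. q y)"
  obtain p where p: "p \<in> momentum_1d (y_mean l \<psi>)" "soliton_momentum \<omega> = p + m"
    using mom unfolding momentum_2d_eq m_def q_integrable(2) by blast
  obtain v where v: "continuous_on UNIV v" "AE x in lborel. v x = y_mean l \<psi> x"
    "((\<lambda>R. cis (2 * momentum_upto v R)) \<longlongrightarrow> cis (2 * p)) at_top" using momentum_1dD[OF p(1)] by blast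
  define I s where "I = soliton_energy \<omega>" and "s = sqrt 2 * sin \<omega>"
  \<comment> \<open>The cutoff to one period is already contained in \<open>q\<close>, so its
    integrals over the line are integrals over a period.\<close>
  have chiq: "chi y * q y = q y" for y
    unfolding q_def integral_mult_right_zero[symmetric] jw_def snd_conv by (simp add: mult.assoc[symmetric] chi_props)
  have chiq2: "chi y * (q y)\<^sup>2 = (q y)\<^sup>2" for y
    using chiq[of y] by (metis mult.assoc power2_eq_square)
  have lower: "AE y in lborel. (I + s * m - K * m\<^sup>2) * chi y + (K * m - s / 2) * q y - K / 4 * (q y)\<^sup>2 \<le> e y"
    using slice_momentum[OF y_mean_ac[OF v(1,2)] v(2,3)]
  proof eventually_elim
    case (elim y)
    show ?case
    proof (cases "y \<in> {0..<l}")
      case True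
      then obtain u where "finite_energy_1d u (\<lambda>x. gx (x, y))" "energy_1d u (\<lambda>x. gx (x, y)) = e y"
        "momentum_limit_1d u (\<lambda>x. gx (x, y)) (p + 1/2 * q y)" using elim by blast
      then have "I - s * (p + 1/2 * q y - soliton_momentum \<omega>) - K * (p + 1/2 * q y - soliton_momentum \<omega>)\<^sup>2 \<le> e y"
        using K(2) unfolding I_def s_def by metis
      moreover have "p + 1/2 * q y - soliton_momentum \<omega> = 1/2 * q y - m" using p(2) by simp
      ultimately have "I - s * (1/2 * q y - m) - K * (1/2 * q y - m)\<^sup>2 \<le> e y" by (simp only:)
      moreover have "I - s * (1/2 * q y - m) - K * (1/2 * q y - m)\<^sup>2 = (I + s * m - K * m\<^sup>2) * 1 + (K * m - s / 2) * q y - K / 4 * (q y)\<^sup>2"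
        by (simp add: power2_eq_square field_simps)
      ultimately show ?thesis using True by (simp add: chi_props)
    next
      case False
      then have c: "chi y = 0" by (rule chi_props)
      then have "q y = 0" using chiq[of y] by simp
      moreover have "e y = 0" by (simp add: e_def c)
      ultimately show ?thesis by (simp add: c)
    qed
  qed
  have iq: "integrable lborel (\<lambda>y. (I + s * m - K * m\<^sup>2) * chi y + (K * m - s / 2) * q y)"
    using chi_integrable q_integrable by (intro Bochner_Integration.integrable_add integrable_mult_right)
  have "(LINT y|lborel. (I + s * m - K * m\<^sup>2) * chi y + (K * m - s / 2) * q y - K / 4 * (q y)\<^sup>2) \<le> (LINT y|lborel. e y)"
    by (rule integral_mono_AE[OF Bochner_Integration.integrable_diff[OF iq integrable_mult_right[OF q_square(1)]] e_integrable(1) lower])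
  also have "(LINT y|lborel. (I + s * m - K * m\<^sup>2) * chi y + (K * m - s / 2) * q y - K / 4 * (q y)\<^sup>2)
     = (I + s * m - K * m\<^sup>2) * l + (K * m - s / 2) * (2 * l * m) - K / 4 * (LINT y|lborel. (q y)\<^sup>2)"
    using iq q_square(1) chi_integrable q_integrable(1) l by (simp add: m_def)
  also have "\<dots> = I * l + K * m\<^sup>2 * l - K / 4 * (LINT y|lborel. (q y)\<^sup>2)" by (simp add: power2_eq_square algebra_simps)
  finally have "I * l + K * m\<^sup>2 * l - K / 4 * (LINT y|lborel. (q y)\<^sup>2) \<le> 1/2 * Dx + 1/4 * V" using e_integrable(2) by simp
  moreover have "0 \<le> K * m\<^sup>2 * l" using K(1) l by simp
  moreover have "K / 4 * (LINT y|lborel. (q y)\<^sup>2) \<le> K / 4 * (4 * l * Dx * Dy)"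
    using K(1) q_square(2) by (intro mult_left_mono) auto
  ultimately show ?thesis using energy_eq by (simp add: I_def algebra_simps)
qed

lemma Dy_zero_if_depends_only_on_x:
  assumes "depends_only_on_x \<psi>"
  shows "Dy = 0"
proof -
  obtain v where "AE z in lborel. case z of (x, y) \<Rightarrow> \<psi> (x, y) = v x" using assms unfolding depends_only_on_x_def by blast
  from plane_AE_y[OF this] have "AE x in lborel. AE y in lborel. \<psi> (x, y) = v x" by simp
  with weak_partial_y_imp_ac[OF weak(2)] have "AE x in lborel. aF x = 0"
  proof eventually_elim
    case (elim x)
    then obtain u where u: "has_ac_derivative u (\<lambda>y. gy (x, y))" "AE y in lborel. \<psi> (x, y) = u y" by blast
    have "u = (\<lambda>_. v x)"
      by (rule continuous_AE_eq[OF ac_continuous_on[OF u(1)] continuous_on_const]) (use u(2) elim(2) in \<open>eventually_elim, simp\<close>)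
    then have "AE y in lborel. gy (x, y) = 0" using ac_derivative_unique[OF u(1)] ac_const by blast
    then have "(LINT y|lborel. chi y * (cmod (gy (x, y)))\<^sup>2) = (LINT y|(lborel::real measure). (0::real))"
      using borel_measurable_slice[OF meas(3)] by (intro integral_cong_AE) auto
    then show ?case by (simp add: aF_def)
  qed
  then have "(LINT x|lborel. aF x) = (LINT x|(lborel::real measure). (0::real))" by (intro integral_cong_AE) auto
  then show ?thesis using aF_integrable(2) by simp
qed

text \<open>Without transverse derivative both \<open>q\<close> and \<open>w\<close> vanish almost
  everywhere, so the momentum is that of the mean profile and every slice agrees with it.\<close>

lemma planar_profile:
  assumes D0: "Dy = 0" and mom: "p \<in> momentum_2d l \<psi>"
  obtains v where "finite_energy_1d v gm" "energy_1d v gm = energy l \<psi>"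
    "((\<lambda>R. cis (2 * momentum_upto v R)) \<longlongrightarrow> cis (2 * p)) at_top"
    "AE z in lborel. snd z \<in> {0..<l} \<longrightarrow> \<psi> z = v (fst z)"
proof -
  have "(LINT y|lborel. (q y)\<^sup>2) = 0"
    using q_square(2) D0 by (intro antisym Bochner_Integration.integral_nonneg) auto
  then have "AE y in lborel. (q y)\<^sup>2 = 0"
    using integral_nonneg_eq_0_iff_AE[OF q_square(1)] by simp
  then have "AE y in lborel. q y = 0" by eventually_elim simp
  moreover have [measurable]: "q \<in> borel_measurable borel" using borel_measurable_integrable[OF q_integrable(1)] by simp
  ultimately have "(LINT y|lborel. q y) = (LINT y|(lborel::real measure). (0::real))" by (intro integral_cong_AE) auto
  then have p: "p \<in> momentum_1d (y_mean l \<psi>)"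
    using mom unfolding momentum_2d_eq q_integrable(2)[symmetric] by auto
  obtain v where v: "continuous_on UNIV v" "AE x in lborel. v x = y_mean l \<psi> x"
    "((\<lambda>R. cis (2 * momentum_upto v R)) \<longlongrightarrow> cis (2 * p)) at_top" using momentum_1dD[OF p] by blast
  note ac = y_mean_ac[OF v(1,2)]
  have "AE x in lborel. aF x = 0"
    using integral_nonneg_eq_0_iff_AE[OF aF_integrable(1)] aF_nonneg aF_integrable(2) D0 by simp
  from AE_fst[OF this] AE_w_bound AE_fst[OF v(2)]
  have main: "AE z in lborel. snd z \<in> {0..<l} \<longrightarrow> \<psi> z = v (fst z)"
    by eventually_elim (auto simp: w_def)
  have key: "AE y in lborel. y \<in> {0..<l} \<longrightarrow> finite_energy_1d v gm \<and> energy_1d v gm = e y"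
    using slice_momentum[OF ac v(2,3)] plane_AE_x[OF main]
  proof eventually_elim
    case (elim y)
    show ?case
    proof (rule impI)
      assume y: "y \<in> {0..<l}"
      then obtain u where u: "AE x in lborel. \<psi> (x, y) = u x" "finite_energy_1d u (\<lambda>x. gx (x, y))" "energy_1d u (\<lambda>x. gx (x, y)) = e y"
        using elim(1) by blast
      have acu: "has_ac_derivative u (\<lambda>x. gx (x, y))" using u(2) by (simp add: finite_energy_1d_def)
      have "AE x in lborel. \<psi> (x, y) = v x" using elim(2) y by simp
      with u(1) have "AE x in lborel. u x = v x" by eventually_elim simp
      then have uv: "u = v" by (rule continuous_AE_eq[OF ac_continuous_on[OF acu] v(1)])
      have g: "AE x in lborel. gx (x, y) = gm x" using ac_derivative_unique[OF acu[unfolded uv] ac] .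
      note [measurable] = borel_measurable_slice[OF meas(2)] ac_measurable_self[OF ac]
      have "integrable lborel (\<lambda>x. (cmod (gm x))\<^sup>2)" by (rule gm_L2(1))
      then have "finite_energy_1d v gm" using u(2) ac unfolding uv finite_energy_1d_def by blast
      moreover have "energy_1d v gm = energy_1d u (\<lambda>x. gx (x, y))"
        unfolding energy_1d_def uv by (rule integral_cong_AE) (use g in \<open>auto\<close>)
      ultimately show "finite_energy_1d v gm \<and> energy_1d v gm = e y" using u(3) by simp
    qed
  qed
  \<comment> \<open>The assertion does not mention the height, and it holds for almost every height
    in an interval of positive length.\<close>
  have fe: "finite_energy_1d v gm"
  proof (rule ccontr)
    assume n: "\<not> ?thesis"
    from key have "AE y in lborel. y \<notin> {0..<l}" by eventually_elim (use n in auto)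
    then have "emeasure lborel {0..<l} = 0" by (subst (asm) AE_iff_measurable[of "{0..<l}"]) auto
    then show False using l by simp
  qed
  have "(LINT y|lborel. e y) = (LINT y|lborel. chi y * energy_1d v gm)"
  proof (rule integral_cong_AE)
    show "AE y in lborel. e y = chi y * energy_1d v gm"
      using key
    proof eventually_elim
      case (elim y)
      then show ?case by (cases "y \<in> {0..<l}") (auto simp: chi_props e_def)
    qed
  qed (use borel_measurable_integrable[OF e_integrable(1)] in auto)
  also have "\<dots> = l * energy_1d v gm" by (simp add: chi_integrable)
  finally have "energy_1d v gm = energy l \<psi>" using e_integrable(2) energy_eq D0 l by simp
  then show ?thesis using that fe v(3) main by blast
qed

lemma periodic: "\<psi> (x, y + of_int n * l) = \<psi> (x, y)"
proof -
  have per: "\<And>x y. \<psi> (x, y + l) = \<psi> (x, y)" using psi by (simp add: energy_space_2d_def)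
  show ?thesis
  proof (induction n rule: int_induct[where k = 0])
    case (step1 i)
    then show ?case using per[of x "y + of_int i * l"] by (simp add: algebra_simps)
  next
    case (step2 i)
    then show ?case using per[of x "y + of_int (i - 1) * l"] by (simp add: algebra_simps)
  qed simp
qed

text \<open>Countably many translates of the fundamental domain cover the plane; translations
  preserve null sets, and periodicity moves each point back into the strip.\<close>

lemma AE_strip_imp_AE:
  assumes "AE z in lborel. snd z \<in> {0..<l} \<longrightarrow> \<psi> z = v (fst z)"
  shows "AE z in lborel. \<psi> z = v (fst z)"
proof -
  have "AE z in lborel. \<forall>n::int. snd z + of_int n * l \<in> {0..<l} \<longrightarrow> \<psi> (fst z, snd z + of_int n * l) = v (fst z)"
  proof (intro AE_all_countable[THEN iffD2] allI)
    fix n :: int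
    have "AE z in distr lborel borel ((+) (0, of_int n * l)). snd z \<in> {0..<l} \<longrightarrow> \<psi> z = v (fst z)"
      unfolding lborel_distr_plus by (rule assms)
    then have "AE z in lborel. snd ((0, of_int n * l) + z) \<in> {0..<l} \<longrightarrow> \<psi> ((0, of_int n * l) + z) = v (fst ((0, of_int n * l) + z))"
      by (rule AE_distrD[rotated]) simp
    then show "AE z in lborel. snd z + of_int n * l \<in> {0..<l} \<longrightarrow> \<psi> (fst z, snd z + of_int n * l) = v (fst z)"
      by (simp add: plus_prod_def add.commute)
  qed
  then show ?thesis
  proof eventually_elim
    case (elim z)
    have "snd z + of_int (- \<lfloor>snd z / l\<rfloor>) * l \<in> {0..<l}"
      using floor_divide_lower[OF l, of "snd z"] floor_divide_upper[OF l, of "snd z"] by (simp add: algebra_simps)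
    then have "\<psi> (fst z, snd z + of_int (- \<lfloor>snd z / l\<rfloor>) * l) = v (fst z)" using elim by blast
    then show ?case unfolding periodic by simp
  qed
qed

end

section \<open>Stretching the transverse variable\<close>

lemma scale_y_density:
  assumes l: "l > 0"
  shows "(lborel :: (real \<times> real) measure) = density (distr lborel borel (\<lambda>z. (fst z, l * snd z))) (\<lambda>_. ennreal l)"
proof -
  define c :: "real \<times> real \<Rightarrow> real" where "c j = (if j = (1, 0) then 1 else l)" for j
  have "(lborel :: (real \<times> real) measure) = density (distr lborel borel (\<lambda>x. 0 + (\<Sum>j\<in>Basis. (c j * (x \<bullet> j)) *\<^sub>R j))) (\<lambda>_. (\<Prod>j\<in>Basis. \<bar>c j\<bar>))"
    by (rule lborel_affine_euclidean) (use l in \<open>auto simp: c_def\<close>)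
  moreover have "(\<lambda>x::real \<times> real. 0 + (\<Sum>j\<in>Basis. (c j * (x \<bullet> j)) *\<^sub>R j)) = (\<lambda>z. (fst z, l * snd z))"
    by (auto simp: Basis_plane c_def fun_eq_iff)
  moreover have "(\<Prod>j\<in>(Basis :: (real \<times> real) set). \<bar>c j\<bar>) = l" using l by (simp add: Basis_plane c_def)
  ultimately show ?thesis by simp
qed

lemma
  fixes h :: "real \<times> real \<Rightarrow> real"
  assumes l: "l > 0" and [measurable]: "h \<in> borel_measurable borel"
  shows scale_y_integrable: "integrable lborel (\<lambda>z. h (fst z, l * snd z)) \<longleftrightarrow> integrable lborel h"
    and scale_y_integral: "(LINT z|lborel. h (fst z, l * snd z)) = (LINT z|lborel. h z) / l"
proof -
  note d = scale_y_density[OF l]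
  have "integrable lborel h \<longleftrightarrow> integrable (density (distr lborel borel (\<lambda>z. (fst z, l * snd z))) (\<lambda>_. ennreal l)) h" using d by simp
  also have "\<dots> \<longleftrightarrow> integrable lborel (\<lambda>z. l * h (fst z, l * snd z))"
    using l by (subst integrable_density) (auto simp: integrable_distr_eq)
  finally show "integrable lborel (\<lambda>z. h (fst z, l * snd z)) \<longleftrightarrow> integrable lborel h" using l by simp
  have "(LINT z|lborel. h z) = (LINT z|density (distr lborel borel (\<lambda>z. (fst z, l * snd z))) (\<lambda>_. ennreal l). h z)" using d by simp
  also have "\<dots> = l * (LINT z|lborel. h (fst z, l * snd z))"
    using l by (subst integral_density) (auto simp: integral_distr)
  finally show "(LINT z|lborel. h (fst z, l * snd z)) = (LINT z|lborel. h z) / l" using l by simp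
qed

lemma L2_loc_scale_y:
  fixes f :: "real \<times> real \<Rightarrow> complex"
  assumes r: "r > 0" and f: "L2_loc f"
  shows "L2_loc (\<lambda>z. c *\<^sub>R f (fst z, r * snd z))"
  unfolding L2_loc_def L2_on_def
proof (intro allI impI conjI)
  have [measurable]: "f \<in> borel_measurable borel" using f compact_empty unfolding L2_loc_def L2_on_def by blast
  show "(\<lambda>z. c *\<^sub>R f (fst z, r * snd z)) \<in> borel_measurable borel" by measurable
  fix K :: "(real \<times> real) set" assume K: "compact K"
  define SK where "SK = (\<lambda>z. (fst z, r * snd z)) ` K"
  have SK: "compact SK" unfolding SK_def by (intro compact_continuous_image K continuous_intros)
  note [measurable] = borel_compact[OF SK]
  have "integrable lborel (\<lambda>z. indicator SK z * (cmod (f z))\<^sup>2)"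
    using f SK unfolding L2_loc_def L2_on_def set_integrable_def by auto
  then have "integrable lborel (\<lambda>z. indicator SK (fst z, r * snd z) * (cmod (f (fst z, r * snd z)))\<^sup>2)"
    by (subst scale_y_integrable[OF r]) auto
  moreover have "indicator SK (fst z, r * snd z) = (indicator K z :: real)" for z
    using r by (cases z) (force simp: SK_def indicator_def image_iff)
  ultimately have "integrable lborel (\<lambda>z. c\<^sup>2 * (indicator K z * (cmod (f (fst z, r * snd z)))\<^sup>2))"
    by (intro integrable_mult_right) simp
  then show "set_integrable lborel K (\<lambda>z. (cmod (c *\<^sub>R f (fst z, r * snd z)))\<^sup>2)"
    unfolding set_integrable_def by (simp add: power_mult_distrib ac_simps)
qed

context strip_function
begin

text \<open>Energy and momentum are averages over the period, so stretching y leaves everything but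
  the transverse derivative unchanged, and its square is multiplied by the square of
  \<open>r\<close>. A function for length \<open>l\<close> thereby becomes a competitor for length
  \<open>l'\<close>.\<close>

lemma energy_space_scaled:
  assumes l': "l' > 0"
  defines "r \<equiv> l / l'"
  defines "\<psi>' \<equiv> \<lambda>(x, y). \<psi> (x, r * y)"
  shows "\<psi>' \<in> energy_space_2d l'" "momentum_2d l' \<psi>' = momentum_2d l \<psi>"
    "l * energy l' \<psi>' = 1/2 * Dx + 1/2 * r\<^sup>2 * Dy + 1/4 * V"
proof -
  have r: "r > 0" "r * l' = l" using l l' by (auto simp: r_def)
  have \<psi>': "\<psi>' z = \<psi> (fst z, r * snd z)" for z by (simp add: \<psi>'_def case_prod_unfold)
  have wx: "has_weak_partial (1, 0) \<psi>' (\<lambda>z. gx (fst z, r * snd z))"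
    using has_weak_partial_scale_y[OF r(1), of "(1, 0)" \<psi> gx] weak(1) by (simp add: \<psi>'_def case_prod_unfold)
  have "has_weak_partial (0, r) \<psi> (\<lambda>z. r *\<^sub>R gy z)" using has_weak_partial_scaleR[OF weak(2), of r] by simp
  then have wy: "has_weak_partial (0, 1) \<psi>' (\<lambda>z. r *\<^sub>R gy (fst z, r * snd z))"
    using has_weak_partial_scale_y[OF r(1), of "(0, 1)" \<psi> "\<lambda>z. r *\<^sub>R gy z"] by (simp add: \<psi>'_def case_prod_unfold)
  note ex = weak_partial_eq(2)[OF wx] and ey = weak_partial_eq(2)[OF wy]
  note [measurable] = locally_integrable_measurable[OF has_weak_partial_locally_integrable(2)[OF weak_partial_eq(1)[OF wx]]]
    locally_integrable_measurable[OF has_weak_partial_locally_integrable(2)[OF weak_partial_eq(1)[OF wy]]]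
  have m': "\<psi>' \<in> borel_measurable borel" unfolding \<psi>'[abs_def] by measurable
  note m'[measurable]
  define X where "X = (\<lambda>z :: real \<times> real. chi (r * snd z))"
  have [measurable]: "X \<in> borel_measurable borel"
    unfolding X_def by (rule measurable_compose[OF _ chi_measurable]) (intro borel_measurable_continuous_onI continuous_intros)
  have cr: "chi (r * b) = indicator {0..<l'} b" for b
  proof -
    have "0 \<le> r * b \<longleftrightarrow> 0 \<le> b" using r(1) by (simp add: zero_le_mult_iff)
    moreover have "r * b < r * l' \<longleftrightarrow> b < l'" using r(1) by simp
    ultimately show ?thesis using r(2) by (simp add: chi_def indicator_def)
  qed
  have strip': "indicator (strip l') z = X z" for z
    unfolding X_def cr by (cases z) (auto simp: strip_def indicator_def)
  have L2: "L2_loc (\<lambda>z. c *\<^sub>R f (fst z, r * snd z))" if "L2_loc f" for f :: "real \<times> real \<Rightarrow> complex" and c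
    by (rule L2_loc_scale_y[OF r(1) that])
  have H: "H1_loc \<psi>" using psi by (simp add: energy_space_2d_def energy_space_def)
  have L2': "L2_loc g'" if "L2_loc g" "AE z in lborel. g z = g' z" "g' \<in> borel_measurable borel" for g g' :: "real \<times> real \<Rightarrow> complex"
    unfolding L2_loc_def L2_on_def
  proof (intro allI impI conjI that(3))
    fix K :: "(real \<times> real) set" assume K: "compact K"
    note [measurable] = that(3) borel_compact[OF K]
    have i: "set_integrable lborel K (\<lambda>z. (cmod (g z))\<^sup>2)" and [measurable]: "g \<in> borel_measurable borel"
      using that(1) K unfolding L2_loc_def L2_on_def by blast+
    show "set_integrable lborel K (\<lambda>z. (cmod (g' z))\<^sup>2)"
      using i that(2) by (subst set_integrable_cong_AE[where g = "\<lambda>z. (cmod (g z))\<^sup>2"]) auto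
  qed
  have L2g: "L2_loc gx" "L2_loc gy"
  proof -
    obtain g where "L2_loc g" "has_weak_partial (1, 0) \<psi> g" using H unfolding H1_loc_def by (auto simp: Basis_plane)
    then show "L2_loc gx" using L2'[of g gx] has_weak_partial_unique[of "(1, 0)" \<psi> g gx] weak(1) by simp
    obtain g where "L2_loc g" "has_weak_partial (0, 1) \<psi> g" using H unfolding H1_loc_def by (auto simp: Basis_plane)
    then show "L2_loc gy" using L2'[of g gy] has_weak_partial_unique[of "(0, 1)" \<psi> g gy] weak(2) by simp
  qed
  have "H1_loc \<psi>'"
    unfolding H1_loc_def Basis_plane
  proof (intro conjI ballI)
    show "L2_loc \<psi>'" using L2[of \<psi> 1] H unfolding H1_loc_def \<psi>'[abs_def] by simp
    fix b :: "real \<times> real" assume "b \<in> {(1, 0), (0, 1)}"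
    then show "\<exists>g. L2_loc g \<and> has_weak_partial b \<psi>' g"
      using L2[OF L2g(1), of 1] L2[OF L2g(2), of r] wx wy by auto
  qed
  have ix: "integrable lborel (\<lambda>z. X z * (cmod (gx (fst z, r * snd z)))\<^sup>2)"
    using scale_y_integrable[OF r(1), of "\<lambda>z. chi (snd z) * (cmod (gx z))\<^sup>2"] integrable_L2(1) by (simp add: X_def)
  have iy: "integrable lborel (\<lambda>z. X z * (cmod (gy (fst z, r * snd z)))\<^sup>2)"
    using scale_y_integrable[OF r(1), of "\<lambda>z. chi (snd z) * (cmod (gy z))\<^sup>2"] integrable_L2(2) by (simp add: X_def)
  have iv: "integrable lborel (\<lambda>z. X z * (1 - (cmod (\<psi>' z))\<^sup>2)\<^sup>2)"
    using scale_y_integrable[OF r(1), of "\<lambda>z. chi (snd z) * (1 - (cmod (\<psi> z))\<^sup>2)\<^sup>2"] integrable_L2(3) by (simp add: X_def \<psi>')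
  have sx: "(LINT z|lborel. X z * (cmod (gx (fst z, r * snd z)))\<^sup>2) = Dx / r"
    using scale_y_integral[OF r(1), of "\<lambda>z. chi (snd z) * (cmod (gx z))\<^sup>2"] by (simp add: X_def Dx_def)
  have sy: "(LINT z|lborel. X z * (cmod (gy (fst z, r * snd z)))\<^sup>2) = Dy / r"
    using scale_y_integral[OF r(1), of "\<lambda>z. chi (snd z) * (cmod (gy z))\<^sup>2"] by (simp add: X_def Dy_def)
  have sv: "(LINT z|lborel. X z * (1 - (cmod (\<psi>' z))\<^sup>2)\<^sup>2) = V / r"
    using scale_y_integral[OF r(1), of "\<lambda>z. chi (snd z) * (1 - (cmod (\<psi> z))\<^sup>2)\<^sup>2"] by (simp add: X_def V_def \<psi>')
  have "L2_on (strip l') (weak_partial (1, 0) \<psi>')"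
    unfolding L2_on_def set_integrable_def strip'
  proof (intro conjI)
    show "integrable lborel (\<lambda>z. X z *\<^sub>R (cmod (weak_partial (1, 0) \<psi>' z))\<^sup>2)"
      by (rule integrable_cong_AE_imp[OF ix]) (measurable, use ex in \<open>eventually_elim, simp\<close>)
  qed measurable
  moreover have "L2_on (strip l') (weak_partial (0, 1) \<psi>')"
    unfolding L2_on_def set_integrable_def strip'
  proof (intro conjI)
    show "integrable lborel (\<lambda>z. X z *\<^sub>R (cmod (weak_partial (0, 1) \<psi>' z))\<^sup>2)"
      by (rule integrable_cong_AE_imp[OF integrable_mult_right[OF iy, of "r\<^sup>2"]])
        (measurable, use ey in \<open>eventually_elim, simp add: power_mult_distrib\<close>)
  qed measurable
  moreover have "L2_on (strip l') (\<lambda>z. 1 - (cmod (\<psi>' z))\<^sup>2)"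
    unfolding L2_on_def set_integrable_def strip' using iv by simp
  moreover have "\<psi>' (x, y + l') = \<psi>' (x, y)" for x y
    using psi r by (simp add: energy_space_2d_def \<psi>' distrib_left)
  ultimately show "\<psi>' \<in> energy_space_2d l'"
    using \<open>H1_loc \<psi>'\<close> by (simp add: energy_space_2d_def energy_space_def Basis_plane)
  have "l' * energy l' \<psi>' = (LINT z|lborel. (1/2 * (X z * (cmod (weak_partial (1, 0) \<psi>' z))\<^sup>2) + 1/2 * (X z * (cmod (weak_partial (0, 1) \<psi>' z))\<^sup>2)) + 1/4 * (X z * (1 - (cmod (\<psi>' z))\<^sup>2)\<^sup>2))"
    unfolding energy_def set_lebesgue_integral_def strip' energy_density_def
    using l' by (simp add: Basis_plane algebra_simps)
  also have "\<dots> = (LINT z|lborel. (1/2 * (X z * (cmod (gx (fst z, r * snd z)))\<^sup>2) + (1/2 * r\<^sup>2) * (X z * (cmod (gy (fst z, r * snd z)))\<^sup>2)) + 1/4 * (X z * (1 - (cmod (\<psi>' z))\<^sup>2)\<^sup>2))"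
  proof (rule integral_cong_AE)
    show "AE z in lborel. (1/2 * (X z * (cmod (weak_partial (1, 0) \<psi>' z))\<^sup>2) + 1/2 * (X z * (cmod (weak_partial (0, 1) \<psi>' z))\<^sup>2)) + 1/4 * (X z * (1 - (cmod (\<psi>' z))\<^sup>2)\<^sup>2)
       = (1/2 * (X z * (cmod (gx (fst z, r * snd z)))\<^sup>2) + (1/2 * r\<^sup>2) * (X z * (cmod (gy (fst z, r * snd z)))\<^sup>2)) + 1/4 * (X z * (1 - (cmod (\<psi>' z))\<^sup>2)\<^sup>2)"
      using ex ey by eventually_elim (simp add: power_mult_distrib)
  qed measurable
  also have "\<dots> = 1/2 * (Dx / r) + (1/2 * r\<^sup>2) * (Dy / r) + 1/4 * (V / r)"
    using ix iy iv sx sy sv by simp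
  finally have "r * (l' * energy l' \<psi>') = r * (1/2 * (Dx / r) + (1/2 * r\<^sup>2) * (Dy / r) + 1/4 * (V / r))" by simp
  also have "\<dots> = 1/2 * Dx + 1/2 * r\<^sup>2 * Dy + 1/4 * V" using r(1) by (simp add: field_simps)
  finally show "l * energy l' \<psi>' = 1/2 * Dx + 1/2 * r\<^sup>2 * Dy + 1/4 * V" by (simp flip: r(2))
  have ym: "y_mean l' \<psi>' = y_mean l \<psi>"
  proof (rule ext)
    fix x
    have "(LINT y|lborel. chi y *\<^sub>R \<psi> (x, y)) = \<bar>r\<bar> *\<^sub>R (LINT y|lborel. chi (0 + r * y) *\<^sub>R \<psi> (x, 0 + r * y))"
      by (rule lborel_integral_real_affine) (use r in simp)
    also have "(LINT y|lborel. chi (0 + r * y) *\<^sub>R \<psi> (x, 0 + r * y)) = (LINT y:{0..<l'}|lborel. \<psi>' (x, y))"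
      unfolding set_lebesgue_integral_def \<psi>'
      by (intro Bochner_Integration.integral_cong) (simp_all add: cr)
    finally have I: "(LINT y:{0..<l}|lborel. \<psi> (x, y)) = r *\<^sub>R (LINT y:{0..<l'}|lborel. \<psi>' (x, y))"
      using r(1) by (simp add: set_lebesgue_integral_def chi_def)
    have ll: "complex_of_real l = of_real r * of_real l'" by (subst r(2)[symmetric]) (rule of_real_mult)
    show "y_mean l' \<psi>' x = y_mean l \<psi> x"
      unfolding y_mean_def I ll scaleR_conv_of_real using r(1) by simp
  qed
  define W where "W = weak_partial (1, 0) w"
  have hw: "has_weak_partial (1, 0) w (\<lambda>z. gx z - gm (fst z))"
    using has_weak_partial_diff[OF weak(1) has_weak_partial_fst[OF y_mean_weak]] unfolding w_def[abs_def] .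
  note W = weak_partial_eq(1)[OF hw, folded W_def]
  have [measurable]: "W \<in> borel_measurable borel" by (rule locally_integrable_measurable[OF has_weak_partial_locally_integrable(2)[OF W]])
  define w' where "w' = (\<lambda>(x, y). \<psi>' (x, y) - y_mean l' \<psi>' x)"
  have w': "w' z = w (fst z, r * snd z)" for z by (simp add: w'_def w_def \<psi>' ym case_prod_unfold)
  have "has_weak_partial (1, 0) w' (\<lambda>z. W (fst z, r * snd z))"
    using has_weak_partial_scale_y[OF r(1), of "(1, 0)" w W] W by (simp add: w'[abs_def] case_prod_unfold)
  note W' = weak_partial_eq[OF this]
  note [measurable] = locally_integrable_measurable[OF has_weak_partial_locally_integrable(2)[OF W'(1)]]
    locally_integrable_measurable[OF has_weak_partial_locally_integrable(1)[OF W'(1)]]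
  define W1 where "W1 = (\<lambda>z. W (fst z, r * snd z))"
  have [measurable]: "W1 \<in> borel_measurable borel"
    unfolding W1_def by (rule measurable_compose[OF _ \<open>W \<in> borel_measurable borel\<close>]) (intro borel_measurable_continuous_onI continuous_intros)
  have "(LINT z:strip l'|lborel. (\<i> * weak_partial (1, 0) w' z) \<bullet> w' z) = (LINT z|lborel. X z * ((\<i> * W1 z) \<bullet> w' z))"
    unfolding set_lebesgue_integral_def strip'
    by (rule integral_cong_AE) (measurable, use W'(2) in \<open>eventually_elim, simp add: W1_def\<close>)
  also have "\<dots> = (LINT z|lborel. chi (r * snd z) * ((\<i> * W (fst z, r * snd z)) \<bullet> w (fst z, r * snd z)))"
    by (simp add: X_def W1_def w')
  also have "\<dots> = (LINT z|lborel. chi (snd z) * ((\<i> * W z) \<bullet> w z)) / r"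
    using scale_y_integral[OF r(1), of "\<lambda>z. chi (snd z) * ((\<i> * W z) \<bullet> w z)"] by (simp add: X_def)
  also have "(LINT z|lborel. chi (snd z) * ((\<i> * W z) \<bullet> w z)) = (LINT z:strip l|lborel. (\<i> * W z) \<bullet> w z)"
    unfolding set_lebesgue_integral_def indicator_strip by simp
  finally have e: "1 / (2 * l') * (LINT z:strip l'|lborel. (\<i> * weak_partial (1, 0) w' z) \<bullet> w' z) = 1 / (2 * l) * (LINT z:strip l|lborel. (\<i> * W z) \<bullet> w z)"
    using r l l' by (simp add: r_def)
  have w0: "w = (\<lambda>(x, y). \<psi> (x, y) - y_mean l \<psi> x)" by (auto simp: w_def)
  show "momentum_2d l' \<psi>' = momentum_2d l \<psi>"
    unfolding momentum_2d_def Let_def w'_def[symmetric] w0[symmetric] W_def[symmetric] e unfolding ym ..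
qed

end

section \<open>Minimizing profiles on the line\<close>

lemma ac_continuous_imp_C1:
  fixes v :: "real \<Rightarrow> 'b::euclidean_space"
  assumes v: "has_ac_derivative v g" and g: "continuous_on UNIV g"
  shows "(v has_vector_derivative g x) (at x)"
proof -
  have eq: "v y = v (x - 1) + integral {x-1..y} g" if "y \<in> {x-1..x+1}" for y
    using ac_diff[OF v, of "x - 1" y] that set_borel_integral_eq_integral(2)[OF ac_integrable[OF v, of "x - 1" y]] by (simp add: algebra_simps)
  have x: "x \<in> {x-1..x+1}" by simp
  have "((\<lambda>y. integral {x-1..y} g) has_vector_derivative g x) (at x within {x-1..x+1})"
    by (rule integral_has_vector_derivative[OF continuous_on_subset[OF g subset_UNIV] x])
  from has_vector_derivative_add[OF has_vector_derivative_const[of "v (x - 1)"] this]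
  have d: "((\<lambda>y. v (x - 1) + integral {x-1..y} g) has_vector_derivative g x) (at x within {x-1..x+1})"
    unfolding add_0_left .
  have "(v has_vector_derivative g x) (at x within {x-1..x+1})"
    by (rule has_vector_derivative_transform[OF x eq d])
  then show ?thesis by (simp add: at_within_Icc_at)
qed

section \<open>The Euler-Lagrange equation of a minimal profile\<close>

lemma polynomial_nonneg_imp_linear_coeff_zero:
  fixes a b c d :: real
  assumes "\<And>t. 0 \<le> a * t + b * t\<^sup>2 + c * t ^ 3 + d * t ^ 4"
  shows "a = 0"
proof -
  have "((\<lambda>t. a * t + b * t\<^sup>2 + c * t ^ 3 + d * t ^ 4) has_real_derivative a) (at 0)"
    by (auto intro!: derivative_eq_intros)
  then show ?thesis by (rule DERIV_local_min[of _ _ _ 1]) (use assms in auto)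
qed

lemma inner_ii_self: "(\<i> * \<gamma>) \<bullet> \<gamma> = 0"
  by (simp add: inner_complex_def)

text \<open>Perturbations need not respect the momentum: by the parabolic lower bound, the energy
  plus a linear and a quadratic term in the momentum change is minimal at the profile. The quadratic
  term does not affect the first variation, and the linear one contributes the multiplier
  \<open>sqrt 2 * sin \<omega>\<close>.\<close>

lemma euler_lagrange_tested:
  assumes fe: "finite_energy_1d v g" and \<omega>: "\<bar>\<omega>\<bar> < pi / 2"
    and lim: "((\<lambda>R. cis (2 * momentum_upto v R)) \<longlongrightarrow> cis (2 * soliton_momentum \<omega>)) at_top"
    and E: "energy_1d v g \<le> soliton_energy \<omega>"
    and a: "C1_compact a a'"
  defines "\<eta> \<equiv> \<lambda>x. 1 - (cmod (v x))\<^sup>2"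
  shows "(LINT x|lborel. a' x * (g x \<bullet> \<gamma>)) = (LINT x|lborel. a x * (\<eta> x * (v x \<bullet> \<gamma>) - sqrt 2 * sin \<omega> * ((\<i> * g x) \<bullet> \<gamma>)))"
proof -
  have ac: "has_ac_derivative v g" and g2: "integrable lborel (\<lambda>x. (cmod (g x))\<^sup>2)" and e2: "integrable lborel (\<lambda>x. (\<eta> x)\<^sup>2)"
    using fe by (auto simp: finite_energy_1d_def \<eta>_def)
  note vc[continuous_intros] = continuous_on_compose2[OF ac_continuous_on[OF ac, of UNIV] _ subset_UNIV]
  obtain N where N: "\<And>x. N < \<bar>x\<bar> \<Longrightarrow> a x = 0" "\<And>x. N < \<bar>x\<bar> \<Longrightarrow> a' x = 0" using C1_compact_support[OF a] by metis
  note ca = C1_compact_continuous[OF a]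
  note [continuous_intros] = continuous_on_compose2[OF ca(1)[of UNIV] _ subset_UNIV] continuous_on_compose2[OF ca(2)[of UNIV] _ subset_UNIV]
  have da: "((\<lambda>x. a x *\<^sub>R \<gamma>) has_vector_derivative a' x *\<^sub>R \<gamma>) (at x)" for x
  proof -
    have "(a has_real_derivative a' x) (at x)" using a unfolding C1_compact_def by blast
    from has_vector_derivative_scaleR[OF this has_vector_derivative_const[of \<gamma>]] show ?thesis by simp
  qed
  have ac\<xi>: "has_ac_derivative (\<lambda>x. \<epsilon> *\<^sub>R (a x *\<^sub>R \<gamma>)) (\<lambda>x. \<epsilon> *\<^sub>R (a' x *\<^sub>R \<gamma>))" for \<epsilon>
  proof (rule ac_C1)
    show "((\<lambda>x. \<epsilon> *\<^sub>R (a x *\<^sub>R \<gamma>)) has_vector_derivative \<epsilon> *\<^sub>R (a' x *\<^sub>R \<gamma>)) (at x)" for x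
      using has_vector_derivative_scaleR[OF DERIV_const da, of \<epsilon> x] by simp
    show "continuous_on UNIV (\<lambda>x. \<epsilon> *\<^sub>R (a' x *\<^sub>R \<gamma>))" by (intro continuous_intros ca)
  qed
  have cint: "integrable lborel f" if "continuous_on UNIV f" "\<And>x. a x = 0 \<Longrightarrow> a' x = 0 \<Longrightarrow> f x = 0" for f :: "real \<Rightarrow> real"
    by (rule continuous_compact_support_integrable[OF that(1), of N]) (use N that(2) in auto)
  have cute: "integrable lborel (\<lambda>x. b x * (G x \<bullet> \<gamma>))"
    if b: "continuous_on UNIV b" "\<And>x. N < \<bar>x\<bar> \<Longrightarrow> b x = 0" and u: "has_ac_derivative u G" for b and u G :: "real \<Rightarrow> complex"
  proof -
    obtain C where C: "\<And>x. \<bar>b x\<bar> \<le> C" using continuous_compact_support_bounded[OF b] by metis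
    have "integrable lborel (\<lambda>x. b x *\<^sub>R G x)"
      by (rule integrable_cutoff[OF locally_integrable_1d[OF ac_measurable[OF u] ac_integrable[OF u]] _ C, where K = "{-N..N}"])
        (use b in \<open>auto intro: borel_measurable_continuous_onI\<close>)
    from integrable_inner_left[OF this, of \<gamma>] show ?thesis by simp
  qed
  have aci: "has_ac_derivative (\<lambda>x. \<i> * v x) (\<lambda>x. \<i> * g x)"
    using ac_bounded_linear[OF bounded_linear_mult_right ac] .
  have i1: "integrable lborel (\<lambda>x. a' x * (g x \<bullet> \<gamma>))" by (rule cute[OF ca(2) N(2) ac])
  have i2: "integrable lborel (\<lambda>x. a x * ((\<i> * g x) \<bullet> \<gamma>))" by (rule cute[OF ca(1) N(1) aci])
  have i3: "integrable lborel (\<lambda>x. \<eta> x * (a x * (v x \<bullet> \<gamma>)))" unfolding \<eta>_def by (rule cint) (auto intro!: continuous_intros)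
  define f2 f3 f4 where
    "f2 x = 1/2 * (a' x)\<^sup>2 * (cmod \<gamma>)\<^sup>2 + (a x * (v x \<bullet> \<gamma>))\<^sup>2 - 1/2 * (\<eta> x * ((a x)\<^sup>2 * (cmod \<gamma>)\<^sup>2))"
    and "f3 x = (a x * (v x \<bullet> \<gamma>)) * ((a x)\<^sup>2 * (cmod \<gamma>)\<^sup>2)"
    and "f4 x = 1/4 * ((a x)\<^sup>2 * (cmod \<gamma>)\<^sup>2)\<^sup>2" for x
  have i4: "integrable lborel f2" "integrable lborel f3" "integrable lborel f4"
    unfolding f2_def f3_def f4_def \<eta>_def by (rule cint; auto intro!: continuous_intros)+
  have i5: "integrable lborel (\<lambda>x. (a' x)\<^sup>2 * (cmod \<gamma>)\<^sup>2)" "integrable lborel (\<lambda>x. (a x)\<^sup>2 * (cmod \<gamma>)\<^sup>2)"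
    by (rule cint; auto intro!: continuous_intros)+
  have i6: "integrable lborel (\<lambda>x. (a x * (v x \<bullet> \<gamma>))\<^sup>2)" "integrable lborel (\<lambda>x. \<eta> x * ((a x)\<^sup>2 * (cmod \<gamma>)\<^sup>2))"
    unfolding \<eta>_def by (rule cint; auto intro!: continuous_intros)+
  define f1 where "f1 x = a' x * (g x \<bullet> \<gamma>) - \<eta> x * (a x * (v x \<bullet> \<gamma>))" for x
  have if1: "integrable lborel f1" unfolding f1_def using i1 i3 by simp
  have i0: "integrable lborel (\<lambda>x. 1/2 * (cmod (g x))\<^sup>2 + 1/4 * (\<eta> x)\<^sup>2)" using g2 e2 by simp
  obtain K where K: "0 \<le> K" "\<And>v g P. finite_energy_1d v g \<Longrightarrow> momentum_limit_1d v g P \<Longrightarrow>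
     soliton_energy \<omega> - sqrt 2 * sin \<omega> * (P - soliton_momentum \<omega>) - K * (P - soliton_momentum \<omega>)\<^sup>2 \<le> energy_1d v g"
    using energy_1d_support[OF \<omega>] by metis
  define M where "M = (LINT x|lborel. a x * ((\<i> * g x) \<bullet> \<gamma>))"
  define u where "u \<epsilon> x = v x + \<epsilon> *\<^sub>R (a x *\<^sub>R \<gamma>)" for \<epsilon> x
  define h where "h \<epsilon> x = g x + \<epsilon> *\<^sub>R (a' x *\<^sub>R \<gamma>)" for \<epsilon> x
  have acu: "has_ac_derivative (u \<epsilon>) (h \<epsilon>)" for \<epsilon> using ac_add[OF ac ac\<xi>] unfolding u_def[abs_def] h_def[abs_def] .
  have hsq: "(cmod (h \<epsilon> x))\<^sup>2 = (cmod (g x))\<^sup>2 + 2 * \<epsilon> * (a' x * (g x \<bullet> \<gamma>)) + \<epsilon>\<^sup>2 * ((a' x)\<^sup>2 * (cmod \<gamma>)\<^sup>2)" for \<epsilon> x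
    unfolding h_def power2_norm_eq_inner by (simp add: inner_add inner_commute algebra_simps power2_eq_square)
  have usq: "1 - (cmod (u \<epsilon> x))\<^sup>2 = \<eta> x - 2 * \<epsilon> * (a x * (v x \<bullet> \<gamma>)) - \<epsilon>\<^sup>2 * ((a x)\<^sup>2 * (cmod \<gamma>)\<^sup>2)" for \<epsilon> x
    unfolding u_def \<eta>_def power2_norm_eq_inner by (simp add: inner_add inner_commute algebra_simps power2_eq_square)
  have dens: "1/2 * (cmod (h \<epsilon> x))\<^sup>2 + 1/4 * (1 - (cmod (u \<epsilon> x))\<^sup>2)\<^sup>2
      = (1/2 * (cmod (g x))\<^sup>2 + 1/4 * (\<eta> x)\<^sup>2) + (\<epsilon> * f1 x + (\<epsilon>\<^sup>2 * f2 x + (\<epsilon> ^ 3 * f3 x + \<epsilon> ^ 4 * f4 x)))" for \<epsilon> x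
    unfolding hsq usq f1_def f2_def f3_def f4_def by (simp add: algebra_simps power2_eq_square power3_eq_cube power4_eq_xxxx)
  have usq2: "(1 - (cmod (u \<epsilon> x))\<^sup>2)\<^sup>2 = 4 * ((1/4 * (\<eta> x)\<^sup>2 + (- \<epsilon>) * (\<eta> x * (a x * (v x \<bullet> \<gamma>))))
      + \<epsilon>\<^sup>2 * ((a x * (v x \<bullet> \<gamma>))\<^sup>2 - 1/2 * (\<eta> x * ((a x)\<^sup>2 * (cmod \<gamma>)\<^sup>2))) + \<epsilon> ^ 3 * f3 x + \<epsilon> ^ 4 * f4 x)" for \<epsilon> x
    unfolding usq f3_def f4_def by (simp add: algebra_simps power2_eq_square power3_eq_cube power4_eq_xxxx)
  have feu: "finite_energy_1d (u \<epsilon>) (h \<epsilon>)" for \<epsilon>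
    unfolding finite_energy_1d_def
  proof (intro conjI acu)
    show "integrable lborel (\<lambda>x. (cmod (h \<epsilon> x))\<^sup>2)" unfolding hsq
      by (intro Bochner_Integration.integrable_add integrable_mult_right g2 i1 i5)
    show "integrable lborel (\<lambda>x. (1 - (cmod (u \<epsilon> x))\<^sup>2)\<^sup>2)" unfolding usq2
      by (intro Bochner_Integration.integrable_add Bochner_Integration.integrable_diff integrable_mult_right e2 i3 i4 i6)
  qed
  have Eu: "energy_1d (u \<epsilon>) (h \<epsilon>) = energy_1d v g + (\<epsilon> * (LINT x|lborel. f1 x) + (\<epsilon>\<^sup>2 * (LINT x|lborel. f2 x) + (\<epsilon> ^ 3 * (LINT x|lborel. f3 x) + \<epsilon> ^ 4 * (LINT x|lborel. f4 x))))" for \<epsilon>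
    unfolding energy_1d_def dens
    by (subst Bochner_Integration.integral_add; (intro Bochner_Integration.integrable_add integrable_mult_right i0 if1 i4)?)
      (simp add: if1 i4 \<eta>_def)
  have du: "u \<epsilon> x - v x = \<epsilon> *\<^sub>R (a x *\<^sub>R \<gamma>)" for \<epsilon> x by (simp add: u_def)
  \<comment> \<open>A fixed direction \<gamma> makes the contribution quadratic in \<epsilon>
    vanish, because \<open>(\<i> * \<gamma>) \<bullet> \<gamma> = 0\<close>; the momentum of the
    perturbed curve is exactly affine in \<epsilon>.\<close>
  have jj: "(\<i> * (g x + h \<epsilon> x)) \<bullet> (u \<epsilon> x - v x) = (2 * \<epsilon>) * (a x * ((\<i> * g x) \<bullet> \<gamma>))" for \<epsilon> x
  proof -
    have "\<i> * (g x + h \<epsilon> x) = 2 *\<^sub>R (\<i> * g x) + (\<epsilon> * a' x) *\<^sub>R (\<i> * \<gamma>)" by (simp add: h_def scaleR_conv_of_real algebra_simps)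
    then show ?thesis unfolding du by (simp add: inner_add_left inner_ii_self algebra_simps)
  qed
  have Pu: "momentum_limit_1d (u \<epsilon>) (h \<epsilon>) (soliton_momentum \<omega> + \<epsilon> * M)" for \<epsilon>
  proof -
    have "momentum_limit_1d (u \<epsilon>) (h \<epsilon>) (soliton_momentum \<omega> + 1/2 * (LINT x|lborel. (\<i> * (g x + h \<epsilon> x)) \<bullet> (u \<epsilon> x - v x)))"
    proof (rule momentum_limit_perturb[OF feu ac lim])
      show "integrable lborel (\<lambda>x. (cmod (u \<epsilon> x - v x))\<^sup>2)"
        using integrable_mult_right[OF i5(2), of "\<epsilon>\<^sup>2"] by (simp add: du power_mult_distrib mult.assoc)
      show "integrable lborel (\<lambda>x. (\<i> * (g x + h \<epsilon> x)) \<bullet> (u \<epsilon> x - v x))"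
        unfolding jj by (intro integrable_mult_right i2)
    qed
    moreover have "1/2 * (LINT x|lborel. (\<i> * (g x + h \<epsilon> x)) \<bullet> (u \<epsilon> x - v x)) = \<epsilon> * M" unfolding jj M_def by simp
    ultimately show ?thesis by simp
  qed
  \<comment> \<open>Gradient and potential make the energy a quartic polynomial in \<epsilon>.
    Subtracting the parabola leaves a nonnegative quartic that vanishes at 0, so its linear
    coefficient is zero.\<close>
  have "(LINT x|lborel. f1 x) + sqrt 2 * sin \<omega> * M = 0"
  proof (rule polynomial_nonneg_imp_linear_coeff_zero)
    fix \<epsilon> :: real
    show "0 \<le> ((LINT x|lborel. f1 x) + sqrt 2 * sin \<omega> * M) * \<epsilon> + ((LINT x|lborel. f2 x) + K * M\<^sup>2) * \<epsilon>\<^sup>2 + (LINT x|lborel. f3 x) * \<epsilon> ^ 3 + (LINT x|lborel. f4 x) * \<epsilon> ^ 4"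
      using K(2)[OF feu Pu, of \<epsilon>] E unfolding Eu by (simp add: algebra_simps power_mult_distrib)
  qed
  moreover have "(LINT x|lborel. f1 x) = (LINT x|lborel. a' x * (g x \<bullet> \<gamma>)) - (LINT x|lborel. \<eta> x * (a x * (v x \<bullet> \<gamma>)))"
    unfolding f1_def using i1 i3 by simp
  moreover have "(LINT x|lborel. a x * (\<eta> x * (v x \<bullet> \<gamma>) - sqrt 2 * sin \<omega> * ((\<i> * g x) \<bullet> \<gamma>)))
      = (LINT x|lborel. \<eta> x * (a x * (v x \<bullet> \<gamma>)) - (sqrt 2 * sin \<omega>) * (a x * ((\<i> * g x) \<bullet> \<gamma>)))"
    by (intro Bochner_Integration.integral_cong) (simp_all add: algebra_simps)
  moreover have "\<dots> = (LINT x|lborel. \<eta> x * (a x * (v x \<bullet> \<gamma>))) - sqrt 2 * sin \<omega> * M"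
    unfolding M_def using i3 i2 by (subst Bochner_Integration.integral_diff) auto
  ultimately show ?thesis by simp
qed

text \<open>Bootstrapping. Testing in all constant directions says that \<open>g\<close> has the
  weak derivative \<open>h\<close>, so \<open>g\<close> has a continuous representative
  \<open>G\<close>. Rewriting \<open>h\<close> with \<open>G\<close> gives a continuous derivative,
  and the equation holds everywhere.\<close>

lemma minimal_profile_smooth:
  assumes fe: "finite_energy_1d v g" and \<omega>: "\<bar>\<omega>\<bar> < pi / 2"
    and lim: "((\<lambda>R. cis (2 * momentum_upto v R)) \<longlongrightarrow> cis (2 * soliton_momentum \<omega>)) at_top"
    and E: "energy_1d v g \<le> soliton_energy \<omega>"
  obtains G where "AE x in lborel. g x = G x" "\<And>x. (v has_vector_derivative G x) (at x)"
    "\<And>x. (G has_vector_derivative (sqrt 2 * sin \<omega>) *\<^sub>R (\<i> * G x) - (1 - (cmod (v x))\<^sup>2) *\<^sub>R v x) (at x)"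
proof -
  have ac: "has_ac_derivative v g" using fe by (simp add: finite_energy_1d_def)
  note vc[continuous_intros] = continuous_on_compose2[OF ac_continuous_on[OF ac, of UNIV] _ subset_UNIV]
  define c where "c = sqrt 2 * sin \<omega>"
  define \<eta> where "\<eta> = (\<lambda>x. 1 - (cmod (v x))\<^sup>2)"
  define h where "h x = c *\<^sub>R (\<i> * g x) - \<eta> x *\<^sub>R v x" for x
  have aci: "has_ac_derivative (\<lambda>x. \<i> * v x) (\<lambda>x. \<i> * g x)" using ac_bounded_linear[OF bounded_linear_mult_right ac] .
  have lg: "locally_integrable g" by (rule locally_integrable_1d[OF ac_measurable[OF ac] ac_integrable[OF ac]])
  have ce: "continuous_on UNIV (\<lambda>x. \<eta> x *\<^sub>R v x)" unfolding \<eta>_def by (intro continuous_intros)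
  have lh: "locally_integrable h"
  proof (rule locally_integrable_1d)
    note [measurable] = ac_measurable[OF ac] borel_measurable_continuous_onI[OF ce]
    show "h \<in> borel_measurable borel" unfolding h_def by measurable
    show "set_integrable lborel {a..b} h" for a b
      unfolding h_def by (intro set_integral_diff set_integrable_scaleR_right ac_integrable[OF aci] locally_integrable_1dD[OF locally_integrable_continuous[OF ce]])
  qed
  have "has_weak_partial 1 g h"
    unfolding has_weak_partial_def
  proof (intro conjI lg lh allI impI)
    fix \<phi> D assume t: "test_function \<phi> (D :: real \<Rightarrow> real \<Rightarrow>\<^sub>L real)"
    note a = test_function_real[OF t]
    obtain N where N: "\<And>x. N < \<bar>x\<bar> \<Longrightarrow> \<phi> x = 0" "\<And>x. N < \<bar>x\<bar> \<Longrightarrow> D x 1 = 0" using C1_compact_support[OF a] by metis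
    have int: "integrable lborel (\<lambda>x. b x *\<^sub>R f x)" if b: "continuous_on UNIV b" "\<And>x. N < \<bar>x\<bar> \<Longrightarrow> b x = 0" and f: "locally_integrable f"
      for b and f :: "real \<Rightarrow> complex"
    proof -
      obtain C where C: "\<And>x. \<bar>b x\<bar> \<le> C" using continuous_compact_support_bounded[OF b] by metis
      show ?thesis by (rule integrable_cutoff[OF f _ C, where K = "{-N..N}"]) (use b in \<open>auto intro: borel_measurable_continuous_onI\<close>)
    qed
    note i1 = int[OF C1_compact_continuous(2)[OF a] N(2) lg] and i2 = int[OF C1_compact_continuous(1)[OF a] N(1) lh]
    have "(LINT x|lborel. D x 1 *\<^sub>R g x) \<bullet> \<gamma> = (- (LINT x|lborel. \<phi> x *\<^sub>R h x)) \<bullet> \<gamma>" for \<gamma>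
    proof -
      have "(LINT x|lborel. D x 1 *\<^sub>R g x) \<bullet> \<gamma> = (LINT x|lborel. D x 1 * (g x \<bullet> \<gamma>))"
        using integral_inner_left[OF i1, of \<gamma>] by simp
      also have "\<dots> = (LINT x|lborel. \<phi> x * (\<eta> x * (v x \<bullet> \<gamma>) - c * ((\<i> * g x) \<bullet> \<gamma>)))"
        unfolding \<eta>_def c_def by (rule euler_lagrange_tested[OF fe \<omega> lim E a])
      also have "\<dots> = (LINT x|lborel. - ((\<phi> x *\<^sub>R h x) \<bullet> \<gamma>))"
        unfolding h_def by (intro Bochner_Integration.integral_cong) (simp_all add: inner_diff_left algebra_simps)
      also have "\<dots> = - (LINT x|lborel. (\<phi> x *\<^sub>R h x) \<bullet> \<gamma>)" by simp
      also have "\<dots> = (- (LINT x|lborel. \<phi> x *\<^sub>R h x)) \<bullet> \<gamma>" using integral_inner_left[OF i2, of \<gamma>] by simp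
      finally show ?thesis .
    qed
    then show "(LINT x|lborel. blinfun_apply (D x) 1 *\<^sub>R g x) = - (LINT x|lborel. \<phi> x *\<^sub>R h x)"
      by (subst vector_eq_rdot[symmetric]) simp
  qed
  then obtain G where G: "has_ac_derivative G h" "AE x in lborel. g x = G x" by (rule weak_partial_imp_ac_1d)
  note Gc = ac_continuous_on[OF G(1), of UNIV]
  have acG: "has_ac_derivative v G"
    by (rule ac_cong_AE[OF ac G(2) borel_measurable_continuous_onI[OF Gc]])
  define H where "H x = c *\<^sub>R (\<i> * G x) - \<eta> x *\<^sub>R v x" for x
  have Hc: "continuous_on UNIV H" unfolding H_def by (intro continuous_intros Gc ce)
  have acH: "has_ac_derivative G H"
    by (rule ac_cong_AE[OF G(1) _ borel_measurable_continuous_onI[OF Hc]]) (use G(2) in \<open>eventually_elim, simp add: H_def h_def\<close>)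
  show ?thesis
  proof (rule that[OF G(2) ac_continuous_imp_C1[OF acG Gc]])
    show "(G has_vector_derivative (sqrt 2 * sin \<omega>) *\<^sub>R (\<i> * G x) - (1 - (cmod (v x))\<^sup>2) *\<^sub>R v x) (at x)" for x
      using ac_continuous_imp_C1[OF acH Hc, of x] by (simp only: H_def c_def \<eta>_def)
  qed
qed

section \<open>Classification of travelling waves of finite energy\<close>

text \<open>The quotient \<open>Y\<close> linearises the equation: it satisfies
  \<open>Y' = - k * Y\<close> and is therefore an exponential.\<close>

lemma riccati_tanh:
  fixes r :: "real \<Rightarrow> real"
  assumes A: "A > 0" and d: "\<And>x. (r has_real_derivative (A\<^sup>2 - (r x)\<^sup>2) / sqrt 2) (at x)" and b: "\<And>x. \<bar>r x\<bar> < A"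
  obtains a where "\<And>x. r x = A * tanh (A / sqrt 2 * (x - a))"
proof -
  define Y where "Y x = (A - r x) / (A + r x)" for x
  define k where "k = sqrt 2 * A"
  have pos: "A + r x > 0" "A - r x > 0" for x using b[of x] by auto
  have Yp: "Y x > 0" for x using pos[of x] by (simp add: Y_def)
  have k: "k > 0" using A by (simp add: k_def)
  have dY: "(Y has_real_derivative - k * Y x) (at x)" for x
  proof -
    define R where "R = (A\<^sup>2 - (r x)\<^sup>2) / sqrt 2"
    have nz: "A + r x \<noteq> 0" using pos[of x] by simp
    have "(Y has_real_derivative (- R * (A + r x) - (A - r x) * R) / ((A + r x) * (A + r x))) (at x)"
      unfolding Y_def R_def by (rule derivative_eq_intros d refl nz | simp)+
    moreover have "(- R * (A + r x) - (A - r x) * R) / ((A + r x) * (A + r x)) = - k * Y x"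
    proof -
      have "- R * (A + r x) - (A - r x) * R = - (2 / sqrt 2) * A * (A - r x) * (A + r x)"
        unfolding R_def by (simp add: field_simps power2_eq_square)
      also have "2 / sqrt 2 = sqrt 2" by (simp add: real_div_sqrt)
      finally show ?thesis using nz by (simp add: Y_def k_def)
    qed
    ultimately show ?thesis by simp
  qed
  have "((\<lambda>x. Y x * exp (k * x)) has_real_derivative 0) (at x)" for x
    by (auto intro!: derivative_eq_intros dY)
  then have const: "Y x * exp (k * x) = Y 0 * exp (k * 0)" for x
    using DERIV_isconst_all[of "\<lambda>x. Y x * exp (k * x)" x 0] by blast
  define a where "a = ln (Y 0) / k"
  have Ye: "Y x = exp (- (k * (x - a)))" for x
  proof -
    have "k * a = ln (Y 0)" using k by (simp add: a_def)
    then have "exp (- (k * (x - a))) = Y 0 * exp (- (k * x))" using Yp[of 0] by (simp add: exp_diff exp_minus algebra_simps divide_inverse)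
    also have "\<dots> = Y x * exp (k * x) * exp (- (k * x))" using const[of x] by simp
    also have "\<dots> = Y x" by (simp add: mult.assoc flip: exp_add)
    finally show ?thesis ..
  qed
  have "r x = A * tanh (A / sqrt 2 * (x - a))" for x
  proof -
    have h: "2 * (A / sqrt 2 * (x - a)) = k * (x - a)"
      by (simp add: k_def real_div_sqrt field_simps flip: power2_eq_square)
    have "tanh (A / sqrt 2 * (x - a)) = (1 - Y x) / (1 + Y x)"
      unfolding tanh_real_altdef Ye using h by (simp add: mult.assoc)
    also have "\<dots> = r x / A"
    proof -
      have "1 - Y x = 2 * r x / (A + r x)" "1 + Y x = 2 * A / (A + r x)"
        using pos[of x] by (simp_all add: Y_def field_simps)
      then show ?thesis using pos[of x] A by simp
    qed
    finally show ?thesis using A by simp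
  qed
  then show ?thesis by (rule that)
qed

text \<open>The vanishing first integrals say that the speed is
  \<open>\<bar>\<eta> x\<bar> / sqrt 2\<close> and that the direction of motion does not turn. The
  curve stays on a straight line, and the coordinate along this line solves a Riccati
  equation.\<close>

theorem traveling_wave_classification:
  assumes dv: "\<And>x. (v has_vector_derivative g x) (at x)"
    and dg: "\<And>x. (g has_vector_derivative c *\<^sub>R (\<i> * g x) - (1 - (cmod (v x))\<^sup>2) *\<^sub>R v x) (at x)"
    and int: "integrable lborel (\<lambda>x. (cmod (g x))\<^sup>2)" "integrable lborel (\<lambda>x. (1 - (cmod (v x))\<^sup>2)\<^sup>2)"
    and c: "\<bar>c\<bar> < sqrt 2" and nontrivial: "energy_1d v g \<noteq> 0"
  obtains C a \<alpha> where "\<bar>C\<bar> < sqrt 2" "\<And>x. v x = cis \<alpha> * dark_soliton C (x - a)"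
proof -
  define a b p q \<eta> where "a x = Re (v x)" and "b x = Im (v x)" and "p x = Re (g x)" and "q x = Im (g x)"
    and "\<eta> x = 1 - (a x)\<^sup>2 - (b x)\<^sup>2" for x
  have eta: "1 - (cmod (v x))\<^sup>2 = \<eta> x" and gsq: "(cmod (g x))\<^sup>2 = (p x)\<^sup>2 + (q x)\<^sup>2" for x
    by (simp_all add: \<eta>_def a_def b_def p_def q_def cmod_power2)
  have D: "((\<lambda>x. Re (f x)) has_real_derivative Re f') (at x)" "((\<lambda>x. Im (f x)) has_real_derivative Im f') (at x)"
    if "(f has_vector_derivative f') (at x)" for f f' x
    using bounded_linear.has_vector_derivative[OF bounded_linear_Re that] bounded_linear.has_vector_derivative[OF bounded_linear_Im that]
    by (simp_all add: has_real_derivative_iff_has_vector_derivative)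
  have da: "(a has_real_derivative p x) (at x)" and db: "(b has_real_derivative q x) (at x)" for x
    using D[OF dv] by (simp_all add: a_def[abs_def] b_def[abs_def] p_def q_def)
  have dp: "(p has_real_derivative - c * q x - \<eta> x * a x) (at x)" and dq: "(q has_real_derivative c * p x - \<eta> x * b x) (at x)" for x
    using D[OF dg] unfolding eta by (simp_all add: a_def b_def p_def[abs_def] q_def[abs_def])
  have d\<eta>: "(\<eta> has_real_derivative - 2 * (a x * p x + b x * q x)) (at x)" for x
    unfolding \<eta>_def[abs_def] by (auto intro!: derivative_eq_intros da db)
  obtain R where R: "(\<lambda>n. (p (R n))\<^sup>2 + (q (R n))\<^sup>2 + (\<eta> (R n))\<^sup>2) \<longlonglongrightarrow> 0" "(\<lambda>n. (p (- R n))\<^sup>2 + (q (- R n))\<^sup>2 + (\<eta> (- R n))\<^sup>2) \<longlonglongrightarrow> 0"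
      "filterlim R at_top sequentially"
    using integrable_sequence_to_zero[of "\<lambda>x. (p x)\<^sup>2 + (q x)\<^sup>2 + (\<eta> x)\<^sup>2"] int unfolding eta gsq by (auto intro: Bochner_Integration.integrable_add)
  define f where "f x = (p x)\<^sup>2 + (q x)\<^sup>2 + (\<eta> x)\<^sup>2" for x
  have f: "(\<lambda>n. f (R n)) \<longlonglongrightarrow> 0" "0 \<le> f x" for x using R(1) by (simp_all add: f_def)
  \<comment> \<open>A conserved quantity dominated by powers of \<open>f\<close> vanishes, because
    \<open>f\<close> tends to zero along the radii \<open>R n\<close>.\<close>
  have zero_if_const: "N x = 0" if "\<And>x. (N has_real_derivative 0) (at x)" "\<And>x. (N x)\<^sup>2 \<le> k * f x + m * (f x)\<^sup>2" for N :: "real \<Rightarrow> real" and k m x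
  proof -
    have "(\<lambda>n. k * f (R n) + m * (f (R n))\<^sup>2) \<longlonglongrightarrow> k * 0 + m * 0\<^sup>2" by (intro tendsto_intros f)
    moreover have "(N x)\<^sup>2 \<le> k * f (R n) + m * (f (R n))\<^sup>2" for n
      using that(2)[of "R n"] DERIV_isconst_all[of N x "R n"] that(1) by simp
    ultimately have "(N x)\<^sup>2 \<le> k * 0 + m * 0\<^sup>2" by (intro LIMSEQ_le_const) auto
    then show ?thesis by simp
  qed
  \<comment> \<open>The integral belonging to translation invariance.\<close>
  have first: "2 * ((p x)\<^sup>2 + (q x)\<^sup>2) - (\<eta> x)\<^sup>2 = 0" for x
  proof (rule zero_if_const[where N = "\<lambda>x. 2 * ((p x)\<^sup>2 + (q x)\<^sup>2) - (\<eta> x)\<^sup>2" and k = 0 and m = 4])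
    show "((\<lambda>x. 2 * ((p x)\<^sup>2 + (q x)\<^sup>2) - (\<eta> x)\<^sup>2) has_real_derivative 0) (at x)" for x
      by (auto intro!: derivative_eq_intros dp dq d\<eta> simp: algebra_simps)
    show "(2 * ((p x)\<^sup>2 + (q x)\<^sup>2) - (\<eta> x)\<^sup>2)\<^sup>2 \<le> 0 * f x + 4 * (f x)\<^sup>2" for x
    proof -
      have "\<bar>2 * ((p x)\<^sup>2 + (q x)\<^sup>2) - (\<eta> x)\<^sup>2\<bar> \<le> \<bar>2 * f x\<bar>"
      proof -
        have "\<bar>2 * u - w\<bar> \<le> \<bar>2 * (u + w)\<bar>" if "0 \<le> u" "0 \<le> w" for u w :: real
          by (rule order_trans[OF abs_leI abs_ge_self]) (use that in auto)
        from this[of "(p x)\<^sup>2 + (q x)\<^sup>2" "(\<eta> x)\<^sup>2"] show ?thesis unfolding f_def by (simp only: sum_power2_ge_zero zero_le_power2 simp_thms)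
      qed
      then show ?thesis by (simp only: abs_le_square_iff power_mult_distrib) simp
    qed
  qed
  \<comment> \<open>The integral belonging to phase invariance: angular momentum corrected by the
    speed.\<close>
  have second: "q x * a x - p x * b x + c / 2 * \<eta> x = 0" for x
  proof (rule zero_if_const[where N = "\<lambda>x. q x * a x - p x * b x + c / 2 * \<eta> x" and k = "4 + c\<^sup>2" and m = 2])
    show "((\<lambda>x. q x * a x - p x * b x + c / 2 * \<eta> x) has_real_derivative 0) (at x)" for x
      by (auto intro!: derivative_eq_intros dp dq d\<eta> da db simp: field_simps)
    show "(q x * a x - p x * b x + c / 2 * \<eta> x)\<^sup>2 \<le> (4 + c\<^sup>2) * f x + 2 * (f x)\<^sup>2" for x
    proof -
      define g2 m where "g2 = (p x)\<^sup>2 + (q x)\<^sup>2" and "m = q x * a x - p x * b x"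
      have "m\<^sup>2 + (p x * a x + q x * b x)\<^sup>2 = g2 * (1 - \<eta> x)"
        by (simp add: g2_def m_def \<eta>_def power2_eq_square algebra_simps)
      then have "m\<^sup>2 \<le> g2 * (1 - \<eta> x)" using zero_le_power2[of "p x * a x + q x * b x"] by linarith
      also have "\<dots> \<le> g2 * (2 + (\<eta> x)\<^sup>2)"
      proof (rule mult_left_mono)
        show "1 - \<eta> x \<le> 2 + (\<eta> x)\<^sup>2" using zero_le_power2[of "\<eta> x + 1/2"] by (simp add: power2_eq_square algebra_simps)
      qed (simp add: g2_def)
      also have "\<dots> \<le> 2 * f x + (f x)\<^sup>2"
      proof -
        have "g2 * (\<eta> x)\<^sup>2 \<le> f x * f x" by (intro mult_mono) (auto simp: f_def g2_def)
        moreover have "g2 \<le> f x" by (simp add: f_def g2_def)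
        ultimately show ?thesis by (simp add: distrib_left flip: power2_eq_square)
      qed
      finally have "m\<^sup>2 \<le> 2 * f x + (f x)\<^sup>2" .
      moreover have "(m + c / 2 * \<eta> x)\<^sup>2 \<le> 2 * m\<^sup>2 + c\<^sup>2 * (\<eta> x)\<^sup>2"
        using zero_le_power2[of "m - c / 2 * \<eta> x"] zero_le_power2[of "c * \<eta> x"] by (simp add: power2_eq_square algebra_simps)
      moreover have "c\<^sup>2 * (\<eta> x)\<^sup>2 \<le> c\<^sup>2 * f x" by (intro mult_left_mono) (auto simp: f_def)
      ultimately show ?thesis unfolding m_def[symmetric] by (simp add: algebra_simps)
    qed
  qed
  \<comment> \<open>Up to a factor the left side is the square of the derivative of \<eta>.
    Lagrange's identity for the position and velocity vectors, with both first integrals inserted,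
    closes the equation for \<eta>.\<close>
  have square: "4 * (a x * p x + b x * q x)\<^sup>2 = (\<eta> x)\<^sup>2 * (2 - c\<^sup>2 - 2 * \<eta> x)" for x
  proof -
    have e1: "(a x * p x + b x * q x)\<^sup>2 + (q x * a x - p x * b x)\<^sup>2 = ((p x)\<^sup>2 + (q x)\<^sup>2) * (1 - \<eta> x)"
      by (simp add: \<eta>_def power2_eq_square algebra_simps)
    have e2: "q x * a x - p x * b x = - (c / 2) * \<eta> x" and e3: "(p x)\<^sup>2 + (q x)\<^sup>2 = (\<eta> x)\<^sup>2 / 2" using first[of x] second[of x] by simp_all
    have "(- (c / 2) * \<eta> x)\<^sup>2 = c\<^sup>2 * (\<eta> x)\<^sup>2 / 4" by (simp add: power2_eq_square)
    with e1[unfolded e2 e3] show ?thesis by (simp add: algebra_simps)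
  qed
  have c2: "c\<^sup>2 < 2" using power_strict_mono[OF c, of 2] by simp
  \<comment> \<open>A negative value forces a negative interior minimum, since \<eta> is small in
    modulus at distant points on both sides. There the derivative vanishes, while both factors on
    the right of \<open>square\<close> are nonzero.\<close>
  have \<eta>_nonneg: "0 \<le> \<eta> x" for x
  proof (rule ccontr)
    assume neg: "\<not> 0 \<le> \<eta> x"
    have pos: "0 < (\<eta> x)\<^sup>2" using neg by simp
    have "eventually (\<lambda>n. R n > \<bar>x\<bar>) sequentially" using R(3) unfolding filterlim_at_top_dense by blast
    with order_tendstoD(2)[OF R(1) pos] order_tendstoD(2)[OF R(2) pos]
    have "eventually (\<lambda>n. R n > \<bar>x\<bar> \<and> (\<eta> (R n))\<^sup>2 < (\<eta> x)\<^sup>2 \<and> (\<eta> (- R n))\<^sup>2 < (\<eta> x)\<^sup>2) sequentially"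
    proof eventually_elim
      case (elim n)
      have "(\<eta> y)\<^sup>2 \<le> (p y)\<^sup>2 + (q y)\<^sup>2 + (\<eta> y)\<^sup>2" for y by simp
      from le_less_trans[OF this elim(1)] le_less_trans[OF this elim(2)] elim(3) show ?case by simp
    qed
    then obtain n where n: "R n > \<bar>x\<bar>" "(\<eta> (R n))\<^sup>2 < (\<eta> x)\<^sup>2" "(\<eta> (- R n))\<^sup>2 < (\<eta> x)\<^sup>2"
      unfolding eventually_sequentially by (metis order_refl)
    have "continuous_on {- R n..R n} \<eta>" using d\<eta> by (meson DERIV_isCont continuous_at_imp_continuous_on)
    moreover have "{- R n..R n} \<noteq> {}" using n(1) by auto
    ultimately obtain z where z: "z \<in> {- R n..R n}" "\<And>y. y \<in> {- R n..R n} \<Longrightarrow> \<eta> z \<le> \<eta> y"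
      using continuous_attains_inf[OF compact_Icc] by metis
    have zx: "\<eta> z \<le> \<eta> x" using n(1) by (intro z(2)) (auto simp: abs_less_iff)
    have sq: "(\<eta> x)\<^sup>2 \<le> (\<eta> z)\<^sup>2" using zx neg by (auto simp: abs_le_square_iff[symmetric])
    have "z \<noteq> R n" "z \<noteq> - R n" using sq n by auto
    then have zi: "- R n < z" "z < R n" using z(1) by auto
    have "- 2 * (a z * p z + b z * q z) = 0"
    proof (rule DERIV_local_min[OF d\<eta>])
      show "0 < min (z + R n) (R n - z)" using zi by simp
      show "\<forall>y. \<bar>z - y\<bar> < min (z + R n) (R n - z) \<longrightarrow> \<eta> z \<le> \<eta> y" using z(2) by (auto simp: abs_less_iff)
    qed
    then have "a z * p z + b z * q z = 0" by simp
    then have "(\<eta> z)\<^sup>2 * (2 - c\<^sup>2 - 2 * \<eta> z) = 0" using square[of z] by simp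
    then show False using zx neg c2 by auto
  qed
  have slope: "\<bar>2 * (a x * p x + b x * q x)\<bar> \<le> 2 * \<eta> x" for x
  proof -
    have "(\<eta> x)\<^sup>2 * (2 - c\<^sup>2 - 2 * \<eta> x) \<le> (\<eta> x)\<^sup>2 * 4"
    proof (rule mult_left_mono)
      have "2 - c\<^sup>2 - 2 * \<eta> x \<le> 2 - 0 - 2 * 0" by (intro diff_mono mult_left_mono order_refl zero_le_power2 \<eta>_nonneg) simp
      then show "2 - c\<^sup>2 - 2 * \<eta> x \<le> 4" by simp
    qed simp
    then have "(2 * (a x * p x + b x * q x))\<^sup>2 \<le> (2 * \<eta> x)\<^sup>2" using square[of x] unfolding power_mult_distrib by simp
    then have "\<bar>2 * (a x * p x + b x * q x)\<bar> \<le> \<bar>2 * \<eta> x\<bar>" unfolding abs_le_square_iff .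
    moreover have "\<bar>2 * \<eta> x\<bar> = 2 * \<eta> x" using \<eta>_nonneg[of x] by simp
    ultimately show ?thesis by (simp only:)
  qed
  \<comment> \<open>The bound \<open>slope\<close> says that the derivative of \<eta> is at most
    twice \<eta> in modulus. By Gronwall in both directions a single zero makes \<eta> vanish
    identically; then the velocity and the energy vanish too.\<close>
  have \<eta>_pos: "0 < \<eta> x" for x
  proof (rule ccontr)
    assume "\<not> 0 < \<eta> x"
    then have x0: "\<eta> x = 0" using \<eta>_nonneg[of x] by simp
    have d1: "((\<lambda>x. exp (s * 2 * x) * \<eta> x) has_real_derivative exp (s * 2 * y) * (s * 2 * \<eta> y - 2 * (a y * p y + b y * q y))) (at y)" for s y
      by (auto intro!: derivative_eq_intros d\<eta> simp: algebra_simps)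
    have sl: "0 \<le> 1 * 2 * \<eta> z - 2 * (a z * p z + b z * q z)" "- 1 * 2 * \<eta> z - 2 * (a z * p z + b z * q z) \<le> 0" for z
      using abs_le_D1[OF slope[of z]] abs_le_D2[OF slope[of z]] by linarith+
    have "\<eta> y \<le> 0" for y
    proof (cases "y \<le> x")
      case True
      have "exp (1 * 2 * y) * \<eta> y \<le> exp (1 * 2 * x) * \<eta> x"
      proof (rule DERIV_nonneg_imp_nondecreasing[OF True])
        show "\<exists>D. ((\<lambda>a. exp (1 * 2 * a) * \<eta> a) has_real_derivative D) (at z) \<and> 0 \<le> D" for z
          by (rule exI, rule conjI[OF d1 mult_nonneg_nonneg[OF exp_ge_zero sl(1)]])
      qed
      then show ?thesis using x0 by (simp add: mult_le_0_iff)
    next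
      case False
      then have "x \<le> y" by simp
      then have "exp (- 1 * 2 * y) * \<eta> y \<le> exp (- 1 * 2 * x) * \<eta> x"
      proof (rule DERIV_nonpos_imp_nonincreasing)
        show "\<exists>D. ((\<lambda>a. exp (- 1 * 2 * a) * \<eta> a) has_real_derivative D) (at z) \<and> D \<le> 0" for z
          by (rule exI, rule conjI[OF d1 mult_nonneg_nonpos[OF exp_ge_zero sl(2)]])
      qed
      then show ?thesis using x0 by (simp add: mult_le_0_iff)
    qed
    then have "\<eta> y = 0" for y using \<eta>_nonneg[of y] by (simp add: order_antisym)
    note \<eta>0 = this
    have "(p y)\<^sup>2 + (q y)\<^sup>2 = 0" for y
    proof -
      have "(p y)\<^sup>2 + (q y)\<^sup>2 = (\<eta> y)\<^sup>2 / 2" using first[of y] by simp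
      also have "\<dots> = 0" using \<eta>0 by simp
      finally show ?thesis .
    qed
    then have "energy_1d v g = 0" unfolding energy_1d_def eta gsq \<eta>0 by simp
    then show False using nontrivial by blast
  qed
  \<comment> \<open>Velocity divided by \<eta> is constant, so the curve moves in a fixed
    direction.\<close>
  have cP: "p x / \<eta> x = p 0 / \<eta> 0" and cQ: "q x / \<eta> x = q 0 / \<eta> 0" for x
  proof -
    have g2: "(\<eta> y)\<^sup>2 = 2 * ((p y)\<^sup>2 + (q y)\<^sup>2)" and ce: "c * \<eta> y = 2 * (p y * b y - q y * a y)" for y using first[of y] second[of y] by (simp_all add: algebra_simps)
    have nP: "(- c * q y - \<eta> y * a y) * \<eta> y - p y * (- 2 * (a y * p y + b y * q y)) = 0" for y
    proof -
      have "(- c * q y - \<eta> y * a y) * \<eta> y = - q y * (c * \<eta> y) - a y * (\<eta> y)\<^sup>2" by (simp add: power2_eq_square algebra_simps)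
      then show ?thesis unfolding g2 ce by (simp add: power2_eq_square algebra_simps)
    qed
    have nQ: "(c * p y - \<eta> y * b y) * \<eta> y - q y * (- 2 * (a y * p y + b y * q y)) = 0" for y
    proof -
      have "(c * p y - \<eta> y * b y) * \<eta> y = p y * (c * \<eta> y) - b y * (\<eta> y)\<^sup>2" by (simp add: power2_eq_square algebra_simps)
      then show ?thesis unfolding g2 ce by (simp add: power2_eq_square algebra_simps)
    qed
    have nz: "\<eta> y \<noteq> 0" for y using \<eta>_pos[of y] by simp
    have "((\<lambda>x. p x / \<eta> x) has_real_derivative 0) (at y)" for y using DERIV_divide[OF dp[of y] d\<eta>[of y] nz] nP[of y] by simp
    then show "p x / \<eta> x = p 0 / \<eta> 0" using DERIV_isconst_all[of "\<lambda>x. p x / \<eta> x" x 0] by blast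
    have "((\<lambda>x. q x / \<eta> x) has_real_derivative 0) (at y)" for y using DERIV_divide[OF dq[of y] d\<eta>[of y] nz] nQ[of y] by simp
    then show "q x / \<eta> x = q 0 / \<eta> 0" using DERIV_isconst_all[of "\<lambda>x. q x / \<eta> x" x 0] by blast
  qed
  \<comment> \<open>The factor \<open>sqrt 2\<close> normalises this direction to a unit vector, the
    cosine and sine of the final phase \<alpha>.\<close>
  define P Q where "P = sqrt 2 * (p 0 / \<eta> 0)" and "Q = sqrt 2 * (q 0 / \<eta> 0)"
  have pq: "p x = P * (\<eta> x / sqrt 2)" "q x = Q * (\<eta> x / sqrt 2)" for x
    using cP[of x] cQ[of x] \<eta>_pos[of x] by (simp_all add: P_def Q_def field_simps)
  have PQ: "P\<^sup>2 + Q\<^sup>2 = 1"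
  proof -
    have "(P\<^sup>2 + Q\<^sup>2) * (\<eta> 0)\<^sup>2 = (\<eta> 0)\<^sup>2" using first[of 0] unfolding pq[of 0] by (simp add: power_mult_distrib power_divide field_simps)
    then show ?thesis using \<eta>_pos[of 0] by simp
  qed
  then obtain \<alpha> where al: "P = cos \<alpha>" "Q = sin \<alpha>" using sincos_total_2pi by metis
  \<comment> \<open>Coordinates of the curve along and across the line on which it moves; the second
    one is constant.\<close>
  define r s where "r x = P * a x + Q * b x" and "s x = P * b x - Q * a x" for x
  have "(s has_real_derivative P * q x - Q * p x) (at x)" for x unfolding s_def[abs_def] by (auto intro!: derivative_eq_intros da db)
  then have "(s has_real_derivative 0) (at x)" for x unfolding pq by (simp add: algebra_simps)
  then have sc: "s x = s 0" for x using DERIV_isconst_all[of s x 0] by blast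
  define C where "C = s 0"
  have "(r has_real_derivative P * p x + Q * q x) (at x)" for x unfolding r_def[abs_def] by (auto intro!: derivative_eq_intros da db)
  moreover have "P * p x + Q * q x = \<eta> x / sqrt 2" for x
  proof -
    have "P * p x + Q * q x = (P\<^sup>2 + Q\<^sup>2) * (\<eta> x / sqrt 2)" unfolding pq by (simp add: power2_eq_square algebra_simps add_divide_distrib)
    then show ?thesis using PQ by simp
  qed
  ultimately have dr: "(r has_real_derivative \<eta> x / sqrt 2) (at x)" for x by simp
  have rs: "(r x)\<^sup>2 + C\<^sup>2 = 1 - \<eta> x" for x
  proof -
    have "(r x)\<^sup>2 + (s x)\<^sup>2 = (P\<^sup>2 + Q\<^sup>2) * ((a x)\<^sup>2 + (b x)\<^sup>2)" by (simp add: r_def s_def power2_eq_square algebra_simps)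
    then show ?thesis using PQ sc[of x] by (simp add: C_def \<eta>_def)
  qed
  define A where "A = sqrt (1 - C\<^sup>2)"
  have C1: "C\<^sup>2 < 1" using rs[of 0] \<eta>_pos[of 0] zero_le_power2[of "r 0"] by linarith
  then have A: "A > 0" "A\<^sup>2 = 1 - C\<^sup>2" by (simp_all add: A_def)
  have eA: "\<eta> x = A\<^sup>2 - (r x)\<^sup>2" for x using rs[of x] A(2) by simp
  have rb: "\<bar>r x\<bar> < A" for x using \<eta>_pos[of x] A(1) unfolding eA by (intro power2_less_imp_less[of "\<bar>r x\<bar>" A]) auto
  obtain x0 where x0: "\<And>x. r x = A * tanh (A / sqrt 2 * (x - x0))"
    using riccati_tanh[OF A(1) dr[unfolded eA] rb] by blast
  show ?thesis
  proof (rule that[of "sqrt 2 * C" \<alpha> x0])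
    have "\<bar>C\<bar> < 1" using C1 by (simp add: abs_square_less_1)
    then show "\<bar>sqrt 2 * C\<bar> < sqrt 2" by (simp add: abs_mult)
    fix x
    have "sqrt ((2 - (sqrt 2 * C)\<^sup>2) / 2) = A" by (simp add: A_def power_mult_distrib diff_divide_distrib)
    moreover have "sqrt (2 - (sqrt 2 * C)\<^sup>2) / 2 = A / sqrt 2"
    proof -
      have "sqrt (2 - (sqrt 2 * C)\<^sup>2) = sqrt 2 * A" by (simp add: A_def power_mult_distrib flip: real_sqrt_mult)
      then show ?thesis by (simp add: field_simps)
    qed
    ultimately have "dark_soliton (sqrt 2 * C) (x - x0) = of_real (r x) + \<i> * of_real C" unfolding dark_soliton_def x0 by simp
    moreover have "v x = cis \<alpha> * (of_real (r x) + \<i> * of_real (s x))"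
    proof -
      have "P * r x - Q * s x = (P\<^sup>2 + Q\<^sup>2) * a x" "P * s x + Q * r x = (P\<^sup>2 + Q\<^sup>2) * b x"
        by (simp_all add: r_def s_def power2_eq_square algebra_simps)
      then show ?thesis using PQ by (simp add: complex_eq_iff al a_def b_def)
    qed
    ultimately show "v x = cis \<alpha> * dark_soliton (sqrt 2 * C) (x - x0)" using sc[of x] by (simp add: C_def)
  qed
qed

text \<open>The multiplier is below the critical speed because the cosine of \<omega> is positive,
  and the positive energy of the soliton excludes constant profiles.\<close>

corollary minimal_profile_is_dark_soliton:
  assumes fe: "finite_energy_1d v g" and \<omega>: "\<bar>\<omega>\<bar> < pi / 2"
    and lim: "((\<lambda>R. cis (2 * momentum_upto v R)) \<longlongrightarrow> cis (2 * soliton_momentum \<omega>)) at_top"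
    and E: "energy_1d v g = soliton_energy \<omega>"
  obtains C a \<alpha> where "\<bar>C\<bar> < sqrt 2" "\<And>x. v x = cis \<alpha> * dark_soliton C (x - a)"
proof -
  obtain G where G: "AE x in lborel. g x = G x" "\<And>x. (v has_vector_derivative G x) (at x)"
    "\<And>x. (G has_vector_derivative (sqrt 2 * sin \<omega>) *\<^sub>R (\<i> * G x) - (1 - (cmod (v x))\<^sup>2) *\<^sub>R v x) (at x)"
    using minimal_profile_smooth[OF fe \<omega> lim eq_refl[OF E]] by metis
  have Gc: "continuous_on UNIV G" using G(3) by (meson continuous_at_imp_continuous_on has_vector_derivative_continuous)
  have ac: "has_ac_derivative v g" using fe by (simp add: finite_energy_1d_def)
  note [measurable] = ac_measurable[OF ac] ac_measurable_self[OF ac] borel_measurable_continuous_onI[OF Gc]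
  have fe1: "integrable lborel (\<lambda>x. (cmod (g x))\<^sup>2)" "integrable lborel (\<lambda>x. (1 - (cmod (v x))\<^sup>2)\<^sup>2)" using fe by (auto simp: finite_energy_1d_def)
  have G2: "integrable lborel (\<lambda>x. (cmod (G x))\<^sup>2)"
    by (rule integrable_cong_AE_imp[OF fe1(1)]) (measurable, use G(1) in \<open>eventually_elim, simp\<close>)
  have cos: "cos \<omega> > 0" using \<omega> by (intro cos_gt_zero_pi) auto
  have "(sin \<omega>)\<^sup>2 < 1" using cos sin_cos_squared_add[of \<omega>] zero_less_power[of "cos \<omega>" 2] by linarith
  then have c: "\<bar>sqrt 2 * sin \<omega>\<bar> < sqrt 2" by (simp add: abs_mult abs_square_less_1)
  have "energy_1d v G = energy_1d v g"
    unfolding energy_1d_def by (rule integral_cong_AE) (measurable, use G(1) in \<open>eventually_elim, simp\<close>)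
  moreover have "soliton_energy \<omega> > 0" using cos by (simp add: soliton_energy_def)
  ultimately have "energy_1d v G \<noteq> 0" using E by simp
  then show ?thesis using traveling_wave_classification[OF G(2,3) G2 fe1(2) c] that by metis
qed

section \<open>Transverse perturbations of the soliton\<close>

lemma half_open_FTC:
  fixes F f :: "real \<Rightarrow> real"
  assumes l: "0 \<le> l" and d: "\<And>x. (F has_real_derivative f x) (at x)" and c: "continuous_on UNIV f"
  shows "set_integrable lborel {0..<l} f" "(LINT x:{0..<l}|lborel. f x) = F l - F 0"
proof -
  have ac: "has_ac_derivative F f" by (rule ac_C1) (use d c in \<open>simp_all add: has_real_derivative_iff_has_vector_derivative\<close>)
  note [measurable] = borel_measurable_continuous_onI[OF c]
  show "set_integrable lborel {0..<l} f"
    by (rule set_integrable_subset[OF ac_integrable[OF ac, of 0 l]]) auto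
  have "(LINT x:{0..<l}|lborel. f x) = (LINT x:{0..l}|lborel. f x)"
    unfolding set_lebesgue_integral_def
  proof (rule integral_cong_AE)
    show "AE x in lborel. indicator {0..<l} x *\<^sub>R f x = indicator {0..l} x *\<^sub>R f x"
      using AE_lborel_singleton[of l] by eventually_elim (auto simp: indicator_def)
  qed measurable
  then show "(LINT x:{0..<l}|lborel. f x) = F l - F 0" using ac_diff[OF ac l] by simp
qed

lemma integral_cos_powers:
  fixes l :: real
  assumes l: "0 < l"
  defines "C \<equiv> \<lambda>y. cos (2 * pi / l * y)"
  shows "(LINT y:{0..<l}|lborel. C y) = 0" "(LINT y:{0..<l}|lborel. (C y)\<^sup>2) = l / 2"
    "(LINT y:{0..<l}|lborel. C y ^ 3) = 0" "(LINT y:{0..<l}|lborel. C y ^ 4) = 3 / 8 * l"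
proof -
  define k where "k = 2 * pi / l"
  define S where "S y = sin (k * y)" for y
  have k: "k \<noteq> 0" "k * l = 2 * pi" using l by (auto simp: k_def)
  have C: "C = (\<lambda>y. cos (k * y))" by (simp add: C_def k_def)
  have S0: "S l = 0" "S 0 = 0" using k by (auto simp: S_def)
  have dS: "(S has_real_derivative k * C y) (at y)" and dC: "(C has_real_derivative - k * S y) (at y)" for y
    unfolding S_def[abs_def] C by (auto intro!: derivative_eq_intros)
  have SS: "S y * S y = 1 - C y * C y" for y
    unfolding S_def C using sin_squared_eq[of "k * y"] by (simp only: power2_eq_square)
  have SSt: "S y * (S y * t) = t - C y * (C y * t)" for y t
    unfolding mult.assoc[symmetric] SS by (simp add: algebra_simps)
  note ring = power2_eq_square power3_eq_cube power4_eq_xxxx algebra_simps SS SSt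
  have cC: "continuous_on UNIV C" unfolding C by (intro continuous_intros)
  have d1: "((\<lambda>y. S y / k) has_real_derivative C y) (at y)" for y
    by (rule DERIV_cong[OF DERIV_cdivide[OF dS]]) (use k in simp)
  have d2: "((\<lambda>y. (y + S y * C y / k) / 2) has_real_derivative (C y)\<^sup>2) (at y)" for y
    by (rule DERIV_cong[OF DERIV_cdivide[OF DERIV_add[OF DERIV_ident DERIV_cdivide[OF DERIV_mult[OF dS dC]]]]])
      (use k in \<open>simp add: add_divide_distrib diff_divide_distrib ring\<close>)
  have d3: "((\<lambda>y. (S y - S y * (S y * S y) / 3) / k) has_real_derivative C y ^ 3) (at y)" for y
    by (rule DERIV_cong[OF DERIV_cdivide[OF DERIV_diff[OF dS DERIV_cdivide[OF DERIV_mult[OF dS DERIV_mult[OF dS dS]]]]]])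
      (use k in \<open>simp add: add_divide_distrib diff_divide_distrib ring\<close>)
  have d4: "((\<lambda>y. 3 / 8 * y + (3 / 8 * (S y * C y) + 1 / 4 * (S y * (C y * (C y * C y)))) / k) has_real_derivative C y ^ 4) (at y)" for y
    by (rule DERIV_cong[OF DERIV_add[OF DERIV_cmult[OF DERIV_ident] DERIV_cdivide[OF DERIV_add[OF DERIV_cmult[OF DERIV_mult[OF dS dC]]
          DERIV_cmult[OF DERIV_mult[OF dS DERIV_mult[OF dC DERIV_mult[OF dC dC]]]]]]]])
      (use k in \<open>simp add: add_divide_distrib diff_divide_distrib ring\<close>)
  note FTC = half_open_FTC(2)[OF less_imp_le[OF l]]
  show "(LINT y:{0..<l}|lborel. C y) = 0" by (subst FTC[OF d1 cC]) (simp add: S0)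
  show "(LINT y:{0..<l}|lborel. (C y)\<^sup>2) = l / 2" by (subst FTC[OF d2]) (auto simp: S0 intro!: continuous_intros cC)
  show "(LINT y:{0..<l}|lborel. C y ^ 3) = 0" by (subst FTC[OF d3]) (auto simp: S0 intro!: continuous_intros cC)
  show "(LINT y:{0..<l}|lborel. C y ^ 4) = 3 / 8 * l" by (subst FTC[OF d4]) (auto simp: S0 intro!: continuous_intros cC)
qed

lemma strip_integral_tensor:
  fixes f h :: "real \<Rightarrow> real"
  assumes f: "integrable lborel f" and h: "continuous_on UNIV h"
  shows "set_integrable lborel (strip l) (\<lambda>z. f (fst z) * h (snd z))"
    "(LINT z:strip l|lborel. f (fst z) * h (snd z)) = (LINT x|lborel. f x) * (LINT y:{0..<l}|lborel. h y)"
proof -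
  have ind: "indicator (strip l) z *\<^sub>R (f (fst z) * h (snd z)) = f (fst z) *\<^sub>R (indicator {0..<l} (snd z) *\<^sub>R h (snd z))" for z
    by (cases z) (auto simp: strip_def indicator_def)
  have "set_integrable lborel {0..l} h"
    using borel_integrable_compact[of "{0..l}" h] continuous_on_subset[OF h] by (simp add: set_integrable_def)
  then have "set_integrable lborel {0..<l} h" by (rule set_integrable_subset) auto
  then have hi: "integrable lborel (\<lambda>y. indicator {0..<l} y *\<^sub>R h y)" by (simp add: set_integrable_def)
  note t = integrable_tensor[OF f hi]
  then show "set_integrable lborel (strip l) (\<lambda>z. f (fst z) * h (snd z))" unfolding set_integrable_def ind .
  have "(LINT z|lborel. f (fst z) *\<^sub>R (indicator {0..<l} (snd z) *\<^sub>R h (snd z))) = (LINT x|lborel. LINT y|lborel. f x *\<^sub>R (indicator {0..<l} y *\<^sub>R h y))"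
    using plane_integral_y[OF t] by simp
  also have "\<dots> = (LINT x|lborel. f x) * (LINT y:{0..<l}|lborel. h y)" by (simp add: set_lebesgue_integral_def)
  finally show "(LINT z:strip l|lborel. f (fst z) * h (snd z)) = (LINT x|lborel. f x) * (LINT y:{0..<l}|lborel. h y)"
    unfolding set_lebesgue_integral_def ind .
qed

text \<open>Every density of the perturbed soliton is a polynomial of degree at most 4 in the
  cosine. The factors are the means of its powers over a period: 1, 0, 1/2, 0 and 3/8.\<close>

lemma strip_integral_cos_polynomial:
  fixes l :: real
  assumes l: "0 < l" and d: "integrable lborel d0" "integrable lborel d1" "integrable lborel d2" "integrable lborel d3" "integrable lborel d4"
  defines "C \<equiv> \<lambda>y. cos (2 * pi / l * y)"
  defines "f \<equiv> \<lambda>z. d0 (fst z) + d1 (fst z) * C (snd z) + d2 (fst z) * (C (snd z))\<^sup>2 + d3 (fst z) * C (snd z) ^ 3 + d4 (fst z) * C (snd z) ^ 4"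
  shows "set_integrable lborel (strip l) f"
    "(LINT z:strip l|lborel. f z) = l * ((LINT x|lborel. d0 x) + 1/2 * (LINT x|lborel. d2 x) + 3/8 * (LINT x|lborel. d4 x))"
proof -
  have cC: "continuous_on UNIV C" unfolding C_def by (intro continuous_intros)
  have t: "set_integrable lborel (strip l) (\<lambda>z. D (fst z) * C (snd z) ^ n)"
    "(LINT z:strip l|lborel. D (fst z) * C (snd z) ^ n) = (LINT x|lborel. D x) * (LINT y:{0..<l}|lborel. C y ^ n)"
    if "integrable lborel D" for D n
    using strip_integral_tensor[OF that continuous_on_power[OF cC, of n]] by simp_all
  have f: "f = (\<lambda>z. d0 (fst z) * C (snd z) ^ 0 + d1 (fst z) * C (snd z) ^ 1 + d2 (fst z) * (C (snd z))\<^sup>2 + d3 (fst z) * C (snd z) ^ 3 + d4 (fst z) * C (snd z) ^ 4)"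
    by (simp add: f_def)
  show "set_integrable lborel (strip l) f" unfolding f by (intro set_integral_add t d)
  have "(LINT z:strip l|lborel. f z) = (LINT x|lborel. d0 x) * (LINT y:{0..<l}|lborel. C y ^ 0) + (LINT x|lborel. d1 x) * (LINT y:{0..<l}|lborel. C y ^ 1)
      + (LINT x|lborel. d2 x) * (LINT y:{0..<l}|lborel. (C y)\<^sup>2) + (LINT x|lborel. d3 x) * (LINT y:{0..<l}|lborel. C y ^ 3) + (LINT x|lborel. d4 x) * (LINT y:{0..<l}|lborel. C y ^ 4)"
    unfolding f by (simp only: set_integral_add t d)
  also have "\<dots> = l * ((LINT x|lborel. d0 x) + 1/2 * (LINT x|lborel. d2 x) + 3/8 * (LINT x|lborel. d4 x))"
  proof -
    have c0: "(LINT y:{0..<l}|lborel. C y ^ 0) = l" using l by (simp add: set_lebesgue_integral_def)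
    have c: "(LINT y:{0..<l}|lborel. C y) = 0" "(LINT y:{0..<l}|lborel. (C y)\<^sup>2) = l / 2"
      "(LINT y:{0..<l}|lborel. C y ^ 3) = 0" "(LINT y:{0..<l}|lborel. C y ^ 4) = 3 / 8 * l"
      unfolding C_def by (rule integral_cos_powers[OF l])+
    show ?thesis unfolding power_one_right c0 c by (simp add: algebra_simps)
  qed
  finally show "(LINT z:strip l|lborel. f z) = l * ((LINT x|lborel. d0 x) + 1/2 * (LINT x|lborel. d2 x) + 3/8 * (LINT x|lborel. d4 x))" .
qed

lemma L2_loc_continuous:
  fixes f :: "'a::euclidean_space \<Rightarrow> complex"
  assumes "continuous_on UNIV f"
  shows "L2_loc f"
  unfolding L2_loc_def L2_on_def set_integrable_def
proof (intro allI impI conjI)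
  show "f \<in> borel_measurable borel" by (rule borel_measurable_continuous_onI[OF assms])
  fix K :: "'a set" assume K: "compact K"
  have "continuous_on K (\<lambda>x. (cmod (f x))\<^sup>2)" by (intro continuous_intros continuous_on_subset[OF assms]) simp
  from borel_integrable_compact[OF K this] show "integrable lborel (\<lambda>x. indicator K x *\<^sub>R (cmod (f x))\<^sup>2)" .
qed

lemma integrable_inner:
  fixes f g :: "real \<Rightarrow> complex"
  assumes [measurable]: "f \<in> borel_measurable borel" "g \<in> borel_measurable borel"
    and int: "integrable lborel (\<lambda>x. (cmod (f x))\<^sup>2)" "integrable lborel (\<lambda>x. (cmod (g x))\<^sup>2)"
  shows "integrable lborel (\<lambda>x. f x \<bullet> g x)"
proof (rule Bochner_Integration.integrable_bound[OF Bochner_Integration.integrable_add[OF int]])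
  have "\<bar>f x \<bullet> g x\<bar> \<le> (cmod (f x))\<^sup>2 + (cmod (g x))\<^sup>2" for x
    using Cauchy_Schwarz_ineq2[of "f x" "g x"] young_product[of "cmod (f x)" "cmod (g x)"] by simp
  then show "AE x in lborel. norm (f x \<bullet> g x) \<le> norm ((cmod (f x))\<^sup>2 + (cmod (g x))\<^sup>2)" by simp
qed measurable

section \<open>Energy and momentum of a cosine perturbation\<close>

text \<open>The perturbation has mean zero in y, so the mean profile remains \<open>u\<close>:
  energy and momentum change only to second order in the amplitude \<epsilon>, plus a quartic term
  in the energy.\<close>

locale transverse_perturbation =
  fixes l \<epsilon> :: real and u u' \<xi> \<xi>' :: "real \<Rightarrow> complex"
  assumes l: "0 < l"
    and du: "\<And>x. (u has_vector_derivative u' x) (at x)" and d\<xi>: "\<And>x. (\<xi> has_vector_derivative \<xi>' x) (at x)"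
    and cont: "continuous_on UNIV u'" "continuous_on UNIV \<xi>'"
    and int: "integrable lborel (\<lambda>x. (cmod (u' x))\<^sup>2)" "integrable lborel (\<lambda>x. (1 - (cmod (u x))\<^sup>2)\<^sup>2)"
      "integrable lborel (\<lambda>x. (cmod (\<xi> x))\<^sup>2)" "integrable lborel (\<lambda>x. (cmod (\<xi>' x))\<^sup>2)"
      "integrable lborel (\<lambda>x. ((cmod (\<xi> x))\<^sup>2)\<^sup>2)" "integrable lborel (\<lambda>x. (u x \<bullet> \<xi> x)\<^sup>2)"
begin

definition C :: "real \<Rightarrow> real" where "C y = cos (2 * pi / l * y)"
definition S :: "real \<Rightarrow> real" where "S y = sin (2 * pi / l * y)"
definition psi :: "real \<times> real \<Rightarrow> complex" where "psi z = u (fst z) + (\<epsilon> * C (snd z)) *\<^sub>R \<xi> (fst z)"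
definition psi_x :: "real \<times> real \<Rightarrow> complex" where "psi_x z = u' (fst z) + (\<epsilon> * C (snd z)) *\<^sub>R \<xi>' (fst z)"
definition psi_y :: "real \<times> real \<Rightarrow> complex" where "psi_y z = (- (\<epsilon> * (2 * pi / l) * S (snd z))) *\<^sub>R \<xi> (fst z)"

lemma continuity: "continuous_on UNIV u" "continuous_on UNIV \<xi>" "continuous_on UNIV C" "continuous_on UNIV S"
proof -
  show "continuous_on UNIV u" "continuous_on UNIV \<xi>"
    using du d\<xi> by (meson continuous_at_imp_continuous_on has_vector_derivative_continuous)+
  show "continuous_on UNIV C" "continuous_on UNIV S" unfolding C_def S_def by (intro continuous_intros)+
qed

lemmas cont_comp[continuous_intros] =
  continuous_on_compose2[OF continuity(1) _ subset_UNIV] continuous_on_compose2[OF continuity(2) _ subset_UNIV]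
  continuous_on_compose2[OF continuity(3) _ subset_UNIV] continuous_on_compose2[OF continuity(4) _ subset_UNIV]
  continuous_on_compose2[OF cont(1) _ subset_UNIV] continuous_on_compose2[OF cont(2) _ subset_UNIV]

lemma psi_continuous: "continuous_on UNIV psi" "continuous_on UNIV psi_x" "continuous_on UNIV psi_y"
  unfolding psi_def psi_x_def psi_y_def by (intro continuous_intros)+

lemmas borel[measurable] = borel_measurable_continuous_onI[OF continuity(1)] borel_measurable_continuous_onI[OF continuity(2)]
  borel_measurable_continuous_onI[OF cont(1)] borel_measurable_continuous_onI[OF cont(2)]

lemma dC: "(C has_real_derivative - (2 * pi / l) * S y) (at y)"
  unfolding C_def[abs_def] S_def using l by (auto intro!: derivative_eq_intros)

lemma weak_x: "has_weak_partial (1, 0) psi psi_x"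
proof (rule weak_partial_x_if_ac[OF locally_integrable_continuous[OF psi_continuous(1)] locally_integrable_continuous[OF psi_continuous(2)]], rule AE_I2, intro exI conjI)
  fix y
  show "has_ac_derivative (\<lambda>x. psi (x, y)) (\<lambda>x. psi_x (x, y))"
  proof (rule ac_C1)
    show "((\<lambda>x. psi (x, y)) has_vector_derivative psi_x (x, y)) (at x)" for x
      unfolding psi_def psi_x_def fst_conv snd_conv
      using has_vector_derivative_add[OF du has_vector_derivative_scaleR[OF DERIV_const d\<xi>]] by simp
    show "continuous_on UNIV (\<lambda>x. psi_x (x, y))" unfolding psi_x_def by (intro continuous_intros)
  qed
  show "AE x in lborel. psi (x, y) = psi (x, y)" by simp
qed

lemma weak_y: "has_weak_partial (0, 1) psi psi_y"
proof (rule weak_partial_y_if_ac[OF locally_integrable_continuous[OF psi_continuous(1)] locally_integrable_continuous[OF psi_continuous(3)]], rule AE_I2, intro exI conjI)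
  fix x
  show "has_ac_derivative (\<lambda>y. psi (x, y)) (\<lambda>y. psi_y (x, y))"
  proof (rule ac_C1)
    fix y
    have d: "((\<lambda>y. \<epsilon> * C y) has_real_derivative - (\<epsilon> * (2 * pi / l) * S y)) (at y)"
      using DERIV_cmult[OF dC, of \<epsilon> y] by (simp add: ac_simps)
    show "((\<lambda>y. psi (x, y)) has_vector_derivative psi_y (x, y)) (at y)"
      unfolding psi_def psi_y_def fst_conv snd_conv
      using has_vector_derivative_add[OF has_vector_derivative_const has_vector_derivative_scaleR[OF d has_vector_derivative_const], of "u x" "\<xi> x"] by simp
    show "continuous_on UNIV (\<lambda>y. psi_y (x, y))" unfolding psi_y_def by (intro continuous_intros)
  qed
  show "AE y in lborel. psi (x, y) = psi (x, y)" by simp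
qed

lemma products: "integrable lborel (\<lambda>x. u' x \<bullet> \<xi>' x)" "integrable lborel (\<lambda>x. (\<i> * \<xi>' x) \<bullet> \<xi> x)"
  "integrable lborel (\<lambda>x. (1 - (cmod (u x))\<^sup>2) * (u x \<bullet> \<xi> x))" "integrable lborel (\<lambda>x. (1 - (cmod (u x))\<^sup>2) * (cmod (\<xi> x))\<^sup>2)"
  "integrable lborel (\<lambda>x. (u x \<bullet> \<xi> x) * (cmod (\<xi> x))\<^sup>2)"
proof -
  show "integrable lborel (\<lambda>x. u' x \<bullet> \<xi>' x)" by (rule integrable_inner) (use int in measurable)
  show "integrable lborel (\<lambda>x. (\<i> * \<xi>' x) \<bullet> \<xi> x)" by (rule integrable_inner) (use int in \<open>simp_all add: norm_mult\<close>)
  show "integrable lborel (\<lambda>x. (1 - (cmod (u x))\<^sup>2) * (u x \<bullet> \<xi> x))" by (rule integrable_real_product[OF int(2) int(6)]) measurable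
  show "integrable lborel (\<lambda>x. (1 - (cmod (u x))\<^sup>2) * (cmod (\<xi> x))\<^sup>2)" by (rule integrable_real_product[OF int(2) int(5)]) measurable
  show "integrable lborel (\<lambda>x. (u x \<bullet> \<xi> x) * (cmod (\<xi> x))\<^sup>2)" by (rule integrable_real_product[OF int(6) int(5)]) measurable
qed

text \<open>The summands with coefficient 0 give the expression the shape of the integrand in
  \<open>strip_integral_cos_polynomial\<close>, so that the equation can be folded into it.\<close>

lemma sq_x: "(cmod (psi_x z))\<^sup>2 = (cmod (u' (fst z)))\<^sup>2 + (2 * \<epsilon> * (u' (fst z) \<bullet> \<xi>' (fst z))) * C (snd z)
    + (\<epsilon>\<^sup>2 * (cmod (\<xi>' (fst z)))\<^sup>2) * (C (snd z))\<^sup>2 + 0 * C (snd z) ^ 3 + 0 * C (snd z) ^ 4"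
  unfolding psi_x_def power2_norm_eq_inner by (simp add: inner_add inner_commute algebra_simps power2_eq_square)

lemma sq_y: "(cmod (psi_y z))\<^sup>2 = (\<epsilon>\<^sup>2 * (2 * pi / l)\<^sup>2 * (cmod (\<xi> (fst z)))\<^sup>2) + 0 * C (snd z)
    + (- (\<epsilon>\<^sup>2 * (2 * pi / l)\<^sup>2) * (cmod (\<xi> (fst z)))\<^sup>2) * (C (snd z))\<^sup>2 + 0 * C (snd z) ^ 3 + 0 * C (snd z) ^ 4"
proof -
  have "(S (snd z))\<^sup>2 = 1 - (C (snd z))\<^sup>2" unfolding S_def C_def by (rule sin_squared_eq)
  then have "(cmod (psi_y z))\<^sup>2 = (\<epsilon> * (2 * pi / l))\<^sup>2 * (1 - (C (snd z))\<^sup>2) * (cmod (\<xi> (fst z)))\<^sup>2"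
    unfolding psi_y_def norm_scaleR power_mult_distrib power2_abs power2_minus by simp
  then show ?thesis unfolding power_mult_distrib[of \<epsilon>] by (simp add: algebra_simps)
qed

lemma sq_v: "(1 - (cmod (psi z))\<^sup>2)\<^sup>2 = (1 - (cmod (u (fst z)))\<^sup>2)\<^sup>2 + (- 4 * \<epsilon> * ((1 - (cmod (u (fst z)))\<^sup>2) * (u (fst z) \<bullet> \<xi> (fst z)))) * C (snd z)
    + (\<epsilon>\<^sup>2 * (4 * (u (fst z) \<bullet> \<xi> (fst z))\<^sup>2 - 2 * ((1 - (cmod (u (fst z)))\<^sup>2) * (cmod (\<xi> (fst z)))\<^sup>2))) * (C (snd z))\<^sup>2
    + (4 * \<epsilon> ^ 3 * ((u (fst z) \<bullet> \<xi> (fst z)) * (cmod (\<xi> (fst z)))\<^sup>2)) * C (snd z) ^ 3 + (\<epsilon> ^ 4 * ((cmod (\<xi> (fst z)))\<^sup>2)\<^sup>2) * C (snd z) ^ 4"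
proof -
  have "(cmod (psi z))\<^sup>2 = (cmod (u (fst z)))\<^sup>2 + 2 * \<epsilon> * C (snd z) * (u (fst z) \<bullet> \<xi> (fst z)) + (\<epsilon> * C (snd z))\<^sup>2 * (cmod (\<xi> (fst z)))\<^sup>2"
    unfolding psi_def power2_norm_eq_inner by (simp add: inner_add inner_commute algebra_simps power2_eq_square)
  then show ?thesis by (simp add: power2_eq_square power3_eq_cube power4_eq_xxxx algebra_simps)
qed

lemma strip_integrals:
  shows "set_integrable lborel (strip l) (\<lambda>z. (cmod (psi_x z))\<^sup>2)" "set_integrable lborel (strip l) (\<lambda>z. (cmod (psi_y z))\<^sup>2)"
    "set_integrable lborel (strip l) (\<lambda>z. (1 - (cmod (psi z))\<^sup>2)\<^sup>2)"
    "(LINT z:strip l|lborel. (cmod (psi_x z))\<^sup>2) = l * ((LINT x|lborel. (cmod (u' x))\<^sup>2) + 1/2 * (\<epsilon>\<^sup>2 * (LINT x|lborel. (cmod (\<xi>' x))\<^sup>2)))"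
    "(LINT z:strip l|lborel. (cmod (psi_y z))\<^sup>2) = l * (1/2 * (\<epsilon>\<^sup>2 * (2 * pi / l)\<^sup>2 * (LINT x|lborel. (cmod (\<xi> x))\<^sup>2)))"
    "(LINT z:strip l|lborel. (1 - (cmod (psi z))\<^sup>2)\<^sup>2) = l * ((LINT x|lborel. (1 - (cmod (u x))\<^sup>2)\<^sup>2)
      + 1/2 * (\<epsilon>\<^sup>2 * (4 * (LINT x|lborel. (u x \<bullet> \<xi> x)\<^sup>2) - 2 * (LINT x|lborel. (1 - (cmod (u x))\<^sup>2) * (cmod (\<xi> x))\<^sup>2)))
      + 3/8 * (\<epsilon> ^ 4 * (LINT x|lborel. ((cmod (\<xi> x))\<^sup>2)\<^sup>2)))"
proof -
  have z: "integrable lborel (\<lambda>x::real. 0::real)" by simp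
  note i = integrable_mult_right
  note X = strip_integral_cos_polynomial[OF l int(1) i[OF products(1), of "2 * \<epsilon>"] i[OF int(4), of "\<epsilon>\<^sup>2"] z z, folded C_def, folded sq_x]
  note Y = strip_integral_cos_polynomial[OF l i[OF int(3), of "\<epsilon>\<^sup>2 * (2 * pi / l)\<^sup>2"] z i[OF int(3), of "- (\<epsilon>\<^sup>2 * (2 * pi / l)\<^sup>2)"] z z, folded C_def, folded sq_y]
  have v2: "integrable lborel (\<lambda>x. 4 * (u x \<bullet> \<xi> x)\<^sup>2 - 2 * ((1 - (cmod (u x))\<^sup>2) * (cmod (\<xi> x))\<^sup>2))"
    by (intro Bochner_Integration.integrable_diff i int products)
  note V = strip_integral_cos_polynomial[OF l int(2) i[OF products(3), of "- 4 * \<epsilon>"] i[OF v2, of "\<epsilon>\<^sup>2"] i[OF products(5), of "4 * \<epsilon> ^ 3"] i[OF int(5), of "\<epsilon> ^ 4"],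
      folded C_def, folded sq_v]
  have "(LINT x|lborel. 4 * (u x \<bullet> \<xi> x)\<^sup>2 - 2 * ((1 - (cmod (u x))\<^sup>2) * (cmod (\<xi> x))\<^sup>2))
      = 4 * (LINT x|lborel. (u x \<bullet> \<xi> x)\<^sup>2) - 2 * (LINT x|lborel. (1 - (cmod (u x))\<^sup>2) * (cmod (\<xi> x))\<^sup>2)"
    using int(6) products(4) by simp
  note V2 = V(2)[unfolded integral_mult_right_zero this]
  show "set_integrable lborel (strip l) (\<lambda>z. (cmod (psi_x z))\<^sup>2)" "set_integrable lborel (strip l) (\<lambda>z. (cmod (psi_y z))\<^sup>2)"
    "set_integrable lborel (strip l) (\<lambda>z. (1 - (cmod (psi z))\<^sup>2)\<^sup>2)" using X(1) Y(1) V(1) .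
  show "(LINT z:strip l|lborel. (cmod (psi_x z))\<^sup>2) = l * ((LINT x|lborel. (cmod (u' x))\<^sup>2) + 1/2 * (\<epsilon>\<^sup>2 * (LINT x|lborel. (cmod (\<xi>' x))\<^sup>2)))"
    using X(2)[unfolded integral_mult_right_zero] by simp
  show "(LINT z:strip l|lborel. (cmod (psi_y z))\<^sup>2) = l * (1/2 * (\<epsilon>\<^sup>2 * (2 * pi / l)\<^sup>2 * (LINT x|lborel. (cmod (\<xi> x))\<^sup>2)))"
    using Y(2)[unfolded integral_mult_right_zero] by simp
  show "(LINT z:strip l|lborel. (1 - (cmod (psi z))\<^sup>2)\<^sup>2) = l * ((LINT x|lborel. (1 - (cmod (u x))\<^sup>2)\<^sup>2)
      + 1/2 * (\<epsilon>\<^sup>2 * (4 * (LINT x|lborel. (u x \<bullet> \<xi> x)\<^sup>2) - 2 * (LINT x|lborel. (1 - (cmod (u x))\<^sup>2) * (cmod (\<xi> x))\<^sup>2)))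
      + 3/8 * (\<epsilon> ^ 4 * (LINT x|lborel. ((cmod (\<xi> x))\<^sup>2)\<^sup>2)))" using V2 .
qed

lemma strip_integral_AE:
  fixes f g :: "real \<times> real \<Rightarrow> real"
  assumes ae: "AE z in lborel. f z = g z" and [measurable]: "f \<in> borel_measurable borel" "g \<in> borel_measurable borel"
  shows "set_integrable lborel (strip l) f \<longleftrightarrow> set_integrable lborel (strip l) g" "(LINT z:strip l|lborel. f z) = (LINT z:strip l|lborel. g z)"
proof -
  have [measurable]: "strip l \<in> sets borel" unfolding strip_def by (intro borel_Times) auto
  have a: "AE z in lborel. indicator (strip l) z *\<^sub>R f z = indicator (strip l) z *\<^sub>R g z" using ae by eventually_elim simp
  show "set_integrable lborel (strip l) f \<longleftrightarrow> set_integrable lborel (strip l) g"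
    unfolding set_integrable_def by (rule integrable_cong_AE[OF _ _ a]) measurable
  show "(LINT z:strip l|lborel. f z) = (LINT z:strip l|lborel. g z)"
    unfolding set_lebesgue_integral_def by (rule integral_cong_AE[OF _ _ a]) measurable
qed

lemma psi_partials_measurable[measurable]:
  "weak_partial (1, 0) psi \<in> borel_measurable borel" "weak_partial (0, 1) psi \<in> borel_measurable borel"
  "psi \<in> borel_measurable borel" "psi_x \<in> borel_measurable borel" "psi_y \<in> borel_measurable borel"
  using weak_partial_eq(1)[OF weak_x] weak_partial_eq(1)[OF weak_y] psi_continuous
  by (auto intro: locally_integrable_measurable has_weak_partial_locally_integrable(2) borel_measurable_continuous_onI)

lemma psi_partials_strip:
  "set_integrable lborel (strip l) (\<lambda>z. (cmod (weak_partial (1, 0) psi z))\<^sup>2)" "set_integrable lborel (strip l) (\<lambda>z. (cmod (weak_partial (0, 1) psi z))\<^sup>2)"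
  "(LINT z:strip l|lborel. (cmod (weak_partial (1, 0) psi z))\<^sup>2) = (LINT z:strip l|lborel. (cmod (psi_x z))\<^sup>2)"
  "(LINT z:strip l|lborel. (cmod (weak_partial (0, 1) psi z))\<^sup>2) = (LINT z:strip l|lborel. (cmod (psi_y z))\<^sup>2)"
proof -
  have ex: "AE z in lborel. (cmod (weak_partial (1, 0) psi z))\<^sup>2 = (cmod (psi_x z))\<^sup>2" using weak_partial_eq(2)[OF weak_x] by eventually_elim simp
  have ey: "AE z in lborel. (cmod (weak_partial (0, 1) psi z))\<^sup>2 = (cmod (psi_y z))\<^sup>2" using weak_partial_eq(2)[OF weak_y] by eventually_elim simp
  have "set_integrable lborel (strip l) (\<lambda>z. (cmod (weak_partial (1, 0) psi z))\<^sup>2) \<longleftrightarrow> set_integrable lborel (strip l) (\<lambda>z. (cmod (psi_x z))\<^sup>2)"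
    by (rule strip_integral_AE[OF ex]) measurable
  then show "set_integrable lborel (strip l) (\<lambda>z. (cmod (weak_partial (1, 0) psi z))\<^sup>2)" using strip_integrals(1) by blast
  have "set_integrable lborel (strip l) (\<lambda>z. (cmod (weak_partial (0, 1) psi z))\<^sup>2) \<longleftrightarrow> set_integrable lborel (strip l) (\<lambda>z. (cmod (psi_y z))\<^sup>2)"
    by (rule strip_integral_AE[OF ey]) measurable
  then show "set_integrable lborel (strip l) (\<lambda>z. (cmod (weak_partial (0, 1) psi z))\<^sup>2)" using strip_integrals(2) by blast
  show "(LINT z:strip l|lborel. (cmod (weak_partial (1, 0) psi z))\<^sup>2) = (LINT z:strip l|lborel. (cmod (psi_x z))\<^sup>2)"
    by (rule strip_integral_AE[OF ex]) measurable
  show "(LINT z:strip l|lborel. (cmod (weak_partial (0, 1) psi z))\<^sup>2) = (LINT z:strip l|lborel. (cmod (psi_y z))\<^sup>2)"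
    by (rule strip_integral_AE[OF ey]) measurable
qed

lemma psi_in_energy_space: "psi \<in> energy_space_2d l"
proof -
  have per: "C (y + l) = C y" for y
  proof -
    have "2 * pi / l * (y + l) = 2 * pi / l * y + 2 * pi" using l by (simp add: field_simps)
    then show ?thesis unfolding C_def by (simp only: cos_periodic)
  qed
  have "H1_loc psi" unfolding H1_loc_def Basis_plane
    using L2_loc_continuous[OF psi_continuous(1)] L2_loc_continuous[OF psi_continuous(2)] L2_loc_continuous[OF psi_continuous(3)] weak_x weak_y by blast
  moreover have "L2_on (strip l) (weak_partial (1, 0) psi)" "L2_on (strip l) (weak_partial (0, 1) psi)" "L2_on (strip l) (\<lambda>z. 1 - (cmod (psi z))\<^sup>2)"
    unfolding L2_on_def using psi_partials_strip(1,2) strip_integrals(3) by simp_all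
  ultimately show ?thesis unfolding energy_space_2d_def energy_space_def by (simp add: Basis_plane psi_def per)
qed

lemma psi_energy:
  "energy l psi = 1/2 * (LINT x|lborel. (cmod (u' x))\<^sup>2) + 1/4 * (LINT x|lborel. (1 - (cmod (u x))\<^sup>2)\<^sup>2)
     + \<epsilon>\<^sup>2 * (1/4 * (LINT x|lborel. (cmod (\<xi>' x))\<^sup>2) + 1/4 * (2 * pi / l)\<^sup>2 * (LINT x|lborel. (cmod (\<xi> x))\<^sup>2)
       + 1/2 * (LINT x|lborel. (u x \<bullet> \<xi> x)\<^sup>2) - 1/4 * (LINT x|lborel. (1 - (cmod (u x))\<^sup>2) * (cmod (\<xi> x))\<^sup>2))
     + 3/32 * \<epsilon> ^ 4 * (LINT x|lborel. ((cmod (\<xi> x))\<^sup>2)\<^sup>2)"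
proof -
  interpret strip_function l psi by (rule strip_function.intro[OF l psi_in_energy_space])
  have "Dx = (LINT z:strip l|lborel. (cmod (psi_x z))\<^sup>2)" "Dy = (LINT z:strip l|lborel. (cmod (psi_y z))\<^sup>2)"
    "V = (LINT z:strip l|lborel. (1 - (cmod (psi z))\<^sup>2)\<^sup>2)"
    unfolding psi_partials_strip(3,4)[symmetric]
    by (simp_all add: Dx_def Dy_def V_def gx_def gy_def set_lebesgue_integral_def indicator_strip)
  then have "l * energy l psi = l * (1/2 * (LINT x|lborel. (cmod (u' x))\<^sup>2) + 1/4 * (LINT x|lborel. (1 - (cmod (u x))\<^sup>2)\<^sup>2)
     + \<epsilon>\<^sup>2 * (1/4 * (LINT x|lborel. (cmod (\<xi>' x))\<^sup>2) + 1/4 * (2 * pi / l)\<^sup>2 * (LINT x|lborel. (cmod (\<xi> x))\<^sup>2)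
       + 1/2 * (LINT x|lborel. (u x \<bullet> \<xi> x)\<^sup>2) - 1/4 * (LINT x|lborel. (1 - (cmod (u x))\<^sup>2) * (cmod (\<xi> x))\<^sup>2))
     + 3/32 * \<epsilon> ^ 4 * (LINT x|lborel. ((cmod (\<xi> x))\<^sup>2)\<^sup>2))"
    unfolding energy_eq strip_integrals(4-6) by (simp only: algebra_simps)
  then show ?thesis using l by simp
qed

lemma psi_y_mean: "y_mean l psi = u"
proof (rule ext)
  fix x
  have i1: "set_integrable lborel {0..<l} (\<lambda>y. u x)" by (rule set_integrable_subset[OF set_integrable_const_Icc[of 0 l]]) auto
  have i2: "set_integrable lborel {0..<l} C"
    by (rule set_integrable_subset[of lborel "{0..l}"])
      (use borel_integrable_compact[of "{0..l}" C] continuous_on_subset[OF continuity(3)] in \<open>auto simp: set_integrable_def\<close>)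
  then have "integrable lborel (\<lambda>y. (indicator {0..<l} y *\<^sub>R C y) *\<^sub>R (\<epsilon> *\<^sub>R \<xi> x))"
    unfolding set_integrable_def by (rule integrable_scaleR_left)
  then have i3: "set_integrable lborel {0..<l} (\<lambda>y. C y *\<^sub>R (\<epsilon> *\<^sub>R \<xi> x))"
    unfolding set_integrable_def by (simp only: real_scaleR_def scaleR_scaleR mult.assoc)
  have "(LINT y:{0..<l}|lborel. psi (x, y)) = (LINT y:{0..<l}|lborel. u x + C y *\<^sub>R (\<epsilon> *\<^sub>R \<xi> x))"
    by (simp add: psi_def mult.commute)
  also have "\<dots> = (LINT y:{0..<l}|lborel. u x) + (LINT y:{0..<l}|lborel. C y *\<^sub>R (\<epsilon> *\<^sub>R \<xi> x))" by (rule set_integral_add(2)[OF i1 i3])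
  also have "(LINT y:{0..<l}|lborel. C y *\<^sub>R (\<epsilon> *\<^sub>R \<xi> x)) = (LINT y:{0..<l}|lborel. C y) *\<^sub>R (\<epsilon> *\<^sub>R \<xi> x)"
  proof -
    have "(LINT y|lborel. (indicator {0..<l} y *\<^sub>R C y) *\<^sub>R (\<epsilon> *\<^sub>R \<xi> x)) = (LINT y|lborel. indicator {0..<l} y *\<^sub>R C y) *\<^sub>R (\<epsilon> *\<^sub>R \<xi> x)"
      using i2 unfolding set_integrable_def by (intro integral_scaleR_left)
    then show ?thesis unfolding set_lebesgue_integral_def by (simp only: real_scaleR_def scaleR_scaleR mult.assoc)
  qed
  also have "(LINT y:{0..<l}|lborel. C y) = 0" using integral_cos_powers(1)[OF l] by (simp add: C_def)
  also have "(LINT y:{0..<l}|lborel. u x) = l *\<^sub>R u x" using l by (simp add: set_lebesgue_integral_def)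
  finally show "y_mean l psi x = u x" unfolding y_mean_def using l by (simp add: scaleR_conv_of_real)
qed

lemma psi_momentum: "momentum_2d l psi = (\<lambda>p. p + \<epsilon>\<^sup>2 / 4 * (LINT x|lborel. (\<i> * \<xi>' x) \<bullet> \<xi> x)) ` momentum_1d u"
proof -
  define w where "w = (\<lambda>(x, y). psi (x, y) - y_mean l psi x)"
  have w: "w z = (\<epsilon> * C (snd z)) *\<^sub>R \<xi> (fst z)" for z by (simp add: w_def psi_y_mean psi_def case_prod_unfold)
  define wx where "wx z = (\<epsilon> * C (snd z)) *\<^sub>R \<xi>' (fst z)" for z
  have u: "has_weak_partial (1, 0) (\<lambda>z :: real \<times> real. u (fst z)) (\<lambda>z. u' (fst z))"
  proof (rule has_weak_partial_fst)
    show "has_weak_partial 1 u u'" by (rule weak_partial_if_ac_1d[OF ac_C1[OF du cont(1)]]) auto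
  qed
  have "has_weak_partial (1, 0) w wx"
    using has_weak_partial_diff[OF weak_x u] by (simp add: psi_def psi_x_def w[abs_def] wx_def[abs_def])
  note W = weak_partial_eq[OF this]
  have cw: "continuous_on UNIV w" "continuous_on UNIV wx" unfolding w wx_def by (intro continuous_intros)+
  note [measurable] = borel_measurable_continuous_onI[OF cw(1)] borel_measurable_continuous_onI[OF cw(2)]
    locally_integrable_measurable[OF has_weak_partial_locally_integrable(2)[OF W(1)]]
  have z: "integrable lborel (\<lambda>x::real. 0::real)" by simp
  have "(LINT z:strip l|lborel. (\<i> * weak_partial (1, 0) w z) \<bullet> w z) = (LINT z:strip l|lborel. (\<i> * wx z) \<bullet> w z)"
    by (rule strip_integral_AE) (use W(2) in \<open>eventually_elim, simp\<close>, measurable)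
  also have "\<dots> = (LINT z:strip l|lborel. 0 + 0 * C (snd z) + (\<epsilon>\<^sup>2 * ((\<i> * \<xi>' (fst z)) \<bullet> \<xi> (fst z))) * (C (snd z))\<^sup>2 + 0 * C (snd z) ^ 3 + 0 * C (snd z) ^ 4)"
    unfolding w wx_def by (simp add: power2_eq_square ac_simps)
  also have "\<dots> = l * (1/2 * (\<epsilon>\<^sup>2 * (LINT x|lborel. (\<i> * \<xi>' x) \<bullet> \<xi> x)))"
    using strip_integral_cos_polynomial(2)[OF l z z integrable_mult_right[OF products(2), of "\<epsilon>\<^sup>2"] z z, folded C_def] by simp
  finally have i: "(LINT z:strip l|lborel. (\<i> * weak_partial (1, 0) w z) \<bullet> w z) = l * (1/2 * (\<epsilon>\<^sup>2 * (LINT x|lborel. (\<i> * \<xi>' x) \<bullet> \<xi> x)))" .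
  have e: "1 / (2 * l) * (LINT z:strip l|lborel. (\<i> * weak_partial (1, 0) w z) \<bullet> w z) = \<epsilon>\<^sup>2 / 4 * (LINT x|lborel. (\<i> * \<xi>' x) \<bullet> \<xi> x)"
    unfolding i using l by simp
  show ?thesis unfolding momentum_2d_def Let_def w_def[symmetric] e unfolding psi_y_mean ..
qed

end

section \<open>Explicit integrals along the soliton\<close>

text \<open>The substitution \<open>t = tanh (m * x)\<close> maps the line onto the interval from -1
  to 1, and \<open>m * (1 - t\<^sup>2)\<close> is its Jacobian. The Jacobian is integrable as a
  nonnegative derivative of a bounded function, and it dominates the rest because \<open>h\<close>
  is bounded there.\<close>

lemma integral_tanh_substitution:
  fixes m :: real and Q h :: "real \<Rightarrow> real"
  assumes m: "m > 0" and dQ: "\<And>t. (Q has_real_derivative h t) (at t)" and ch: "continuous_on UNIV h"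
  shows "integrable lborel (\<lambda>x. h (tanh (m * x)) * (m * (1 - (tanh (m * x))\<^sup>2)))"
    "(LINT x|lborel. h (tanh (m * x)) * (m * (1 - (tanh (m * x))\<^sup>2))) = Q 1 - Q (- 1)"
proof -
  define T where "T x = tanh (m * x)" for x
  define s where "s x = m * (1 - (T x)\<^sup>2)" for x
  have dT: "(T has_real_derivative s x) (at x)" for x
    unfolding T_def[abs_def] s_def by (auto intro!: derivative_eq_intros)
  have Tb: "\<bar>T x\<bar> < 1" for x unfolding T_def using tanh_real_lt_1[of "m * x"] tanh_real_gt_neg1[of "m * x"] by (simp add: abs_less_iff)
  have s0: "0 \<le> s x" for x
  proof -
    have "(T x)\<^sup>2 < 1" using Tb[of x] by (simp add: abs_square_less_1)
    then show ?thesis using m by (simp add: s_def)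
  qed
  have cT: "continuous_on UNIV T" using dT by (meson DERIV_isCont continuous_at_imp_continuous_on)
  have cs: "continuous_on UNIV s" unfolding s_def by (intro continuous_intros cT)
  have mt: "filterlim (\<lambda>x. m * x) at_top at_top" "filterlim (\<lambda>x. m * x) at_bot at_bot"
    using m by (auto intro!: filterlim_tendsto_pos_mult_at_top filterlim_tendsto_pos_mult_at_bot filterlim_ident tendsto_const)
  have Tt: "(T \<longlongrightarrow> 1) at_top" "(T \<longlongrightarrow> - 1) at_bot"
    unfolding T_def by (rule filterlim_compose[OF tanh_real_at_top mt(1)], rule filterlim_compose[OF tanh_real_at_bot mt(2)])
  have "set_integrable lborel (einterval (- \<infinity>) \<infinity>) s"
    by (rule interval_integral_FTC_nonneg(1)[where F = T and A = "- 1" and B = 1])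
      (use dT s0 Tt cs in \<open>auto simp: ereal_tendsto_simps continuous_on_eq_continuous_at\<close>)
  then have si: "integrable lborel s" by (simp add: set_integrable_def)
  have cT1: "continuous_on {-1..1} h" by (rule continuous_on_subset[OF ch]) simp
  have "\<exists>M. \<forall>t\<in>{-1..1}. \<bar>h t\<bar> \<le> M"
    using compact_imp_bounded[OF compact_continuous_image[OF cT1 compact_Icc]] unfolding bounded_iff by auto
  then obtain M where M: "\<And>t. t \<in> {-1..1} \<Longrightarrow> \<bar>h t\<bar> \<le> M" by blast
  have cf: "continuous_on UNIV (\<lambda>x. h (T x) * s x)"
    by (intro continuous_intros cs continuous_on_compose2[OF ch cT subset_UNIV])
  have if': "integrable lborel (\<lambda>x. h (T x) * s x)"
  proof (rule Bochner_Integration.integrable_bound[OF integrable_mult_right[OF si, of M]])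
    show "(\<lambda>x. h (T x) * s x) \<in> borel_measurable lborel" using borel_measurable_continuous_onI[OF cf] by simp
    have "norm (h (T x) * s x) \<le> norm (M * s x)" for x
    proof -
      have "\<bar>h (T x)\<bar> \<le> M" using Tb[of x] by (intro M) (simp add: abs_less_iff)
      then have "\<bar>h (T x)\<bar> * s x \<le> \<bar>M\<bar> * s x" using s0[of x] by (intro mult_right_mono) auto
      then show ?thesis using s0[of x] by (simp add: abs_mult)
    qed
    then show "AE x in lborel. norm (h (T x) * s x) \<le> norm (M * s x)" by simp
  qed
  then show "integrable lborel (\<lambda>x. h (tanh (m * x)) * (m * (1 - (tanh (m * x))\<^sup>2)))" by (simp add: T_def s_def)
  have dF: "((\<lambda>x. Q (T x)) has_vector_derivative h (T x) * s x) (at x)" for x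
    using DERIV_chain2[OF dQ dT] by (simp add: has_real_derivative_iff_has_vector_derivative)
  have Ql: "((\<lambda>x. Q (T x)) \<longlongrightarrow> Q 1) at_top" "((\<lambda>x. Q (T x)) \<longlongrightarrow> Q (- 1)) at_bot"
    using isCont_tendsto_compose[OF DERIV_isCont[OF dQ] Tt(1)] isCont_tendsto_compose[OF DERIV_isCont[OF dQ] Tt(2)] .
  have "(LBINT x=-\<infinity>..\<infinity>. h (T x) * s x) = Q 1 - Q (- 1)"
  proof (rule interval_integral_FTC_integrable[where F = "\<lambda>x. Q (T x)"])
    show "(((\<lambda>x. Q (T x)) \<circ> real_of_ereal) \<longlongrightarrow> Q (- 1)) (at_right (- \<infinity>))"
      "(((\<lambda>x. Q (T x)) \<circ> real_of_ereal) \<longlongrightarrow> Q 1) (at_left \<infinity>)"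
      unfolding ereal_tendsto_simps by (rule Ql)+
  qed (use dF if' cf in \<open>auto simp: continuous_on_eq_continuous_at set_integrable_def\<close>)
  then show "(LINT x|lborel. h (tanh (m * x)) * (m * (1 - (tanh (m * x))\<^sup>2))) = Q 1 - Q (- 1)"
    by (simp add: T_def s_def interval_lebesgue_integral_def set_lebesgue_integral_def)
qed

lemma integral_tanh_polynomial:
  fixes m c0 c2 c4 c6 :: real
  assumes m: "m > 0" and f: "\<And>x. f x = (c0 + c2 * (tanh (m * x))\<^sup>2 + c4 * tanh (m * x) ^ 4 + c6 * tanh (m * x) ^ 6) * (m * (1 - (tanh (m * x))\<^sup>2))"
  shows "integrable lborel f" "(LINT x|lborel. f x) = 2 * (c0 + c2 / 3 + c4 / 5 + c6 / 7)"
proof -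
  define Q where "Q t = c0 * t + c2 / 3 * t ^ 3 + c4 / 5 * t ^ 5 + c6 / 7 * t ^ 7" for t
  define h where "h t = c0 + c2 * t\<^sup>2 + c4 * t ^ 4 + c6 * t ^ 6" for t
  have dQ: "(Q has_real_derivative h t) (at t)" for t
    unfolding Q_def[abs_def] h_def by (auto intro!: derivative_eq_intros)
  have ch: "continuous_on UNIV h" unfolding h_def by (intro continuous_intros)
  have fh: "f = (\<lambda>x. h (tanh (m * x)) * (m * (1 - (tanh (m * x))\<^sup>2)))" using f by (simp add: h_def fun_eq_iff)
  show "integrable lborel f" "(LINT x|lborel. f x) = 2 * (c0 + c2 / 3 + c4 / 5 + c6 / 7)"
    unfolding fh integral_tanh_substitution(2)[OF m dQ ch] by (rule integral_tanh_substitution(1)[OF m dQ ch], simp add: Q_def)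
qed

lemma has_vector_derivative_Complex:
  assumes "(a has_real_derivative a') (at x)" "(b has_real_derivative b') (at x)"
  shows "((\<lambda>x. Complex (a x) (b x)) has_vector_derivative Complex a' b') (at x)"
proof -
  have d: "((\<lambda>x. complex_of_real (g x)) has_vector_derivative complex_of_real g') (at x)" if "(g has_real_derivative g') (at x)" for g g'
    using bounded_linear.has_vector_derivative[OF bounded_linear_of_real] that by (auto simp: has_real_derivative_iff_has_vector_derivative)
  show ?thesis unfolding Complex_eq
    using has_vector_derivative_add[OF d[OF assms(1)] bounded_linear.has_vector_derivative[OF bounded_linear_mult_right d[OF assms(2)]]] .
qed

locale soliton_profile =
  fixes \<omega> :: real
  assumes \<omega>: "\<bar>\<omega>\<bar> < pi / 2"
begin

definition A :: real where "A = cos \<omega>"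
definition m :: real where "m = A / sqrt 2"
definition \<kappa> :: real where "\<kappa> = - 2 * tan \<omega>"
definition T :: "real \<Rightarrow> real" where "T x = tanh (m * x)"
definition S :: "real \<Rightarrow> real" where "S x = 1 / cosh (m * x)"
definition u :: "real \<Rightarrow> complex" where "u x = Complex (A * T x) (sin \<omega>)"
definition u' :: "real \<Rightarrow> complex" where "u' x = Complex (A * (m * (1 - (T x)\<^sup>2))) 0"
text \<open>The negative direction. At \<open>u\<close>, the second variation of energy plus
  \<open>sqrt 2 * sin \<omega>\<close> times momentum sends \<xi> to
  \<open>- m\<^sup>2 * \<i> * S\<close>, so the form at \<xi> is \<open>- m\<^sup>2\<close> times
  the integral of the square of \<open>S\<close>. For the black soliton \<open>S\<close> is the
  known ground state of the imaginary part; the real part with factor \<kappa> cancels the real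
  component of the image for all other speeds.\<close>

definition \<xi> :: "real \<Rightarrow> complex" where "\<xi> x = Complex (\<kappa> * (T x * S x)) (S x)"
definition \<xi>' :: "real \<Rightarrow> complex" where "\<xi>' x = Complex (\<kappa> * (m * S x * (1 - 2 * (T x)\<^sup>2))) (- (m * T x * S x))"

lemma A: "A > 0" and m: "m > 0" and mA: "A * A = 2 * m * m"
  and A\<kappa>: "A * \<kappa> = - 2 * sin \<omega>" and sin_sq: "(sin \<omega>)\<^sup>2 = 1 - A * A"
proof -
  show "A > 0" unfolding A_def using \<omega> by (intro cos_gt_zero_pi) auto
  then show "m > 0" "A * A = 2 * m * m" "A * \<kappa> = - 2 * sin \<omega>" by (simp_all add: m_def \<kappa>_def tan_def A_def)
  show "(sin \<omega>)\<^sup>2 = 1 - A * A" unfolding A_def by (simp add: sin_squared_eq flip: power2_eq_square)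
qed

lemma S_sq: "(S x)\<^sup>2 = 1 - (T x)\<^sup>2"
proof -
  have "1 - (T x)\<^sup>2 = ((cosh (m * x))\<^sup>2 - (sinh (m * x))\<^sup>2) / (cosh (m * x))\<^sup>2"
    by (simp add: T_def tanh_def power_divide diff_divide_distrib)
  also have "(cosh (m * x))\<^sup>2 - (sinh (m * x))\<^sup>2 = 1" by (simp add: cosh_square_eq)
  finally show ?thesis by (simp add: S_def power_divide)
qed

lemma dT: "(T has_real_derivative m * (1 - (T x)\<^sup>2)) (at x)"
  unfolding T_def[abs_def] by (auto intro!: derivative_eq_intros)

lemma dS: "(S has_real_derivative - (m * T x * S x)) (at x)"
proof -
  have "cosh (m * x) \<noteq> 0" by simp
  then show ?thesis unfolding S_def[abs_def] T_def tanh_def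
    by (auto intro!: derivative_eq_intros simp: field_simps power2_eq_square)
qed

lemma du: "(u has_vector_derivative u' x) (at x)"
  unfolding u_def[abs_def] u'_def by (rule has_vector_derivative_Complex) (auto intro!: derivative_eq_intros dT)

lemma d\<xi>: "(\<xi> has_vector_derivative \<xi>' x) (at x)"
proof -
  have "((\<lambda>x. T x * S x) has_real_derivative m * S x * (1 - 2 * (T x)\<^sup>2)) (at x)"
    by (rule DERIV_cong[OF DERIV_mult[OF dT dS]]) (simp add: algebra_simps power2_eq_square)
  from has_vector_derivative_Complex[OF DERIV_cmult[OF this, of \<kappa>] dS] show ?thesis unfolding \<xi>_def[abs_def] \<xi>'_def .
qed

lemma continuity: "continuous_on UNIV T" "continuous_on UNIV S" "continuous_on UNIV u'" "continuous_on UNIV \<xi>'"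
proof -
  show c: "continuous_on UNIV T" "continuous_on UNIV S"
    using dT dS by (meson DERIV_isCont continuous_at_imp_continuous_on)+
  show "continuous_on UNIV u'" "continuous_on UNIV \<xi>'"
    unfolding u'_def \<xi>'_def Complex_eq by (intro continuous_intros c)+
qed

lemma eta: "1 - (cmod (u x))\<^sup>2 = A * A * (1 - (T x)\<^sup>2)"
  unfolding u_def cmod_power2 using sin_sq by (simp add: power_mult_distrib power2_eq_square algebra_simps)

lemma pow6: "t ^ 6 = t * (t * (t * (t * (t * (t :: real)))))" "t ^ 4 = t * (t * (t * t))" "t\<^sup>2 = t * t"
  by (simp_all add: power2_eq_square power4_eq_xxxx eval_nat_numeral)

text \<open>After \<open>S\<close> is eliminated through its square, every integrand is an even
  polynomial in \<open>T\<close> of degree at most 6 times the Jacobian of the tanh substitution, so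
  its value is read off from the coefficients.\<close>

lemma integrals:
  "integrable lborel (\<lambda>x. (cmod (u' x))\<^sup>2)" "(LINT x|lborel. (cmod (u' x))\<^sup>2) = 4 / 3 * (A * A * m)"
  "integrable lborel (\<lambda>x. (1 - (cmod (u x))\<^sup>2)\<^sup>2)" "(LINT x|lborel. (1 - (cmod (u x))\<^sup>2)\<^sup>2) = 4 / 3 * (A * A * (A * A) / m)"
  "integrable lborel (\<lambda>x. (cmod (\<xi> x))\<^sup>2)" "(LINT x|lborel. (cmod (\<xi> x))\<^sup>2) = 2 / m * (1 + \<kappa>\<^sup>2 / 3)"
  "integrable lborel (\<lambda>x. (cmod (\<xi>' x))\<^sup>2)" "(LINT x|lborel. (cmod (\<xi>' x))\<^sup>2) = 2 * m * (7 / 15 * \<kappa>\<^sup>2 + 1 / 3)"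
  "integrable lborel (\<lambda>x. ((cmod (\<xi> x))\<^sup>2)\<^sup>2)"
  "(LINT x|lborel. ((cmod (\<xi> x))\<^sup>2)\<^sup>2) = 2 / m * (1 + (2 * \<kappa>\<^sup>2 - 1) / 3 + (\<kappa> ^ 4 - 2 * \<kappa>\<^sup>2) / 5 - \<kappa> ^ 4 / 7)"
  "integrable lborel (\<lambda>x. (u x \<bullet> \<xi> x)\<^sup>2)" "(LINT x|lborel. (u x \<bullet> \<xi> x)\<^sup>2) = 14 / 15 * (sin \<omega>)\<^sup>2 / m"
  "(LINT x|lborel. (1 - (cmod (u x))\<^sup>2) * (cmod (\<xi> x))\<^sup>2) = 2 * (A * A) / m * (1 + (\<kappa>\<^sup>2 - 1) / 3 - \<kappa>\<^sup>2 / 5)"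
  "(LINT x|lborel. (\<i> * \<xi>' x) \<bullet> \<xi> x) = 4 / 3 * \<kappa>"
proof -
  note P = integral_tanh_polynomial[OF m, folded T_def]
  have m0: "m \<noteq> 0" using m by simp
  have xisq: "(cmod (\<xi> x))\<^sup>2 = (1 - (T x)\<^sup>2) * (1 + \<kappa>\<^sup>2 * (T x)\<^sup>2)" for x
    unfolding \<xi>_def cmod_power2 complex.sel power_mult_distrib S_sq by (simp add: algebra_simps)
  have uxi: "u x \<bullet> \<xi> x = S x * (sin \<omega> * (1 - 2 * (T x)\<^sup>2))" for x
  proof -
    have "u x \<bullet> \<xi> x = S x * (A * \<kappa> * (T x)\<^sup>2 + sin \<omega>)" unfolding u_def \<xi>_def inner_complex_def by (simp add: power2_eq_square algebra_simps)
    then show ?thesis unfolding A\<kappa> by (simp add: algebra_simps)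
  qed
  have uxi2: "(u x \<bullet> \<xi> x)\<^sup>2 = (1 - (T x)\<^sup>2) * ((sin \<omega>)\<^sup>2 * (1 - 2 * (T x)\<^sup>2)\<^sup>2)" for x
    unfolding uxi power_mult_distrib S_sq ..
  have "(cmod (u' x))\<^sup>2 = (A * A * m + (- (A * A * m)) * (T x)\<^sup>2 + 0 * T x ^ 4 + 0 * T x ^ 6) * (m * (1 - (T x)\<^sup>2))" for x
    unfolding u'_def cmod_power2 by (simp add: pow6 algebra_simps)
  note h = this
  show "integrable lborel (\<lambda>x. (cmod (u' x))\<^sup>2)" by (rule P(1)[OF h])
  show "(LINT x|lborel. (cmod (u' x))\<^sup>2) = 4 / 3 * (A * A * m)" by (subst P(2)[OF h]) (use m0 in \<open>simp add: field_simps\<close>)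
  have "(1 - (cmod (u x))\<^sup>2)\<^sup>2 = (A * A * (A * A) / m + (- (A * A * (A * A) / m)) * (T x)\<^sup>2 + 0 * T x ^ 4 + 0 * T x ^ 6) * (m * (1 - (T x)\<^sup>2))" for x
    unfolding eta using m0 by (simp add: pow6 field_simps)
  note h = this
  show "integrable lborel (\<lambda>x. (1 - (cmod (u x))\<^sup>2)\<^sup>2)" by (rule P(1)[OF h])
  show "(LINT x|lborel. (1 - (cmod (u x))\<^sup>2)\<^sup>2) = 4 / 3 * (A * A * (A * A) / m)" by (subst P(2)[OF h]) (use m0 in \<open>simp add: field_simps\<close>)
  have "(cmod (\<xi> x))\<^sup>2 = (1 / m + (\<kappa>\<^sup>2 / m) * (T x)\<^sup>2 + 0 * T x ^ 4 + 0 * T x ^ 6) * (m * (1 - (T x)\<^sup>2))" for x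
    unfolding xisq using m0 by (simp add: field_simps)
  note h = this
  show "integrable lborel (\<lambda>x. (cmod (\<xi> x))\<^sup>2)" by (rule P(1)[OF h])
  show "(LINT x|lborel. (cmod (\<xi> x))\<^sup>2) = 2 / m * (1 + \<kappa>\<^sup>2 / 3)" by (subst P(2)[OF h]) (use m0 in \<open>simp add: field_simps\<close>)
  have "(cmod (\<xi>' x))\<^sup>2 = (m * \<kappa>\<^sup>2 + (m - 4 * m * \<kappa>\<^sup>2) * (T x)\<^sup>2 + (4 * m * \<kappa>\<^sup>2) * T x ^ 4 + 0 * T x ^ 6) * (m * (1 - (T x)\<^sup>2))" for x
    unfolding \<xi>'_def cmod_power2 complex.sel power_mult_distrib S_sq power2_minus by (simp add: pow6 algebra_simps)
  note h = this
  show "integrable lborel (\<lambda>x. (cmod (\<xi>' x))\<^sup>2)" by (rule P(1)[OF h])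
  show "(LINT x|lborel. (cmod (\<xi>' x))\<^sup>2) = 2 * m * (7 / 15 * \<kappa>\<^sup>2 + 1 / 3)" by (subst P(2)[OF h]) (use m0 in \<open>simp add: field_simps\<close>)
  have "((cmod (\<xi> x))\<^sup>2)\<^sup>2 = (1 / m + ((2 * \<kappa>\<^sup>2 - 1) / m) * (T x)\<^sup>2 + ((\<kappa> ^ 4 - 2 * \<kappa>\<^sup>2) / m) * T x ^ 4 + (- (\<kappa> ^ 4 / m)) * T x ^ 6) * (m * (1 - (T x)\<^sup>2))" for x
    unfolding xisq using m0 by (simp add: pow6 field_simps)
  note h = this
  show "integrable lborel (\<lambda>x. ((cmod (\<xi> x))\<^sup>2)\<^sup>2)" by (rule P(1)[OF h])
  show "(LINT x|lborel. ((cmod (\<xi> x))\<^sup>2)\<^sup>2) = 2 / m * (1 + (2 * \<kappa>\<^sup>2 - 1) / 3 + (\<kappa> ^ 4 - 2 * \<kappa>\<^sup>2) / 5 - \<kappa> ^ 4 / 7)" by (subst P(2)[OF h]) (use m0 in \<open>simp add: field_simps\<close>)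
  have "(u x \<bullet> \<xi> x)\<^sup>2 = ((sin \<omega>)\<^sup>2 / m + (- 4 * ((sin \<omega>)\<^sup>2 / m)) * (T x)\<^sup>2 + (4 * ((sin \<omega>)\<^sup>2 / m)) * T x ^ 4 + 0 * T x ^ 6) * (m * (1 - (T x)\<^sup>2))" for x
    unfolding uxi2 using m0 by (simp add: pow6 field_simps)
  note h = this
  show "integrable lborel (\<lambda>x. (u x \<bullet> \<xi> x)\<^sup>2)" by (rule P(1)[OF h])
  show "(LINT x|lborel. (u x \<bullet> \<xi> x)\<^sup>2) = 14 / 15 * (sin \<omega>)\<^sup>2 / m" by (subst P(2)[OF h]) (use m0 in \<open>simp add: field_simps\<close>)
  have "(1 - (cmod (u x))\<^sup>2) * (cmod (\<xi> x))\<^sup>2 = (A * A / m + (A * A / m * (\<kappa>\<^sup>2 - 1)) * (T x)\<^sup>2 + (- (A * A / m * \<kappa>\<^sup>2)) * T x ^ 4 + 0 * T x ^ 6) * (m * (1 - (T x)\<^sup>2))" for x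
    unfolding xisq eta using m0 by (simp add: pow6 field_simps)
  note h = this
  show "(LINT x|lborel. (1 - (cmod (u x))\<^sup>2) * (cmod (\<xi> x))\<^sup>2) = 2 * (A * A) / m * (1 + (\<kappa>\<^sup>2 - 1) / 3 - \<kappa>\<^sup>2 / 5)"
    by (subst P(2)[OF h]) (use m0 in \<open>simp add: field_simps\<close>)
  have "(\<i> * \<xi>' x) \<bullet> \<xi> x = (\<kappa> + (- \<kappa>) * (T x)\<^sup>2 + 0 * T x ^ 4 + 0 * T x ^ 6) * (m * (1 - (T x)\<^sup>2))" for x
  proof -
    have "(\<i> * \<xi>' x) \<bullet> \<xi> x = \<kappa> * m * (1 - (T x)\<^sup>2) * (S x)\<^sup>2" unfolding \<xi>_def \<xi>'_def inner_complex_def by (simp add: power2_eq_square algebra_simps)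
    then show ?thesis unfolding S_sq by (simp add: pow6 algebra_simps)
  qed
  from P(2)[OF this] show "(LINT x|lborel. (\<i> * \<xi>' x) \<bullet> \<xi> x) = 4 / 3 * \<kappa>" by simp
qed

text \<open>The end values are \<open>cis \<omega>\<close> and \<open>cis (pi - \<omega>)\<close>, a
  phase jump of \<open>2 * \<omega> - pi\<close>. The shift by pi built into
  \<open>soliton_momentum\<close> shows up as a full turn after doubling.\<close>

lemma u_momentum_limit: "((\<lambda>R. cis (2 * momentum_upto u R)) \<longlongrightarrow> cis (2 * soliton_momentum \<omega>)) at_top"
proof -
  have ac: "has_ac_derivative u u'" by (rule ac_C1[OF du continuity(3)])
  have acT: "has_ac_derivative T (\<lambda>x. m * (1 - (T x)\<^sup>2))"
    by (rule ac_C1) (use dT continuity(1) in \<open>auto simp: has_real_derivative_iff_has_vector_derivative intro!: continuous_intros\<close>)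
  have mt: "filterlim (\<lambda>x. m * x) at_top at_top" using m by (auto intro!: filterlim_tendsto_pos_mult_at_top filterlim_ident tendsto_const)
  have Tt: "(T \<longlongrightarrow> 1) at_top" unfolding T_def by (rule filterlim_compose[OF tanh_real_at_top mt])
  have To: "T (- x) = - T x" for x by (simp add: T_def)
  have int: "(LINT x:{-R..R}|lborel. (\<i> * u' x) \<bullet> u x) = 2 * A * sin \<omega> * T R" if "0 < R" for R
  proof -
    have "(LINT x:{-R..R}|lborel. (\<i> * u' x) \<bullet> u x) = (LINT x:{-R..R}|lborel. (A * sin \<omega>) * (m * (1 - (T x)\<^sup>2)))"
      by (simp add: u_def u'_def inner_complex_def ac_simps)
    also have "\<dots> = (A * sin \<omega>) * (T R - T (- R))" using ac_diff[OF acT, of "- R" R] that by simp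
    finally show ?thesis by (simp add: To)
  qed
  have Tp: "T R > 0" if "0 < R" for R unfolding T_def using that m by simp
  have nz: "u R \<noteq> 0" "u (- R) \<noteq> 0" if "0 < R" for R using Tp[OF that] A by (auto simp: u_def To complex_eq_iff)
  have ul: "(u \<longlongrightarrow> Complex (A * 1) (sin \<omega>)) at_top" "((\<lambda>R. u (- R)) \<longlongrightarrow> Complex (- (A * 1)) (sin \<omega>)) at_top"
    unfolding u_def To mult_minus_right by (intro tendsto_intros tendsto_Complex Tt)+
  have c1: "Complex (A * 1) (sin \<omega>) = cis \<omega>" and c2: "Complex (- (A * 1)) (sin \<omega>) = cis (pi - \<omega>)"
    by (simp_all add: complex_eq_iff A_def)
  have "((\<lambda>R. cis (2 * A * sin \<omega> * T R) * sgn (u R) * cnj (sgn (u (- R)))) \<longlongrightarrow> cis (2 * A * sin \<omega> * 1) * sgn (cis \<omega>) * cnj (sgn (cis (pi - \<omega>)))) at_top"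
    using ul unfolding c1 c2 by (intro tendsto_intros tendsto_cis Tt) auto
  moreover have "cis (2 * A * sin \<omega> * 1) * sgn (cis \<omega>) * cnj (sgn (cis (pi - \<omega>))) = cis (2 * soliton_momentum \<omega>)"
  proof -
    have "cis (2 * A * sin \<omega> * 1) * sgn (cis \<omega>) * cnj (sgn (cis (pi - \<omega>))) = cis (2 * A * sin \<omega> + \<omega> + (\<omega> - pi))"
      by (simp add: sgn_eq cis_cnj cis_mult)
    also have "\<dots> = cis (2 * soliton_momentum \<omega> - 2 * pi)" unfolding soliton_momentum_def A_def sin_double by (simp add: algebra_simps)
    also have "\<dots> = cis (2 * soliton_momentum \<omega>)" by (simp flip: cis_divide)
    finally show ?thesis .
  qed
  ultimately have "((\<lambda>R. cis (2 * A * sin \<omega> * T R) * sgn (u R) * cnj (sgn (u (- R)))) \<longlongrightarrow> cis (2 * soliton_momentum \<omega>)) at_top" by simp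
  then show ?thesis
  proof (rule Lim_transform_eventually)
    show "\<forall>\<^sub>F R in at_top. cis (2 * A * sin \<omega> * T R) * sgn (u R) * cnj (sgn (u (- R))) = cis (2 * momentum_upto u R)"
      using eventually_gt_at_top[of 0] by eventually_elim (simp add: momentum_upto_cis[OF ac nz] int)
  qed
qed

lemma u_momentum: "momentum_1d u = {p. cis (2 * p) = cis (2 * soliton_momentum \<omega>)}"
proof (intro set_eqI iffI CollectI)
  have uc: "continuous_on UNIV u" using du by (meson continuous_at_imp_continuous_on has_vector_derivative_continuous)
  fix p
  {
    assume "p \<in> momentum_1d u"
    then obtain v where v: "continuous_on UNIV v" "AE x in lborel. v x = u x"
      "((\<lambda>R. cis (2 * momentum_upto v R)) \<longlongrightarrow> cis (2 * p)) at_top" by (rule momentum_1dD)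
    have "v = u" by (rule continuous_AE_eq[OF v(1) uc v(2)])
    with v(3) u_momentum_limit show "cis (2 * p) = cis (2 * soliton_momentum \<omega>)" using tendsto_unique[OF trivial_limit_at_top_linorder] by blast
  }
  {
    assume "p \<in> {p. cis (2 * p) = cis (2 * soliton_momentum \<omega>)}"
    then show "p \<in> momentum_1d u" using u_momentum_limit by (intro momentum_1dI[OF uc]) auto
  }
qed

text \<open>Here \<open>e\<close> is the squared amplitude. With \<open>e = 0\<close> this is the
  planar soliton itself, whose energy bounds the minimum from above; with \<open>e > 0\<close> it is
  the destabilising competitor.\<close>

theorem competitor:
  assumes l: "0 < l" and e: "0 \<le> e"
  obtains \<psi> where "\<psi> \<in> energy_space_2d l" "momentum_2d l \<psi> = {p. cis (2 * p) = cis (2 * (soliton_momentum \<omega> + e * \<kappa> / 3))}"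
    "energy l \<psi> = soliton_energy \<omega> + e * (m * (\<kappa>\<^sup>2 / 3 - 1 / 2) + 1/4 * (2 * pi / l)\<^sup>2 * (2 / m * (1 + \<kappa>\<^sup>2 / 3))
       + 3/32 * e * (2 / m * (1 + (2 * \<kappa>\<^sup>2 - 1) / 3 + (\<kappa> ^ 4 - 2 * \<kappa>\<^sup>2) / 5 - \<kappa> ^ 4 / 7)))"
proof -
  interpret P: transverse_perturbation l "sqrt e" u u' \<xi> \<xi>'
    by (rule transverse_perturbation.intro[OF l du d\<xi> continuity(3,4) integrals(1,3,5,7,9,11)])
  have se: "(sqrt e)\<^sup>2 = e" "sqrt e ^ 4 = e * e" using e by (simp_all add: power4_eq_xxxx mult.assoc)
  have mom: "momentum_2d l P.psi = {p. cis (2 * p) = cis (2 * (soliton_momentum \<omega> + e * \<kappa> / 3))}"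
    unfolding P.psi_momentum se integrals(14) u_momentum
  proof (intro set_eqI iffI)
    fix q
    have key: "cis (2 * (p + e * \<kappa> / 3)) = cis (2 * p) * cis (2 * (e * \<kappa> / 3))" for p by (simp add: cis_mult algebra_simps)
    have nz: "cis t \<noteq> 0" for t by simp
    { assume "q \<in> (\<lambda>p. p + e / 4 * (4 / 3 * \<kappa>)) ` {p. cis (2 * p) = cis (2 * soliton_momentum \<omega>)}"
      then obtain p where "q = p + e * \<kappa> / 3" "cis (2 * p) = cis (2 * soliton_momentum \<omega>)" by auto
      then show "q \<in> {p. cis (2 * p) = cis (2 * (soliton_momentum \<omega> + e * \<kappa> / 3))}" by (simp only: mem_Collect_eq key) }
    { assume "q \<in> {p. cis (2 * p) = cis (2 * (soliton_momentum \<omega> + e * \<kappa> / 3))}"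
      then have "cis (2 * ((q - e * \<kappa> / 3) + e * \<kappa> / 3)) = cis (2 * (soliton_momentum \<omega> + e * \<kappa> / 3))" by simp
      then have "cis (2 * (q - e * \<kappa> / 3)) = cis (2 * soliton_momentum \<omega>)" unfolding key using nz by simp
      then show "q \<in> (\<lambda>p. p + e / 4 * (4 / 3 * \<kappa>)) ` {p. cis (2 * p) = cis (2 * soliton_momentum \<omega>)}"
        by (intro image_eqI[of _ _ "q - e * \<kappa> / 3"]) auto }
  qed
  have s2: "(sin \<omega>)\<^sup>2 = m * m * \<kappa>\<^sup>2 / 2"
  proof -
    have "4 * (sin \<omega>)\<^sup>2 = (A * \<kappa>)\<^sup>2" unfolding A\<kappa> by (simp add: power_mult_distrib)
    also have "\<dots> = 2 * m * m * \<kappa>\<^sup>2" by (simp add: power_mult_distrib power2_eq_square mA[symmetric])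
    finally show ?thesis by simp
  qed
  have m0: "m \<noteq> 0" using m by simp
  have I: "1/2 * (4 / 3 * (A * A * m)) + 1/4 * (4 / 3 * (A * A * (A * A) / m)) = soliton_energy \<omega>"
  proof -
    have "1/2 * (4 / 3 * (A * A * m)) + 1/4 * (4 / 3 * (A * A * (A * A) / m)) = 4 / 3 * (A * A * m)"
      unfolding mA using m0 by (simp add: field_simps)
    also have "\<dots> = 4 / 3 * A ^ 3 / sqrt 2" by (simp add: m_def power3_eq_cube)
    also have "\<dots> = 2 / 3 * A ^ 3 * (2 / sqrt 2)" by simp
    also have "2 / sqrt 2 = sqrt 2" by (simp add: real_div_sqrt)
    finally show ?thesis by (simp add: soliton_energy_def A_def)
  qed
  \<comment> \<open>Expressing the sine and \<open>A\<close> through \<open>m\<close> and \<kappa>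
    collapses the four second-order terms into a single one.\<close>
  have B: "1/4 * (2 * m * (7 / 15 * \<kappa>\<^sup>2 + 1 / 3)) + K + 1/2 * (14 / 15 * (sin \<omega>)\<^sup>2 / m) - 1/4 * (2 * (A * A) / m * (1 + (\<kappa>\<^sup>2 - 1) / 3 - \<kappa>\<^sup>2 / 5))
      = m * (\<kappa>\<^sup>2 / 3 - 1 / 2) + K" for K
    unfolding s2 mA using m0 by (simp add: field_simps power2_eq_square)
  have fin: "s + e * (a + k) + 3/32 * (e * e) * y = s + e * (a + k + 3/32 * e * y)" for s a k y :: real
    by (simp add: algebra_simps)
  show ?thesis
  proof (rule that[OF P.psi_in_energy_space mom])
    show "energy l P.psi = soliton_energy \<omega> + e * (m * (\<kappa>\<^sup>2 / 3 - 1 / 2) + 1/4 * (2 * pi / l)\<^sup>2 * (2 / m * (1 + \<kappa>\<^sup>2 / 3))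
       + 3/32 * e * (2 / m * (1 + (2 * \<kappa>\<^sup>2 - 1) / 3 + (\<kappa> ^ 4 - 2 * \<kappa>\<^sup>2) / 5 - \<kappa> ^ 4 / 7)))"
      unfolding P.psi_energy se integrals(2,4,6,8,10,12,13) I B fin ..
  qed
qed

end

section \<open>The critical length\<close>

text \<open>Concavity of energy in momentum: the slope \<open>- sqrt 2 * sin t\<close> decreases
  along the branch while the momentum increases.\<close>

lemma soliton_energy_le_tangent:
  assumes \<omega>: "\<bar>\<omega>\<bar> < pi / 2" and \<omega>': "\<bar>\<omega>'\<bar> < pi / 2"
  shows "soliton_energy \<omega>' \<le> soliton_energy \<omega> - sqrt 2 * sin \<omega> * (soliton_momentum \<omega>' - soliton_momentum \<omega>)"
proof -
  define g where "g t = soliton_energy t + sqrt 2 * sin \<omega> * soliton_momentum t" for t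
  have dg: "(g has_real_derivative 2 * sqrt 2 * (cos t)\<^sup>2 * (sin \<omega> - sin t)) (at t)" for t
    unfolding g_def[abs_def]
    by (rule DERIV_cong[OF DERIV_add[OF soliton_energy_derivative DERIV_cmult[OF soliton_momentum_derivative]]]) (simp add: algebra_simps)
  have "g \<omega>' \<le> g \<omega>"
  proof (cases "\<omega>' \<le> \<omega>")
    case True
    show ?thesis
    proof (rule DERIV_nonneg_imp_nondecreasing[OF True])
      fix t assume t: "\<omega>' \<le> t" "t \<le> \<omega>"
      have "sin t \<le> sin \<omega>" by (rule sin_monotone_2pi_le) (use t \<omega> \<omega>' in auto)
      then show "\<exists>y. (g has_real_derivative y) (at t) \<and> 0 \<le> y" using dg[of t] by (intro exI conjI) auto
    qed
  next
    case False
    then have "\<omega> \<le> \<omega>'" by simp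
    then show ?thesis
    proof (rule DERIV_nonpos_imp_nonincreasing)
      fix t assume t: "\<omega> \<le> t" "t \<le> \<omega>'"
      have "sin \<omega> \<le> sin t" by (rule sin_monotone_2pi_le) (use t \<omega> \<omega>' in auto)
      then have "2 * sqrt 2 * (cos t)\<^sup>2 * (sin \<omega> - sin t) \<le> 0" by (intro mult_nonneg_nonpos) auto
      then show "\<exists>y. (g has_real_derivative y) (at t) \<and> y \<le> 0" using dg[of t] by blast
    qed
  qed
  then show ?thesis by (simp add: g_def algebra_simps)
qed

lemma soliton_momentum_strict_mono:
  assumes "- (pi / 2) < a" "a < b" "b < pi / 2"
  shows "soliton_momentum a < soliton_momentum b"
proof (rule DERIV_pos_imp_increasing[OF assms(2)])
  fix t assume "a \<le> t" "t \<le> b"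
  then have "cos t > 0" using assms by (intro cos_gt_zero_pi) auto
  then have "0 < 2 * (cos t)\<^sup>2" by simp
  then show "\<exists>y. (soliton_momentum has_real_derivative y) (at t) \<and> 0 < y" using soliton_momentum_derivative[of t] by blast
qed

text \<open>The competitor is built on a nearby soliton, whose momentum differs from the prescribed one by exactly
  what the transverse perturbation contributes; to leading order the two energy changes add up to
  a negative multiple of the squared amplitude.\<close>

lemma transverse_instability_parameters:
  fixes Y :: "real \<Rightarrow> real"
  assumes \<omega>: "\<bar>\<omega>\<bar> < pi / 2" and Y: "isCont Y \<omega>"
  obtains \<omega>' e where "\<bar>\<omega>'\<bar> < pi / 2" "0 < e" "soliton_momentum \<omega>' + e * (- 2 * tan \<omega>') / 3 = soliton_momentum \<omega>"
    "cos \<omega>' / sqrt 2 * ((- 2 * tan \<omega>')\<^sup>2 / 3 - 1 / 2) + 3/32 * e * Y \<omega>' + sqrt 2 * sin \<omega> * (- 2 * tan \<omega>') / 3 < 0"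
proof -
  have cos: "cos \<omega> > 0" using \<omega> by (intro cos_gt_zero_pi) auto
  \<comment> \<open>The neighbouring soliton lies further from the black one. Then the momentum it
    still lacks has the sign of the factor \<open>- 2 * tan (W t)\<close>, so that a positive
    squared amplitude can supply it.\<close>
  define W where "W t = \<omega> + t * sgn \<omega>" for t
  \<comment> \<open>For \<omega> = 0 the perturbation leaves the momentum unchanged and the
    amplitude is free; otherwise this value makes the momentum balance exact.\<close>
  define e where "e t = (if \<omega> = 0 then t else 3 * (soliton_momentum \<omega> - soliton_momentum (W t)) / (- 2 * tan (W t)))" for t
  have W: "(W \<longlongrightarrow> \<omega>) (at_right 0)"
  proof -
    have "(W \<longlongrightarrow> \<omega> + 0 * sgn \<omega>) (at_right 0)" unfolding W_def by (intro tendsto_intros)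
    then show ?thesis by simp
  qed
  have tanW: "((\<lambda>t. tan (W t)) \<longlongrightarrow> tan \<omega>) (at_right 0)" by (intro tendsto_tan W) (use cos in simp)
  have pW: "((\<lambda>t. soliton_momentum (W t)) \<longlongrightarrow> soliton_momentum \<omega>) (at_right 0)"
    by (rule isCont_tendsto_compose[OF DERIV_isCont[OF soliton_momentum_derivative] W])
  have YW: "((\<lambda>t. Y (W t)) \<longlongrightarrow> Y \<omega>) (at_right 0)" by (rule isCont_tendsto_compose[OF Y W])
  have eW: "(e \<longlongrightarrow> 0) (at_right 0)"
  proof (cases "\<omega> = 0")
    case True
    then show ?thesis unfolding e_def by (simp add: tendsto_ident_at)
  next
    case False
    have "tan \<omega> \<noteq> 0" using False \<omega> by (metis abs_less_iff cos less_irrefl minus_less_iff tan_gt_zero tan_minus neg_0_less_iff_less linorder_neqE_linordered_idom)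
    then have lim: "((\<lambda>t. 3 * (soliton_momentum \<omega> - soliton_momentum (W t)) / (- 2 * tan (W t))) \<longlongrightarrow> 3 * (soliton_momentum \<omega> - soliton_momentum \<omega>) / (- 2 * tan \<omega>)) (at_right 0)"
      by (intro tendsto_intros pW tanW) simp
    have z: "3 * (soliton_momentum \<omega> - soliton_momentum \<omega>) / (- 2 * tan \<omega>) = 0" by simp
    have "e = (\<lambda>t. 3 * (soliton_momentum \<omega> - soliton_momentum (W t)) / (- 2 * tan (W t)))"
      using False by (simp add: e_def fun_eq_iff)
    then show ?thesis using lim[unfolded z] by (simp only:)
  qed
  have lim: "((\<lambda>t. cos (W t) / sqrt 2 * ((- 2 * tan (W t))\<^sup>2 / 3 - 1 / 2) + 3/32 * e t * Y (W t) + sqrt 2 * sin \<omega> * (- 2 * tan (W t)) / 3) \<longlongrightarrow>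
     cos \<omega> / sqrt 2 * ((- 2 * tan \<omega>)\<^sup>2 / 3 - 1 / 2) + 3/32 * 0 * Y \<omega> + sqrt 2 * sin \<omega> * (- 2 * tan \<omega>) / 3) (at_right 0)"
    by (intro tendsto_intros W tanW YW eW) auto
  have "cos \<omega> / sqrt 2 * ((- 2 * tan \<omega>)\<^sup>2 / 3 - 1 / 2) + 3/32 * 0 * Y \<omega> + sqrt 2 * sin \<omega> * (- 2 * tan \<omega>) / 3 = - (cos \<omega> / sqrt 2 / 2)"
  proof -
    have "sin \<omega> = cos \<omega> * tan \<omega>" using cos by (simp add: tan_def)
    then show ?thesis by (simp add: field_simps power2_eq_square)
  qed
  also have "\<dots> < 0" using cos by simp
  finally have neg: "eventually (\<lambda>t. cos (W t) / sqrt 2 * ((- 2 * tan (W t))\<^sup>2 / 3 - 1 / 2) + 3/32 * e t * Y (W t) + sqrt 2 * sin \<omega> * (- 2 * tan (W t)) / 3 < 0) (at_right 0)"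
    by (rule order_tendstoD(2)[OF lim])
  have "eventually (\<lambda>t. \<bar>W t\<bar> < pi / 2) (at_right 0)" by (rule order_tendstoD(2)[OF tendsto_rabs[OF W] \<omega>])
  with neg have "eventually (\<lambda>t. cos (W t) / sqrt 2 * ((- 2 * tan (W t))\<^sup>2 / 3 - 1 / 2) + 3/32 * e t * Y (W t) + sqrt 2 * sin \<omega> * (- 2 * tan (W t)) / 3 < 0 \<and> \<bar>W t\<bar> < pi / 2 \<and> 0 < t) (at_right 0)"
    using eventually_at_right_less[of "0::real"] by eventually_elim blast
  then obtain t where t: "cos (W t) / sqrt 2 * ((- 2 * tan (W t))\<^sup>2 / 3 - 1 / 2) + 3/32 * e t * Y (W t) + sqrt 2 * sin \<omega> * (- 2 * tan (W t)) / 3 < 0"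
    "\<bar>W t\<bar> < pi / 2" "0 < t" using eventually_happens'[OF trivial_limit_at_right_real] by blast
  define D \<tau> where "D = 3 * (soliton_momentum \<omega> - soliton_momentum (W t))" and "\<tau> = - 2 * tan (W t)"
  have quotient: "0 < e t \<and> soliton_momentum (W t) + e t * \<tau> / 3 = soliton_momentum \<omega>"
    if "\<omega> \<noteq> 0" and s: "D < 0 \<and> \<tau> < 0 \<or> 0 < D \<and> 0 < \<tau>"
  proof -
    have e: "e t = D / \<tau>" using that(1) by (simp add: e_def D_def \<tau>_def)
    have "0 < D / \<tau>" using s by (auto intro: divide_pos_pos divide_neg_neg)
    moreover have "D / \<tau> * \<tau> = D" using s by auto
    moreover have "D / 3 = soliton_momentum \<omega> - soliton_momentum (W t)" by (simp add: D_def)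
    ultimately show ?thesis unfolding e by (simp only:) simp
  qed
  have sgn: "0 < e t \<and> soliton_momentum (W t) + e t * \<tau> / 3 = soliton_momentum \<omega>"
  proof -
    consider "\<omega> = 0" | "\<omega> > 0" | "\<omega> < 0" by linarith
    then show ?thesis
    proof cases
      case 1
      then show ?thesis using t(3) by (simp add: e_def W_def \<tau>_def)
    next
      case 2
      then have W2: "W t = \<omega> + t" by (simp add: W_def)
      have "tan (W t) > 0" using 2 t W2 by (intro tan_gt_zero) auto
      moreover have "soliton_momentum \<omega> < soliton_momentum (W t)" using 2 t W2 by (intro soliton_momentum_strict_mono) auto
      ultimately show ?thesis using 2 by (intro quotient) (auto simp: D_def \<tau>_def)
    next
      case 3
      then have W2: "W t = \<omega> - t" by (simp add: W_def)
      have "tan (- W t) > 0" using 3 t W2 by (intro tan_gt_zero) auto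
      moreover have "soliton_momentum (W t) < soliton_momentum \<omega>" using 3 t W2 \<omega> by (intro soliton_momentum_strict_mono) auto
      ultimately show ?thesis using 3 by (intro quotient) (auto simp: D_def \<tau>_def)
    qed
  qed
  show ?thesis using that[of "W t" "e t"] t sgn unfolding \<tau>_def by blast
qed

text \<open>The parameters \<omega>' and \<open>e\<close> are fixed before the length. They make the
  energy change strictly negative without the transverse gradient, whose cost is proportional to the
  square of \<open>2 * pi / l\<close>; so negativity survives for all large lengths.\<close>

lemma transverse_instability:
  assumes om: "\<bar>\<omega>\<bar> < pi / 2"
  obtains L where "\<And>l. L \<le> l \<Longrightarrow> 0 < l \<Longrightarrow>
    \<exists>\<psi>\<in>energy_space_2d l. momentum_2d l \<psi> = {p. cis (2 * p) = cis (2 * soliton_momentum \<omega>)} \<and> energy l \<psi> < soliton_energy \<omega>"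
proof -
  define Y where "Y t = 2 / (cos t / sqrt 2) * (1 + (2 * (- 2 * tan t)\<^sup>2 - 1) / 3 + ((- 2 * tan t) ^ 4 - 2 * (- 2 * tan t)\<^sup>2) / 5 - (- 2 * tan t) ^ 4 / 7)" for t :: real
  have "cos \<omega> > 0" using om by (intro cos_gt_zero_pi) auto
  then have Yc: "isCont Y \<omega>" unfolding Y_def by (intro continuous_intros) auto
  obtain \<omega>' e where w: "\<bar>\<omega>'\<bar> < pi / 2" "0 < e" "soliton_momentum \<omega>' + e * (- 2 * tan \<omega>') / 3 = soliton_momentum \<omega>"
    "cos \<omega>' / sqrt 2 * ((- 2 * tan \<omega>')\<^sup>2 / 3 - 1 / 2) + 3/32 * e * Y \<omega>' + sqrt 2 * sin \<omega> * (- 2 * tan \<omega>') / 3 < 0"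
    using transverse_instability_parameters[OF om Yc] by metis
  interpret soliton_profile \<omega>' by (rule soliton_profile.intro[OF w(1)])
  define B where "B = m * (\<kappa>\<^sup>2 / 3 - 1 / 2) + 3/32 * e * Y \<omega>' + sqrt 2 * sin \<omega> * \<kappa> / 3"
  have B: "B < 0" using w(4) by (simp add: B_def m_def A_def \<kappa>_def)
  have Y: "Y \<omega>' = 2 / m * (1 + (2 * \<kappa>\<^sup>2 - 1) / 3 + (\<kappa> ^ 4 - 2 * \<kappa>\<^sup>2) / 5 - \<kappa> ^ 4 / 7)"
    unfolding Y_def m_def A_def \<kappa>_def ..
  define X where "X = 2 / m * (1 + \<kappa>\<^sup>2 / 3)"
  have "((\<lambda>l::real. B + 1/4 * (2 * pi / l)\<^sup>2 * X) \<longlongrightarrow> B + 1/4 * 0\<^sup>2 * X) at_top"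
    by (intro tendsto_intros tendsto_divide_0[OF tendsto_const] filterlim_at_top_imp_at_infinity filterlim_ident)
  then have "eventually (\<lambda>l. B + 1/4 * (2 * pi / l)\<^sup>2 * X < 0) at_top" by (rule order_tendstoD(2)) (use B in simp)
  then obtain L where L: "\<And>l. L \<le> l \<Longrightarrow> B + 1/4 * (2 * pi / l)\<^sup>2 * X < 0" unfolding eventually_at_top_linorder by blast
  show ?thesis
  proof (rule that[of L])
    fix l assume l: "L \<le> l" "0 < l"
    obtain \<psi> where \<psi>: "\<psi> \<in> energy_space_2d l" "momentum_2d l \<psi> = {p. cis (2 * p) = cis (2 * (soliton_momentum \<omega>' + e * \<kappa> / 3))}"
      "energy l \<psi> = soliton_energy \<omega>' + e * (m * (\<kappa>\<^sup>2 / 3 - 1 / 2) + 1/4 * (2 * pi / l)\<^sup>2 * X + 3/32 * e * Y \<omega>')"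
      unfolding X_def Y using competitor[OF l(2) less_imp_le[OF w(2)]] by blast
    have p: "soliton_momentum \<omega>' + e * \<kappa> / 3 = soliton_momentum \<omega>" using w(3) by (simp only: \<kappa>_def)
    then have d: "soliton_momentum \<omega>' - soliton_momentum \<omega> = - (e * \<kappa> / 3)" by linarith
    have "soliton_energy \<omega>' \<le> soliton_energy \<omega> - sqrt 2 * sin \<omega> * (- (e * \<kappa> / 3))"
      using soliton_energy_le_tangent[OF om w(1)] unfolding d .
    then have "soliton_energy \<omega>' \<le> soliton_energy \<omega> + e * (sqrt 2 * sin \<omega> * \<kappa> / 3)" by (simp add: ac_simps)
    moreover have "soliton_energy \<omega> + e * (B + 1/4 * (2 * pi / l)\<^sup>2 * X) - energy l \<psi>
        = soliton_energy \<omega> + e * (sqrt 2 * sin \<omega> * \<kappa> / 3) - soliton_energy \<omega>'"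
      unfolding \<psi>(3) B_def by (simp add: algebra_simps)
    ultimately have "energy l \<psi> \<le> soliton_energy \<omega> + e * (B + 1/4 * (2 * pi / l)\<^sup>2 * X)" by linarith
    moreover have "e * (B + 1/4 * (2 * pi / l)\<^sup>2 * X) < 0" using L[OF l(1)] w(2) by (simp add: mult_pos_neg)
    ultimately have "energy l \<psi> < soliton_energy \<omega>" by linarith
    then show "\<exists>\<psi>\<in>energy_space_2d l. momentum_2d l \<psi> = {p. cis (2 * p) = cis (2 * soliton_momentum \<omega>)} \<and> energy l \<psi> < soliton_energy \<omega>"
      using \<psi>(1,2) p by auto
  qed
qed

text \<open>Each class contains the momentum of some parameter in the closed branch. At the two ends
  \<open>cos \<omega>\<close> is 0, the soliton is constant and its momentum lies in the class of 0,
  so a class without 0 belongs to a genuine soliton.\<close>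

lemma R_mod_pi_soliton_momentum:
  assumes "\<pp> \<in> R_mod_pi" "0 \<notin> \<pp>"
  obtains \<omega> where "\<bar>\<omega>\<bar> < pi / 2" "\<pp> = {p. cis (2 * p) = cis (2 * soliton_momentum \<omega>)}"
proof -
  obtain x where x: "\<pp> = {(s, t). [s = t] (rmod pi)} `` {x}" using assms(1) unfolding R_mod_pi_def by (rule quotientE)
  obtain P where P: "0 \<le> P" "P \<le> pi" "cis (2 * x) = cis (2 * P)" by (rule reduce_mod_pi)
  obtain \<omega> where w: "\<bar>\<omega>\<bar> \<le> pi / 2" "soliton_momentum \<omega> = P" by (rule soliton_momentum_surj[OF P(1,2)])
  have pp: "\<pp> = {p. cis (2 * p) = cis (2 * soliton_momentum \<omega>)}"
  proof (intro set_eqI iffI)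
    fix p
    { assume "p \<in> \<pp>" then show "p \<in> {p. cis (2 * p) = cis (2 * soliton_momentum \<omega>)}"
        using rcong_pi_cis[of x p] P(3) unfolding x w(2) by auto }
    { assume "p \<in> {p. cis (2 * p) = cis (2 * soliton_momentum \<omega>)}" then show "p \<in> \<pp>"
        using cis_rcong_pi[of x p] P(3) unfolding x w(2) by auto }
  qed
  have "\<bar>\<omega>\<bar> \<noteq> pi / 2"
  proof
    assume "\<bar>\<omega>\<bar> = pi / 2"
    then have "\<omega> = pi / 2 \<or> \<omega> = - (pi / 2)" by linarith
    then have "soliton_momentum \<omega> = pi \<or> soliton_momentum \<omega> = 0" using soliton_momentum_ends by metis
    then have "cis (2 * soliton_momentum \<omega>) = 1" by (elim disjE) (simp_all only:, simp_all)
    then show False using assms(2) unfolding pp by simp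
  qed
  with w(1) have "\<bar>\<omega>\<bar> < pi / 2" by linarith
  then show ?thesis using pp by (rule that)
qed

theorem mainTheorem2:
  fixes \<pp> :: "real set"
  assumes "\<pp> \<in> R_mod_pi" and "0 \<notin> \<pp>"
  shows "\<exists>l\<^sub>\<pp>>0. \<forall>l>0. \<forall>U. is_minimizer_2d l \<pp> U \<longrightarrow>
           (l < l\<^sub>\<pp> \<longrightarrow> planar_dark_soliton_upto_symmetry U) \<and>
           (l > l\<^sub>\<pp> \<longrightarrow> \<not> depends_only_on_x U \<and> \<not> planar_dark_soliton_upto_symmetry U)"
proof -
  obtain \<omega> where \<omega>: "\<bar>\<omega>\<bar> < pi / 2" and pp: "\<pp> = {p. cis (2 * p) = cis (2 * soliton_momentum \<omega>)}"
    using R_mod_pi_soliton_momentum[OF assms] .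
  define I where "I = soliton_energy \<omega>"
  interpret sol: soliton_profile \<omega> by (rule soliton_profile.intro[OF \<omega>])
  have I0: "0 < I" using sol.A(1) by (simp add: I_def soliton_energy_def sol.A_def)
  obtain K where K: "0 \<le> K" "\<And>v g P. finite_energy_1d v g \<Longrightarrow> momentum_limit_1d v g P \<Longrightarrow>
     soliton_energy \<omega> - sqrt 2 * sin \<omega> * (P - soliton_momentum \<omega>) - K * (P - soliton_momentum \<omega>)\<^sup>2 \<le> energy_1d v g"
    using energy_1d_support[OF \<omega>] by metis
  have lower: "l * I + 1/2 * strip_function.Dy l \<psi> - K * l * strip_function.Dx l \<psi> * strip_function.Dy l \<psi> \<le> l * energy l \<psi>"
    if "0 < l" "\<psi> \<in> energy_space_2d l" "momentum_2d l \<psi> = \<pp>" for l \<psi>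
    unfolding I_def using that(3) pp
    by (intro strip_function.energy_lower_bound[OF strip_function.intro[OF that(1,2)] K]) auto
  \<comment> \<open>The lengths for which the planar soliton is optimal in the class \<pp>.\<close>
  define \<S> where "\<S> = {l. 0 < l \<and> (\<forall>\<psi>\<in>energy_space_2d l. momentum_2d l \<psi> = \<pp> \<longrightarrow> I \<le> energy l \<psi>)}"
  \<comment> \<open>If some energy were below \<open>I\<close>, then \<open>Dx\<close> \<le>
    \<open>2 * l\<^sub>0 * I\<close>, and this choice gives \<open>K * l\<^sub>0 * Dx\<close> \<le>
    1/2, so \<open>Dy / 2\<close> covers the loss. The summand 1 in the denominator gives
    \<open>l\<^sub>0\<close> \<le> 1, which enters that estimate.\<close>
  define l\<^sub>0 where "l\<^sub>0 = 1 / (1 + 4 * K * I)"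
  have KI: "0 \<le> 4 * K * I" using K(1) I0 by simp
  then have l0: "0 < l\<^sub>0" "l\<^sub>0 \<le> 1" "4 * K * I * l\<^sub>0 \<le> 1" by (auto simp: l\<^sub>0_def field_simps)
  have "l\<^sub>0 \<in> \<S>"
    unfolding \<S>_def mem_Collect_eq
  proof (intro conjI l0(1) ballI impI)
    fix \<psi> assume \<psi>: "\<psi> \<in> energy_space_2d l\<^sub>0" "momentum_2d l\<^sub>0 \<psi> = \<pp>"
    interpret strip_function l\<^sub>0 \<psi> by (rule strip_function.intro[OF l0(1) \<psi>(1)])
    show "I \<le> energy l\<^sub>0 \<psi>"
    proof (rule ccontr)
      assume less: "\<not> I \<le> energy l\<^sub>0 \<psi>"
      have "1/2 * Dx \<le> l\<^sub>0 * energy l\<^sub>0 \<psi>" unfolding energy_eq using D_nonneg by simp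
      also have "\<dots> \<le> l\<^sub>0 * I" using less l0(1) by simp
      finally have "K * l\<^sub>0 * Dx \<le> K * l\<^sub>0 * (2 * (l\<^sub>0 * I))" using K(1) l0(1) by (intro mult_left_mono) auto
      also have "\<dots> = 1/2 * (l\<^sub>0 * (4 * K * I * l\<^sub>0))" by (simp add: algebra_simps)
      also have "\<dots> \<le> 1/2 * (1 * 1)" using l0 KI by (intro mult_left_mono mult_mono) auto
      finally have "K * l\<^sub>0 * Dx * Dy \<le> 1/2 * Dy" using mult_right_mono[OF _ D_nonneg(2), of "K * l\<^sub>0 * Dx" "1/2"] by simp
      with lower[OF l0(1) \<psi>] have "l\<^sub>0 * I \<le> l\<^sub>0 * energy l\<^sub>0 \<psi>" by linarith
      then show False using less l0(1) by simp
    qed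
  qed
  obtain L where L: "\<And>l. L \<le> l \<Longrightarrow> 0 < l \<Longrightarrow> \<exists>\<psi>\<in>energy_space_2d l. momentum_2d l \<psi> = \<pp> \<and> energy l \<psi> < I"
    using transverse_instability[OF \<omega>] unfolding pp I_def by metis
  have bdd: "bdd_above \<S>"
  proof (rule bdd_aboveI)
    fix l assume "l \<in> \<S>"
    then show "l \<le> L" using L[of l] unfolding \<S>_def by (cases "l \<le> L") (auto simp: not_le)
  qed
  \<comment> \<open>The infimum of a real set is a lower bound only if the set is bounded below,
    hence the detour through nonnegative energies.\<close>
  have minimal: "energy l U \<le> energy l \<psi>" if "is_minimizer_2d l \<pp> U" "0 < l" "\<psi> \<in> energy_space_2d l" "momentum_2d l \<psi> = \<pp>" for l U \<psi>
  proof -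
    have "0 \<le> energy l \<psi>" if "\<psi> \<in> energy_space_2d l" for \<psi>
    proof -
      interpret strip_function l \<psi> by (rule strip_function.intro[OF \<open>0 < l\<close> that])
      have "0 \<le> l * energy l \<psi>" unfolding energy_eq using D_nonneg by simp
      then show ?thesis using \<open>0 < l\<close> by (simp add: zero_le_mult_iff)
    qed
    then have "bdd_below {energy l \<psi> |\<psi>. \<psi> \<in> energy_space_2d l \<and> momentum_2d l \<psi> = \<pp>}" by (intro bdd_belowI[of _ 0]) auto
    then show ?thesis using that unfolding is_minimizer_2d_def min_energy_2d_def by (auto intro!: cInf_lower)
  qed
  have planar: "energy l U \<le> I" if U: "is_minimizer_2d l \<pp> U" and l: "0 < l" for l U
  proof -
    obtain \<psi> where "\<psi> \<in> energy_space_2d l" "momentum_2d l \<psi> = \<pp>" "energy l \<psi> = I"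
      using sol.competitor[OF l order_refl] unfolding pp I_def by auto
    then show ?thesis using minimal[OF U l] by metis
  qed
  have Sup0: "0 < Sup \<S>" using cSup_upper[OF \<open>l\<^sub>0 \<in> \<S>\<close> bdd] l0(1) by linarith
  show ?thesis
  proof (intro exI[of _ "Sup \<S>"] conjI Sup0 allI impI)
    fix l U assume l: "0 < l" and U: "is_minimizer_2d l \<pp> U"
    have Us: "U \<in> energy_space_2d l" "momentum_2d l U = \<pp>" using U by (auto simp: is_minimizer_2d_def)
    interpret strip_function l U by (rule strip_function.intro[OF l Us(1)])
    {
      assume "l < Sup \<S>"
      \<comment> \<open>The minimizer, stretched to \<open>l'\<close>, still has energy at least
        \<open>I\<close>; unstretched it has at most \<open>I\<close>. The two differ only in the
        factor of \<open>Dy\<close>, which is smaller after stretching, so \<open>Dy\<close> must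
        vanish.\<close>
      then obtain l' where l': "l' \<in> \<S>" "l < l'" using less_cSup_iff[OF _ bdd, of l] \<open>l\<^sub>0 \<in> \<S>\<close> by blast
      have l'0: "0 < l'" using l' l by linarith
      note sc = energy_space_scaled[OF l'0]
      have "l * I \<le> 1/2 * Dx + 1/2 * (l / l')\<^sup>2 * Dy + 1/4 * V"
        using l'(1) sc(1) sc(2) Us(2) l unfolding sc(3)[symmetric] \<S>_def by auto
      moreover have en: "1/2 * Dx + 1/2 * Dy + 1/4 * V \<le> l * I" using planar[OF U l] l unfolding energy_eq[symmetric] by simp
      ultimately have "Dy * (1 - (l / l')\<^sup>2) \<le> 0" by (simp add: algebra_simps)
      moreover have "(l / l')\<^sup>2 < 1" using l l'(2) l'0 by (simp add: abs_square_less_1)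
      ultimately have "Dy \<le> 0" by (simp add: mult_le_0_iff)
      then have D0: "Dy = 0" using D_nonneg(2) by simp
      have "energy l U = I"
      proof (rule antisym[OF planar[OF U l]])
        have "l * I \<le> l * energy l U" using lower[OF l Us] D0 by simp
        then show "I \<le> energy l U" using l by simp
      qed
      have "soliton_momentum \<omega> \<in> momentum_2d l U" unfolding Us(2) pp by simp
      then obtain v where v: "finite_energy_1d v gm" "energy_1d v gm = energy l U"
        "((\<lambda>R. cis (2 * momentum_upto v R)) \<longlongrightarrow> cis (2 * soliton_momentum \<omega>)) at_top"
        "AE z in lborel. snd z \<in> {0..<l} \<longrightarrow> U z = v (fst z)"
        by (rule planar_profile[OF D0])
      have "energy_1d v gm = soliton_energy \<omega>" using v(2) \<open>energy l U = I\<close> by (simp add: I_def)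
      with v(1) \<omega> v(3) obtain C a \<alpha> where C: "\<bar>C\<bar> < sqrt 2" "\<And>x. v x = cis \<alpha> * dark_soliton C (x - a)"
        by (rule minimal_profile_is_dark_soliton) blast
      have "AE z in lborel. U z = v (fst z)" by (rule AE_strip_imp_AE[OF v(4)])
      then have "AE z in lborel. case z of (x, y) \<Rightarrow> U (x, y) = cis \<alpha> * dark_soliton C (x - a)"
        by eventually_elim (simp add: C(2) case_prod_unfold)
      then show "planar_dark_soliton_upto_symmetry U" unfolding planar_dark_soliton_upto_symmetry_def using C(1) by blast
    }
    assume "Sup \<S> < l"
    \<comment> \<open>Beyond the supremum some competitor is cheaper than the soliton, whereas the
      lower bound keeps every function with \<open>Dy = 0\<close> at energy at least
      \<open>I\<close>.\<close>
    then have "l \<notin> \<S>" using cSup_upper[OF _ bdd, of l] by auto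
    then obtain \<psi> where c: "\<psi> \<in> energy_space_2d l" "momentum_2d l \<psi> = \<pp>" "energy l \<psi> < I" using l unfolding \<S>_def by (auto simp: not_le)
    have less: "energy l U < I" by (rule le_less_trans[OF minimal[OF U l c(1,2)] c(3)])
    show dep: "\<not> depends_only_on_x U"
    proof
      assume "depends_only_on_x U"
      then have "Dy = 0" by (rule Dy_zero_if_depends_only_on_x)
      then have "l * I \<le> l * energy l U" using lower[OF l Us] by simp
      then show False using less l by simp
    qed
    show "\<not> planar_dark_soliton_upto_symmetry U"
    proof
      assume "planar_dark_soliton_upto_symmetry U"
      then obtain c a \<alpha> where "AE (x, y) in lborel. U (x, y) = cis \<alpha> * dark_soliton c (x - a)"
        unfolding planar_dark_soliton_upto_symmetry_def by blast
      then have "depends_only_on_x U"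
        unfolding depends_only_on_x_def by (rule exI[where x = "\<lambda>x. cis \<alpha> * dark_soliton c (x - a)"])
      with dep show False by blast
    qed
  qed
qed

end
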